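(* Let $\mathcal{R}$ be a von Neumann algebra. For normal states $\omega$ and $\rho$ on $\mathcal{R}$ the following statements are equivalent: (i) There exists a quantum channel $\phi$ on $\mathcal{R}$ such that $\omega\circ\phi=\rho$. (ii) For every faithful normal representation $\pi$ of $\mathcal{R}$ on a Hilbert space $\mathcal{H}_\pi$ and any normal state $\tilde\omega$ on $\mathrm{B}(\mathcal{H}_\pi)$ that extends $\omega\circ\pi^{-1}$ (a state on $\pi(\mathcal{R})$) there exists a normal state $\tilde\rho$ on $\mathrm{B}(\mathcal{H}_\pi)$ that extends $\rho\circ\pi^{-1}$ such that $\tilde\omega|\pi(\mathcal{R})'=\tilde\rho|\pi(\mathcal{R})'$. (iii) For some faithful normal representation of $\mathcal{R}$ on a Hilbert space $\mathcal{H}$ (via which $\mathcal{R}$ is regarded as a subalgebra of $\mathrm{B}(\mathcal{H})$) such that $\omega$ is the restriction to $\mathcal{R}$ of a vector state $\tilde\omega$ on $\mathrm{B}(\mathcal{H})$, there exists a normal state $\tilde\rho$ on $\mathrm{B}(\mathcal{H})$ such that $\tilde\rho|\mathcal{R}=\rho$ and $\tilde\rho|\mathcal{R}'=\tilde\omega|\mathcal{R}'$. (iv) Let $\pi_\omega$ be the GNS representation of $\mathcal{R}$ engendered by $\omega$ on a Hilbert space $\mathcal{H}_\omega$ and let $\xi_\omega$ be the corresponding cyclic vector. The state $\rho$ annihilates the kernel of $\pi_\omega$, and there exists a normal state $\tilde\rho$ on $\mathrm{B}(\mathcal{H}_\omega)$ such that $\tilde\rho|\pi_\omega(\mathcal{R})$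 is the state induced by $\rho$ on $\pi_\omega(\mathcal{R})\cong\mathcal{R}/\ker\pi_\omega$ and $\tilde\rho|\pi_\omega(\mathcal{R})'=\tilde\omega|\pi_\omega(\mathcal{R})'$, where $\tilde\omega$ is the vector state $x\mapsto\langle x\xi_\omega,\xi_\omega\rangle$ on $\mathrm{B}(\mathcal{H}_\omega)$.
   Context: A quantum channel on a von Neumann algebra $\mathcal{R}$ is a map $\phi:\mathcal{R}\to\mathcal{R}$ of the form $\phi(x)=\sum_{j\in\mathbb{J}}a_j^*xa_j$ ($x\in\mathcal{R}$), where $\mathbb{J}$ is some index set and $a_j\in\mathcal{R}$ are such that $\sum_{j\in\mathbb{J}}a_j^*a_j=1$ with convergence in the strong operator topology. $\mathcal{M}'$ denotes the commutant of $\mathcal{M}$ in the ambient $\mathrm{B}(\mathcal{H})$. Normal means weak* (ultraweakly) continuous. A vector state on $\mathrm{B}(\mathcal{H})$ is a state of the form $x\mapsto\langle x\xi,\xi\rangle$ with $\xi\in\mathcal{H}$ a unit vector. *)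

theory Defs
  imports "HOL-Analysis.Analysis" "HOL-Algebra.Module" "HOL-Algebra.Algebraic_Closure_Type"
begin

section \<open>Hilbert spaces and their bounded operators\<close>

text \<open>
  The statement quantifies over Hilbert spaces inside formulas, so a Hilbert space is a record with
  a carrier set rather than a type.  The fields \<open>mult\<close> and \<open>one\<close>, inherited from the record of
  modules, play no role for Hilbert spaces.
\<close>

record 'h hilbert = "(complex, 'h) module" +
  hinner :: "'h \<Rightarrow> 'h \<Rightarrow> complex"

definition hnorm :: "'h hilbert \<Rightarrow> 'h \<Rightarrow> real" where
  "hnorm H \<xi> = sqrt (Re (hinner H \<xi> \<xi>))"

text \<open>
  The locale \<open>Metric_space\<close> demands nonnegativity and symmetry also outside the carrier, where
  the metric is therefore set to \<open>0\<close>.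
\<close>

definition hdist :: "'h hilbert \<Rightarrow> 'h \<Rightarrow> 'h \<Rightarrow> real" where
  "hdist H \<xi> \<eta> =
     (if \<xi> \<in> carrier H \<and> \<eta> \<in> carrier H then hnorm H (\<xi> \<ominus>\<^bsub>H\<^esub> \<eta>) else 0)"

text \<open>The inner product is linear in the first argument.\<close>

locale hilbert_space = module "ring_of_type_algebra :: complex ring" H
  for H :: "'h hilbert" (structure) +
  assumes hinner_add_left:
      "\<lbrakk>\<xi> \<in> carrier H; \<eta> \<in> carrier H; \<zeta> \<in> carrier H\<rbrakk> \<Longrightarrow>
        hinner H (\<xi> \<oplus>\<^bsub>H\<^esub> \<eta>) \<zeta> = hinner H \<xi> \<zeta> + hinner H \<eta> \<zeta>"
    and hinner_smult_left:
      "\<lbrakk>\<xi> \<in> carrier H; \<eta> \<in> carrier H\<rbrakk> \<Longrightarrow> hinner H (c \<odot>\<^bsub>H\<^esub> \<xi>) \<eta> = c * hinner H \<xi> \<eta>"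
    and hinner_commute:
      "\<lbrakk>\<xi> \<in> carrier H; \<eta> \<in> carrier H\<rbrakk> \<Longrightarrow> hinner H \<eta> \<xi> = cnj (hinner H \<xi> \<eta>)"
    and hinner_nonneg: "\<xi> \<in> carrier H \<Longrightarrow> hinner H \<xi> \<xi> \<in> \<real>\<^sub>\<ge>\<^sub>0"
    and hinner_eq_zero: "\<lbrakk>\<xi> \<in> carrier H; hinner H \<xi> \<xi> = 0\<rbrakk> \<Longrightarrow> \<xi> = \<zero>\<^bsub>H\<^esub>"
    and complete: "Metric_space.mcomplete (carrier H) (hdist H)"

text \<open>
  An operator is a function that is \<open>undefined\<close> outside the carrier, so that operators agreeing on
  the carrier are equal.
\<close>

definition bounded_operator :: "'h hilbert \<Rightarrow> ('h \<Rightarrow> 'h) \<Rightarrow> bool" where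
  "bounded_operator H x \<longleftrightarrow>
     x \<in> carrier H \<rightarrow>\<^sub>E carrier H \<and>
     (\<forall>\<xi>\<in>carrier H. \<forall>\<eta>\<in>carrier H. x (\<xi> \<oplus>\<^bsub>H\<^esub> \<eta>) = x \<xi> \<oplus>\<^bsub>H\<^esub> x \<eta>) \<and>
     (\<forall>c. \<forall>\<xi>\<in>carrier H. x (c \<odot>\<^bsub>H\<^esub> \<xi>) = c \<odot>\<^bsub>H\<^esub> x \<xi>) \<and>
     (\<exists>C. \<forall>\<xi>\<in>carrier H. hnorm H (x \<xi>) \<le> C * hnorm H \<xi>)"

definition bop :: "'h hilbert \<Rightarrow> (complex, 'h \<Rightarrow> 'h) module" where
  "bop H =
     \<lparr>carrier = {x. bounded_operator H x},
      mult = compose (carrier H),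
      one = (\<lambda>\<xi>\<in>carrier H. \<xi>),
      zero = (\<lambda>\<xi>\<in>carrier H. \<zero>\<^bsub>H\<^esub>),
      add = (\<lambda>x y. \<lambda>\<xi>\<in>carrier H. x \<xi> \<oplus>\<^bsub>H\<^esub> y \<xi>),
      smult = (\<lambda>c x. \<lambda>\<xi>\<in>carrier H. c \<odot>\<^bsub>H\<^esub> x \<xi>)\<rparr>"

definition adj :: "'h hilbert \<Rightarrow> ('h \<Rightarrow> 'h) \<Rightarrow> 'h \<Rightarrow> 'h" where
  "adj H x = (THE y. y \<in> carrier (bop H) \<and>
     (\<forall>\<xi>\<in>carrier H. \<forall>\<eta>\<in>carrier H. hinner H (x \<xi>) \<eta> = hinner H \<xi> (y \<eta>)))"

definition strong_operator_topology :: "'h hilbert \<Rightarrow> ('h \<Rightarrow> 'h) topology" where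
  "strong_operator_topology H = topology_generated_by
     {{x \<in> carrier (bop H). x \<xi> \<in> U} | \<xi> U.
        \<xi> \<in> carrier H \<and> openin (Metric_space.mtopology (carrier H) (hdist H)) U}"

text \<open>
  The ultraweak (weak*) topology is the initial topology for the functionals in the predual,
  \<open>x \<mapsto> \<Sum>n. \<langle>x \<xi>\<^sub>n, \<eta>\<^sub>n\<rangle>\<close> with square-summable sequences of vectors.
\<close>

definition square_summable :: "'h hilbert \<Rightarrow> (nat \<Rightarrow> 'h) \<Rightarrow> bool" where
  "square_summable H \<xi> \<longleftrightarrow> range \<xi> \<subseteq> carrier H \<and> summable (\<lambda>n. (hnorm H (\<xi> n))\<^sup>2)"

definition ultraweak_topology :: "'h hilbert \<Rightarrow> ('h \<Rightarrow> 'h) topology" where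
  "ultraweak_topology H = topology_generated_by
     {{x \<in> carrier (bop H). (\<Sum>n. hinner H (x (\<xi> n)) (\<eta> n)) \<in> U} | \<xi> \<eta> U.
        square_summable H \<xi> \<and> square_summable H \<eta> \<and> open U}"


section \<open>Von Neumann algebras, normal states and representations\<close>

definition commutant :: "'h hilbert \<Rightarrow> ('h \<Rightarrow> 'h) set \<Rightarrow> ('h \<Rightarrow> 'h) set" where
  "commutant H S = {y \<in> carrier (bop H). \<forall>x\<in>S. x \<otimes>\<^bsub>bop H\<^esub> y = y \<otimes>\<^bsub>bop H\<^esub> x}"

text \<open>A double commutant is automatically a subalgebra that contains the identity operator.\<close>

definition von_neumann_algebra :: "'h hilbert \<Rightarrow> ('h \<Rightarrow> 'h) set \<Rightarrow> bool" where
  "von_neumann_algebra H R \<longleftrightarrow>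
     R \<subseteq> carrier (bop H) \<and> (\<forall>x\<in>R. adj H x \<in> R) \<and> commutant H (commutant H R) = R"

text \<open>
  In the following \<open>R\<close> is a von Neumann algebra on \<open>H\<close>; in particular it may be all of
  \<open>carrier (bop H)\<close>.  Only the values on \<open>R\<close> of a functional or a map matter.
\<close>

definition is_state :: "'h hilbert \<Rightarrow> ('h \<Rightarrow> 'h) set \<Rightarrow> (('h \<Rightarrow> 'h) \<Rightarrow> complex) \<Rightarrow> bool" where
  "is_state H R \<omega> \<longleftrightarrow>
     (\<forall>x\<in>R. \<forall>y\<in>R. \<omega> (x \<oplus>\<^bsub>bop H\<^esub> y) = \<omega> x + \<omega> y) \<and>
     (\<forall>c. \<forall>x\<in>R. \<omega> (c \<odot>\<^bsub>bop H\<^esub> x) = c * \<omega> x) \<and>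
     (\<forall>x\<in>R. \<omega> (adj H x \<otimes>\<^bsub>bop H\<^esub> x) \<in> \<real>\<^sub>\<ge>\<^sub>0) \<and>
     \<omega> \<one>\<^bsub>bop H\<^esub> = 1"

definition normal_state :: "'h hilbert \<Rightarrow> ('h \<Rightarrow> 'h) set \<Rightarrow> (('h \<Rightarrow> 'h) \<Rightarrow> complex) \<Rightarrow> bool" where
  "normal_state H R \<omega> \<longleftrightarrow>
     is_state H R \<omega> \<and> continuous_map (subtopology (ultraweak_topology H) R) euclidean \<omega>"

definition vector_functional :: "'h hilbert \<Rightarrow> 'h \<Rightarrow> ('h \<Rightarrow> 'h) \<Rightarrow> complex" where
  "vector_functional H \<xi> x = hinner H (x \<xi>) \<xi>"

definition vector_state :: "'h hilbert \<Rightarrow> (('h \<Rightarrow> 'h) \<Rightarrow> complex) \<Rightarrow> bool" where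
  "vector_state H \<omega> \<longleftrightarrow> (\<exists>\<xi>\<in>carrier H. hnorm H \<xi> = 1 \<and> \<omega> = vector_functional H \<xi>)"

definition star_representation ::
  "'h hilbert \<Rightarrow> ('h \<Rightarrow> 'h) set \<Rightarrow> 'k hilbert \<Rightarrow> (('h \<Rightarrow> 'h) \<Rightarrow> 'k \<Rightarrow> 'k) \<Rightarrow> bool" where
  "star_representation H R K \<pi> \<longleftrightarrow>
     \<pi> \<in> R \<rightarrow> carrier (bop K) \<and>
     (\<forall>x\<in>R. \<forall>y\<in>R. \<pi> (x \<oplus>\<^bsub>bop H\<^esub> y) = \<pi> x \<oplus>\<^bsub>bop K\<^esub> \<pi> y) \<and>
     (\<forall>c. \<forall>x\<in>R. \<pi> (c \<odot>\<^bsub>bop H\<^esub> x) = c \<odot>\<^bsub>bop K\<^esub> \<pi> x) \<and>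
     (\<forall>x\<in>R. \<forall>y\<in>R. \<pi> (x \<otimes>\<^bsub>bop H\<^esub> y) = \<pi> x \<otimes>\<^bsub>bop K\<^esub> \<pi> y) \<and>
     (\<forall>x\<in>R. \<pi> (adj H x) = adj K (\<pi> x)) \<and>
     \<pi> \<one>\<^bsub>bop H\<^esub> = \<one>\<^bsub>bop K\<^esub>"

definition faithful_normal_representation ::
  "'h hilbert \<Rightarrow> ('h \<Rightarrow> 'h) set \<Rightarrow> 'k hilbert \<Rightarrow> (('h \<Rightarrow> 'h) \<Rightarrow> 'k \<Rightarrow> 'k) \<Rightarrow> bool" where
  "faithful_normal_representation H R K \<pi> \<longleftrightarrow>
     hilbert_space K \<and> star_representation H R K \<pi> \<and> inj_on \<pi> R \<and>
     continuous_map (subtopology (ultraweak_topology H) R) (ultraweak_topology K) \<pi>"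


section \<open>Quantum channels\<close>

text \<open>
  Sums over an arbitrary index set are limits of the net of finite partial sums.  The type argument
  is the type from which the index sets are taken.
\<close>

definition quantum_channel ::
  "'j itself \<Rightarrow> 'h hilbert \<Rightarrow> ('h \<Rightarrow> 'h) set \<Rightarrow> (('h \<Rightarrow> 'h) \<Rightarrow> 'h \<Rightarrow> 'h) \<Rightarrow> bool" where
  "quantum_channel _ H R \<phi> \<longleftrightarrow>
     \<phi> \<in> R \<rightarrow> R \<and>
     (\<exists>(J :: 'j set) a. a \<in> J \<rightarrow> R \<and>
        limitin (strong_operator_topology H)
          (\<lambda>F. \<Oplus>\<^bsub>bop H\<^esub> j\<in>F. adj H (a j) \<otimes>\<^bsub>bop H\<^esub> a j)
          \<one>\<^bsub>bop H\<^esub> (finite_subsets_at_top J) \<and>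
        (\<forall>x\<in>R. limitin (strong_operator_topology H)
          (\<lambda>F. \<Oplus>\<^bsub>bop H\<^esub> j\<in>F. adj H (a j) \<otimes>\<^bsub>bop H\<^esub> x \<otimes>\<^bsub>bop H\<^esub> a j)
          (\<phi> x) (finite_subsets_at_top J)))"


section \<open>The GNS construction\<close>

text \<open>
  The GNS space is the completion of \<open>R\<close> for the semi-inner product \<open>(x, y) \<mapsto> \<omega> (y\<^sup>* x)\<close>, modulo
  vectors of seminorm zero.  Quotient and completion are taken in one step: the elements are
  classes of sequences in \<open>R\<close> that are Cauchy for the seminorm, two sequences being equivalent
  if the seminorm of their difference tends to \<open>0\<close>.
\<close>

definition gns_form ::
  "'h hilbert \<Rightarrow> (('h \<Rightarrow> 'h) \<Rightarrow> complex) \<Rightarrow> ('h \<Rightarrow> 'h) \<Rightarrow> ('h \<Rightarrow> 'h) \<Rightarrow> complex" where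
  "gns_form H \<omega> x y = \<omega> (adj H y \<otimes>\<^bsub>bop H\<^esub> x)"

definition gns_dist ::
  "'h hilbert \<Rightarrow> (('h \<Rightarrow> 'h) \<Rightarrow> complex) \<Rightarrow> ('h \<Rightarrow> 'h) \<Rightarrow> ('h \<Rightarrow> 'h) \<Rightarrow> real" where
  "gns_dist H \<omega> x y = sqrt (Re (gns_form H \<omega> (x \<ominus>\<^bsub>bop H\<^esub> y) (x \<ominus>\<^bsub>bop H\<^esub> y)))"

definition gns_cauchy ::
  "'h hilbert \<Rightarrow> ('h \<Rightarrow> 'h) set \<Rightarrow> (('h \<Rightarrow> 'h) \<Rightarrow> complex) \<Rightarrow> (nat \<Rightarrow> 'h \<Rightarrow> 'h) set" where
  "gns_cauchy H R \<omega> =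
     {\<sigma>. range \<sigma> \<subseteq> R \<and> (\<forall>\<epsilon>>0. \<exists>N. \<forall>m\<ge>N. \<forall>n\<ge>N. gns_dist H \<omega> (\<sigma> m) (\<sigma> n) < \<epsilon>)}"

definition gns_equiv ::
  "'h hilbert \<Rightarrow> ('h \<Rightarrow> 'h) set \<Rightarrow> (('h \<Rightarrow> 'h) \<Rightarrow> complex) \<Rightarrow>
     ((nat \<Rightarrow> 'h \<Rightarrow> 'h) \<times> (nat \<Rightarrow> 'h \<Rightarrow> 'h)) set" where
  "gns_equiv H R \<omega> =
     {(\<sigma>, \<tau>). \<sigma> \<in> gns_cauchy H R \<omega> \<and> \<tau> \<in> gns_cauchy H R \<omega> \<and>
        (\<lambda>n. gns_dist H \<omega> (\<sigma> n) (\<tau> n)) \<longlonglongrightarrow> 0}"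

definition gns_class ::
  "'h hilbert \<Rightarrow> ('h \<Rightarrow> 'h) set \<Rightarrow> (('h \<Rightarrow> 'h) \<Rightarrow> complex) \<Rightarrow>
     (nat \<Rightarrow> 'h \<Rightarrow> 'h) \<Rightarrow> (nat \<Rightarrow> 'h \<Rightarrow> 'h) set" where
  "gns_class H R \<omega> \<sigma> = gns_equiv H R \<omega> `` {\<sigma>}"

definition gns_repr :: "(nat \<Rightarrow> 'h \<Rightarrow> 'h) set \<Rightarrow> nat \<Rightarrow> 'h \<Rightarrow> 'h" where
  "gns_repr A = (SOME \<sigma>. \<sigma> \<in> A)"

definition gns_space ::
  "'h hilbert \<Rightarrow> ('h \<Rightarrow> 'h) set \<Rightarrow> (('h \<Rightarrow> 'h) \<Rightarrow> complex) \<Rightarrow> (nat \<Rightarrow> 'h \<Rightarrow> 'h) set hilbert" where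
  "gns_space H R \<omega> =
     \<lparr>carrier = gns_cauchy H R \<omega> // gns_equiv H R \<omega>,
      mult = undefined,
      one = undefined,
      zero = gns_class H R \<omega> (\<lambda>n. \<zero>\<^bsub>bop H\<^esub>),
      add = (\<lambda>A B. gns_class H R \<omega> (\<lambda>n. gns_repr A n \<oplus>\<^bsub>bop H\<^esub> gns_repr B n)),
      smult = (\<lambda>c A. gns_class H R \<omega> (\<lambda>n. c \<odot>\<^bsub>bop H\<^esub> gns_repr A n)),
      hinner = (\<lambda>A B. lim (\<lambda>n. gns_form H \<omega> (gns_repr A n) (gns_repr B n)))\<rparr>"

definition gns_representation ::
  "'h hilbert \<Rightarrow> ('h \<Rightarrow> 'h) set \<Rightarrow> (('h \<Rightarrow> 'h) \<Rightarrow> complex) \<Rightarrow>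
     ('h \<Rightarrow> 'h) \<Rightarrow> (nat \<Rightarrow> 'h \<Rightarrow> 'h) set \<Rightarrow> (nat \<Rightarrow> 'h \<Rightarrow> 'h) set" where
  "gns_representation H R \<omega> x =
     (\<lambda>A\<in>carrier (gns_space H R \<omega>). gns_class H R \<omega> (\<lambda>n. x \<otimes>\<^bsub>bop H\<^esub> gns_repr A n))"

definition gns_vector ::
  "'h hilbert \<Rightarrow> ('h \<Rightarrow> 'h) set \<Rightarrow> (('h \<Rightarrow> 'h) \<Rightarrow> complex) \<Rightarrow> (nat \<Rightarrow> 'h \<Rightarrow> 'h) set" where
  "gns_vector H R \<omega> = gns_class H R \<omega> (\<lambda>n. \<one>\<^bsub>bop H\<^esub>)"


section \<open>The universe of Hilbert spaces\<close>

text \<open>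
  HOL cannot quantify over types inside a formula, so "every Hilbert space" and "some index set"
  range over the carriers and index sets contained in one type.  This type has an arbitrary
  part \<open>'u\<close>, so for a suitable \<open>'u\<close> every given Hilbert space or index set occurs; the part
  \<open>nat \<Rightarrow> 'h\<close> makes the type large enough, for every \<open>'u\<close>, to contain the Hilbert sum of countably
  many copies of a Hilbert space with carrier in \<open>'h\<close>, on which every normal state is a vector state.
\<close>

type_synonym ('h, 'u) universe = "(nat \<Rightarrow> 'h) + 'u"

end

theory Submission
  imports Defs
begin

text \<open>
  The engine is that a normal state \<open>\<omega>\<close> on a von Neumann algebra \<open>R\<close> on \<open>H\<close> is a countable sum of
  vector functionals, \<open>\<omega> x = \<Sum>n. \<langle>x \<zeta>\<^sub>n, \<zeta>\<^sub>n\<rangle>\<close> (\<open>normal_state_decomposition\<close>).  By the definition of the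
  ultraweak topology, \<open>\<omega> x = \<langle>(x \<otimes> 1) \<xi>, \<eta>\<rangle>\<close> on the Hilbert sum of countably many copies of \<open>H\<close>.
  Positivity of \<open>\<omega>\<close> bounds it by the vector functional of \<open>\<xi> + \<eta>\<close>, so that
  \<open>\<omega> x = \<langle>(x \<otimes> 1) (\<xi> + \<eta>), T (\<xi> + \<eta>)\<rangle>\<close> with a positive contraction \<open>T\<close> in the commutant of
  \<open>R \<otimes> 1\<close>.  Since \<open>T\<close> is a sum of squares of selfadjoint operators that again commute with
  \<open>R \<otimes> 1\<close>, this is a sum of vector functionals.

  Two consequences concern a representation \<open>\<pi>\<close> in which every vector state has this form: its
  cyclic subrepresentations embed into the countable multiple of the identity representation, and
  the intertwiners from \<open>\<pi>\<close> to the identity representation separate vectors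
  (\<open>cyclic_subrepresentation\<close>, \<open>intertwiners_separate\<close>).  All normal representations are of this
  kind, and so is the GNS representation of a normal state, which allows the conditions on
  faithful normal representations and the condition on the GNS representation to be treated
  together.

  From a channel \<open>\<phi> x = \<Sum>j. a\<^sub>j\<^sup>* x a\<^sub>j\<close> and an extension \<open>\<omega>'\<close> of \<open>\<omega>\<close>, the functional
  \<open>\<rho>' y = \<Sum>j. \<omega>' (\<pi>(a\<^sub>j)\<^sup>* y \<pi>(a\<^sub>j))\<close> extends \<open>\<omega> \<circ> \<phi>\<close>, and it agrees with \<open>\<omega>'\<close> on the commutant of
  \<open>\<pi>(R)\<close> because \<open>\<Sum>j. \<pi>(a\<^sub>j)\<^sup>* \<pi>(a\<^sub>j) = 1\<close> (\<open>channel_imp_extension\<close>).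

  Conversely (\<open>extension_imp_channel\<close>), let \<open>\<omega> x = \<langle>\<pi>(x) \<xi>, \<xi>\<rangle>\<close>, and let
  \<open>\<rho>' y = \<Sum>n. \<langle>y \<eta>\<^sub>n, \<eta>\<^sub>n\<rangle>\<close> agree with the vector state of \<open>\<xi>\<close> on the commutant of \<open>\<pi>(R)\<close>.  For every
  intertwiner \<open>T\<close> from \<open>\<pi>\<close> to the identity representation, \<open>T\<^sup>* T\<close> belongs to that commutant, hence
  \<open>\<Sum>n. \<parallel>T \<eta>\<^sub>n\<parallel>\<^sup>2 = \<parallel>T \<xi>\<parallel>\<^sup>2\<close>.  The isometry \<open>T \<xi> \<mapsto> (T \<eta>\<^sub>n)\<^sub>n\<close> commutes with the commutant of \<open>R\<close>, since
  an intertwiner followed by an element of the commutant is again an intertwiner.  Its components \<open>a\<^sub>n\<close> therefore belong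
  to \<open>R\<close>, and \<open>T (\<pi>(a\<^sub>n) \<xi>) = a\<^sub>n (T \<xi>) = T \<eta>\<^sub>n\<close> for all \<open>T\<close> gives \<open>\<pi>(a\<^sub>n) \<xi> = \<eta>\<^sub>n\<close>, that is,
  \<open>\<rho> x = \<Sum>n. \<omega> (a\<^sub>n\<^sup>* x a\<^sub>n)\<close>.  The projection \<open>c\<close> onto the orthogonal complement of the initial space
  completes the family \<open>a\<close> to a channel and contributes nothing to \<open>\<rho>\<close>, because \<open>\<pi>(c) \<xi> = 0\<close>.

  A faithful normal representation in which \<open>\<omega>\<close> is a vector state is the countable multiple of the
  identity representation, with the vector \<open>(\<zeta>\<^sub>n)\<^sub>n\<close>.
\<close>


section \<open>Vector calculus in a Hilbert space with a carrier\<close>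

lemma complex_scalars [simp]:
  "carrier (ring_of_type_algebra :: complex ring) = UNIV"
  "\<zero>\<^bsub>(ring_of_type_algebra :: complex ring)\<^esub> = 0"
  "\<one>\<^bsub>(ring_of_type_algebra :: complex ring)\<^esub> = 1"
  "a \<oplus>\<^bsub>(ring_of_type_algebra :: complex ring)\<^esub> b = a + b"
  "a \<otimes>\<^bsub>(ring_of_type_algebra :: complex ring)\<^esub> b = a * b"
  by (simp_all add: ring_of_type_algebra_def)

lemma hvec_closed [simp, intro]:
  assumes "hilbert_space H"
  shows "\<zero>\<^bsub>H\<^esub> \<in> carrier H"
    and "\<xi> \<in> carrier H \<Longrightarrow> \<eta> \<in> carrier H \<Longrightarrow> \<xi> \<oplus>\<^bsub>H\<^esub> \<eta> \<in> carrier H"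
    and "\<xi> \<in> carrier H \<Longrightarrow> \<eta> \<in> carrier H \<Longrightarrow> \<xi> \<ominus>\<^bsub>H\<^esub> \<eta> \<in> carrier H"
    and "\<xi> \<in> carrier H \<Longrightarrow> c \<odot>\<^bsub>H\<^esub> \<xi> \<in> carrier H"
proof -
  interpret hilbert_space H by fact
  show "\<zero>\<^bsub>H\<^esub> \<in> carrier H"
    and "\<xi> \<in> carrier H \<Longrightarrow> \<eta> \<in> carrier H \<Longrightarrow> \<xi> \<oplus>\<^bsub>H\<^esub> \<eta> \<in> carrier H"
    and "\<xi> \<in> carrier H \<Longrightarrow> \<eta> \<in> carrier H \<Longrightarrow> \<xi> \<ominus>\<^bsub>H\<^esub> \<eta> \<in> carrier H"
    and "\<xi> \<in> carrier H \<Longrightarrow> c \<odot>\<^bsub>H\<^esub> \<xi> \<in> carrier H"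
    by auto
qed

lemma hinner_simps [simp]:
  assumes "hilbert_space H"
  shows "\<xi> \<in> carrier H \<Longrightarrow> \<eta> \<in> carrier H \<Longrightarrow> \<zeta> \<in> carrier H \<Longrightarrow>
        hinner H (\<xi> \<oplus>\<^bsub>H\<^esub> \<eta>) \<zeta> = hinner H \<xi> \<zeta> + hinner H \<eta> \<zeta>"
    and "\<xi> \<in> carrier H \<Longrightarrow> \<eta> \<in> carrier H \<Longrightarrow> \<zeta> \<in> carrier H \<Longrightarrow>
        hinner H \<zeta> (\<xi> \<oplus>\<^bsub>H\<^esub> \<eta>) = hinner H \<zeta> \<xi> + hinner H \<zeta> \<eta>"
    and "\<xi> \<in> carrier H \<Longrightarrow> \<eta> \<in> carrier H \<Longrightarrow> hinner H (c \<odot>\<^bsub>H\<^esub> \<xi>) \<eta> = c * hinner H \<xi> \<eta>"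
    and "\<xi> \<in> carrier H \<Longrightarrow> \<eta> \<in> carrier H \<Longrightarrow> hinner H \<xi> (c \<odot>\<^bsub>H\<^esub> \<eta>) = cnj c * hinner H \<xi> \<eta>"
    and "\<xi> \<in> carrier H \<Longrightarrow> hinner H \<zero>\<^bsub>H\<^esub> \<xi> = 0"
    and "\<xi> \<in> carrier H \<Longrightarrow> hinner H \<xi> \<zero>\<^bsub>H\<^esub> = 0"
    and "\<xi> \<in> carrier H \<Longrightarrow> \<eta> \<in> carrier H \<Longrightarrow> \<zeta> \<in> carrier H \<Longrightarrow>
        hinner H (\<xi> \<ominus>\<^bsub>H\<^esub> \<eta>) \<zeta> = hinner H \<xi> \<zeta> - hinner H \<eta> \<zeta>"
    and "\<xi> \<in> carrier H \<Longrightarrow> \<eta> \<in> carrier H \<Longrightarrow> \<zeta> \<in> carrier H \<Longrightarrow>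
        hinner H \<zeta> (\<xi> \<ominus>\<^bsub>H\<^esub> \<eta>) = hinner H \<zeta> \<xi> - hinner H \<zeta> \<eta>"
proof -
  interpret hilbert_space H by fact
  have zl: "hinner H \<zero>\<^bsub>H\<^esub> \<xi> = 0" if "\<xi> \<in> carrier H" for \<xi>
    using hinner_add_left[of "\<zero>\<^bsub>H\<^esub>" "\<zero>\<^bsub>H\<^esub>" \<xi>] that by simp
  have nl: "hinner H (\<ominus>\<^bsub>H\<^esub> \<eta>) \<zeta> = - hinner H \<eta> \<zeta>" if "\<eta> \<in> carrier H" "\<zeta> \<in> carrier H" for \<eta> \<zeta>
    using hinner_add_left[of "\<ominus>\<^bsub>H\<^esub> \<eta>" \<eta> \<zeta>] that zl[of \<zeta>] M.l_neg[of \<eta>]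
    by (simp add: eq_neg_iff_add_eq_0)
  have ml: "hinner H (\<xi> \<ominus>\<^bsub>H\<^esub> \<eta>) \<zeta> = hinner H \<xi> \<zeta> - hinner H \<eta> \<zeta>"
    if "\<xi> \<in> carrier H" "\<eta> \<in> carrier H" "\<zeta> \<in> carrier H" for \<xi> \<eta> \<zeta>
    using that by (simp add: a_minus_def hinner_add_left nl)
  have c: "hinner H \<xi> \<eta> = cnj (hinner H \<eta> \<xi>)" if "\<xi> \<in> carrier H" "\<eta> \<in> carrier H" for \<xi> \<eta>
    using hinner_commute that by blast
  show "\<xi> \<in> carrier H \<Longrightarrow> \<eta> \<in> carrier H \<Longrightarrow> \<zeta> \<in> carrier H \<Longrightarrow>
        hinner H (\<xi> \<oplus>\<^bsub>H\<^esub> \<eta>) \<zeta> = hinner H \<xi> \<zeta> + hinner H \<eta> \<zeta>"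
    and "\<xi> \<in> carrier H \<Longrightarrow> \<eta> \<in> carrier H \<Longrightarrow> hinner H (c \<odot>\<^bsub>H\<^esub> \<xi>) \<eta> = c * hinner H \<xi> \<eta>"
    and "\<xi> \<in> carrier H \<Longrightarrow> hinner H \<zero>\<^bsub>H\<^esub> \<xi> = 0"
    and "\<xi> \<in> carrier H \<Longrightarrow> \<eta> \<in> carrier H \<Longrightarrow> \<zeta> \<in> carrier H \<Longrightarrow>
        hinner H (\<xi> \<ominus>\<^bsub>H\<^esub> \<eta>) \<zeta> = hinner H \<xi> \<zeta> - hinner H \<eta> \<zeta>"
    by (simp_all add: hinner_add_left hinner_smult_left zl ml)
  show "\<xi> \<in> carrier H \<Longrightarrow> \<eta> \<in> carrier H \<Longrightarrow> \<zeta> \<in> carrier H \<Longrightarrow>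
        hinner H \<zeta> (\<xi> \<oplus>\<^bsub>H\<^esub> \<eta>) = hinner H \<zeta> \<xi> + hinner H \<zeta> \<eta>"
    by (subst c, simp, simp, subst (2 3) c) (simp_all add: hinner_add_left)
  show "\<xi> \<in> carrier H \<Longrightarrow> \<eta> \<in> carrier H \<Longrightarrow> hinner H \<xi> (c \<odot>\<^bsub>H\<^esub> \<eta>) = cnj c * hinner H \<xi> \<eta>"
    by (subst (1 2) c) (simp_all add: hinner_smult_left)
  show "\<xi> \<in> carrier H \<Longrightarrow> hinner H \<xi> \<zero>\<^bsub>H\<^esub> = 0"
    by (subst c) (simp_all add: zl)
  show "\<xi> \<in> carrier H \<Longrightarrow> \<eta> \<in> carrier H \<Longrightarrow> \<zeta> \<in> carrier H \<Longrightarrow>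
        hinner H \<zeta> (\<xi> \<ominus>\<^bsub>H\<^esub> \<eta>) = hinner H \<zeta> \<xi> - hinner H \<zeta> \<eta>"
    by (subst c, simp, simp, subst (2 3) c) (simp_all add: ml)
qed

lemma hinner_cnj: "hilbert_space H \<Longrightarrow> \<xi> \<in> carrier H \<Longrightarrow> \<eta> \<in> carrier H \<Longrightarrow>
    cnj (hinner H \<xi> \<eta>) = hinner H \<eta> \<xi>"
  by (simp add: hilbert_space.hinner_commute[of H \<xi> \<eta>])

lemma hnorm_nonneg [simp]: "hilbert_space H \<Longrightarrow> \<xi> \<in> carrier H \<Longrightarrow> 0 \<le> hnorm H \<xi>"
  using hilbert_space.hinner_nonneg[of H \<xi>]
  by (auto simp: hnorm_def complex_nonneg_Reals_iff)

lemma hnorm_power2: "hilbert_space H \<Longrightarrow> \<xi> \<in> carrier H \<Longrightarrow> (hnorm H \<xi>)\<^sup>2 = Re (hinner H \<xi> \<xi>)"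
  using hilbert_space.hinner_nonneg[of H \<xi>]
  by (auto simp: hnorm_def complex_nonneg_Reals_iff)

lemma hinner_self: "hilbert_space H \<Longrightarrow> \<xi> \<in> carrier H \<Longrightarrow>
    hinner H \<xi> \<xi> = complex_of_real ((hnorm H \<xi>)\<^sup>2)"
  using hilbert_space.hinner_nonneg[of H \<xi>]
  by (auto simp: hnorm_power2 complex_nonneg_Reals_iff complex_eq_iff simp del: of_real_power)

lemma hnorm_zero [simp]: "hilbert_space H \<Longrightarrow> hnorm H \<zero>\<^bsub>H\<^esub> = 0"
  by (simp add: hnorm_def)

lemma hnorm_eq_0_iff: "hilbert_space H \<Longrightarrow> \<xi> \<in> carrier H \<Longrightarrow> hnorm H \<xi> = 0 \<longleftrightarrow> \<xi> = \<zero>\<^bsub>H\<^esub>"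
  using hilbert_space.hinner_eq_zero[of H \<xi>] by (auto simp: hinner_self)

text \<open>
  Vectors are compared by testing them against all vectors: this turns identities between vectors
  of a carrier into identities between complex numbers, which the simplifier can handle.
\<close>

lemma hvec_eqI:
  assumes "hilbert_space H" "\<xi> \<in> carrier H" "\<eta> \<in> carrier H"
    and "\<And>\<zeta>. \<zeta> \<in> carrier H \<Longrightarrow> hinner H \<xi> \<zeta> = hinner H \<eta> \<zeta>"
  shows "\<xi> = \<eta>"
proof -
  interpret hilbert_space H by fact
  have "hinner H (\<xi> \<ominus>\<^bsub>H\<^esub> \<eta>) (\<xi> \<ominus>\<^bsub>H\<^esub> \<eta>) = 0"
    using assms by simp
  then have "\<xi> \<ominus>\<^bsub>H\<^esub> \<eta> = \<zero>\<^bsub>H\<^esub>" using assms hinner_eq_zero by blast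
  then show ?thesis using assms by (metis M.minus_equality M.minus_minus M.add.inv_closed M.a_comm a_minus_def)
qed

lemma hvec_eqI_right:
  assumes "hilbert_space H" "\<xi> \<in> carrier H" "\<eta> \<in> carrier H"
    and "\<And>\<zeta>. \<zeta> \<in> carrier H \<Longrightarrow> hinner H \<zeta> \<xi> = hinner H \<zeta> \<eta>"
  shows "\<xi> = \<eta>"
  by (rule hvec_eqI[OF assms(1-3)]) (metis assms hinner_cnj)

lemma hdiff_eq_zero_iff:
  assumes "hilbert_space H" "\<xi> \<in> carrier H" "\<eta> \<in> carrier H"
  shows "hnorm H (\<xi> \<ominus>\<^bsub>H\<^esub> \<eta>) = 0 \<longleftrightarrow> \<xi> = \<eta>"
proof
  assume "hnorm H (\<xi> \<ominus>\<^bsub>H\<^esub> \<eta>) = 0"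
  then have z: "\<xi> \<ominus>\<^bsub>H\<^esub> \<eta> = \<zero>\<^bsub>H\<^esub>" using assms by (simp add: hnorm_eq_0_iff)
  show "\<xi> = \<eta>"
  proof (rule hvec_eqI[OF assms])
    fix \<zeta> assume \<zeta>: "\<zeta> \<in> carrier H"
    have "hinner H \<xi> \<zeta> - hinner H \<eta> \<zeta> = hinner H (\<xi> \<ominus>\<^bsub>H\<^esub> \<eta>) \<zeta>" using assms \<zeta> by simp
    also have "\<dots> = 0" unfolding z using assms \<zeta> by simp
    finally show "hinner H \<xi> \<zeta> = hinner H \<eta> \<zeta>" by simp
  qed
next
  assume "\<xi> = \<eta>"
  then show "hnorm H (\<xi> \<ominus>\<^bsub>H\<^esub> \<eta>) = 0" using assms by (simp add: hnorm_def)
qed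

text \<open>The discriminant argument behind every Cauchy-Schwarz inequality.\<close>

lemma quadratic_form_discriminant:
  fixes b :: complex and a d :: real
  assumes d0: "0 \<le> d"
    and nonneg: "\<And>c. 0 \<le> a + 2 * Re (c * b) + (norm c)\<^sup>2 * d"
  shows "(norm b)\<^sup>2 \<le> a * d"
proof (cases "d = 0")
  case True
  have "b = 0"
  proof (rule ccontr)
    assume "b \<noteq> 0"
    then have pos: "(norm b)\<^sup>2 > 0" by simp
    define t where "t = - (\<bar>a\<bar> + 1) / (norm b)\<^sup>2"
    have "Re (of_real t * cnj b * b) = t * (norm b)\<^sup>2"
      by (metis complex_norm_square mult.commute mult.assoc of_real_mult Re_complex_of_real of_real_power)
    also have "\<dots> = - (\<bar>a\<bar> + 1)" using pos by (simp add: t_def)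
    finally show False using nonneg[of "of_real t * cnj b"] True by simp
  qed
  then show ?thesis using True by simp
next
  case False
  then have d: "d > 0" using d0 by simp
  have e1: "Re ((- cnj b / of_real d) * b) = - ((norm b)\<^sup>2 / d)"
  proof -
    have "(- cnj b / of_real d) * b = - complex_of_real ((norm b)\<^sup>2) / of_real d"
      by (simp add: complex_norm_square mult.commute del: of_real_power)
    also have "\<dots> = complex_of_real (- ((norm b)\<^sup>2 / d))" by simp
    finally show ?thesis by (simp only: Re_complex_of_real)
  qed
  have e2: "(norm (- cnj b / of_real d))\<^sup>2 * d = (norm b)\<^sup>2 / d"
    using d by (simp add: norm_divide power_divide power2_eq_square)
  have "0 \<le> a - (norm b)\<^sup>2 / d"
    using nonneg[of "- cnj b / of_real d"] e1 e2 by linarith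
  then show ?thesis using d by (simp add: field_simps)
qed

lemma hnorm_add_smult:
  assumes "hilbert_space H" "\<xi> \<in> carrier H" "\<eta> \<in> carrier H"
  shows "(hnorm H (\<xi> \<oplus>\<^bsub>H\<^esub> c \<odot>\<^bsub>H\<^esub> \<eta>))\<^sup>2
    = (hnorm H \<xi>)\<^sup>2 + 2 * Re (c * hinner H \<eta> \<xi>) + (norm c)\<^sup>2 * (hnorm H \<eta>)\<^sup>2"
proof -
  have "hinner H (\<xi> \<oplus>\<^bsub>H\<^esub> c \<odot>\<^bsub>H\<^esub> \<eta>) (\<xi> \<oplus>\<^bsub>H\<^esub> c \<odot>\<^bsub>H\<^esub> \<eta>)
      = hinner H \<xi> \<xi> + (c * hinner H \<eta> \<xi> + cnj (c * hinner H \<eta> \<xi>)) + c * cnj c * hinner H \<eta> \<eta>"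
    using assms by (simp add: hinner_cnj algebra_simps)
  also have "Re \<dots> = (hnorm H \<xi>)\<^sup>2 + 2 * Re (c * hinner H \<eta> \<xi>) + (norm c)\<^sup>2 * (hnorm H \<eta>)\<^sup>2"
    using assms
    by (simp add: hinner_self complex_mult_cnj cmod_power2 del: of_real_power complex_cnj_mult)
  finally show ?thesis using assms by (simp only: hnorm_power2 hvec_closed)
qed

lemma hcauchy_schwarz:
  assumes H: "hilbert_space H" and "\<xi> \<in> carrier H" "\<eta> \<in> carrier H"
  shows "norm (hinner H \<xi> \<eta>) \<le> hnorm H \<xi> * hnorm H \<eta>"
proof -
  have "0 \<le> (hnorm H \<xi>)\<^sup>2 + 2 * Re (c * hinner H \<eta> \<xi>) + (norm c)\<^sup>2 * (hnorm H \<eta>)\<^sup>2" for c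
    by (metis hnorm_add_smult[OF assms] zero_le_power2)
  then have q: "(norm (hinner H \<eta> \<xi>))\<^sup>2 \<le> (hnorm H \<xi>)\<^sup>2 * (hnorm H \<eta>)\<^sup>2"
    by (intro quadratic_form_discriminant) auto
  have "norm (hinner H \<xi> \<eta>) = norm (hinner H \<eta> \<xi>)"
    by (metis assms complex_mod_cnj hinner_cnj)
  then have "(norm (hinner H \<xi> \<eta>))\<^sup>2 \<le> (hnorm H \<xi> * hnorm H \<eta>)\<^sup>2"
    using q by (simp only: power_mult_distrib)
  then show ?thesis by (rule power2_le_imp_le) (use assms in auto)
qed

lemma hnorm_smult: "hilbert_space H \<Longrightarrow> \<xi> \<in> carrier H \<Longrightarrow> hnorm H (c \<odot>\<^bsub>H\<^esub> \<xi>) = norm c * hnorm H \<xi>"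
proof -
  assume a: "hilbert_space H" "\<xi> \<in> carrier H"
  have "hinner H (c \<odot>\<^bsub>H\<^esub> \<xi>) (c \<odot>\<^bsub>H\<^esub> \<xi>) = (c * cnj c) * hinner H \<xi> \<xi>" using a by simp
  also have "\<dots> = complex_of_real ((norm c)\<^sup>2 * (hnorm H \<xi>)\<^sup>2)"
    using a by (simp add: hinner_self flip: complex_norm_square)
  finally have "(hnorm H (c \<odot>\<^bsub>H\<^esub> \<xi>))\<^sup>2 = (norm c * hnorm H \<xi>)\<^sup>2"
    using a by (simp only: hnorm_power2 hvec_closed(4) Re_complex_of_real power_mult_distrib)
  then show ?thesis using a by (simp add: power2_eq_iff_nonneg)
qed

lemma hnorm_triangle:
  assumes "hilbert_space H" "\<xi> \<in> carrier H" "\<eta> \<in> carrier H"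
  shows "hnorm H (\<xi> \<oplus>\<^bsub>H\<^esub> \<eta>) \<le> hnorm H \<xi> + hnorm H \<eta>"
proof -
  have "Re (hinner H \<xi> \<eta>) \<le> hnorm H \<xi> * hnorm H \<eta>"
    using hcauchy_schwarz[OF assms] complex_Re_le_cmod[of "hinner H \<xi> \<eta>"] by linarith
  moreover have "Re (hinner H \<eta> \<xi>) = Re (hinner H \<xi> \<eta>)"
    using assms by (metis complex_cnj(1) hinner_cnj complex.sel(1) complex_surj)
  ultimately have "(hnorm H (\<xi> \<oplus>\<^bsub>H\<^esub> \<eta>))\<^sup>2 \<le> (hnorm H \<xi> + hnorm H \<eta>)\<^sup>2"
    using assms by (simp add: hnorm_power2 power2_sum)
  then show ?thesis using assms by (simp add: power2_le_iff_abs_le)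
qed

lemma hminus_conv: "hilbert_space H \<Longrightarrow> \<xi> \<in> carrier H \<Longrightarrow> \<eta> \<in> carrier H \<Longrightarrow>
    \<xi> \<ominus>\<^bsub>H\<^esub> \<eta> = \<xi> \<oplus>\<^bsub>H\<^esub> (-1) \<odot>\<^bsub>H\<^esub> \<eta>"
  by (rule hvec_eqI) auto

lemma hnorm_minus_commute: "hilbert_space H \<Longrightarrow> \<xi> \<in> carrier H \<Longrightarrow> \<eta> \<in> carrier H \<Longrightarrow>
    hnorm H (\<xi> \<ominus>\<^bsub>H\<^esub> \<eta>) = hnorm H (\<eta> \<ominus>\<^bsub>H\<^esub> \<xi>)"
  by (simp add: hnorm_def algebra_simps)

lemma hnorm_triangle_minus:
  assumes "hilbert_space H" "\<xi> \<in> carrier H" "\<eta> \<in> carrier H" "\<zeta> \<in> carrier H"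
  shows "hnorm H (\<xi> \<ominus>\<^bsub>H\<^esub> \<zeta>) \<le> hnorm H (\<xi> \<ominus>\<^bsub>H\<^esub> \<eta>) + hnorm H (\<eta> \<ominus>\<^bsub>H\<^esub> \<zeta>)"
proof -
  have "\<xi> \<ominus>\<^bsub>H\<^esub> \<zeta> = (\<xi> \<ominus>\<^bsub>H\<^esub> \<eta>) \<oplus>\<^bsub>H\<^esub> (\<eta> \<ominus>\<^bsub>H\<^esub> \<zeta>)"
    using assms by (intro hvec_eqI[of H]) auto
  then show ?thesis using assms hnorm_triangle[of H "\<xi> \<ominus>\<^bsub>H\<^esub> \<eta>" "\<eta> \<ominus>\<^bsub>H\<^esub> \<zeta>"] by simp
qed

text \<open>A norm bound for a vector that is known only through its inner products.\<close>

lemma hnorm_le_by_testing: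
  assumes "hilbert_space H" "\<xi> \<in> carrier H" "0 \<le> C"
    and "norm (hinner H \<xi> \<xi>) \<le> C * hnorm H \<xi>"
  shows "hnorm H \<xi> \<le> C"
proof (cases "hnorm H \<xi> = 0")
  case False
  then have "hnorm H \<xi> > 0" using assms hnorm_nonneg[of H \<xi>] by linarith
  moreover have "hnorm H \<xi> * hnorm H \<xi> \<le> C * hnorm H \<xi>"
    using assms by (simp add: hinner_self power2_eq_square norm_mult)
  ultimately show ?thesis by simp
qed (use assms in simp)

lemma hparallelogram:
  assumes "hilbert_space H" "\<xi> \<in> carrier H" "\<eta> \<in> carrier H"
  shows "(hnorm H (\<xi> \<oplus>\<^bsub>H\<^esub> \<eta>))\<^sup>2 + (hnorm H (\<xi> \<ominus>\<^bsub>H\<^esub> \<eta>))\<^sup>2 = 2 * (hnorm H \<xi>)\<^sup>2 + 2 * (hnorm H \<eta>)\<^sup>2"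
  using assms by (simp add: hnorm_power2)


subsection \<open>Completeness\<close>

lemma hdist_metric:
  assumes "hilbert_space H"
  shows "Metric_space (carrier H) (hdist H)"
proof
  show "0 \<le> hdist H x y" for x y using assms by (simp add: hdist_def)
  show "hdist H x y = hdist H y x" for x y using assms by (simp add: hdist_def hnorm_minus_commute)
  show "x \<in> carrier H \<Longrightarrow> y \<in> carrier H \<Longrightarrow> (hdist H x y = 0) = (x = y)" for x y
    using assms by (simp add: hdist_def hdiff_eq_zero_iff)
  show "x \<in> carrier H \<Longrightarrow> y \<in> carrier H \<Longrightarrow> z \<in> carrier H \<Longrightarrow> hdist H x z \<le> hdist H x y + hdist H y z" for x y z
    using assms by (simp add: hdist_def hnorm_triangle_minus)
qed

lemma hlimitin_iff:
  assumes "hilbert_space H" "\<And>i. f i \<in> carrier H"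
  shows "limitin (Metric_space.mtopology (carrier H) (hdist H)) f l F \<longleftrightarrow>
    l \<in> carrier H \<and> ((\<lambda>i. hnorm H (f i \<ominus>\<^bsub>H\<^esub> l)) \<longlongrightarrow> 0) F"
proof -
  interpret Metric_space "carrier H" "hdist H" by (rule hdist_metric) fact
  have "\<bar>hnorm H (f i \<ominus>\<^bsub>H\<^esub> l)\<bar> = hdist H (f i) l" if "l \<in> carrier H" for i
    using that assms by (simp add: hdist_def)
  then show ?thesis
    using assms by (auto simp: limitin_metric tendsto_iff dist_real_def)
qed

lemma hilbert_complete:
  assumes "hilbert_space H" "\<And>n. s n \<in> carrier H"
    and "\<And>\<epsilon>. \<epsilon> > 0 \<Longrightarrow> \<exists>N. \<forall>m\<ge>N. \<forall>n\<ge>N. hnorm H (s m \<ominus>\<^bsub>H\<^esub> s n) < \<epsilon>"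
  obtains l where "l \<in> carrier H" "(\<lambda>n. hnorm H (s n \<ominus>\<^bsub>H\<^esub> l)) \<longlonglongrightarrow> 0"
proof -
  interpret Metric_space "carrier H" "hdist H" by (rule hdist_metric) fact
  have "MCauchy s"
    unfolding MCauchy_def using assms by (auto simp: hdist_def)
  then obtain l where "limitin mtopology s l sequentially"
    using hilbert_space.complete[OF assms(1)] unfolding mcomplete_def by blast
  then show thesis using that[of l] hlimitin_iff[OF assms(1) assms(2), of "\<lambda>n. n" l sequentially] by blast
qed

lemma hinner_tendsto_left:
  assumes "hilbert_space H" "\<And>n. s n \<in> carrier H" "l \<in> carrier H" "\<zeta> \<in> carrier H"
    and "((\<lambda>n. hnorm H (s n \<ominus>\<^bsub>H\<^esub> l)) \<longlongrightarrow> 0) F"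
  shows "((\<lambda>n. hinner H (s n) \<zeta>) \<longlongrightarrow> hinner H l \<zeta>) F"
proof -
  have "((\<lambda>n. hnorm H (s n \<ominus>\<^bsub>H\<^esub> l) * hnorm H \<zeta>) \<longlongrightarrow> 0) F"
    using tendsto_mult_left_zero[OF assms(5)] .
  moreover have "norm (hinner H (s n) \<zeta> - hinner H l \<zeta>) \<le> hnorm H (s n \<ominus>\<^bsub>H\<^esub> l) * hnorm H \<zeta>" for n
    using hcauchy_schwarz[of H "s n \<ominus>\<^bsub>H\<^esub> l" \<zeta>] assms by simp
  ultimately have "((\<lambda>n. hinner H (s n) \<zeta> - hinner H l \<zeta>) \<longlongrightarrow> 0) F"
    by (metis (mono_tags, lifting) Lim_null_comparison always_eventually)
  then show ?thesis by (simp add: LIM_zero_cancel)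
qed

lemma hinner_tendsto_right:
  assumes "hilbert_space H" "\<And>n. s n \<in> carrier H" "l \<in> carrier H" "\<zeta> \<in> carrier H"
    and "((\<lambda>n. hnorm H (s n \<ominus>\<^bsub>H\<^esub> l)) \<longlongrightarrow> 0) F"
  shows "((\<lambda>n. hinner H \<zeta> (s n)) \<longlongrightarrow> hinner H \<zeta> l) F"
  using tendsto_cnj[OF hinner_tendsto_left[OF assms]] assms by (simp add: hinner_cnj)

text \<open>
  All group and module axioms of a Hilbert space follow from the sesquilinearity of the inner
  product, because two vectors at distance zero are equal.
\<close>

lemma hilbert_spaceI:
  fixes H :: "'h hilbert"
  assumes hz: "\<zero>\<^bsub>H\<^esub> \<in> carrier H"
    and add: "\<And>\<xi> \<eta>. \<xi> \<in> carrier H \<Longrightarrow> \<eta> \<in> carrier H \<Longrightarrow> \<xi> \<oplus>\<^bsub>H\<^esub> \<eta> \<in> carrier H"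
    and smult: "\<And>c \<xi>. \<xi> \<in> carrier H \<Longrightarrow> c \<odot>\<^bsub>H\<^esub> \<xi> \<in> carrier H"
    and izero: "\<And>\<zeta>. \<zeta> \<in> carrier H \<Longrightarrow> hinner H \<zero>\<^bsub>H\<^esub> \<zeta> = 0"
    and iadd: "\<And>\<xi> \<eta> \<zeta>. \<xi> \<in> carrier H \<Longrightarrow> \<eta> \<in> carrier H \<Longrightarrow> \<zeta> \<in> carrier H \<Longrightarrow>
        hinner H (\<xi> \<oplus>\<^bsub>H\<^esub> \<eta>) \<zeta> = hinner H \<xi> \<zeta> + hinner H \<eta> \<zeta>"
    and ismult: "\<And>c \<xi> \<zeta>. \<xi> \<in> carrier H \<Longrightarrow> \<zeta> \<in> carrier H \<Longrightarrow>
        hinner H (c \<odot>\<^bsub>H\<^esub> \<xi>) \<zeta> = c * hinner H \<xi> \<zeta>"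
    and icnj: "\<And>\<xi> \<eta>. \<xi> \<in> carrier H \<Longrightarrow> \<eta> \<in> carrier H \<Longrightarrow> hinner H \<eta> \<xi> = cnj (hinner H \<xi> \<eta>)"
    and nonneg: "\<And>\<xi>. \<xi> \<in> carrier H \<Longrightarrow> hinner H \<xi> \<xi> \<in> \<real>\<^sub>\<ge>\<^sub>0"
    and sep: "\<And>\<xi> \<eta>. \<xi> \<in> carrier H \<Longrightarrow> \<eta> \<in> carrier H \<Longrightarrow>
        hinner H \<xi> \<xi> - hinner H \<xi> \<eta> - hinner H \<eta> \<xi> + hinner H \<eta> \<eta> = 0 \<Longrightarrow> \<xi> = \<eta>"
    and complete: "\<And>s. (\<And>n. s n \<in> carrier H) \<Longrightarrow>
        (\<And>\<epsilon>. \<epsilon> > 0 \<Longrightarrow> \<exists>N. \<forall>m\<ge>N. \<forall>n\<ge>N. hnorm H (s m \<oplus>\<^bsub>H\<^esub> (-1) \<odot>\<^bsub>H\<^esub> s n) < \<epsilon>) \<Longrightarrow>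
        \<exists>l\<in>carrier H. (\<lambda>n. hnorm H (s n \<oplus>\<^bsub>H\<^esub> (-1) \<odot>\<^bsub>H\<^esub> l)) \<longlonglongrightarrow> 0"
  shows "hilbert_space H"
proof -
  have eqI: "\<xi> = \<eta>" if "\<xi> \<in> carrier H" "\<eta> \<in> carrier H"
    "\<And>\<zeta>. \<zeta> \<in> carrier H \<Longrightarrow> hinner H \<xi> \<zeta> = hinner H \<eta> \<zeta>" for \<xi> \<eta>
    using sep[OF that(1,2)] that by simp
  note simps = hz add smult izero iadd ismult
  have ag: "abelian_group H"
  proof (rule abelian_groupI)
    show "\<exists>\<eta>\<in>carrier H. \<eta> \<oplus>\<^bsub>H\<^esub> \<xi> = \<zero>\<^bsub>H\<^esub>" if "\<xi> \<in> carrier H" for \<xi>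
      using that by (intro bexI[of _ "(-1) \<odot>\<^bsub>H\<^esub> \<xi>"] eqI) (auto simp: simps)
  qed (auto intro!: eqI simp: simps)
  have mod: "module (ring_of_type_algebra :: complex ring) H"
    by (rule moduleI) (auto intro!: ag comm_ring_1_class.cring_from_type_algebra eqI simp: simps algebra_simps)
  have minus: "\<xi> \<ominus>\<^bsub>H\<^esub> \<eta> = \<xi> \<oplus>\<^bsub>H\<^esub> (-1) \<odot>\<^bsub>H\<^esub> \<eta>" if "\<xi> \<in> carrier H" "\<eta> \<in> carrier H" for \<xi> \<eta>
  proof -
    interpret abelian_group H by (rule ag)
    have "(-1) \<odot>\<^bsub>H\<^esub> \<eta> \<oplus>\<^bsub>H\<^esub> \<eta> = \<zero>\<^bsub>H\<^esub>" using that by (intro eqI) (auto simp: simps)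
    then have "\<ominus>\<^bsub>H\<^esub> \<eta> = (-1) \<odot>\<^bsub>H\<^esub> \<eta>" using that smult minus_equality by blast
    then show ?thesis by (simp add: a_minus_def)
  qed
  interpret module "ring_of_type_algebra :: complex ring" H by (rule mod)
  have re: "Re (hinner H \<xi> \<xi>) \<ge> 0" "Im (hinner H \<xi> \<xi>) = 0" if "\<xi> \<in> carrier H" for \<xi>
    using nonneg[OF that] by (auto simp: complex_nonneg_Reals_iff)
  have iaddr: "hinner H \<zeta> (\<xi> \<oplus>\<^bsub>H\<^esub> \<eta>) = hinner H \<zeta> \<xi> + hinner H \<zeta> \<eta>"
    if "\<xi> \<in> carrier H" "\<eta> \<in> carrier H" "\<zeta> \<in> carrier H" for \<xi> \<eta> \<zeta>
    using that icnj[of "\<xi> \<oplus>\<^bsub>H\<^esub> \<eta>" \<zeta>] icnj[of \<xi> \<zeta>] icnj[of \<eta> \<zeta>] by (simp add: simps)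
  have ismultr: "hinner H \<zeta> (c \<odot>\<^bsub>H\<^esub> \<xi>) = cnj c * hinner H \<zeta> \<xi>"
    if "\<xi> \<in> carrier H" "\<zeta> \<in> carrier H" for \<xi> \<zeta> c
    using that icnj[of "c \<odot>\<^bsub>H\<^esub> \<xi>" \<zeta>] icnj[of \<xi> \<zeta>] by (simp add: simps)
  have pre: "hilbert_space H" if cpl: "Metric_space.mcomplete (carrier H) (hdist H)"
  proof (rule hilbert_space.intro[OF mod hilbert_space_axioms.intro])
    show "\<xi> = \<zero>\<^bsub>H\<^esub>" if "\<xi> \<in> carrier H" "hinner H \<xi> \<xi> = 0" for \<xi>
      using sep[of \<xi> "\<zero>\<^bsub>H\<^esub>"] that izero[OF that(1)] izero[OF hz] icnj[OF hz that(1)] hz by simp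
  qed (rule iadd ismult icnj nonneg cpl; assumption)+
  \<comment> \<open>the metric axioms are needed before completeness can be stated for the metric\<close>
  interpret M: Metric_space "carrier H" "hdist H"
  proof
    show "0 \<le> hdist H x y" for x y using re(1) smult add by (auto simp: hdist_def hnorm_def)
    show "hdist H x y = hdist H y x" for x y
      by (simp add: hdist_def hnorm_def minus iaddr ismultr simps algebra_simps)
    show "x \<in> carrier H \<Longrightarrow> y \<in> carrier H \<Longrightarrow> (hdist H x y = 0) = (x = y)" for x y
      using re[of "x \<ominus>\<^bsub>H\<^esub> y"] sep[of x y]
      by (auto simp: hdist_def hnorm_def minus iaddr ismultr simps algebra_simps complex_eq_iff)
    show "hdist H x z \<le> hdist H x y + hdist H y z"
      if "x \<in> carrier H" "y \<in> carrier H" "z \<in> carrier H" for x y z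
    proof -
      let ?a = "x \<ominus>\<^bsub>H\<^esub> y" and ?b = "y \<ominus>\<^bsub>H\<^esub> z"
      let ?n = "\<lambda>v. Re (hinner H v v)"
      have ab: "?a \<in> carrier H" "?b \<in> carrier H" using that by auto
      have "0 \<le> ?n ?a + 2 * Re (c * hinner H ?b ?a) + (norm c)\<^sup>2 * ?n ?b" for c
      proof -
        have "0 \<le> Re (hinner H (?a \<oplus>\<^bsub>H\<^esub> c \<odot>\<^bsub>H\<^esub> ?b) (?a \<oplus>\<^bsub>H\<^esub> c \<odot>\<^bsub>H\<^esub> ?b))"
          using ab by (intro re(1) add smult)
        also have "hinner H (?a \<oplus>\<^bsub>H\<^esub> c \<odot>\<^bsub>H\<^esub> ?b) (?a \<oplus>\<^bsub>H\<^esub> c \<odot>\<^bsub>H\<^esub> ?b)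
          = hinner H ?a ?a + (c * hinner H ?b ?a + cnj (c * hinner H ?b ?a)) + (c * cnj c) * hinner H ?b ?b"
          using ab icnj[of ?b ?a] by (simp add: simps iaddr ismultr algebra_simps del: minus)
        also have "Re \<dots> = ?n ?a + 2 * Re (c * hinner H ?b ?a) + (norm c)\<^sup>2 * ?n ?b"
          by (simp add: complex_mult_cnj cmod_power2 del: complex_cnj_mult)
        finally show ?thesis .
      qed
      from quadratic_form_discriminant[OF re(1)[OF ab(2)] this]
      have "norm (hinner H ?b ?a) \<le> sqrt (?n ?a * ?n ?b)"
        by (simp add: real_le_rsqrt)
      then have cs: "Re (hinner H ?b ?a) \<le> sqrt (?n ?a) * sqrt (?n ?b)"
        using complex_Re_le_cmod[of "hinner H ?b ?a"] by (simp add: real_sqrt_mult)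
      have "x \<ominus>\<^bsub>H\<^esub> z = ?a \<oplus>\<^bsub>H\<^esub> ?b"
        using that by (intro eqI) (auto simp: minus simps)
      then have "?n (x \<ominus>\<^bsub>H\<^esub> z) = ?n ?a + 2 * Re (hinner H ?b ?a) + ?n ?b"
        using ab icnj[of ?b ?a] by (simp add: simps iaddr del: minus)
      also have "\<dots> \<le> (sqrt (?n ?a) + sqrt (?n ?b))\<^sup>2"
        using cs re(1)[OF ab(1)] re(1)[OF ab(2)] by (simp add: power2_sum)
      finally show ?thesis
        using that re(1)[OF ab(1)] re(1)[OF ab(2)] by (simp add: hdist_def hnorm_def real_le_lsqrt)
    qed
  qed
  have "M.mcomplete"
    unfolding M.mcomplete_def
  proof (intro allI impI)
    fix s assume s: "M.MCauchy s"
    then have sc: "s n \<in> carrier H" for n by (auto simp: M.MCauchy_def)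
    have "\<exists>l\<in>carrier H. (\<lambda>n. hnorm H (s n \<oplus>\<^bsub>H\<^esub> (-1) \<odot>\<^bsub>H\<^esub> l)) \<longlonglongrightarrow> 0"
    proof (rule complete[OF sc])
      fix \<epsilon> :: real assume "\<epsilon> > 0"
      then show "\<exists>N. \<forall>m\<ge>N. \<forall>n\<ge>N. hnorm H (s m \<oplus>\<^bsub>H\<^esub> (-1) \<odot>\<^bsub>H\<^esub> s n) < \<epsilon>"
        using s sc by (fastforce simp: M.MCauchy_def hdist_def minus)
    qed
    then obtain l where l: "l \<in> carrier H" "(\<lambda>n. hnorm H (s n \<oplus>\<^bsub>H\<^esub> (-1) \<odot>\<^bsub>H\<^esub> l)) \<longlonglongrightarrow> 0"
      by blast
    have "\<bar>hnorm H (s n \<oplus>\<^bsub>H\<^esub> (-1) \<odot>\<^bsub>H\<^esub> l)\<bar> = hdist H (s n) l" for n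
      using l(1) sc re(1) by (simp add: hdist_def minus hnorm_def add smult)
    then have "limitin M.mtopology s l sequentially"
      using l sc by (auto simp: M.limitin_metric tendsto_iff dist_real_def)
    then show "\<exists>x. limitin M.mtopology s x sequentially" by blast
  qed
  then show ?thesis by (rule pre)
qed


section \<open>Bounded operators and their adjoints\<close>

text \<open>  An operator is carried along with its adjoint: linearity then follows from the adjoint relation,
  and the two operators enter symmetrically (\<open>adjoint_pair_sym\<close>).\<close>

definition adjoint_pair :: "'k hilbert \<Rightarrow> 'l hilbert \<Rightarrow> ('k \<Rightarrow> 'l) \<Rightarrow> ('l \<Rightarrow> 'k) \<Rightarrow> bool" where
  "adjoint_pair K L T S \<longleftrightarrow>
     T \<in> carrier K \<rightarrow> carrier L \<and> S \<in> carrier L \<rightarrow> carrier K \<and>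
     (\<forall>\<kappa>\<in>carrier K. \<forall>\<nu>\<in>carrier L. hinner L (T \<kappa>) \<nu> = hinner K \<kappa> (S \<nu>)) \<and>
     (\<exists>C. \<forall>\<kappa>\<in>carrier K. hnorm L (T \<kappa>) \<le> C * hnorm K \<kappa>)"

lemma adjoint_pair_closed:
  assumes "adjoint_pair K L T S"
  shows "\<kappa> \<in> carrier K \<Longrightarrow> T \<kappa> \<in> carrier L" "\<nu> \<in> carrier L \<Longrightarrow> S \<nu> \<in> carrier K"
  using assms by (auto simp: adjoint_pair_def)

lemma adjoint_pair_left:
  "adjoint_pair K L T S \<Longrightarrow> \<kappa> \<in> carrier K \<Longrightarrow> \<nu> \<in> carrier L \<Longrightarrow>
    hinner L (T \<kappa>) \<nu> = hinner K \<kappa> (S \<nu>)"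
  by (auto simp: adjoint_pair_def)

lemma adjoint_pair_right:
  assumes "hilbert_space K" "hilbert_space L" "adjoint_pair K L T S" "\<kappa> \<in> carrier K" "\<nu> \<in> carrier L"
  shows "hinner L \<nu> (T \<kappa>) = hinner K (S \<nu>) \<kappa>"
  using hinner_cnj[of L "T \<kappa>" \<nu>] hinner_cnj[of K \<kappa> "S \<nu>"] adjoint_pair_left[OF assms(3-5)]
    adjoint_pair_closed[OF assms(3)] assms by simp

lemma adjoint_pair_add:
  assumes "hilbert_space K" "hilbert_space L" "adjoint_pair K L T S" "\<kappa> \<in> carrier K" "\<mu> \<in> carrier K"
  shows "T (\<kappa> \<oplus>\<^bsub>K\<^esub> \<mu>) = T \<kappa> \<oplus>\<^bsub>L\<^esub> T \<mu>"
  by (rule hvec_eqI[OF assms(2)])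
     (use assms adjoint_pair_closed[OF assms(3)] in \<open>auto simp: adjoint_pair_left[OF assms(3)]\<close>)

lemma adjoint_pair_smult:
  assumes "hilbert_space K" "hilbert_space L" "adjoint_pair K L T S" "\<kappa> \<in> carrier K"
  shows "T (c \<odot>\<^bsub>K\<^esub> \<kappa>) = c \<odot>\<^bsub>L\<^esub> T \<kappa>"
  by (rule hvec_eqI[OF assms(2)])
     (use assms adjoint_pair_closed[OF assms(3)] in \<open>auto simp: adjoint_pair_left[OF assms(3)]\<close>)

lemma adjoint_pair_zero:
  assumes "hilbert_space K" "hilbert_space L" "adjoint_pair K L T S"
  shows "T \<zero>\<^bsub>K\<^esub> = \<zero>\<^bsub>L\<^esub>"
  by (rule hvec_eqI[OF assms(2)])
     (use assms adjoint_pair_closed[OF assms(3)] in \<open>auto simp: adjoint_pair_left[OF assms(3)]\<close>)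

lemma adjoint_pair_minus:
  assumes "hilbert_space K" "hilbert_space L" "adjoint_pair K L T S" "\<kappa> \<in> carrier K" "\<mu> \<in> carrier K"
  shows "T (\<kappa> \<ominus>\<^bsub>K\<^esub> \<mu>) = T \<kappa> \<ominus>\<^bsub>L\<^esub> T \<mu>"
  by (rule hvec_eqI[OF assms(2)])
     (use assms adjoint_pair_closed[OF assms(3)] in \<open>auto simp: adjoint_pair_left[OF assms(3)]\<close>)

lemma adjoint_pair_bound:
  assumes "hilbert_space K" "adjoint_pair K L T S"
  shows "\<exists>C\<ge>0. \<forall>\<kappa>\<in>carrier K. hnorm L (T \<kappa>) \<le> C * hnorm K \<kappa>"
proof -
  obtain C where C: "\<forall>\<kappa>\<in>carrier K. hnorm L (T \<kappa>) \<le> C * hnorm K \<kappa>"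
    using assms(2) by (auto simp: adjoint_pair_def)
  have "hnorm L (T \<kappa>) \<le> \<bar>C\<bar> * hnorm K \<kappa>" if "\<kappa> \<in> carrier K" for \<kappa>
    using C that mult_right_mono[of C "\<bar>C\<bar>" "hnorm K \<kappa>"] assms(1) by fastforce
  then show ?thesis by (intro exI[of _ "\<bar>C\<bar>"]) auto
qed

lemma adjoint_pair_sym:
  assumes "hilbert_space K" "hilbert_space L" "adjoint_pair K L T S"
  shows "adjoint_pair L K S T"
proof -
  obtain C where C: "C \<ge> 0" "\<And>\<kappa>. \<kappa> \<in> carrier K \<Longrightarrow> hnorm L (T \<kappa>) \<le> C * hnorm K \<kappa>"
    using adjoint_pair_bound[OF assms(1,3)] by blast
  note cl = adjoint_pair_closed[OF assms(3)]
  have "hnorm K (S \<nu>) \<le> C * hnorm L \<nu>" if l: "\<nu> \<in> carrier L" for \<nu>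
  proof (rule hnorm_le_by_testing)
    have "norm (hinner K (S \<nu>) (S \<nu>)) = norm (hinner L (T (S \<nu>)) \<nu>)"
      using l by (simp add: adjoint_pair_left[OF assms(3)] cl)
    also have "\<dots> \<le> hnorm L (T (S \<nu>)) * hnorm L \<nu>"
      using l assms by (intro hcauchy_schwarz) (auto intro: cl)
    also have "\<dots> \<le> (C * hnorm K (S \<nu>)) * hnorm L \<nu>"
      using l assms by (intro mult_right_mono C cl) auto
    finally show "norm (hinner K (S \<nu>) (S \<nu>)) \<le> C * hnorm L \<nu> * hnorm K (S \<nu>)"
      by (simp add: ac_simps)
  qed (use l assms cl C in auto)
  then show ?thesis
    using assms cl adjoint_pair_right[OF assms] by (auto simp: adjoint_pair_def)
qed

lemma adjoint_pair_comp:
  assumes "hilbert_space K" "hilbert_space L" "hilbert_space M"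
    and "adjoint_pair K L T S" "adjoint_pair L M T' S'"
  shows "adjoint_pair K M (\<lambda>\<kappa>. T' (T \<kappa>)) (\<lambda>\<mu>. S (S' \<mu>))"
proof -
  obtain C where C: "C \<ge> 0" "\<And>\<kappa>. \<kappa> \<in> carrier K \<Longrightarrow> hnorm L (T \<kappa>) \<le> C * hnorm K \<kappa>"
    using adjoint_pair_bound[OF assms(1,4)] by blast
  obtain C' where C': "C' \<ge> 0" "\<And>\<kappa>. \<kappa> \<in> carrier L \<Longrightarrow> hnorm M (T' \<kappa>) \<le> C' * hnorm L \<kappa>"
    using adjoint_pair_bound[OF assms(2,5)] by blast
  note cl = adjoint_pair_closed[OF assms(4)] adjoint_pair_closed[OF assms(5)]
  have "hnorm M (T' (T \<kappa>)) \<le> (C' * C) * hnorm K \<kappa>" if "\<kappa> \<in> carrier K" for \<kappa>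
    using C'(2)[OF cl(1)[OF that]] mult_left_mono[OF C(2)[OF that] C'(1)] by (simp add: mult.assoc)
  then show ?thesis
    using cl by (auto simp: adjoint_pair_def adjoint_pair_left[OF assms(4)] adjoint_pair_left[OF assms(5)])
qed

lemma adjoint_pair_lincomb:
  assumes "hilbert_space K" "hilbert_space L"
    and "adjoint_pair K L T S" "adjoint_pair K L T' S'"
  shows "adjoint_pair K L (\<lambda>\<kappa>. T \<kappa> \<oplus>\<^bsub>L\<^esub> c \<odot>\<^bsub>L\<^esub> T' \<kappa>) (\<lambda>\<mu>. S \<mu> \<oplus>\<^bsub>K\<^esub> cnj c \<odot>\<^bsub>K\<^esub> S' \<mu>)"
proof -
  obtain C where C: "C \<ge> 0" "\<And>\<kappa>. \<kappa> \<in> carrier K \<Longrightarrow> hnorm L (T \<kappa>) \<le> C * hnorm K \<kappa>"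
    using adjoint_pair_bound[OF assms(1,3)] by blast
  obtain C' where C': "C' \<ge> 0" "\<And>\<kappa>. \<kappa> \<in> carrier K \<Longrightarrow> hnorm L (T' \<kappa>) \<le> C' * hnorm K \<kappa>"
    using adjoint_pair_bound[OF assms(1,4)] by blast
  note cl = adjoint_pair_closed[OF assms(3)] adjoint_pair_closed[OF assms(4)]
  have "hnorm L (T \<kappa> \<oplus>\<^bsub>L\<^esub> c \<odot>\<^bsub>L\<^esub> T' \<kappa>) \<le> (C + norm c * C') * hnorm K \<kappa>" if "\<kappa> \<in> carrier K" for \<kappa>
    using hnorm_triangle[of L "T \<kappa>" "c \<odot>\<^bsub>L\<^esub> T' \<kappa>"] C(2)[OF that]
      mult_left_mono[OF C'(2)[OF that], of "norm c"] assms cl that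
    by (simp add: hnorm_smult algebra_simps)
  then show ?thesis
    using cl assms by (auto simp: adjoint_pair_def adjoint_pair_left[OF assms(3)] adjoint_pair_left[OF assms(4)])
qed

lemma adjoint_pair_id: "adjoint_pair K K (\<lambda>\<kappa>. \<kappa>) (\<lambda>\<kappa>. \<kappa>)"
  by (auto simp: adjoint_pair_def intro!: exI[of _ 1])

text \<open>
  An indexed family \<open>u\<close> of vectors, together with data \<open>v\<close> or \<open>f\<close> attached to them, is treated as a
  linear subspace with a linear map if linear combinations can be formed inside the index set.
  Indexing makes it unnecessary to check that the data depend on the vector only.

  In the Riesz representation theorem on a subspace, the representing vector minimizes
  \<open>\<parallel>u\<parallel>\<^sup>2 - 2 Re f\<close>, and by the parallelogram law every minimizing sequence is Cauchy.  As a limit of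
  vectors of the subspace, it is orthogonal to everything that the subspace is orthogonal to.
\<close>

lemma riesz_on_subspace:
  assumes K: "hilbert_space K" and u: "\<And>i. i \<in> I \<Longrightarrow> u i \<in> carrier K" and ne: "I \<noteq> {}"
    and lin: "\<And>i j c. i \<in> I \<Longrightarrow> j \<in> I \<Longrightarrow>
      \<exists>k\<in>I. u k = u i \<oplus>\<^bsub>K\<^esub> c \<odot>\<^bsub>K\<^esub> u j \<and> f k = f i + c * f j"
    and C: "0 \<le> C" and bound: "\<And>i. i \<in> I \<Longrightarrow> norm (f i) \<le> C * hnorm K (u i)"
  shows "\<exists>\<eta>\<in>carrier K. (\<forall>i\<in>I. f i = hinner K (u i) \<eta>) \<and> hnorm K \<eta> \<le> C \<and>
    (\<forall>\<kappa>\<in>carrier K. (\<forall>i\<in>I. hinner K (u i) \<kappa> = 0) \<longrightarrow> hinner K \<eta> \<kappa> = 0)"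
proof -
  note [simp] = K u
  define Q where "Q i = (hnorm K (u i))\<^sup>2 - 2 * Re (f i)" for i
  define m where "m = Inf (Q ` I)"
  have Q_below: "- C\<^sup>2 \<le> Q i" if "i \<in> I" for i
  proof -
    have "Re (f i) \<le> C * hnorm K (u i)"
      using bound[OF that] complex_Re_le_cmod[of "f i"] by linarith
    then show ?thesis
      using zero_le_power2[of "hnorm K (u i) - C"] by (simp add: Q_def power2_diff algebra_simps)
  qed
  have bdd: "bdd_below (Q ` I)" using Q_below by (auto intro!: bdd_belowI)
  have m_le: "m \<le> Q i" if "i \<in> I" for i
    unfolding m_def using bdd that by (intro cInf_lower) auto
  have "\<exists>i\<in>I. Q i < m + 1 / (real n + 1)" for n
  proof -
    have "Inf (Q ` I) < m + 1 / (real n + 1)" by (simp add: m_def)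
    from cInf_lessD[OF _ this] show ?thesis using ne by auto
  qed
  then obtain s where s: "\<And>n. s n \<in> I" "\<And>n. Q (s n) < m + 1 / (real n + 1)" by metis
  \<comment> \<open>the parallelogram law: \<open>u k\<close> is the midpoint of \<open>u i\<close> and \<open>u j\<close>\<close>
  have mid: "(hnorm K (u i \<ominus>\<^bsub>K\<^esub> u j))\<^sup>2 \<le> 2 * Q i + 2 * Q j - 4 * m" if ij: "i \<in> I" "j \<in> I" for i j
  proof -
    obtain z where z: "z \<in> I" "u z = u i \<oplus>\<^bsub>K\<^esub> (-1) \<odot>\<^bsub>K\<^esub> u i" "f z = f i + (-1) * f i"
      using lin[OF ij(1) ij(1), of "-1"] by blast
    obtain a where a: "a \<in> I" "u a = u i \<oplus>\<^bsub>K\<^esub> 1 \<odot>\<^bsub>K\<^esub> u j" "f a = f i + 1 * f j"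
      using lin[OF ij, of 1] by blast
    obtain k where k: "k \<in> I" "u k = u z \<oplus>\<^bsub>K\<^esub> (1/2) \<odot>\<^bsub>K\<^esub> u a" "f k = f z + (1/2) * f a"
      using lin[OF z(1) a(1), of "1/2"] by blast
    have "2 * Q i + 2 * Q j - 4 * Q k = (hnorm K (u i \<ominus>\<^bsub>K\<^esub> u j))\<^sup>2"
      using ij by (simp add: Q_def hnorm_power2 k z a algebra_simps)
    then show ?thesis using m_le[OF k(1)] by linarith
  qed
  obtain \<eta> where \<eta>: "\<eta> \<in> carrier K" "(\<lambda>n. hnorm K (u (s n) \<ominus>\<^bsub>K\<^esub> \<eta>)) \<longlonglongrightarrow> 0"
  proof (rule hilbert_complete[OF K])
    fix e :: real assume e: "e > 0"
    obtain N where N: "4 / e\<^sup>2 < real N" using reals_Archimedean2 by blast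
    have "hnorm K (u (s p) \<ominus>\<^bsub>K\<^esub> u (s q)) < e" if "p \<ge> N" "q \<ge> N" for p q
    proof -
      have r: "1 / (real r + 1) \<le> 1 / (real N + 1)" if "r \<ge> N" for r using that by (simp add: frac_le)
      have "(hnorm K (u (s p) \<ominus>\<^bsub>K\<^esub> u (s q)))\<^sup>2 < 4 / (real N + 1)"
        using mid[OF s(1) s(1), of p q] s(2)[of p] s(2)[of q] r[OF that(1)] r[OF that(2)] by linarith
      also have "\<dots> < e\<^sup>2"
      proof -
        have "4 < e\<^sup>2 * real N" using N e by (simp add: pos_divide_less_eq mult.commute)
        also have "\<dots> \<le> e\<^sup>2 * (real N + 1)" by (simp add: algebra_simps)
        finally show ?thesis by (simp add: pos_divide_less_eq mult.commute)
      qed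
      finally show ?thesis using e by (simp add: power_less_imp_less_base)
    qed
    then show "\<exists>N. \<forall>m\<ge>N. \<forall>n\<ge>N. hnorm K (u (s m) \<ominus>\<^bsub>K\<^esub> u (s n)) < e" by blast
  qed (use s in auto)
  have lim: "(\<lambda>n. hinner K (u (s n)) \<kappa>) \<longlonglongrightarrow> hinner K \<eta> \<kappa>" if "\<kappa> \<in> carrier K" for \<kappa>
    using that s \<eta> by (intro hinner_tendsto_left) auto
  have lim': "(\<lambda>n. hinner K \<kappa> (u (s n))) \<longlonglongrightarrow> hinner K \<kappa> \<eta>" if "\<kappa> \<in> carrier K" for \<kappa>
    using that s \<eta> by (intro hinner_tendsto_right) auto
  have rep: "f d = hinner K (u d) \<eta>" if d: "d \<in> I" for d
  proof -
    \<comment> \<open>the first variation of \<open>Q\<close> in the direction \<open>u d\<close> almost vanishes at \<open>u (s n)\<close>\<close>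
    have est: "(norm (hinner K (u d) (u (s n)) - f d))\<^sup>2 \<le> (1 / (real n + 1)) * (hnorm K (u d))\<^sup>2" for n
    proof (rule quadratic_form_discriminant)
      fix c
      obtain k where k: "k \<in> I" "u k = u (s n) \<oplus>\<^bsub>K\<^esub> c \<odot>\<^bsub>K\<^esub> u d" "f k = f (s n) + c * f d"
        using lin[OF s(1) d, of n c] by blast
      have "(hnorm K (u k))\<^sup>2 = (hnorm K (u (s n)))\<^sup>2 + 2 * Re (c * hinner K (u d) (u (s n)))
          + (norm c)\<^sup>2 * (hnorm K (u d))\<^sup>2"
        unfolding k(2) by (rule hnorm_add_smult[OF K u[OF s(1)] u[OF d]])
      then have "Q k = Q (s n) + 2 * Re (c * (hinner K (u d) (u (s n)) - f d)) + (norm c)\<^sup>2 * (hnorm K (u d))\<^sup>2"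
        by (simp add: Q_def k(3) algebra_simps)
      then show "0 \<le> 1 / (real n + 1) + 2 * Re (c * (hinner K (u d) (u (s n)) - f d))
          + (norm c)\<^sup>2 * (hnorm K (u d))\<^sup>2"
        using m_le[OF k(1)] s(2)[of n] by linarith
    qed simp
    have "(\<lambda>n. (1 / (real n + 1)) * (hnorm K (u d))\<^sup>2) \<longlonglongrightarrow> 0"
      using LIMSEQ_inverse_real_of_nat by (intro tendsto_mult_left_zero) (simp add: inverse_eq_divide add.commute)
    moreover have "(\<lambda>n. (norm (hinner K (u d) (u (s n)) - f d))\<^sup>2) \<longlonglongrightarrow> (norm (hinner K (u d) \<eta> - f d))\<^sup>2"
      using lim'[of "u d"] d by (intro tendsto_intros) auto
    ultimately have "(norm (hinner K (u d) \<eta> - f d))\<^sup>2 \<le> 0"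
      using est by (intro LIMSEQ_le[of _ _ _ 0]) auto
    then show ?thesis by simp
  qed
  have "hnorm K \<eta> \<le> C"
  proof (rule hnorm_le_by_testing[OF K \<eta>(1) C])
    have "(\<lambda>n. C * (hnorm K (u (s n) \<ominus>\<^bsub>K\<^esub> \<eta>) + hnorm K \<eta>)) \<longlonglongrightarrow> C * (0 + hnorm K \<eta>)"
      by (intro tendsto_intros \<eta>)
    moreover have "(\<lambda>n. norm (hinner K (u (s n)) \<eta>)) \<longlonglongrightarrow> norm (hinner K \<eta> \<eta>)"
      by (intro tendsto_norm lim \<eta>)
    moreover have "norm (hinner K (u (s n)) \<eta>) \<le> C * (hnorm K (u (s n) \<ominus>\<^bsub>K\<^esub> \<eta>) + hnorm K \<eta>)" for n
    proof -
      have "u (s n) = (u (s n) \<ominus>\<^bsub>K\<^esub> \<eta>) \<oplus>\<^bsub>K\<^esub> \<eta>"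
        using s \<eta> by (intro hvec_eqI[OF K]) auto
      then have "hnorm K (u (s n)) \<le> hnorm K (u (s n) \<ominus>\<^bsub>K\<^esub> \<eta>) + hnorm K \<eta>"
        using hnorm_triangle[OF K, of "u (s n) \<ominus>\<^bsub>K\<^esub> \<eta>" \<eta>] s \<eta> by simp
      then have "C * hnorm K (u (s n)) \<le> C * (hnorm K (u (s n) \<ominus>\<^bsub>K\<^esub> \<eta>) + hnorm K \<eta>)"
        using C by (rule mult_left_mono)
      then show ?thesis using bound[OF s(1)[of n]] rep[OF s(1)[of n]] by simp
    qed
    ultimately show "norm (hinner K \<eta> \<eta>) \<le> C * hnorm K \<eta>"
      by (intro LIMSEQ_le[of "\<lambda>n. norm (hinner K (u (s n)) \<eta>)"]) auto
  qed
  moreover have "hinner K \<eta> \<kappa> = 0" if "\<kappa> \<in> carrier K" "\<forall>i\<in>I. hinner K (u i) \<kappa> = 0" for \<kappa>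
    using LIMSEQ_unique[OF lim[OF that(1)], of 0] that(2) s(1) by simp
  ultimately show ?thesis using \<eta>(1) rep by blast
qed

text \<open>At \<open>\<kappa>\<close>, the adjoint is the vector that represents the bounded functional \<open>\<nu> \<mapsto> \<langle>G \<nu>, \<kappa>\<rangle>\<close>.\<close>

lemma adjoint_exists:
  assumes K: "hilbert_space K" and L: "hilbert_space L"
    and G: "\<And>\<nu>. \<nu> \<in> carrier L \<Longrightarrow> G \<nu> \<in> carrier K"
    and lin: "\<And>\<nu> \<mu> c. \<nu> \<in> carrier L \<Longrightarrow> \<mu> \<in> carrier L \<Longrightarrow>
      G (\<nu> \<oplus>\<^bsub>L\<^esub> c \<odot>\<^bsub>L\<^esub> \<mu>) = G \<nu> \<oplus>\<^bsub>K\<^esub> c \<odot>\<^bsub>K\<^esub> G \<mu>"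
    and C: "0 \<le> C" and bound: "\<And>\<nu>. \<nu> \<in> carrier L \<Longrightarrow> hnorm K (G \<nu>) \<le> C * hnorm L \<nu>"
  shows "\<exists>F. adjoint_pair L K G F \<and> (\<forall>\<kappa>\<in>carrier K. hnorm L (F \<kappa>) \<le> C * hnorm K \<kappa>)"
proof -
  have "\<exists>\<eta>\<in>carrier L. (\<forall>\<nu>\<in>carrier L. hinner K (G \<nu>) \<kappa> = hinner L \<nu> \<eta>) \<and> hnorm L \<eta> \<le> C * hnorm K \<kappa>"
    if \<kappa>: "\<kappa> \<in> carrier K" for \<kappa>
  proof -
    have "\<exists>\<eta>\<in>carrier L. (\<forall>\<nu>\<in>carrier L. hinner K (G \<nu>) \<kappa> = hinner L \<nu> \<eta>) \<and> hnorm L \<eta> \<le> C * hnorm K \<kappa> \<and>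
      (\<forall>\<mu>\<in>carrier L. (\<forall>\<nu>\<in>carrier L. hinner L \<nu> \<mu> = 0) \<longrightarrow> hinner L \<eta> \<mu> = 0)"
    proof (rule riesz_on_subspace[OF L])
      show "carrier L \<noteq> {}" using L hvec_closed(1) by blast
      show "\<exists>k\<in>carrier L. k = i \<oplus>\<^bsub>L\<^esub> c \<odot>\<^bsub>L\<^esub> j \<and> hinner K (G k) \<kappa> = hinner K (G i) \<kappa> + c * hinner K (G j) \<kappa>"
        if "i \<in> carrier L" "j \<in> carrier L" for i j c
        using that K L \<kappa> G lin[OF that] by simp
      show "norm (hinner K (G i) \<kappa>) \<le> C * hnorm K \<kappa> * hnorm L i" if "i \<in> carrier L" for i
      proof -
        have "norm (hinner K (G i) \<kappa>) \<le> hnorm K (G i) * hnorm K \<kappa>"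
          using that K \<kappa> G by (intro hcauchy_schwarz) auto
        also have "\<dots> \<le> C * hnorm L i * hnorm K \<kappa>" using K \<kappa> bound[OF that] by (intro mult_right_mono) auto
        finally show ?thesis by (simp add: ac_simps)
      qed
    qed (use K C \<kappa> in auto)
    then show ?thesis by blast
  qed
  then obtain F where F: "\<And>\<kappa>. \<kappa> \<in> carrier K \<Longrightarrow> F \<kappa> \<in> carrier L \<and>
      (\<forall>\<nu>\<in>carrier L. hinner K (G \<nu>) \<kappa> = hinner L \<nu> (F \<kappa>)) \<and> hnorm L (F \<kappa>) \<le> C * hnorm K \<kappa>"
    by metis
  then have "adjoint_pair L K G F"
    using G bound by (auto simp: adjoint_pair_def intro!: exI[of _ C])
  then show ?thesis using F by blast
qed

text \<open>
  A densely defined bounded operator is extended through its adjoint, which the Riesz theorem on the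
  subspace provides, so that no limits of operator values are needed.
\<close>

lemma extend_operator:
  assumes K: "hilbert_space K" and L: "hilbert_space L"
    and u: "\<And>i. i \<in> I \<Longrightarrow> u i \<in> carrier K" and v: "\<And>i. i \<in> I \<Longrightarrow> v i \<in> carrier L" and ne: "I \<noteq> {}"
    and lin: "\<And>i j c. i \<in> I \<Longrightarrow> j \<in> I \<Longrightarrow>
      \<exists>k\<in>I. u k = u i \<oplus>\<^bsub>K\<^esub> c \<odot>\<^bsub>K\<^esub> u j \<and> v k = v i \<oplus>\<^bsub>L\<^esub> c \<odot>\<^bsub>L\<^esub> v j"
    and C: "0 \<le> C" and bound: "\<And>i. i \<in> I \<Longrightarrow> hnorm L (v i) \<le> C * hnorm K (u i)"
  obtains F G where "adjoint_pair K L F G" "\<And>i. i \<in> I \<Longrightarrow> F (u i) = v i"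
    "\<And>\<kappa>. \<kappa> \<in> carrier K \<Longrightarrow> hnorm L (F \<kappa>) \<le> C * hnorm K \<kappa>"
    "\<And>\<kappa>. \<kappa> \<in> carrier K \<Longrightarrow> (\<And>i. i \<in> I \<Longrightarrow> hinner K (u i) \<kappa> = 0) \<Longrightarrow> F \<kappa> = \<zero>\<^bsub>L\<^esub>"
proof -
  note [simp] = K L u v
  have "\<exists>\<eta>\<in>carrier K. (\<forall>i\<in>I. hinner L (v i) \<nu> = hinner K (u i) \<eta>) \<and> hnorm K \<eta> \<le> C * hnorm L \<nu> \<and>
    (\<forall>\<kappa>\<in>carrier K. (\<forall>i\<in>I. hinner K (u i) \<kappa> = 0) \<longrightarrow> hinner K \<eta> \<kappa> = 0)"
    if l: "\<nu> \<in> carrier L" for \<nu>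
  proof (rule riesz_on_subspace[OF K u ne])
    show "\<exists>k\<in>I. u k = u i \<oplus>\<^bsub>K\<^esub> c \<odot>\<^bsub>K\<^esub> u j \<and> hinner L (v k) \<nu> = hinner L (v i) \<nu> + c * hinner L (v j) \<nu>"
      if "i \<in> I" "j \<in> I" for i j c
      using lin[OF that, of c] that l by fastforce
    show "norm (hinner L (v i) \<nu>) \<le> C * hnorm L \<nu> * hnorm K (u i)" if "i \<in> I" for i
    proof -
      have "norm (hinner L (v i) \<nu>) \<le> hnorm L (v i) * hnorm L \<nu>"
        using that l by (intro hcauchy_schwarz) auto
      also have "\<dots> \<le> C * hnorm K (u i) * hnorm L \<nu>" using l bound[OF that] by (intro mult_right_mono) auto
      finally show ?thesis by (simp add: ac_simps)
    qed
  qed (use C l in auto)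
  then obtain G where G': "\<And>\<nu>. \<nu> \<in> carrier L \<Longrightarrow> G \<nu> \<in> carrier K \<and>
      (\<forall>i\<in>I. hinner L (v i) \<nu> = hinner K (u i) (G \<nu>)) \<and> hnorm K (G \<nu>) \<le> C * hnorm L \<nu> \<and>
      (\<forall>\<kappa>\<in>carrier K. (\<forall>i\<in>I. hinner K (u i) \<kappa> = 0) \<longrightarrow> hinner K (G \<nu>) \<kappa> = 0)"
    by metis
  have G: "\<And>\<nu>. \<nu> \<in> carrier L \<Longrightarrow> G \<nu> \<in> carrier K"
      "\<And>\<nu> i. \<nu> \<in> carrier L \<Longrightarrow> i \<in> I \<Longrightarrow> hinner L (v i) \<nu> = hinner K (u i) (G \<nu>)"
      "\<And>\<nu>. \<nu> \<in> carrier L \<Longrightarrow> hnorm K (G \<nu>) \<le> C * hnorm L \<nu>"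
      "\<And>\<nu> \<kappa>. \<nu> \<in> carrier L \<Longrightarrow> \<kappa> \<in> carrier K \<Longrightarrow> (\<forall>i\<in>I. hinner K (u i) \<kappa> = 0) \<Longrightarrow> hinner K (G \<nu>) \<kappa> = 0"
    using G' by blast+
  have Glin: "G (\<nu> \<oplus>\<^bsub>L\<^esub> c \<odot>\<^bsub>L\<^esub> \<mu>) = G \<nu> \<oplus>\<^bsub>K\<^esub> c \<odot>\<^bsub>K\<^esub> G \<mu>" if "\<nu> \<in> carrier L" "\<mu> \<in> carrier L" for \<nu> \<mu> c
  proof -
    let ?p = "G (\<nu> \<oplus>\<^bsub>L\<^esub> c \<odot>\<^bsub>L\<^esub> \<mu>)" and ?q = "G \<nu> \<oplus>\<^bsub>K\<^esub> c \<odot>\<^bsub>K\<^esub> G \<mu>"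
    have orth: "\<forall>i\<in>I. hinner K (u i) (?p \<ominus>\<^bsub>K\<^esub> ?q) = 0"
      using that by (simp add: G(1) G(2)[symmetric])
    have "hinner K (?p \<ominus>\<^bsub>K\<^esub> ?q) (?p \<ominus>\<^bsub>K\<^esub> ?q) = 0"
      using that G(4)[OF _ _ orth] by (simp add: G(1) del: hinner_simps(8))
    then show ?thesis
      using that hdiff_eq_zero_iff[OF K, of ?p ?q] by (simp add: G(1) hnorm_def)
  qed
  obtain F where F: "adjoint_pair L K G F" "\<And>\<kappa>. \<kappa> \<in> carrier K \<Longrightarrow> hnorm L (F \<kappa>) \<le> C * hnorm K \<kappa>"
    using adjoint_exists[OF K L G(1) Glin C G(3)] by blast
  have FG: "adjoint_pair K L F G" by (rule adjoint_pair_sym[OF L K F(1)])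
  show thesis
  proof (rule that[OF FG _ F(2)])
    show "F (u i) = v i" if "i \<in> I" for i
      using that by (intro hvec_eqI[OF L]) (auto simp: adjoint_pair_left[OF FG] adjoint_pair_closed[OF FG] G(2))
    show "F \<kappa> = \<zero>\<^bsub>L\<^esub>" if "\<kappa> \<in> carrier K" "\<And>i. i \<in> I \<Longrightarrow> hinner K (u i) \<kappa> = 0" for \<kappa>
    proof (rule hvec_eqI_right[OF L])
      show "hinner L \<nu> (F \<kappa>) = hinner L \<nu> \<zero>\<^bsub>L\<^esub>" if l: "\<nu> \<in> carrier L" for \<nu>
        using G(4)[OF l] \<open>\<kappa> \<in> carrier K\<close> l that(1) \<open>\<And>i. i \<in> I \<Longrightarrow> hinner K (u i) \<kappa> = 0\<close>
        by (simp add: adjoint_pair_right[OF K L FG])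
    qed (use that adjoint_pair_closed[OF FG] in auto)
  qed
qed

text \<open>  Bounded operators are determined by their values on a subspace and on its orthogonal complement.
  The vector \<open>P' \<nu> - Q' \<nu>\<close> is orthogonal to the subspace, so \<open>P\<close> and \<open>Q\<close> agree on it, and this makes its norm
  \<open>0\<close>; no vector has to be decomposed.\<close>

lemma operators_agree:
  assumes K: "hilbert_space K" and L: "hilbert_space L"
    and P: "adjoint_pair K L P P'" and Q: "adjoint_pair K L Q Q'"
    and u: "\<And>i. i \<in> I \<Longrightarrow> u i \<in> carrier K"
    and eq: "\<And>i. i \<in> I \<Longrightarrow> P (u i) = Q (u i)"
    and orth: "\<And>\<kappa>. \<kappa> \<in> carrier K \<Longrightarrow> (\<And>i. i \<in> I \<Longrightarrow> hinner K (u i) \<kappa> = 0) \<Longrightarrow> P \<kappa> = Q \<kappa>"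
    and \<kappa>: "\<kappa> \<in> carrier K"
  shows "P \<kappa> = Q \<kappa>"
proof -
  note [simp] = K L u adjoint_pair_closed[OF P] adjoint_pair_closed[OF Q]
  have "P' \<nu> = Q' \<nu>" if l: "\<nu> \<in> carrier L" for \<nu>
  proof -
    let ?d = "P' \<nu> \<ominus>\<^bsub>K\<^esub> Q' \<nu>"
    have "hinner K (u i) ?d = 0" if "i \<in> I" for i
      using l that eq[OF that] adjoint_pair_left[OF P, of "u i" \<nu>] adjoint_pair_left[OF Q, of "u i" \<nu>] by simp
    then have "P ?d = Q ?d" using l by (intro orth) auto
    then have "hinner K ?d (P' \<nu>) = hinner K ?d (Q' \<nu>)"
      using l by (simp add: adjoint_pair_left[OF P, symmetric] adjoint_pair_left[OF Q, symmetric] del: hinner_simps(7))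
    then have "hinner K ?d ?d = 0" using l by simp
    then show ?thesis using l hdiff_eq_zero_iff[OF K, of "P' \<nu>" "Q' \<nu>"] by (simp add: hnorm_def)
  qed
  then show ?thesis
    using \<kappa> by (intro hvec_eqI[OF L]) (auto simp: adjoint_pair_left[OF P] adjoint_pair_left[OF Q])
qed

text \<open>
  If the extended map preserves norms on the subspace, the extension is a partial isometry whose
  initial space is the closure of the subspace.
\<close>

lemma extend_isometry:
  assumes K: "hilbert_space K" and L: "hilbert_space L"
    and u: "\<And>i. i \<in> I \<Longrightarrow> u i \<in> carrier K" and v: "\<And>i. i \<in> I \<Longrightarrow> v i \<in> carrier L" and ne: "I \<noteq> {}"
    and lin: "\<And>i j c. i \<in> I \<Longrightarrow> j \<in> I \<Longrightarrow>
      \<exists>k\<in>I. u k = u i \<oplus>\<^bsub>K\<^esub> c \<odot>\<^bsub>K\<^esub> u j \<and> v k = v i \<oplus>\<^bsub>L\<^esub> c \<odot>\<^bsub>L\<^esub> v j"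
    and isom: "\<And>i. i \<in> I \<Longrightarrow> hnorm L (v i) = hnorm K (u i)"
  obtains F G where "adjoint_pair K L F G" "\<And>i. i \<in> I \<Longrightarrow> F (u i) = v i" "\<And>i. i \<in> I \<Longrightarrow> G (v i) = u i"
    "\<And>\<kappa>. \<kappa> \<in> carrier K \<Longrightarrow> (\<And>i. i \<in> I \<Longrightarrow> hinner K (u i) \<kappa> = 0) \<Longrightarrow> F \<kappa> = \<zero>\<^bsub>L\<^esub>"
    "\<And>\<kappa>. \<kappa> \<in> carrier K \<Longrightarrow> F (G (F \<kappa>)) = F \<kappa>"
proof -
  note [simp] = K L u v
  obtain F G where FG: "adjoint_pair K L F G" and F: "\<And>i. i \<in> I \<Longrightarrow> F (u i) = v i"
    and F0: "\<And>\<kappa>. \<kappa> \<in> carrier K \<Longrightarrow> (\<And>i. i \<in> I \<Longrightarrow> hinner K (u i) \<kappa> = 0) \<Longrightarrow> F \<kappa> = \<zero>\<^bsub>L\<^esub>"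
    by (rule extend_operator[OF K L u v ne lin, of 1]) (auto simp: isom)
  note [simp] = adjoint_pair_closed[OF FG]
  \<comment> \<open>polarization; the coefficients \<open>1\<close> and \<open>\<i>\<close> give the real and the imaginary part\<close>
  have inner: "hinner L (v i) (v j) = hinner K (u i) (u j)" if ij: "i \<in> I" "j \<in> I" for i j
  proof -
    have re: "Re (c * hinner L (v j) (v i)) = Re (c * hinner K (u j) (u i))" for c
    proof -
      obtain k where k: "k \<in> I" "u k = u i \<oplus>\<^bsub>K\<^esub> c \<odot>\<^bsub>K\<^esub> u j" "v k = v i \<oplus>\<^bsub>L\<^esub> c \<odot>\<^bsub>L\<^esub> v j"
        using lin[OF ij, of c] by blast
      show ?thesis
        using isom[OF k(1)] isom[OF ij(1)] isom[OF ij(2)] hnorm_add_smult[OF K u[OF ij(1)] u[OF ij(2)], of c]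
          hnorm_add_smult[OF L v[OF ij(1)] v[OF ij(2)], of c] by (simp only: k(2,3))
    qed
    have "hinner L (v j) (v i) = hinner K (u j) (u i)"
      using re[of 1] re[of \<i>] by (simp add: complex_eq_iff)
    then show ?thesis using hinner_cnj[OF K u[OF ij(2)] u[OF ij(1)]] hinner_cnj[OF L v[OF ij(2)] v[OF ij(1)]] by simp
  qed
  have G: "G (v i) = u i" if i: "i \<in> I" for i
  proof -
    let ?d = "G (v i) \<ominus>\<^bsub>K\<^esub> u i"
    have dc: "?d \<in> carrier K" using i by simp
    have orth: "hinner K (u j) ?d = 0" if j: "j \<in> I" for j
      using i j inner[OF j i] adjoint_pair_left[OF FG, of "u j" "v i"] by (simp add: F)
    have "F ?d = \<zero>\<^bsub>L\<^esub>" by (rule F0[OF dc orth])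
    then have "hinner K (G (v i)) ?d = 0"
      using i dc adjoint_pair_right[OF K L FG dc, of "v i"] by simp
    moreover have "hinner K (u i) ?d = 0" by (rule orth[OF i])
    ultimately have "hinner K ?d ?d = 0" using i dc hinner_simps(7)[OF K, of "G (v i)" "u i" ?d] by simp
    then show ?thesis using i hdiff_eq_zero_iff[OF K, of "G (v i)" "u i"] by (simp add: hnorm_def)
  qed
  have GF: "adjoint_pair K K (\<lambda>\<kappa>. G (F \<kappa>)) (\<lambda>\<kappa>. G (F \<kappa>))"
    by (rule adjoint_pair_comp[OF K L K FG adjoint_pair_sym[OF K L FG]])
  have FGF: "adjoint_pair K L (\<lambda>\<kappa>. F (G (F \<kappa>))) (\<lambda>\<kappa>. G (F (G \<kappa>)))"
    by (rule adjoint_pair_comp[OF K K L GF FG])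
  have "F (G (F \<kappa>)) = F \<kappa>" if "\<kappa> \<in> carrier K" for \<kappa>
  proof (rule operators_agree[OF K L FGF FG u])
    show "F (G (F \<kappa>)) = F \<kappa>" if "\<kappa> \<in> carrier K" "\<And>i. i \<in> I \<Longrightarrow> hinner K (u i) \<kappa> = 0" for \<kappa>
      using F0[OF that] adjoint_pair_zero[OF L K adjoint_pair_sym[OF K L FG]] adjoint_pair_zero[OF K L FG] by simp
  qed (use that in \<open>auto simp: F G\<close>)
  then show thesis using that[OF FG F G F0] by blast
qed

text \<open>
  The extension intertwines what the given map intertwines.  On the orthogonal complement of the
  subspace both sides vanish, since it is invariant under \<open>s\<close> if the subspace is invariant under \<open>s'\<close>.
\<close>

lemma extension_intertwines:
  assumes K: "hilbert_space K" and L: "hilbert_space L"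
    and FG: "adjoint_pair K L F G" and F: "\<And>i. i \<in> I \<Longrightarrow> F (u i) = v i"
    and F0: "\<And>\<kappa>. \<kappa> \<in> carrier K \<Longrightarrow> (\<And>i. i \<in> I \<Longrightarrow> hinner K (u i) \<kappa> = 0) \<Longrightarrow> F \<kappa> = \<zero>\<^bsub>L\<^esub>"
    and u: "\<And>i. i \<in> I \<Longrightarrow> u i \<in> carrier K"
    and s: "adjoint_pair K K s s'" and t: "adjoint_pair L L t t'"
    and st: "\<And>i. i \<in> I \<Longrightarrow> \<exists>k\<in>I. u k = s (u i) \<and> v k = t (v i)"
    and s': "\<And>i. i \<in> I \<Longrightarrow> \<exists>k\<in>I. u k = s' (u i)"
    and \<kappa>: "\<kappa> \<in> carrier K"
  shows "F (s \<kappa>) = t (F \<kappa>)"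
proof (rule operators_agree[OF K L adjoint_pair_comp[OF K K L s FG] adjoint_pair_comp[OF K L L FG t] u _ _ \<kappa>])
  show "F (s (u i)) = t (F (u i))" if "i \<in> I" for i
    using st[OF that] F that by metis
  show "F (s \<mu>) = t (F \<mu>)" if m: "\<mu> \<in> carrier K" "\<And>i. i \<in> I \<Longrightarrow> hinner K (u i) \<mu> = 0" for \<mu>
  proof -
    have "hinner K (u i) (s \<mu>) = 0" if i: "i \<in> I" for i
    proof -
      obtain k where "k \<in> I" "u k = s' (u i)" using s'[OF i] by blast
      then show ?thesis
        using m(1) m(2)[of k] u[OF i] adjoint_pair_right[OF K K s, of \<mu> "u i"] by simp
    qed
    then have "F (s \<mu>) = \<zero>\<^bsub>L\<^esub>" using m adjoint_pair_closed[OF s] by (intro F0) auto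
    moreover have "F \<mu> = \<zero>\<^bsub>L\<^esub>" using m by (intro F0) auto
    ultimately show ?thesis using adjoint_pair_zero[OF L L t] by simp
  qed
qed


section \<open>The algebra of bounded operators\<close>

lemma bop_carrier_iff: "x \<in> carrier (bop H) \<longleftrightarrow> bounded_operator H x"
  by (simp add: bop_def)

lemma bop_vec_closed [simp, intro]:
  "x \<in> carrier (bop H) \<Longrightarrow> \<xi> \<in> carrier H \<Longrightarrow> x \<xi> \<in> carrier H"
  by (auto simp: bop_carrier_iff bounded_operator_def)

lemma bop_apply [simp]:
  assumes "\<xi> \<in> carrier H"
  shows "(x \<otimes>\<^bsub>bop H\<^esub> y) \<xi> = x (y \<xi>)" "\<one>\<^bsub>bop H\<^esub> \<xi> = \<xi>" "\<zero>\<^bsub>bop H\<^esub> \<xi> = \<zero>\<^bsub>H\<^esub>"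
    "(x \<oplus>\<^bsub>bop H\<^esub> y) \<xi> = x \<xi> \<oplus>\<^bsub>H\<^esub> y \<xi>" "(c \<odot>\<^bsub>bop H\<^esub> x) \<xi> = c \<odot>\<^bsub>H\<^esub> x \<xi>"
  using assms by (simp_all add: bop_def compose_def)

lemma bop_linear [simp]:
  assumes "x \<in> carrier (bop H)" "\<xi> \<in> carrier H"
  shows "\<eta> \<in> carrier H \<Longrightarrow> x (\<xi> \<oplus>\<^bsub>H\<^esub> \<eta>) = x \<xi> \<oplus>\<^bsub>H\<^esub> x \<eta>" "x (c \<odot>\<^bsub>H\<^esub> \<xi>) = c \<odot>\<^bsub>H\<^esub> x \<xi>"
  using assms unfolding bop_carrier_iff bounded_operator_def by blast+

lemma bop_eqI:
  assumes "x \<in> carrier (bop H)" "y \<in> carrier (bop H)" "\<And>\<xi>. \<xi> \<in> carrier H \<Longrightarrow> x \<xi> = y \<xi>"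
  shows "x = y"
proof (rule extensionalityI[of x "carrier H"])
  show "x \<in> extensional (carrier H)" "y \<in> extensional (carrier H)"
    using assms(1,2) unfolding bop_carrier_iff bounded_operator_def PiE_def by blast+
qed (rule assms(3))

lemma restrict_bop:
  assumes H: "hilbert_space H" and p: "adjoint_pair H H T S"
  shows "restrict T (carrier H) \<in> carrier (bop H)"
proof -
  have "\<exists>C. \<forall>\<xi>\<in>carrier H. hnorm H (T \<xi>) \<le> C * hnorm H \<xi>" using p by (simp add: adjoint_pair_def)
  moreover have "restrict T (carrier H) \<in> carrier H \<rightarrow>\<^sub>E carrier H"
    using adjoint_pair_closed(1)[OF p] by auto
  ultimately show ?thesis
    unfolding bop_carrier_iff bounded_operator_def
    using H by (simp add: adjoint_pair_add[OF H H p] adjoint_pair_smult[OF H H p])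
qed

lemma adj_unique:
  assumes H: "hilbert_space H" and x: "x \<in> carrier (bop H)" and y: "y \<in> carrier (bop H)"
    and eq: "\<And>\<xi> \<eta>. \<xi> \<in> carrier H \<Longrightarrow> \<eta> \<in> carrier H \<Longrightarrow> hinner H (x \<xi>) \<eta> = hinner H \<xi> (y \<eta>)"
  shows "adj H x = y"
  unfolding adj_def
proof (rule the_equality)
  show "z = y" if "z \<in> carrier (bop H) \<and> (\<forall>\<xi>\<in>carrier H. \<forall>\<eta>\<in>carrier H. hinner H (x \<xi>) \<eta> = hinner H \<xi> (z \<eta>))" for z
    using that y eq by (intro bop_eqI[of z H y] hvec_eqI_right[OF H]) auto
qed (use y eq in auto)

lemma adj_pair:
  assumes H: "hilbert_space H" and x: "x \<in> carrier (bop H)"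
  shows "adjoint_pair H H x (adj H x)" "adj H x \<in> carrier (bop H)"
proof -
  obtain C where C: "\<And>\<xi>. \<xi> \<in> carrier H \<Longrightarrow> hnorm H (x \<xi>) \<le> C * hnorm H \<xi>"
    using x unfolding bop_carrier_iff bounded_operator_def by blast
  have "hnorm H (x \<xi>) \<le> \<bar>C\<bar> * hnorm H \<xi>" if "\<xi> \<in> carrier H" for \<xi>
    using C[OF that] that mult_right_mono[of C "\<bar>C\<bar>" "hnorm H \<xi>"] H by fastforce
  then obtain y where y: "adjoint_pair H H x y"
    using adjoint_exists[OF H H, of x "\<bar>C\<bar>"] x H by auto
  have yr: "restrict y (carrier H) \<in> carrier (bop H)"
    by (rule restrict_bop[OF H adjoint_pair_sym[OF H H y]])
  have a: "adj H x = restrict y (carrier H)"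
    by (rule adj_unique[OF H x yr]) (simp add: adjoint_pair_left[OF y])
  show "adj H x \<in> carrier (bop H)" using a yr by simp
  show "adjoint_pair H H x (adj H x)"
    using y yr unfolding a by (auto simp: adjoint_pair_def)
qed

lemma adj_restrict:
  assumes H: "hilbert_space H" and p: "adjoint_pair H H T S"
  shows "adj H (restrict T (carrier H)) = restrict S (carrier H)"
  by (rule adj_unique[OF H restrict_bop[OF H p] restrict_bop[OF H adjoint_pair_sym[OF H H p]]])
     (simp add: adjoint_pair_left[OF p])

lemma hinner_adj:
  assumes "hilbert_space H" "x \<in> carrier (bop H)" "\<xi> \<in> carrier H" "\<eta> \<in> carrier H"
  shows "hinner H (adj H x \<xi>) \<eta> = hinner H \<xi> (x \<eta>)"
  using adjoint_pair_right[OF assms(1,1) adj_pair(1)[OF assms(1,2)]] assms by simp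

lemma bop_closed [simp, intro]:
  assumes H: "hilbert_space H"
  shows "\<one>\<^bsub>bop H\<^esub> \<in> carrier (bop H)" "\<zero>\<^bsub>bop H\<^esub> \<in> carrier (bop H)"
    "x \<in> carrier (bop H) \<Longrightarrow> adj H x \<in> carrier (bop H)"
    "x \<in> carrier (bop H) \<Longrightarrow> c \<odot>\<^bsub>bop H\<^esub> x \<in> carrier (bop H)"
    "x \<in> carrier (bop H) \<Longrightarrow> y \<in> carrier (bop H) \<Longrightarrow> x \<otimes>\<^bsub>bop H\<^esub> y \<in> carrier (bop H)"
    "x \<in> carrier (bop H) \<Longrightarrow> y \<in> carrier (bop H) \<Longrightarrow> x \<oplus>\<^bsub>bop H\<^esub> y \<in> carrier (bop H)"
proof -
  have zero: "adjoint_pair H H (\<lambda>\<xi>. \<zero>\<^bsub>H\<^esub>) (\<lambda>\<xi>. \<zero>\<^bsub>H\<^esub>)"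
    using H by (auto simp: adjoint_pair_def intro!: exI[of _ 0])
  have sum: "adjoint_pair H H (\<lambda>\<xi>. x \<xi> \<oplus>\<^bsub>H\<^esub> c \<odot>\<^bsub>H\<^esub> y \<xi>) (\<lambda>\<xi>. adj H x \<xi> \<oplus>\<^bsub>H\<^esub> cnj c \<odot>\<^bsub>H\<^esub> adj H y \<xi>)"
    if "x \<in> carrier (bop H)" "y \<in> carrier (bop H)" for x y c
    by (rule adjoint_pair_lincomb[OF H H adj_pair(1)[OF H that(1)] adj_pair(1)[OF H that(2)]])
  show z: "\<zero>\<^bsub>bop H\<^esub> \<in> carrier (bop H)"
    using restrict_bop[OF H zero] by (simp add: bop_def)
  show "\<one>\<^bsub>bop H\<^esub> \<in> carrier (bop H)"
    using restrict_bop[OF H adjoint_pair_id] by (simp add: bop_def)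
  show "x \<in> carrier (bop H) \<Longrightarrow> adj H x \<in> carrier (bop H)"
    by (rule adj_pair(2)[OF H])
  have ext: "z = restrict f (carrier H) \<Longrightarrow> restrict f (carrier H) \<in> carrier (bop H) \<Longrightarrow> z \<in> carrier (bop H)" for z f
    by simp
  show "x \<in> carrier (bop H) \<Longrightarrow> y \<in> carrier (bop H) \<Longrightarrow> x \<otimes>\<^bsub>bop H\<^esub> y \<in> carrier (bop H)"
    using restrict_bop[OF H adjoint_pair_comp[OF H H H adj_pair(1)[OF H, of y] adj_pair(1)[OF H, of x]]]
    by (simp add: bop_def compose_def)
  show "x \<oplus>\<^bsub>bop H\<^esub> y \<in> carrier (bop H)" if xy: "x \<in> carrier (bop H)" "y \<in> carrier (bop H)"
  proof -
    have "x \<oplus>\<^bsub>bop H\<^esub> y = restrict (\<lambda>\<xi>. x \<xi> \<oplus>\<^bsub>H\<^esub> 1 \<odot>\<^bsub>H\<^esub> y \<xi>) (carrier H)"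
      unfolding bop_def by (auto simp: fun_eq_iff xy H intro!: hvec_eqI[OF H])
    then show ?thesis using restrict_bop[OF H sum[OF xy, of 1]] by simp
  qed
  show "c \<odot>\<^bsub>bop H\<^esub> x \<in> carrier (bop H)" if x: "x \<in> carrier (bop H)"
  proof -
    have "c \<odot>\<^bsub>bop H\<^esub> x = restrict (\<lambda>\<xi>. \<zero>\<^bsub>bop H\<^esub> \<xi> \<oplus>\<^bsub>H\<^esub> c \<odot>\<^bsub>H\<^esub> x \<xi>) (carrier H)"
      unfolding bop_def by (auto simp: fun_eq_iff x H intro!: hvec_eqI[OF H])
    then show ?thesis using restrict_bop[OF H sum[OF z x, of c]] by simp
  qed
qed

lemma adj_simps [simp]:
  assumes H: "hilbert_space H"
  shows "x \<in> carrier (bop H) \<Longrightarrow> adj H (adj H x) = x"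
    "x \<in> carrier (bop H) \<Longrightarrow> y \<in> carrier (bop H) \<Longrightarrow> adj H (x \<otimes>\<^bsub>bop H\<^esub> y) = adj H y \<otimes>\<^bsub>bop H\<^esub> adj H x"
    "x \<in> carrier (bop H) \<Longrightarrow> y \<in> carrier (bop H) \<Longrightarrow> adj H (x \<oplus>\<^bsub>bop H\<^esub> y) = adj H x \<oplus>\<^bsub>bop H\<^esub> adj H y"
    "x \<in> carrier (bop H) \<Longrightarrow> adj H (c \<odot>\<^bsub>bop H\<^esub> x) = cnj c \<odot>\<^bsub>bop H\<^esub> adj H x"
    "adj H \<one>\<^bsub>bop H\<^esub> = \<one>\<^bsub>bop H\<^esub>"
  using H by (auto intro!: adj_unique[OF H] simp: hinner_adj adjoint_pair_left[OF adj_pair(1)[OF H]])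

lemma bop_abelian_group: 
  assumes H: "hilbert_space H"
  shows "abelian_group (bop H)"
proof (rule abelian_groupI)
  show "\<exists>y\<in>carrier (bop H). y \<oplus>\<^bsub>bop H\<^esub> x = \<zero>\<^bsub>bop H\<^esub>" if "x \<in> carrier (bop H)" for x
    using that H
    by (intro bexI[of _ "(-1) \<odot>\<^bsub>bop H\<^esub> x"] bop_eqI[of _ H]) (auto intro!: hvec_eqI[OF H])
qed (use H in \<open>auto intro!: bop_eqI[of _ H] hvec_eqI[OF H]\<close>)

lemma bop_minus_conv:
  assumes H: "hilbert_space H" and "x \<in> carrier (bop H)" "y \<in> carrier (bop H)"
  shows "x \<ominus>\<^bsub>bop H\<^esub> y = x \<oplus>\<^bsub>bop H\<^esub> (-1) \<odot>\<^bsub>bop H\<^esub> y"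
proof -
  interpret abelian_group "bop H" by (rule bop_abelian_group[OF H])
  have "(-1) \<odot>\<^bsub>bop H\<^esub> y \<oplus>\<^bsub>bop H\<^esub> y = \<zero>\<^bsub>bop H\<^esub>"
    using assms by (intro bop_eqI[of _ H]) (auto intro!: hvec_eqI[OF H])
  then have "\<ominus>\<^bsub>bop H\<^esub> y = (-1) \<odot>\<^bsub>bop H\<^esub> y"
    using assms by (intro minus_equality) auto
  then show ?thesis by (simp add: a_minus_def)
qed

lemma bop_minus_apply [simp]:
  "hilbert_space H \<Longrightarrow> x \<in> carrier (bop H) \<Longrightarrow> y \<in> carrier (bop H) \<Longrightarrow> \<xi> \<in> carrier H \<Longrightarrow>
    (x \<ominus>\<^bsub>bop H\<^esub> y) \<xi> = x \<xi> \<ominus>\<^bsub>H\<^esub> y \<xi>"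
  by (simp add: bop_minus_conv hminus_conv)

lemma bop_finsum:
  assumes H: "hilbert_space H" and "finite F" "\<And>j. j \<in> F \<Longrightarrow> f j \<in> carrier (bop H)"
  shows "(\<Oplus>\<^bsub>bop H\<^esub> j\<in>F. f j) \<in> carrier (bop H)"
    and "\<xi> \<in> carrier H \<Longrightarrow> \<eta> \<in> carrier H \<Longrightarrow>
      hinner H ((\<Oplus>\<^bsub>bop H\<^esub> j\<in>F. f j) \<xi>) \<eta> = (\<Sum>j\<in>F. hinner H (f j \<xi>) \<eta>)"
proof -
  interpret B: abelian_group "bop H" by (rule bop_abelian_group[OF H])
  have "(\<Oplus>\<^bsub>bop H\<^esub> j\<in>F. f j) \<in> carrier (bop H) \<and>
    (\<forall>\<xi>\<in>carrier H. \<forall>\<eta>\<in>carrier H. hinner H ((\<Oplus>\<^bsub>bop H\<^esub> j\<in>F. f j) \<xi>) \<eta> = (\<Sum>j\<in>F. hinner H (f j \<xi>) \<eta>))"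
    using assms(2,3)
  proof (induction F)
    case (insert j F)
    then have "(\<Oplus>\<^bsub>bop H\<^esub> j\<in>insert j F. f j) = f j \<oplus>\<^bsub>bop H\<^esub> (\<Oplus>\<^bsub>bop H\<^esub> j\<in>F. f j)"
      by (intro B.finsum_insert) auto
    then show ?case using insert H by auto
  qed (use H in auto)
  then show "(\<Oplus>\<^bsub>bop H\<^esub> j\<in>F. f j) \<in> carrier (bop H)"
    and "\<xi> \<in> carrier H \<Longrightarrow> \<eta> \<in> carrier H \<Longrightarrow>
      hinner H ((\<Oplus>\<^bsub>bop H\<^esub> j\<in>F. f j) \<xi>) \<eta> = (\<Sum>j\<in>F. hinner H (f j \<xi>) \<eta>)"
    by auto
qed

lemma bop_bound:
  assumes "hilbert_space H" "x \<in> carrier (bop H)"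
  shows "\<exists>C\<ge>0. \<forall>\<xi>\<in>carrier H. hnorm H (x \<xi>) \<le> C * hnorm H \<xi>"
  by (rule adjoint_pair_bound[OF assms(1) adj_pair(1)[OF assms]])

subsection \<open>Von Neumann algebras\<close>

lemma commutantD:
  assumes "y \<in> commutant H S"
  shows "y \<in> carrier (bop H)" "x \<in> S \<Longrightarrow> \<xi> \<in> carrier H \<Longrightarrow> x (y \<xi>) = y (x \<xi>)"
proof -
  show "y \<in> carrier (bop H)" using assms by (simp add: commutant_def)
  assume *: "x \<in> S" "\<xi> \<in> carrier H"
  then have "(x \<otimes>\<^bsub>bop H\<^esub> y) \<xi> = (y \<otimes>\<^bsub>bop H\<^esub> x) \<xi>" using assms by (simp add: commutant_def)
  then show "x (y \<xi>) = y (x \<xi>)" using * by simp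
qed

lemma commutantI:
  assumes "hilbert_space H" "S \<subseteq> carrier (bop H)" "y \<in> carrier (bop H)"
    and "\<And>x \<xi>. x \<in> S \<Longrightarrow> \<xi> \<in> carrier H \<Longrightarrow> x (y \<xi>) = y (x \<xi>)"
  shows "y \<in> commutant H S"
  using assms by (auto simp: commutant_def intro!: bop_eqI[of _ H])

lemma commutant_adj:
  assumes H: "hilbert_space H" and S: "S \<subseteq> carrier (bop H)" "\<And>x. x \<in> S \<Longrightarrow> adj H x \<in> S"
    and y: "y \<in> commutant H S"
  shows "adj H y \<in> commutant H S"
proof (rule commutantI[OF H S(1)])
  note [simp] = H
  have yb: "y \<in> carrier (bop H)" by (rule commutantD(1)[OF y])
  show "adj H y \<in> carrier (bop H)" using yb by simp
  show "x (adj H y \<xi>) = adj H y (x \<xi>)" if "x \<in> S" "\<xi> \<in> carrier H" for x \<xi>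
  proof (rule hvec_eqI[OF H])
    have xb: "x \<in> carrier (bop H)" using that S by auto
    show "hinner H (x (adj H y \<xi>)) \<zeta> = hinner H (adj H y (x \<xi>)) \<zeta>" if z: "\<zeta> \<in> carrier H" for \<zeta>
    proof -
      have "hinner H (x (adj H y \<xi>)) \<zeta> = hinner H \<xi> (y (adj H x \<zeta>))"
        using xb yb z \<open>\<xi> \<in> carrier H\<close> by (simp add: adjoint_pair_left[OF adj_pair(1)[OF H xb]] hinner_adj)
      also have "\<dots> = hinner H \<xi> (adj H x (y \<zeta>))"
        using commutantD(2)[OF y S(2)[OF \<open>x \<in> S\<close>] z] by simp
      also have "\<dots> = hinner H (adj H y (x \<xi>)) \<zeta>"
        using xb yb z \<open>\<xi> \<in> carrier H\<close> by (simp add: adjoint_pair_left[OF adj_pair(1)[OF H xb]] hinner_adj)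
      finally show ?thesis .
    qed
  qed (use that S yb in auto)
qed

lemma vn_subset: "von_neumann_algebra H R \<Longrightarrow> x \<in> R \<Longrightarrow> x \<in> carrier (bop H)"
  by (auto simp: von_neumann_algebra_def)

text \<open>The double commutant condition is the source of all elements of \<open>R\<close> that are constructed below.\<close>

lemma vn_memI:
  assumes H: "hilbert_space H" and R: "von_neumann_algebra H R" and a: "a \<in> carrier (bop H)"
    and "\<And>y \<xi>. y \<in> commutant H R \<Longrightarrow> \<xi> \<in> carrier H \<Longrightarrow> a (y \<xi>) = y (a \<xi>)"
  shows "a \<in> R"
proof -
  have "a \<in> commutant H (commutant H R)"
    using assms by (intro commutantI[OF H]) (auto dest: commutantD)
  then show ?thesis using R by (simp add: von_neumann_algebra_def)
qed

lemma vn_closed [simp, intro]: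
  assumes H: "hilbert_space H" and R: "von_neumann_algebra H R"
  shows "\<one>\<^bsub>bop H\<^esub> \<in> R" "\<zero>\<^bsub>bop H\<^esub> \<in> R"
    "x \<in> R \<Longrightarrow> adj H x \<in> R" "x \<in> R \<Longrightarrow> c \<odot>\<^bsub>bop H\<^esub> x \<in> R"
    "x \<in> R \<Longrightarrow> y \<in> R \<Longrightarrow> x \<otimes>\<^bsub>bop H\<^esub> y \<in> R" "x \<in> R \<Longrightarrow> y \<in> R \<Longrightarrow> x \<oplus>\<^bsub>bop H\<^esub> y \<in> R"
    "x \<in> R \<Longrightarrow> y \<in> R \<Longrightarrow> x \<ominus>\<^bsub>bop H\<^esub> y \<in> R"
proof -
  note [simp] = H vn_subset[OF R]
  have z: "y \<zero>\<^bsub>H\<^esub> = \<zero>\<^bsub>H\<^esub>" if "y \<in> carrier (bop H)" for y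
    by (rule adjoint_pair_zero[OF H H adj_pair(1)[OF H that]])
  have mem: "a \<in> R" if "a \<in> carrier (bop H)" "\<And>y \<xi>. y \<in> carrier (bop H) \<Longrightarrow>
      (\<And>x \<zeta>. x \<in> R \<Longrightarrow> \<zeta> \<in> carrier H \<Longrightarrow> x (y \<zeta>) = y (x \<zeta>)) \<Longrightarrow> \<xi> \<in> carrier H \<Longrightarrow> a (y \<xi>) = y (a \<xi>)" for a
    by (rule vn_memI[OF H R that(1)], rule that(2)) (auto dest: commutantD(1) intro: commutantD(2))
  show "\<one>\<^bsub>bop H\<^esub> \<in> R" "\<zero>\<^bsub>bop H\<^esub> \<in> R" by (rule mem; simp add: z)+
  show "x \<in> R \<Longrightarrow> adj H x \<in> R" using R by (simp add: von_neumann_algebra_def)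
  show sm: "x \<in> R \<Longrightarrow> c \<odot>\<^bsub>bop H\<^esub> x \<in> R" for x c by (rule mem; simp)
  show "x \<in> R \<Longrightarrow> y \<in> R \<Longrightarrow> x \<otimes>\<^bsub>bop H\<^esub> y \<in> R" by (rule mem; simp)
  show ad: "x \<in> R \<Longrightarrow> y \<in> R \<Longrightarrow> x \<oplus>\<^bsub>bop H\<^esub> y \<in> R" for x y by (rule mem; simp)
  show "x \<in> R \<Longrightarrow> y \<in> R \<Longrightarrow> x \<ominus>\<^bsub>bop H\<^esub> y \<in> R"
    using ad sm bop_minus_conv[OF H vn_subset[OF R] vn_subset[OF R]] by simp
qed

lemma vn_bop:
  assumes "hilbert_space H"
  shows "von_neumann_algebra H (carrier (bop H))"
  using assms by (auto simp: von_neumann_algebra_def commutant_def)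


section \<open>Ultraweakly continuous functionals\<close>

lemma square_summable_vec [simp]: "square_summable H \<xi> \<Longrightarrow> \<xi> n \<in> carrier H"
  by (auto simp: square_summable_def)

lemma square_summable_iff:
  "square_summable H \<xi> \<longleftrightarrow> (\<forall>n. \<xi> n \<in> carrier H) \<and> (\<lambda>n. (hnorm H (\<xi> n))\<^sup>2) summable_on UNIV"
  by (auto simp: square_summable_def summable_on_UNIV_nonneg_real_iff)

lemma abs_summable_hinner:
  assumes H: "hilbert_space H" and "\<And>i. i \<in> I \<Longrightarrow> \<xi> i \<in> carrier H" "\<And>i. i \<in> I \<Longrightarrow> \<eta> i \<in> carrier H"
    and "(\<lambda>i. (hnorm H (\<xi> i))\<^sup>2) summable_on I" "(\<lambda>i. (hnorm H (\<eta> i))\<^sup>2) summable_on I"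
  shows "(\<lambda>i. norm (hinner H (\<xi> i) (\<eta> i))) summable_on I"
proof (rule summable_on_comparison_test)
  show "(\<lambda>i. (hnorm H (\<xi> i))\<^sup>2 + (hnorm H (\<eta> i))\<^sup>2) summable_on I"
    by (intro summable_on_add assms)
  show "norm (hinner H (\<xi> i) (\<eta> i)) \<le> (hnorm H (\<xi> i))\<^sup>2 + (hnorm H (\<eta> i))\<^sup>2" if "i \<in> I" for i
  proof -
    have "hnorm H (\<xi> i) * hnorm H (\<eta> i) \<le> (hnorm H (\<xi> i))\<^sup>2 + (hnorm H (\<eta> i))\<^sup>2"
      using zero_le_power2[of "hnorm H (\<xi> i) - hnorm H (\<eta> i)"] zero_le_power2[of "hnorm H (\<xi> i)"]
        zero_le_power2[of "hnorm H (\<eta> i)"]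
      unfolding power2_diff by linarith
    then show ?thesis using hcauchy_schwarz[OF H assms(2,3)[OF that]] by linarith
  qed
qed simp

lemma summable_bounded_image:
  assumes H: "hilbert_space H" and L: "hilbert_space L" and T: "adjoint_pair H L T S"
    and \<xi>: "\<And>i. i \<in> I \<Longrightarrow> \<xi> i \<in> carrier H" "(\<lambda>i. (hnorm H (\<xi> i))\<^sup>2) summable_on I"
  shows "(\<lambda>i. (hnorm L (T (\<xi> i)))\<^sup>2) summable_on I"
proof -
  obtain C where C: "C \<ge> 0" "\<forall>\<xi>\<in>carrier H. hnorm L (T \<xi>) \<le> C * hnorm H \<xi>"
    using adjoint_pair_bound[OF H T] by blast
  show ?thesis
  proof (rule summable_on_comparison_test)
    show "(\<lambda>i. C\<^sup>2 * (hnorm H (\<xi> i))\<^sup>2) summable_on I" by (intro summable_on_cmult_right \<xi>)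
    show "(hnorm L (T (\<xi> i)))\<^sup>2 \<le> C\<^sup>2 * (hnorm H (\<xi> i))\<^sup>2" if "i \<in> I" for i
      using power_mono[of "hnorm L (T (\<xi> i))" "C * hnorm H (\<xi> i)" 2] C \<xi>(1)[OF that] L
        adjoint_pair_closed(1)[OF T] by (simp add: power_mult_distrib)
  qed simp
qed

lemma square_summable_image:
  assumes H: "hilbert_space H" and L: "hilbert_space L" and T: "adjoint_pair H L T S"
    and \<xi>: "square_summable H \<xi>"
  shows "square_summable L (\<lambda>n. T (\<xi> n))"
  using \<xi> summable_bounded_image[OF H L T, of UNIV \<xi>] adjoint_pair_closed[OF T]
  by (auto simp: square_summable_iff)

lemma uw_abs_summable:
  assumes H: "hilbert_space H" and x: "x \<in> carrier (bop H)" and "square_summable H \<xi>" "square_summable H \<eta>"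
  shows "(\<lambda>n. norm (hinner H (x (\<xi> n)) (\<eta> n))) summable_on UNIV"
  using assms square_summable_image[OF H H adj_pair(1)[OF H x]]
  by (intro abs_summable_hinner[OF H]) (auto simp: square_summable_iff)

lemma uw_has_sum:
  assumes H: "hilbert_space H" and x: "x \<in> carrier (bop H)" and "square_summable H \<xi>" "square_summable H \<eta>"
  shows "((\<lambda>n. hinner H (x (\<xi> n)) (\<eta> n)) has_sum (\<Sum>n. hinner H (x (\<xi> n)) (\<eta> n))) UNIV"
proof -
  obtain s where s: "((\<lambda>n. hinner H (x (\<xi> n)) (\<eta> n)) has_sum s) UNIV"
    using abs_summable_summable[OF uw_abs_summable[OF assms]] by (auto simp: summable_on_def)
  then show ?thesis using sums_unique[OF has_sum_imp_sums[OF s]] by simp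
qed

lemma has_sum_imp_suminf:
  fixes f :: "nat \<Rightarrow> 'a :: {topological_comm_monoid_add, t2_space}"
  shows "(f has_sum s) UNIV \<Longrightarrow> (\<Sum>n. f n) = s"
  using has_sum_imp_sums sums_unique by metis

lemma uw_topspace:
  assumes "hilbert_space H"
  shows "topspace (ultraweak_topology H) = carrier (bop H)"
proof -
  have "square_summable H (\<lambda>n. \<zero>\<^bsub>H\<^esub>)" using assms by (simp add: square_summable_iff)
  then show ?thesis
    unfolding ultraweak_topology_def topology_generated_by_topspace
    by (auto intro!: exI[of _ "carrier (bop H)"] exI[of _ "\<lambda>n. \<zero>\<^bsub>H\<^esub>"] exI[of _ UNIV])
qed

lemma uw_continuous:
  assumes H: "hilbert_space H" and "square_summable H \<xi>" "square_summable H \<eta>"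
  shows "continuous_map (ultraweak_topology H) euclidean (\<lambda>x. \<Sum>n. hinner H (x (\<xi> n)) (\<eta> n))"
  unfolding continuous_map_def
proof (intro conjI allI impI)
  fix U :: "complex set" assume "openin euclidean U"
  then have "openin (ultraweak_topology H) {x \<in> carrier (bop H). (\<Sum>n. hinner H (x (\<xi> n)) (\<eta> n)) \<in> U}"
    unfolding ultraweak_topology_def using assms by (intro topology_generated_by_Basis) auto
  then show "openin (ultraweak_topology H)
     {x \<in> topspace (ultraweak_topology H). (\<Sum>n. hinner H (x (\<xi> n)) (\<eta> n)) \<in> U}"
    by (simp add: uw_topspace[OF H])
qed simp

lemma has_sum_interleave:
  fixes f g :: "nat \<Rightarrow> 'a :: {topological_comm_monoid_add, t2_space}"
  assumes "(f has_sum a) UNIV" "(g has_sum b) UNIV"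
  shows "((\<lambda>n. if even n then f (n div 2) else g (n div 2)) has_sum a + b) UNIV"
proof -
  let ?h = "\<lambda>n. if even n then f (n div 2) else g (n div 2)"
  have "(?h has_sum a) (range (\<lambda>n. 2 * n))"
    using assms(1) by (subst has_sum_reindex) (auto simp: o_def inj_on_def)
  moreover have "(?h has_sum b) (range (\<lambda>n. 2 * n + 1))"
    using assms(2) by (subst has_sum_reindex) (auto simp: o_def inj_on_def)
  moreover have "range (\<lambda>n. 2 * n) \<inter> range (\<lambda>n::nat. 2 * n + 1) = {}"
    by (auto; presburger)
  ultimately have "(?h has_sum a + b) (range (\<lambda>n. 2 * n) \<union> range (\<lambda>n. 2 * n + 1))"
    by (rule has_sum_Un_disjoint)
  moreover have "range (\<lambda>n. 2 * n) \<union> range (\<lambda>n::nat. 2 * n + 1) = UNIV"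
    by (auto simp: image_iff) presburger
  ultimately show ?thesis by simp
qed

text \<open>  Interleaving the sequences of two functionals that define the ultraweak topology gives the
  sequences of their sum, so these functionals form a vector space.\<close>

lemma uw_functional_lincomb:
  assumes H: "hilbert_space H" and s: "square_summable H \<xi>" "square_summable H \<eta>" "square_summable H \<xi>'" "square_summable H \<eta>'"
  shows "\<exists>\<alpha> \<beta>. square_summable H \<alpha> \<and> square_summable H \<beta> \<and> (\<forall>x\<in>carrier (bop H).
    (\<Sum>n. hinner H (x (\<alpha> n)) (\<beta> n)) = (\<Sum>n. hinner H (x (\<xi> n)) (\<eta> n)) + c * (\<Sum>n. hinner H (x (\<xi>' n)) (\<eta>' n)))"
proof -
  define mix :: "(nat \<Rightarrow> 'a) \<Rightarrow> (nat \<Rightarrow> 'a) \<Rightarrow> nat \<Rightarrow> 'a"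
    where "mix f g n = (if even n then f (n div 2) else g (n div 2))" for f g n
  have mixs: "square_summable H (mix f g)" if fg: "square_summable H f" "square_summable H g" for f g
  proof -
    have "(\<lambda>n. (hnorm H (mix f g n))\<^sup>2) = (\<lambda>n. if even n then (hnorm H (f (n div 2)))\<^sup>2 else (hnorm H (g (n div 2)))\<^sup>2)"
      by (auto simp: mix_def fun_eq_iff)
    moreover obtain a b where "((\<lambda>n. (hnorm H (f n))\<^sup>2) has_sum a) UNIV" "((\<lambda>n. (hnorm H (g n))\<^sup>2) has_sum b) UNIV"
      using fg unfolding square_summable_iff summable_on_def by blast
    ultimately have "((\<lambda>n. (hnorm H (mix f g n))\<^sup>2) has_sum (a + b)) UNIV"
      using has_sum_interleave[of "\<lambda>n. (hnorm H (f n))\<^sup>2" a "\<lambda>n. (hnorm H (g n))\<^sup>2" b] by simp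
    moreover have "mix f g n \<in> carrier H" for n using fg by (simp add: mix_def)
    ultimately show ?thesis by (auto simp: square_summable_iff summable_on_def)
  qed
  have cs: "square_summable H (\<lambda>n. c \<odot>\<^bsub>H\<^esub> \<xi>' n)"
    using s(3) H by (auto simp: square_summable_iff hnorm_smult power_mult_distrib intro!: summable_on_cmult_right)
  have "(\<Sum>n. hinner H (x (mix \<xi> (\<lambda>n. c \<odot>\<^bsub>H\<^esub> \<xi>' n) n)) (mix \<eta> \<eta>' n))
    = (\<Sum>n. hinner H (x (\<xi> n)) (\<eta> n)) + c * (\<Sum>n. hinner H (x (\<xi>' n)) (\<eta>' n))" if x: "x \<in> carrier (bop H)" for x
  proof -
    have "((\<lambda>n. if even n then hinner H (x (\<xi> (n div 2))) (\<eta> (n div 2)) else c * hinner H (x (\<xi>' (n div 2))) (\<eta>' (n div 2)))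
      has_sum (\<Sum>n. hinner H (x (\<xi> n)) (\<eta> n)) + c * (\<Sum>n. hinner H (x (\<xi>' n)) (\<eta>' n))) UNIV"
      by (intro has_sum_interleave has_sum_cmult_right uw_has_sum H x s)
    also have "(\<lambda>n. if even n then hinner H (x (\<xi> (n div 2))) (\<eta> (n div 2)) else c * hinner H (x (\<xi>' (n div 2))) (\<eta>' (n div 2)))
      = (\<lambda>n. hinner H (x (mix \<xi> (\<lambda>n. c \<odot>\<^bsub>H\<^esub> \<xi>' n) n)) (mix \<eta> \<eta>' n))"
      using H x s by (auto simp: mix_def fun_eq_iff)
    finally show ?thesis by (rule has_sum_imp_suminf)
  qed
  then show ?thesis using mixs[OF s(1) cs] mixs[OF s(2,4)] by blast
qed

text \<open>
  The topology is generated by preimages under the functionals; an intersection of two neighbourhoods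
  merges their finite sets of functionals and takes the smaller radius.
\<close>

lemma uw_basic_neighbourhood:
  assumes H: "hilbert_space H" and U: "openin (ultraweak_topology H) U" and z: "z \<in> U"
  shows "\<exists>P \<epsilon>. finite P \<and> \<epsilon> > 0 \<and> (\<forall>(\<xi>, \<eta>)\<in>P. square_summable H \<xi> \<and> square_summable H \<eta>) \<and>
    (\<forall>x\<in>carrier (bop H). (\<forall>(\<xi>, \<eta>)\<in>P.
       dist (\<Sum>n. hinner H (x (\<xi> n)) (\<eta> n)) (\<Sum>n. hinner H (z (\<xi> n)) (\<eta> n)) < \<epsilon>) \<longrightarrow> x \<in> U)"
proof -
  have "generate_topology_on {{x \<in> carrier (bop H). (\<Sum>n. hinner H (x (\<xi> n)) (\<eta> n)) \<in> U} | \<xi> \<eta> U.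
        square_summable H \<xi> \<and> square_summable H \<eta> \<and> open U} U"
    using U unfolding ultraweak_topology_def by (rule openin_topology_generated_by)
  then show ?thesis using z
  proof induction
    case (Int a b)
    obtain P e where P: "finite P" "e > 0" "\<forall>(\<xi>, \<eta>)\<in>P. square_summable H \<xi> \<and> square_summable H \<eta>"
      "\<forall>x\<in>carrier (bop H). (\<forall>(\<xi>, \<eta>)\<in>P.
       dist (\<Sum>n. hinner H (x (\<xi> n)) (\<eta> n)) (\<Sum>n. hinner H (z (\<xi> n)) (\<eta> n)) < e) \<longrightarrow> x \<in> a"
      using Int by auto
    obtain P' e' where P': "finite P'" "e' > 0" "\<forall>(\<xi>, \<eta>)\<in>P'. square_summable H \<xi> \<and> square_summable H \<eta>"
      "\<forall>x\<in>carrier (bop H). (\<forall>(\<xi>, \<eta>)\<in>P'.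
       dist (\<Sum>n. hinner H (x (\<xi> n)) (\<eta> n)) (\<Sum>n. hinner H (z (\<xi> n)) (\<eta> n)) < e') \<longrightarrow> x \<in> b"
      using Int by auto
    show ?case
      by (rule exI[of _ "P \<union> P'"], rule exI[of _ "min e e'"]) (use P P' in fastforce)
  next
    case (UN A)
    then obtain k where k: "k \<in> A" "z \<in> k" by blast
    from UN.IH[OF k] k(1) show ?case by (meson UnionI)
  next
    case (Basis s)
    then obtain \<xi> \<eta> V where s: "s = {x \<in> carrier (bop H). (\<Sum>n. hinner H (x (\<xi> n)) (\<eta> n)) \<in> V}"
      "square_summable H \<xi>" "square_summable H \<eta>" "open V" by blast
    then obtain e where "e > 0" "\<And>w. dist w (\<Sum>n. hinner H (z (\<xi> n)) (\<eta> n)) < e \<Longrightarrow> w \<in> V"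
      using Basis.prems by (auto simp: open_dist)
    then show ?case
      using s by (intro exI[of _ "{(\<xi>, \<eta>)}"] exI[of _ e]) auto
  qed simp
qed

text \<open>
  Continuity at \<open>0\<close> makes a functional vanish on the common kernel of finitely many of the
  functionals that define the topology, so it is a linear combination of them.
\<close>

lemma uw_functional_representation:
  assumes H: "hilbert_space H" and R: "von_neumann_algebra H R"
    and add: "\<And>x y. x \<in> R \<Longrightarrow> y \<in> R \<Longrightarrow> \<phi> (x \<oplus>\<^bsub>bop H\<^esub> y) = \<phi> x + \<phi> y"
    and smult: "\<And>c x. x \<in> R \<Longrightarrow> \<phi> (c \<odot>\<^bsub>bop H\<^esub> x) = c * \<phi> x"
    and cont: "continuous_map (subtopology (ultraweak_topology H) R) euclidean \<phi>"
  shows "\<exists>\<xi> \<eta>. square_summable H \<xi> \<and> square_summable H \<eta> \<and>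
    (\<forall>x\<in>R. \<phi> x = (\<Sum>n. hinner H (x (\<xi> n)) (\<eta> n)))"
proof -
  define f where "f p x = (\<Sum>n. hinner H (x (fst p n)) (snd p n))" for p :: "(nat \<Rightarrow> 'a) \<times> (nat \<Rightarrow> 'a)" and x
  define Q where "Q = {p. square_summable H (fst p) \<and> square_summable H (snd p)}"
  note [simp] = H R vn_subset[OF R]
  have f_lin: "f p (x \<oplus>\<^bsub>bop H\<^esub> c \<odot>\<^bsub>bop H\<^esub> y) = f p x + c * f p y"
    if "p \<in> Q" "x \<in> carrier (bop H)" "y \<in> carrier (bop H)" for p x y c
  proof -
    have "((\<lambda>n. hinner H (x (fst p n)) (snd p n) + c * hinner H (y (fst p n)) (snd p n)) has_sum (f p x + c * f p y)) UNIV"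
      unfolding f_def using that by (intro has_sum_add has_sum_cmult_right uw_has_sum) (auto simp: Q_def)
    also have "(\<lambda>n. hinner H (x (fst p n)) (snd p n) + c * hinner H (y (fst p n)) (snd p n))
      = (\<lambda>n. hinner H ((x \<oplus>\<^bsub>bop H\<^esub> c \<odot>\<^bsub>bop H\<^esub> y) (fst p n)) (snd p n))"
      using that by (auto simp: Q_def fun_eq_iff)
    finally show ?thesis unfolding f_def[of _ "x \<oplus>\<^bsub>bop H\<^esub> c \<odot>\<^bsub>bop H\<^esub> y"] by (rule has_sum_imp_suminf)
  qed
  have f0: "f p \<zero>\<^bsub>bop H\<^esub> = 0" if "p \<in> Q" for p
    using that by (simp add: f_def Q_def)
  have z0: "(0 :: complex) \<odot>\<^bsub>bop H\<^esub> \<zero>\<^bsub>bop H\<^esub> = \<zero>\<^bsub>bop H\<^esub>"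
    by (intro bop_eqI[of _ H]) (auto intro!: hvec_eqI[OF H])
  have \<phi>0: "\<phi> \<zero>\<^bsub>bop H\<^esub> = 0" using smult[of "\<zero>\<^bsub>bop H\<^esub>" 0] by (simp add: z0)
  have zs: "\<zero>\<^bsub>bop H\<^esub> \<oplus>\<^bsub>bop H\<^esub> c \<odot>\<^bsub>bop H\<^esub> x = c \<odot>\<^bsub>bop H\<^esub> x" if "x \<in> carrier (bop H)" for c x
    using that by (intro bop_eqI[of _ H]) (auto intro!: hvec_eqI[OF H])
  have f_smult: "f p (c \<odot>\<^bsub>bop H\<^esub> x) = c * f p x" if "p \<in> Q" "x \<in> carrier (bop H)" for p c x
    using f_lin[OF that(1) _ that(2), of "\<zero>\<^bsub>bop H\<^esub>" c] f0[OF that(1)] zs[OF that(2), of c] by simp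
  \<comment> \<open>\<open>\<bar>\<phi>\<bar> < 1\<close> on a neighbourhood of \<open>0\<close>, which contains all multiples of \<open>x\<close> if the \<open>f p\<close> vanish at \<open>x\<close>\<close>
  obtain P where P: "finite P" "P \<subseteq> Q" "\<And>x. x \<in> R \<Longrightarrow> (\<forall>p\<in>P. f p x = 0) \<Longrightarrow> \<phi> x = 0"
  proof -
    have "openin (subtopology (ultraweak_topology H) R)
        {x \<in> topspace (subtopology (ultraweak_topology H) R). \<phi> x \<in> ball 0 1}"
      using cont by (rule openin_continuous_map_preimage) simp
    then obtain U where U: "openin (ultraweak_topology H) U" "{x \<in> R. \<phi> x \<in> ball 0 1} = U \<inter> R"
      by (auto simp: openin_subtopology uw_topspace Int_absorb1 subset_iff Collect_conj_eq)
    have "\<zero>\<^bsub>bop H\<^esub> \<in> R \<and> \<phi> \<zero>\<^bsub>bop H\<^esub> \<in> ball 0 1" by (simp add: \<phi>0)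
    then have "\<zero>\<^bsub>bop H\<^esub> \<in> U" using U(2) by blast
    from uw_basic_neighbourhood[OF H U(1) this] obtain P e where
      P: "finite P" "e > 0" "P \<subseteq> Q" and nb: "\<And>x. x \<in> carrier (bop H) \<Longrightarrow> (\<forall>p\<in>P. dist (f p x) (f p \<zero>\<^bsub>bop H\<^esub>) < e) \<Longrightarrow> x \<in> U"
      unfolding f_def Q_def by (fastforce simp: case_prod_unfold)
    have "\<phi> x = 0" if x: "x \<in> R" "\<forall>p\<in>P. f p x = 0" for x
    proof (rule ccontr)
      assume nz: "\<phi> x \<noteq> 0"
      let ?y = "(1 / \<phi> x) \<odot>\<^bsub>bop H\<^esub> x"
      have "f p ?y = 0" if "p \<in> P" for p
        using that x(2) f_smult[of p x "1 / \<phi> x"] vn_subset[OF R x(1)] P(3) by auto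
      then have "?y \<in> U" using x P f0 by (intro nb) (auto simp: subset_iff)
      then have "?y \<in> {x \<in> R. \<phi> x \<in> ball 0 1}" using U(2) x by auto
      then show False using smult[OF x(1), of "1 / \<phi> x"] nz by simp
    qed
    then show thesis using P by (intro that) auto
  qed
  \<comment> \<open>subtracting the multiple of \<open>f p\<close> that agrees with \<open>\<phi>\<close> at \<open>w\<close> removes \<open>p\<close> from the finite set\<close>
  have "\<exists>p\<in>Q. \<forall>x\<in>R. \<phi> x = f p x"
    using P add smult
  proof (induction P arbitrary: \<phi> rule: finite_induct)
    case empty
    have "(\<lambda>n. \<zero>\<^bsub>H\<^esub>, \<lambda>n. \<zero>\<^bsub>H\<^esub>) \<in> Q" by (simp add: Q_def square_summable_iff)
    moreover have "f (\<lambda>n. \<zero>\<^bsub>H\<^esub>, \<lambda>n. \<zero>\<^bsub>H\<^esub>) x = 0" if "x \<in> R" for x using that by (simp add: f_def)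
    ultimately show ?case using empty(2) by (intro bexI[of _ "(\<lambda>n. \<zero>\<^bsub>H\<^esub>, \<lambda>n. \<zero>\<^bsub>H\<^esub>)"]) auto
  next
    case (insert p P)
    have p: "p \<in> Q" "P \<subseteq> Q" using insert.prems by auto
    show ?case
    proof (cases "\<exists>w\<in>R. (\<forall>q\<in>P. f q w = 0) \<and> f p w \<noteq> 0")
      case True
      then obtain w where w: "w \<in> R" "\<And>q. q \<in> P \<Longrightarrow> f q w = 0" "f p w \<noteq> 0" by blast
      define c where "c = \<phi> w / f p w"
      have \<phi>lin: "\<phi> (x \<oplus>\<^bsub>bop H\<^esub> c \<odot>\<^bsub>bop H\<^esub> y) = \<phi> x + c * \<phi> y" if "x \<in> R" "y \<in> R" for x y c
        using that insert.prems by simp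
      have "\<exists>q\<in>Q. \<forall>x\<in>R. \<phi> x - c * f p x = f q x"
      proof (rule insert.IH[OF p(2)])
        show "\<phi> x - c * f p x = 0" if x: "x \<in> R" "\<forall>q\<in>P. f q x = 0" for x
        proof -
          let ?y = "x \<oplus>\<^bsub>bop H\<^esub> (- f p x / f p w) \<odot>\<^bsub>bop H\<^esub> w"
          have "?y \<in> R" using x w by simp
          moreover have "\<forall>q\<in>insert p P. f q ?y = 0"
            using x w p by (auto simp: f_lin subset_iff)
          ultimately have "\<phi> ?y = 0" using insert.prems(2) by blast
          then show ?thesis using x w by (simp add: \<phi>lin c_def field_simps)
        qed
        show "\<phi> (x \<oplus>\<^bsub>bop H\<^esub> y) - c * f p (x \<oplus>\<^bsub>bop H\<^esub> y) = \<phi> x - c * f p x + (\<phi> y - c * f p y)"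
          if "x \<in> R" "y \<in> R" for x y
        proof -
          have "1 \<odot>\<^bsub>bop H\<^esub> y = y" using that by (intro bop_eqI[of _ H]) (auto intro!: hvec_eqI[OF H])
          then show ?thesis using f_lin[OF p(1), of x y 1] that insert.prems by (simp add: algebra_simps)
        qed
        show "\<phi> (d \<odot>\<^bsub>bop H\<^esub> x) - c * f p (d \<odot>\<^bsub>bop H\<^esub> x) = d * (\<phi> x - c * f p x)" if "x \<in> R" for d x
          using that p insert.prems by (simp add: f_smult algebra_simps)
      qed
      then obtain q where q: "q \<in> Q" "\<And>x. x \<in> R \<Longrightarrow> \<phi> x = f q x + c * f p x"
        by (auto simp: algebra_simps)
      obtain \<alpha> \<beta> where "square_summable H \<alpha>" "square_summable H \<beta>"
        "\<forall>x\<in>carrier (bop H). (\<Sum>n. hinner H (x (\<alpha> n)) (\<beta> n)) = f q x + c * f p x"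
        using uw_functional_lincomb[OF H, of "fst q" "snd q" "fst p" "snd p" c] q(1) p(1)
        unfolding f_def Q_def by blast
      then show ?thesis using q by (intro bexI[of _ "(\<alpha>, \<beta>)"]) (auto simp: Q_def f_def)
    next
      case False
      then show ?thesis using insert.prems p by (intro insert.IH) auto
    qed
  qed
  then show ?thesis unfolding f_def Q_def by auto
qed

lemma normal_state_of_sequence:
  assumes H: "hilbert_space H" and \<kappa>: "square_summable H \<kappa>"
    and one: "((\<lambda>n. (hnorm H (\<kappa> n))\<^sup>2) has_sum 1) UNIV"
  shows "normal_state H (carrier (bop H)) (\<lambda>x. \<Sum>n. hinner H (x (\<kappa> n)) (\<kappa> n))"
proof -
  note [simp] = H \<kappa>
  note hs = uw_has_sum[OF H _ \<kappa> \<kappa>]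
  have eqI: "(\<Sum>n. hinner H (x (\<kappa> n)) (\<kappa> n)) = s" if "((\<lambda>n. hinner H (x (\<kappa> n)) (\<kappa> n)) has_sum s) UNIV" for x s
    using that by (rule has_sum_imp_suminf)
  have "is_state H (carrier (bop H)) (\<lambda>x. \<Sum>n. hinner H (x (\<kappa> n)) (\<kappa> n))"
    unfolding is_state_def
  proof (intro conjI ballI allI)
    show "(\<Sum>n. hinner H ((x \<oplus>\<^bsub>bop H\<^esub> y) (\<kappa> n)) (\<kappa> n))
      = (\<Sum>n. hinner H (x (\<kappa> n)) (\<kappa> n)) + (\<Sum>n. hinner H (y (\<kappa> n)) (\<kappa> n))"
      if "x \<in> carrier (bop H)" "y \<in> carrier (bop H)" for x y
      using has_sum_add[OF hs[OF that(1)] hs[OF that(2)]] that by (intro eqI) simp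
    show "(\<Sum>n. hinner H ((c \<odot>\<^bsub>bop H\<^esub> x) (\<kappa> n)) (\<kappa> n)) = c * (\<Sum>n. hinner H (x (\<kappa> n)) (\<kappa> n))"
      if "x \<in> carrier (bop H)" for c x
      using has_sum_cmult_right[OF hs[OF that], of c] that by (intro eqI) simp
    show "(\<Sum>n. hinner H ((adj H x \<otimes>\<^bsub>bop H\<^esub> x) (\<kappa> n)) (\<kappa> n)) \<in> \<real>\<^sub>\<ge>\<^sub>0" if x: "x \<in> carrier (bop H)" for x
    proof -
      have "((\<lambda>n. complex_of_real ((hnorm H (x (\<kappa> n)))\<^sup>2)) has_sum
          (\<Sum>n. hinner H ((adj H x \<otimes>\<^bsub>bop H\<^esub> x) (\<kappa> n)) (\<kappa> n))) UNIV" (is "(_ has_sum ?s) _")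
        using hs[of "adj H x \<otimes>\<^bsub>bop H\<^esub> x"] x by (simp add: hinner_adj hinner_self)
      moreover obtain r where r: "((\<lambda>n. (hnorm H (x (\<kappa> n)))\<^sup>2) has_sum r) UNIV"
        using square_summable_image[OF H H adj_pair(1)[OF H x] \<kappa>] by (auto simp: square_summable_iff summable_on_def)
      then have "((\<lambda>n. complex_of_real ((hnorm H (x (\<kappa> n)))\<^sup>2)) has_sum complex_of_real r) UNIV"
        by (rule has_sum_of_real)
      ultimately have "?s = complex_of_real r" by (rule has_sum_unique)
      moreover have "r \<ge> 0" by (rule has_sum_nonneg[OF r]) simp
      ultimately show ?thesis by simp
    qed
    show "(\<Sum>n. hinner H (\<one>\<^bsub>bop H\<^esub> (\<kappa> n)) (\<kappa> n)) = 1"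
      using has_sum_of_real[OF one, where 'a = complex] by (intro eqI) (simp add: hinner_self)
  qed
  then show ?thesis
    unfolding normal_state_def using uw_continuous[OF H \<kappa> \<kappa>]
    by (auto intro: continuous_map_from_subtopology)
qed

lemma normal_vector_state:
  assumes H: "hilbert_space H" and \<xi>: "\<xi> \<in> carrier H" "hnorm H \<xi> = 1"
  shows "normal_state H (carrier (bop H)) (vector_functional H \<xi>)"
proof -
  define \<kappa> where "\<kappa> n = (if n = 0 then \<xi> else \<zero>\<^bsub>H\<^esub>)" for n :: nat
  have h: "((\<lambda>n. (hnorm H (\<kappa> n))\<^sup>2) has_sum 1) UNIV"
    using H \<xi> by (intro has_sum_finite_neutralI[of "{0}"]) (auto simp: \<kappa>_def)
  then have s: "square_summable H \<kappa>"
    using H \<xi> by (auto simp: square_summable_iff \<kappa>_def summable_on_def)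
  have eq: "(\<Sum>n. hinner H (x (\<kappa> n)) (\<kappa> n)) = vector_functional H \<xi> x" if "x \<in> carrier (bop H)" for x
    using that H \<xi> by (subst suminf_finite[of "{0}"]) (auto simp: \<kappa>_def vector_functional_def)
  have "normal_state H (carrier (bop H)) (\<lambda>x. \<Sum>n. hinner H (x (\<kappa> n)) (\<kappa> n))"
    by (rule normal_state_of_sequence[OF H s h])
  then have st: "is_state H (carrier (bop H)) (\<lambda>x. \<Sum>n. hinner H (x (\<kappa> n)) (\<kappa> n))"
    and ct: "continuous_map (subtopology (ultraweak_topology H) (carrier (bop H))) euclidean (\<lambda>x. \<Sum>n. hinner H (x (\<kappa> n)) (\<kappa> n))"
    by (auto simp: normal_state_def)
  have "is_state H (carrier (bop H)) (vector_functional H \<xi>)"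
    using st H by (simp add: is_state_def eq)
  moreover have "continuous_map (subtopology (ultraweak_topology H) (carrier (bop H))) euclidean (vector_functional H \<xi>)"
    using ct by (rule continuous_map_eq) (simp add: eq)
  ultimately show ?thesis by (simp add: normal_state_def)
qed


section \<open>Countable multiples of a Hilbert space\<close>

text \<open>
  The Hilbert sum of countably many copies of \<open>H\<close>, realized in the left summand of the universe so
  that it is available there for every right summand.
\<close>

definition ell2 :: "'h hilbert \<Rightarrow> ('h, 'u) universe hilbert" where
  "ell2 H =
     \<lparr>carrier = Inl ` Collect (square_summable H),
      mult = undefined,
      one = undefined,
      zero = Inl (\<lambda>n. \<zero>\<^bsub>H\<^esub>),
      add = (\<lambda>a b. Inl (\<lambda>n. projl a n \<oplus>\<^bsub>H\<^esub> projl b n)),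
      smult = (\<lambda>c a. Inl (\<lambda>n. c \<odot>\<^bsub>H\<^esub> projl a n)),
      hinner = (\<lambda>a b. \<Sum>n. hinner H (projl a n) (projl b n))\<rparr>"

lemma ell2_simps [simp]:
  "Inl f \<in> carrier (ell2 H) \<longleftrightarrow> square_summable H f"
  "\<zero>\<^bsub>ell2 H\<^esub> = Inl (\<lambda>n. \<zero>\<^bsub>H\<^esub>)"
  "Inl f \<oplus>\<^bsub>ell2 H\<^esub> Inl g = Inl (\<lambda>n. f n \<oplus>\<^bsub>H\<^esub> g n)"
  "c \<odot>\<^bsub>ell2 H\<^esub> Inl f = Inl (\<lambda>n. c \<odot>\<^bsub>H\<^esub> f n)"
  by (auto simp: ell2_def)

lemma ell2_cases:
  assumes "a \<in> carrier (ell2 H)"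
  obtains f where "a = Inl f" "square_summable H f"
  using assms by (auto simp: ell2_def)

lemma square_summable_zero [simp]: "hilbert_space H \<Longrightarrow> square_summable H (\<lambda>n. \<zero>\<^bsub>H\<^esub>)"
  by (simp add: square_summable_iff)

lemma square_summable_smult [simp]:
  "hilbert_space H \<Longrightarrow> square_summable H f \<Longrightarrow> square_summable H (\<lambda>n. c \<odot>\<^bsub>H\<^esub> f n)"
  by (auto simp: square_summable_iff hnorm_smult power_mult_distrib intro!: summable_on_cmult_right)

lemma hnorm_add_power2_le:
  assumes "hilbert_space H" "\<xi> \<in> carrier H" "\<eta> \<in> carrier H"
  shows "(hnorm H (\<xi> \<oplus>\<^bsub>H\<^esub> \<eta>))\<^sup>2 \<le> 2 * (hnorm H \<xi>)\<^sup>2 + 2 * (hnorm H \<eta>)\<^sup>2"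
  using hparallelogram[OF assms] zero_le_power2[of "hnorm H (\<xi> \<ominus>\<^bsub>H\<^esub> \<eta>)"] by linarith

lemma square_summable_add [simp]:
  assumes H: "hilbert_space H" and f: "square_summable H f" and g: "square_summable H g"
  shows "square_summable H (\<lambda>n. f n \<oplus>\<^bsub>H\<^esub> g n)"
proof -
  have "(\<lambda>n. (hnorm H (f n \<oplus>\<^bsub>H\<^esub> g n))\<^sup>2) summable_on UNIV"
  proof (rule summable_on_comparison_test)
    show "(\<lambda>n. 2 * (hnorm H (f n))\<^sup>2 + 2 * (hnorm H (g n))\<^sup>2) summable_on UNIV"
      using f g by (intro summable_on_add summable_on_cmult_right) (auto simp: square_summable_iff)
  qed (use H f g in \<open>auto intro: hnorm_add_power2_le\<close>)
  then show ?thesis using H f g by (simp add: square_summable_iff)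
qed

lemma square_summable_minus [simp]:
  "hilbert_space H \<Longrightarrow> square_summable H f \<Longrightarrow> square_summable H g \<Longrightarrow> square_summable H (\<lambda>n. f n \<ominus>\<^bsub>H\<^esub> g n)"
  by (simp add: hminus_conv)

lemma ell2_hinner:
  assumes "hilbert_space H" "square_summable H f" "square_summable H g"
  shows "((\<lambda>n. hinner H (f n) (g n)) has_sum hinner (ell2 H) (Inl f) (Inl g)) UNIV"
  using uw_has_sum[OF assms(1) bop_closed(1)[OF assms(1)] assms(2,3)] assms by (simp add: ell2_def)

lemma ell2_hinner_eqI:
  assumes "hilbert_space H" "square_summable H f" "square_summable H g"
    and "((\<lambda>n. hinner H (f n) (g n)) has_sum s) UNIV"
  shows "hinner (ell2 H) (Inl f) (Inl g) = s"
  using ell2_hinner[OF assms(1-3)] assms(4) by (rule has_sum_unique)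

lemma ell2_hnorm_has_sum:
  assumes H: "hilbert_space H" and f: "square_summable H f"
  shows "((\<lambda>n. (hnorm H (f n))\<^sup>2) has_sum (hnorm (ell2 H) (Inl f))\<^sup>2) UNIV"
    (is "(_ has_sum (hnorm ?L _)\<^sup>2) _")
proof -
  obtain s where s: "((\<lambda>n. (hnorm H (f n))\<^sup>2) has_sum s) UNIV"
    using f by (auto simp: square_summable_iff summable_on_def)
  have "hinner ?L (Inl f) (Inl f) = complex_of_real s"
    using has_sum_of_real[OF s, where 'a = complex] H f by (intro ell2_hinner_eqI) (auto simp: hinner_self)
  moreover have "s \<ge> 0" by (rule has_sum_nonneg[OF s]) simp
  ultimately have "(hnorm ?L (Inl f))\<^sup>2 = s" by (simp add: hnorm_def)
  then show ?thesis using s by simp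
qed

lemma ell2_hnorm_nonneg:
  assumes H: "hilbert_space H" and f: "square_summable H f"
  shows "0 \<le> hnorm (ell2 H) (Inl f)" (is "_ \<le> hnorm ?L _")
proof -
  obtain s where s: "((\<lambda>n. (hnorm H (f n))\<^sup>2) has_sum s) UNIV"
    using f by (auto simp: square_summable_iff summable_on_def)
  have "hinner ?L (Inl f) (Inl f) = complex_of_real s"
    using has_sum_of_real[OF s, where 'a = complex] H f by (intro ell2_hinner_eqI) (auto simp: hinner_self)
  moreover have "s \<ge> 0" by (rule has_sum_nonneg[OF s]) simp
  ultimately show ?thesis by (simp add: hnorm_def)
qed

lemma ell2_hinner_self:
  fixes H :: "'h hilbert"
  defines "L \<equiv> ell2 H :: ('h, 'u) universe hilbert"
  assumes H: "hilbert_space H" and f: "square_summable H f"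
  shows "hinner L (Inl f) (Inl f) = complex_of_real ((hnorm L (Inl f))\<^sup>2)"
  unfolding L_def
  using has_sum_of_real[OF ell2_hnorm_has_sum[OF H f], where 'a = complex] H f
  by (intro ell2_hinner_eqI) (auto simp: hinner_self)

text \<open>  A Cauchy sequence converges in every component; the estimates for its differences carry over to
  the componentwise limit through finite partial sums.\<close>

lemma hilbert_ell2 [simp]:
  assumes H: "hilbert_space H"
  shows "hilbert_space (ell2 H :: ('h, 'u) universe hilbert)"
proof (rule hilbert_spaceI)
  let ?L = "ell2 H :: ('h, 'u) universe hilbert"
  note [simp] = H
  note hs = ell2_hinner[OF H]
  show "\<zero>\<^bsub>?L\<^esub> \<in> carrier ?L" by simp
  show "a \<oplus>\<^bsub>?L\<^esub> b \<in> carrier ?L" if "a \<in> carrier ?L" "b \<in> carrier ?L" for a b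
    using that by (auto elim!: ell2_cases)
  show "c \<odot>\<^bsub>?L\<^esub> a \<in> carrier ?L" if "a \<in> carrier ?L" for c a
    using that by (auto elim!: ell2_cases)
  show "hinner ?L \<zero>\<^bsub>?L\<^esub> a = 0" if "a \<in> carrier ?L" for a
    using that by (auto elim!: ell2_cases intro!: ell2_hinner_eqI)
  show "hinner ?L (a \<oplus>\<^bsub>?L\<^esub> b) d = hinner ?L a d + hinner ?L b d"
    if abd: "a \<in> carrier ?L" "b \<in> carrier ?L" "d \<in> carrier ?L" for a b d
  proof -
    obtain f g h where f: "a = Inl f" "b = Inl g" "d = Inl h" "square_summable H f" "square_summable H g" "square_summable H h"
      using abd by (auto elim!: ell2_cases)
    show ?thesis
      using has_sum_add[OF hs[OF f(4,6)] hs[OF f(5,6)]] f by (auto intro!: ell2_hinner_eqI)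
  qed
  show "hinner ?L (c \<odot>\<^bsub>?L\<^esub> a) b = c * hinner ?L a b"
    if ab: "a \<in> carrier ?L" "b \<in> carrier ?L" for c a b
  proof -
    obtain f g where f: "a = Inl f" "b = Inl g" "square_summable H f" "square_summable H g"
      using ab by (auto elim!: ell2_cases)
    show ?thesis
      using has_sum_cmult_right[OF hs[OF f(3,4)], of c] f by (auto intro!: ell2_hinner_eqI)
  qed
  show "hinner ?L b a = cnj (hinner ?L a b)"
    if ab: "a \<in> carrier ?L" "b \<in> carrier ?L" for a b
  proof -
    obtain f g where f: "a = Inl f" "b = Inl g" "square_summable H f" "square_summable H g"
      using ab by (auto elim!: ell2_cases)
    have "((\<lambda>n. cnj (hinner H (f n) (g n))) has_sum cnj (hinner ?L a b)) UNIV"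
      unfolding f(1,2) by (subst has_sum_cnj_iff) (rule hs[OF f(3,4)])
    then show ?thesis using f by (auto intro!: ell2_hinner_eqI simp: hinner_cnj)
  qed
  show "hinner ?L a a \<in> \<real>\<^sub>\<ge>\<^sub>0" if "a \<in> carrier ?L" for a
    using that
    by (elim ell2_cases) (simp only: ell2_hinner_self H nonneg_Reals_of_real_iff zero_le_power2)
  show "a = b" if ab: "a \<in> carrier ?L" "b \<in> carrier ?L"
    and z: "hinner ?L a a - hinner ?L a b - hinner ?L b a + hinner ?L b b = 0" for a b
  proof -
    obtain f g where f: "a = Inl f" "b = Inl g" "square_summable H f" "square_summable H g"
      using ab by (auto elim!: ell2_cases)
    have "((\<lambda>n. hinner H (f n) (f n) + (-1) * hinner H (f n) (g n) + (-1) * hinner H (g n) (f n) + hinner H (g n) (g n))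
      has_sum (hinner ?L a a + (-1) * hinner ?L a b + (-1) * hinner ?L b a + hinner ?L b b)) UNIV"
      unfolding f(1,2) using f by (intro has_sum_add has_sum_cmult_right hs)
    moreover have "hinner H (f n) (f n) + (-1) * hinner H (f n) (g n) + (-1) * hinner H (g n) (f n) + hinner H (g n) (g n)
      = complex_of_real ((hnorm H (f n \<ominus>\<^bsub>H\<^esub> g n))\<^sup>2)" for n
      using f by (simp add: hinner_self[symmetric] algebra_simps del: of_real_power)
    moreover have "hinner ?L a a + (-1) * hinner ?L a b + (-1) * hinner ?L b a + hinner ?L b b = complex_of_real 0"
      using z by simp
    ultimately have "((\<lambda>n. complex_of_real ((hnorm H (f n \<ominus>\<^bsub>H\<^esub> g n))\<^sup>2)) has_sum complex_of_real 0) UNIV"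
      by simp
    then have 0: "((\<lambda>n. (hnorm H (f n \<ominus>\<^bsub>H\<^esub> g n))\<^sup>2) has_sum 0) UNIV"
      by (subst (asm) has_sum_of_real_iff)
    have "(hnorm H (f n \<ominus>\<^bsub>H\<^esub> g n))\<^sup>2 = 0" for n
      by (rule nonneg_has_sum_le_0D[OF 0]) auto
    then have "f n = g n" for n using f by (simp add: hdiff_eq_zero_iff)
    then show ?thesis using f by auto
  qed
  show "\<exists>l\<in>carrier ?L. (\<lambda>k. hnorm ?L (s k \<oplus>\<^bsub>?L\<^esub> (-1) \<odot>\<^bsub>?L\<^esub> l)) \<longlonglongrightarrow> 0"
    if sc: "\<And>k. s k \<in> carrier ?L"
      and cauchy: "\<And>\<epsilon>. \<epsilon> > 0 \<Longrightarrow> \<exists>N. \<forall>k\<ge>N. \<forall>j\<ge>N. hnorm ?L (s k \<oplus>\<^bsub>?L\<^esub> (-1) \<odot>\<^bsub>?L\<^esub> s j) < \<epsilon>" for s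
  proof -
    have "\<forall>k. \<exists>f. s k = Inl f \<and> square_summable H f" using sc by (metis ell2_cases)
    then obtain F where F: "\<And>k. s k = Inl (F k)" "\<And>k. square_summable H (F k)" by metis
    have diff: "s k \<oplus>\<^bsub>?L\<^esub> (-1) \<odot>\<^bsub>?L\<^esub> Inl g = Inl (\<lambda>n. F k n \<ominus>\<^bsub>H\<^esub> g n)" if "\<And>n. g n \<in> carrier H" for k g
      using that F by (simp add: hminus_conv)
    have fin: "(\<Sum>n\<in>A. (hnorm H (F k n \<ominus>\<^bsub>H\<^esub> F j n))\<^sup>2) \<le> (hnorm ?L (s k \<oplus>\<^bsub>?L\<^esub> (-1) \<odot>\<^bsub>?L\<^esub> s j))\<^sup>2"
      if "finite A" for A k j
      unfolding F(1)[of j] diff[of "F j" k, OF square_summable_vec[OF F(2)]]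
      using that F by (intro finite_sum_le_has_sum[OF ell2_hnorm_has_sum[OF H]]) auto
    have "\<exists>l\<in>carrier H. (\<lambda>k. hnorm H (F k n \<ominus>\<^bsub>H\<^esub> l)) \<longlonglongrightarrow> 0" for n
    proof -
      obtain l where "l \<in> carrier H" "(\<lambda>k. hnorm H (F k n \<ominus>\<^bsub>H\<^esub> l)) \<longlonglongrightarrow> 0"
      proof (rule hilbert_complete[OF H, of "\<lambda>k. F k n"])
        fix \<epsilon> :: real assume "\<epsilon> > 0"
        then obtain N where N: "\<And>k j. k \<ge> N \<Longrightarrow> j \<ge> N \<Longrightarrow> hnorm ?L (s k \<oplus>\<^bsub>?L\<^esub> (-1) \<odot>\<^bsub>?L\<^esub> s j) < \<epsilon>"
          using cauchy by blast
        have "hnorm H (F k n \<ominus>\<^bsub>H\<^esub> F j n) < \<epsilon>" if "k \<ge> N" "j \<ge> N" for k j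
        proof -
          have "(hnorm H (F k n \<ominus>\<^bsub>H\<^esub> F j n))\<^sup>2 \<le> (hnorm ?L (s k \<oplus>\<^bsub>?L\<^esub> (-1) \<odot>\<^bsub>?L\<^esub> s j))\<^sup>2"
            using fin[of "{n}" k j] by simp
          moreover have "0 \<le> hnorm ?L (s k \<oplus>\<^bsub>?L\<^esub> (-1) \<odot>\<^bsub>?L\<^esub> s j)"
            unfolding F(1)[of j] diff[of "F j" k, OF square_summable_vec[OF F(2)]]
            using F by (intro ell2_hnorm_nonneg) auto
          ultimately show ?thesis using N[OF that] by (meson le_less_trans power2_le_imp_le)
        qed
        then show "\<exists>N. \<forall>k\<ge>N. \<forall>j\<ge>N. hnorm H (F k n \<ominus>\<^bsub>H\<^esub> F j n) < \<epsilon>" by blast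
      qed (use F in auto)
      then show ?thesis by blast
    qed
    then obtain G where G: "\<And>n. G n \<in> carrier H" "\<And>n. (\<lambda>k. hnorm H (F k n \<ominus>\<^bsub>H\<^esub> G n)) \<longlonglongrightarrow> 0"
      by metis
    have est: "\<exists>N. \<forall>k\<ge>N. square_summable H (\<lambda>n. F k n \<ominus>\<^bsub>H\<^esub> G n) \<and>
        hnorm ?L (s k \<oplus>\<^bsub>?L\<^esub> (-1) \<odot>\<^bsub>?L\<^esub> Inl G) \<le> \<epsilon>" if e: "\<epsilon> > 0" for \<epsilon>
    proof -
      obtain N where N: "\<And>k j. k \<ge> N \<Longrightarrow> j \<ge> N \<Longrightarrow> hnorm ?L (s k \<oplus>\<^bsub>?L\<^esub> (-1) \<odot>\<^bsub>?L\<^esub> s j) < \<epsilon>"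
        using cauchy[OF e] by blast
      have "square_summable H (\<lambda>n. F k n \<ominus>\<^bsub>H\<^esub> G n) \<and> hnorm ?L (s k \<oplus>\<^bsub>?L\<^esub> (-1) \<odot>\<^bsub>?L\<^esub> Inl G) \<le> \<epsilon>" if k: "k \<ge> N" for k
      proof -
        have b: "(\<Sum>n\<in>A. (hnorm H (F k n \<ominus>\<^bsub>H\<^esub> G n))\<^sup>2) \<le> \<epsilon>\<^sup>2" if A: "finite A" for A
        proof (rule LIMSEQ_le_const2)
          have "(\<lambda>j. hnorm H (F k n \<ominus>\<^bsub>H\<^esub> F j n)) \<longlonglongrightarrow> hnorm H (F k n \<ominus>\<^bsub>H\<^esub> G n)" for n
          proof -
            have "(\<lambda>j. hnorm H (F k n \<ominus>\<^bsub>H\<^esub> F j n) - hnorm H (F k n \<ominus>\<^bsub>H\<^esub> G n)) \<longlonglongrightarrow> 0"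
            proof (rule Lim_null_comparison[OF _ G(2)[of n]], rule always_eventually, rule allI)
              fix j
              have "hnorm H (F k n \<ominus>\<^bsub>H\<^esub> F j n) \<le> hnorm H (F k n \<ominus>\<^bsub>H\<^esub> G n) + hnorm H (G n \<ominus>\<^bsub>H\<^esub> F j n)"
                "hnorm H (F k n \<ominus>\<^bsub>H\<^esub> G n) \<le> hnorm H (F k n \<ominus>\<^bsub>H\<^esub> F j n) + hnorm H (F j n \<ominus>\<^bsub>H\<^esub> G n)"
                using F G by (auto intro: hnorm_triangle_minus)
              then show "norm (hnorm H (F k n \<ominus>\<^bsub>H\<^esub> F j n) - hnorm H (F k n \<ominus>\<^bsub>H\<^esub> G n)) \<le> hnorm H (F j n \<ominus>\<^bsub>H\<^esub> G n)"
                using hnorm_minus_commute[OF H, of "G n" "F j n"] F G by auto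
            qed
            then show ?thesis by (simp add: LIM_zero_cancel)
          qed
          then show "(\<lambda>j. \<Sum>n\<in>A. (hnorm H (F k n \<ominus>\<^bsub>H\<^esub> F j n))\<^sup>2) \<longlonglongrightarrow> (\<Sum>n\<in>A. (hnorm H (F k n \<ominus>\<^bsub>H\<^esub> G n))\<^sup>2)"
            by (intro tendsto_intros)
          show "\<exists>M. \<forall>j\<ge>M. (\<Sum>n\<in>A. (hnorm H (F k n \<ominus>\<^bsub>H\<^esub> F j n))\<^sup>2) \<le> \<epsilon>\<^sup>2"
          proof (intro exI[of _ N] allI impI)
            fix j assume j: "j \<ge> N"
            have "0 \<le> hnorm ?L (s k \<oplus>\<^bsub>?L\<^esub> (-1) \<odot>\<^bsub>?L\<^esub> s j)"
              unfolding F(1)[of j] diff[of "F j" k, OF square_summable_vec[OF F(2)]]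
              using F by (intro ell2_hnorm_nonneg) auto
            then have "(hnorm ?L (s k \<oplus>\<^bsub>?L\<^esub> (-1) \<odot>\<^bsub>?L\<^esub> s j))\<^sup>2 \<le> \<epsilon>\<^sup>2"
              using N[OF k j] by (intro power_mono) auto
            then show "(\<Sum>n\<in>A. (hnorm H (F k n \<ominus>\<^bsub>H\<^esub> F j n))\<^sup>2) \<le> \<epsilon>\<^sup>2"
              using fin[OF A, of k j] by linarith
          qed
        qed
        have "(\<lambda>n. (hnorm H (F k n \<ominus>\<^bsub>H\<^esub> G n))\<^sup>2) summable_on UNIV"
          using b by (intro nonneg_bdd_above_summable_on) (auto intro!: bdd_aboveI2)
        then have ss: "square_summable H (\<lambda>n. F k n \<ominus>\<^bsub>H\<^esub> G n)"
          using F G by (simp add: square_summable_iff)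
        have "(hnorm ?L (Inl (\<lambda>n. F k n \<ominus>\<^bsub>H\<^esub> G n)))\<^sup>2 \<le> \<epsilon>\<^sup>2"
          using b by (intro has_sum_le_finite_sums[OF ell2_hnorm_has_sum[OF H ss]]) auto
        then have "hnorm ?L (Inl (\<lambda>n. F k n \<ominus>\<^bsub>H\<^esub> G n)) \<le> \<epsilon>"
          by (rule power2_le_imp_le) (use e in auto)
        then show ?thesis using ss diff[of G k, OF G(1)] by simp
      qed
      then show ?thesis by blast
    qed
    have "square_summable H G"
    proof -
      obtain k where k: "square_summable H (\<lambda>n. F k n \<ominus>\<^bsub>H\<^esub> G n)" using est[of 1] by auto
      have "(\<lambda>n. F k n \<ominus>\<^bsub>H\<^esub> (F k n \<ominus>\<^bsub>H\<^esub> G n)) = G"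
        using F G by (auto simp: fun_eq_iff intro!: hvec_eqI[OF H])
      then show ?thesis using square_summable_minus[OF H F(2)[of k] k] by simp
    qed
    moreover have "(\<lambda>k. hnorm ?L (s k \<oplus>\<^bsub>?L\<^esub> (-1) \<odot>\<^bsub>?L\<^esub> Inl G)) \<longlonglongrightarrow> 0"
      unfolding lim_sequentially
    proof (intro allI impI)
      fix r :: real assume r: "r > 0"
      then obtain N where N: "\<And>k. k \<ge> N \<Longrightarrow> hnorm ?L (s k \<oplus>\<^bsub>?L\<^esub> (-1) \<odot>\<^bsub>?L\<^esub> Inl G) \<le> r / 2"
        "\<And>k. k \<ge> N \<Longrightarrow> square_summable H (\<lambda>n. F k n \<ominus>\<^bsub>H\<^esub> G n)"
        using est[of "r / 2"] by auto
      have "dist (hnorm ?L (s k \<oplus>\<^bsub>?L\<^esub> (-1) \<odot>\<^bsub>?L\<^esub> Inl G)) 0 < r" if k: "k \<ge> N" for k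
      proof -
        have "0 \<le> hnorm ?L (s k \<oplus>\<^bsub>?L\<^esub> (-1) \<odot>\<^bsub>?L\<^esub> Inl G)"
          unfolding diff[of G k, OF G(1)]
          by (rule ell2_hnorm_nonneg[OF H N(2)[OF k]])
        then show ?thesis using N(1)[OF k] r by simp
      qed
      then show "\<exists>N. \<forall>k\<ge>N. dist (hnorm ?L (s k \<oplus>\<^bsub>?L\<^esub> (-1) \<odot>\<^bsub>?L\<^esub> Inl G)) 0 < r" by blast
    qed
    ultimately show ?thesis by (intro bexI[of _ "Inl G"]) auto
  qed
qed

text \<open>The operator \<open>x \<otimes> 1\<close> on the countable multiple.\<close>

definition ampl :: "'h hilbert \<Rightarrow> ('h \<Rightarrow> 'h) \<Rightarrow> ('h, 'u) universe \<Rightarrow> ('h, 'u) universe" where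
  "ampl H x = (\<lambda>a\<in>carrier (ell2 H). Inl (\<lambda>n. x (projl a n)))"

lemma ampl_Inl [simp]: "square_summable H f \<Longrightarrow> ampl H x (Inl f) = Inl (\<lambda>n. x (f n))"
  by (simp add: ampl_def)

lemma square_summable_bop [simp]:
  "hilbert_space H \<Longrightarrow> x \<in> carrier (bop H) \<Longrightarrow> square_summable H f \<Longrightarrow> square_summable H (\<lambda>n. x (f n))"
  by (rule square_summable_image[OF _ _ adj_pair(1)])

lemma ampl_pair:
  assumes H: "hilbert_space H" and x: "x \<in> carrier (bop H)"
  shows "adjoint_pair (ell2 H) (ell2 H) (ampl H x) (ampl H (adj H x))"
    (is "adjoint_pair ?L _ _ _")
proof -
  obtain C where C: "C \<ge> 0" "\<forall>\<xi>\<in>carrier H. hnorm H (x \<xi>) \<le> C * hnorm H \<xi>"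
    using bop_bound[OF H x] by blast
  have "hnorm ?L (ampl H x a) \<le> C * hnorm ?L a" if a: "a \<in> carrier ?L" for a
  proof -
    obtain f where f: "a = Inl f" "square_summable H f" using a by (rule ell2_cases)
    have "(hnorm ?L (Inl (\<lambda>n. x (f n))))\<^sup>2 \<le> C\<^sup>2 * (hnorm ?L (Inl f))\<^sup>2"
    proof (rule has_sum_mono)
      show "((\<lambda>n. (hnorm H (x (f n)))\<^sup>2) has_sum (hnorm ?L (Inl (\<lambda>n. x (f n))))\<^sup>2) UNIV"
        using H x f by (intro ell2_hnorm_has_sum) auto
      show "((\<lambda>n. C\<^sup>2 * (hnorm H (f n))\<^sup>2) has_sum C\<^sup>2 * (hnorm ?L (Inl f))\<^sup>2) UNIV"
        using H f by (intro has_sum_cmult_right ell2_hnorm_has_sum)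
      show "(hnorm H (x (f n)))\<^sup>2 \<le> C\<^sup>2 * (hnorm H (f n))\<^sup>2" for n
        using power_mono[of "hnorm H (x (f n))" "C * hnorm H (f n)" 2] C H x f by (simp add: power_mult_distrib)
    qed
    then have "(hnorm ?L (Inl (\<lambda>n. x (f n))))\<^sup>2 \<le> (C * hnorm ?L (Inl f))\<^sup>2"
      by (simp add: power_mult_distrib)
    then have "hnorm ?L (Inl (\<lambda>n. x (f n))) \<le> C * hnorm ?L (Inl f)"
      by (rule power2_le_imp_le) (use C H f in auto)
    then show ?thesis using f by simp
  qed
  moreover have "hinner ?L (ampl H x a) b = hinner ?L a (ampl H (adj H x) b)"
    if ab: "a \<in> carrier ?L" "b \<in> carrier ?L" for a b
  proof -
    obtain f g where f: "a = Inl f" "b = Inl g" "square_summable H f" "square_summable H g"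
      using ab by (auto elim!: ell2_cases)
    have "((\<lambda>n. hinner H (x (f n)) (g n)) has_sum hinner ?L (Inl f) (Inl (\<lambda>n. adj H x (g n)))) UNIV"
      using ell2_hinner[OF H f(3), of "\<lambda>n. adj H x (g n)"] f H x
      by (simp add: adjoint_pair_left[OF adj_pair(1)[OF H x]])
    then show ?thesis using f H x by (auto intro!: ell2_hinner_eqI)
  qed
  ultimately show ?thesis
    using H x unfolding adjoint_pair_def by (intro conjI exI[of _ C]) (auto elim!: ell2_cases)
qed

lemma ampl_bop: "hilbert_space H \<Longrightarrow> x \<in> carrier (bop H) \<Longrightarrow> ampl H x \<in> carrier (bop (ell2 H))"
  using restrict_bop[OF hilbert_ell2 ampl_pair] by (simp add: ampl_def)

lemma component_pair:
  assumes H: "hilbert_space H"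
  shows "adjoint_pair (ell2 H) H (\<lambda>a. projl a n) (\<lambda>\<xi>. Inl (\<lambda>m. if m = n then \<xi> else \<zero>\<^bsub>H\<^esub>))"
    (is "adjoint_pair ?L _ _ _")
proof -
  have sing: "square_summable H (\<lambda>m. if m = n then \<xi> else \<zero>\<^bsub>H\<^esub>)" if "\<xi> \<in> carrier H" for \<xi>
  proof -
    have "((\<lambda>m. (hnorm H (if m = n then \<xi> else \<zero>\<^bsub>H\<^esub>))\<^sup>2) has_sum (hnorm H \<xi>)\<^sup>2) UNIV"
      using H that by (intro has_sum_finite_neutralI[of "{n}"]) auto
    then show ?thesis using H that by (auto simp: square_summable_iff summable_on_def)
  qed
  have "hinner H (projl a n) \<xi> = hinner ?L a (Inl (\<lambda>m. if m = n then \<xi> else \<zero>\<^bsub>H\<^esub>))"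
    if a: "a \<in> carrier ?L" and \<xi>: "\<xi> \<in> carrier H" for a \<xi>
  proof -
    obtain f where f: "a = Inl f" "square_summable H f" using a by (rule ell2_cases)
    have h: "((\<lambda>m. hinner H (f m) (if m = n then \<xi> else \<zero>\<^bsub>H\<^esub>)) has_sum hinner H (f n) \<xi>) UNIV"
      using H f \<xi> by (intro has_sum_finite_neutralI[of "{n}"]) auto
    show ?thesis
      unfolding f(1) sum.sel by (rule ell2_hinner_eqI[OF H f(2) sing[OF \<xi>] h, symmetric])
  qed
  moreover have "hnorm H (projl a n) \<le> 1 * hnorm ?L a" if a: "a \<in> carrier ?L" for a
  proof -
    obtain f where f: "a = Inl f" "square_summable H f" using a by (rule ell2_cases)
    have "(hnorm H (f n))\<^sup>2 \<le> (hnorm ?L (Inl f))\<^sup>2"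
      using finite_sum_le_has_sum[OF ell2_hnorm_has_sum[OF H f(2)], of "{n}"] by simp
    then have "hnorm H (f n) \<le> hnorm ?L (Inl f)"
      by (rule power2_le_imp_le) (use H f in auto)
    then show ?thesis using f by simp
  qed
  ultimately show ?thesis
    using sing H unfolding adjoint_pair_def by (intro conjI exI[of _ 1]) (auto elim!: ell2_cases)
qed

text \<open>
  A square-summable family over an arbitrary index set has countable support, so it can be replaced
  by a sequence without changing any sum of a function of its members.
\<close>

lemma square_summable_family_enum:
  assumes H: "hilbert_space H" and \<kappa>: "\<And>i. i \<in> I \<Longrightarrow> \<kappa> i \<in> carrier H"
    and s: "(\<lambda>i. (hnorm H (\<kappa> i))\<^sup>2) summable_on I"
  shows "\<exists>\<zeta>. square_summable H \<zeta> \<and>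
    (\<forall>f :: 'h \<Rightarrow> complex. f \<zero>\<^bsub>H\<^esub> = 0 \<longrightarrow> (\<forall>t. ((\<lambda>i. f (\<kappa> i)) has_sum t) I \<longleftrightarrow> ((\<lambda>n. f (\<zeta> n)) has_sum t) UNIV))"
proof -
  define A where "A = {i \<in> I. \<kappa> i \<noteq> \<zero>\<^bsub>H\<^esub>}"
  have "A = {i \<in> I. (hnorm H (\<kappa> i))\<^sup>2 \<noteq> 0}"
    using H \<kappa> by (auto simp: A_def hnorm_eq_0_iff)
  then have count: "countable A" using summable_countable_real[OF s] by simp
  have bij: "bij_betw (to_nat_on A) A (to_nat_on A ` A)"
    using inj_on_to_nat_on[OF count] by (simp add: bij_betw_def)
  define \<zeta> where "\<zeta> n = (if n \<in> to_nat_on A ` A then \<kappa> (from_nat_into A n) else \<zero>\<^bsub>H\<^esub>)" for n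
  have eq: "\<zeta> (to_nat_on A i) = \<kappa> i" if "i \<in> A" for i
    using that count by (simp add: \<zeta>_def)
  have key: "((\<lambda>i. f (\<kappa> i)) has_sum t) I \<longleftrightarrow> ((\<lambda>n. f (\<zeta> n)) has_sum t) UNIV"
    if "f \<zero>\<^bsub>H\<^esub> = 0" for f :: "'h \<Rightarrow> complex" and t
  proof -
    have "((\<lambda>i. f (\<kappa> i)) has_sum t) I \<longleftrightarrow> ((\<lambda>i. f (\<kappa> i)) has_sum t) A"
      using that by (intro has_sum_cong_neutral) (auto simp: A_def)
    also have "\<dots> \<longleftrightarrow> ((\<lambda>i. f (\<zeta> (to_nat_on A i))) has_sum t) A"
      by (intro has_sum_cong) (simp add: eq)
    also have "\<dots> \<longleftrightarrow> ((\<lambda>n. f (\<zeta> n)) has_sum t) (to_nat_on A ` A)"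
      by (rule has_sum_reindex_bij_betw[OF bij])
    also have "\<dots> \<longleftrightarrow> ((\<lambda>n. f (\<zeta> n)) has_sum t) UNIV"
      using that by (intro has_sum_cong_neutral) (auto simp: \<zeta>_def)
    finally show ?thesis .
  qed
  have "\<zeta> n \<in> carrier H" for n
    using H \<kappa> count by (auto simp: \<zeta>_def A_def)
  moreover obtain r where "((\<lambda>i. (hnorm H (\<kappa> i))\<^sup>2) has_sum r) I" using s by (auto simp: summable_on_def)
  then have "((\<lambda>i. complex_of_real ((hnorm H (\<kappa> i))\<^sup>2)) has_sum complex_of_real r) I"
    by (rule has_sum_of_real)
  then have "((\<lambda>n. complex_of_real ((hnorm H (\<zeta> n))\<^sup>2)) has_sum complex_of_real r) UNIV"
    using key[of "\<lambda>v. complex_of_real ((hnorm H v)\<^sup>2)"] H by simp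
  then have "((\<lambda>n. (hnorm H (\<zeta> n))\<^sup>2) has_sum r) UNIV"
    by (subst (asm) has_sum_of_real_iff)
  ultimately have "square_summable H \<zeta>" by (auto simp: square_summable_iff summable_on_def)
  then show ?thesis using key by blast
qed


section \<open>The GNS space is a Hilbert space\<close>

locale state_on_algebra =
  fixes H :: "'h hilbert" and R :: "('h \<Rightarrow> 'h) set" and \<omega> :: "('h \<Rightarrow> 'h) \<Rightarrow> complex"
  assumes H [simp]: "hilbert_space H" and R [simp]: "von_neumann_algebra H R" and state: "is_state H R \<omega>"
begin

abbreviation form where "form x y \<equiv> gns_form H \<omega> x y"

definition seminorm :: "('h \<Rightarrow> 'h) \<Rightarrow> real" where
  "seminorm x = sqrt (Re (form x x))"

abbreviation cauchy where "cauchy \<equiv> gns_cauchy H R \<omega>"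
abbreviation cls where "cls \<equiv> gns_class H R \<omega>"
abbreviation gns where "gns \<equiv> gns_space H R \<omega>"

lemma R_bop [simp]: "x \<in> R \<Longrightarrow> x \<in> carrier (bop H)"
  by (rule vn_subset[OF R])

lemma bop_distrib:
  assumes "x \<in> carrier (bop H)" "y \<in> carrier (bop H)" "z \<in> carrier (bop H)"
  shows "z \<otimes>\<^bsub>bop H\<^esub> (x \<oplus>\<^bsub>bop H\<^esub> y) = z \<otimes>\<^bsub>bop H\<^esub> x \<oplus>\<^bsub>bop H\<^esub> z \<otimes>\<^bsub>bop H\<^esub> y"
    "(x \<oplus>\<^bsub>bop H\<^esub> y) \<otimes>\<^bsub>bop H\<^esub> z = x \<otimes>\<^bsub>bop H\<^esub> z \<oplus>\<^bsub>bop H\<^esub> y \<otimes>\<^bsub>bop H\<^esub> z"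
  using assms by (auto intro!: bop_eqI[of _ H])

lemma bop_smult_mult:
  assumes "x \<in> carrier (bop H)" "z \<in> carrier (bop H)"
  shows "z \<otimes>\<^bsub>bop H\<^esub> (c \<odot>\<^bsub>bop H\<^esub> x) = c \<odot>\<^bsub>bop H\<^esub> (z \<otimes>\<^bsub>bop H\<^esub> x)"
    "(c \<odot>\<^bsub>bop H\<^esub> x) \<otimes>\<^bsub>bop H\<^esub> z = c \<odot>\<^bsub>bop H\<^esub> (x \<otimes>\<^bsub>bop H\<^esub> z)"
  using assms by (auto intro!: bop_eqI[of _ H])

lemma state_add: "x \<in> R \<Longrightarrow> y \<in> R \<Longrightarrow> \<omega> (x \<oplus>\<^bsub>bop H\<^esub> y) = \<omega> x + \<omega> y"
  using state by (simp add: is_state_def)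

lemma state_smult: "x \<in> R \<Longrightarrow> \<omega> (c \<odot>\<^bsub>bop H\<^esub> x) = c * \<omega> x"
  using state by (simp add: is_state_def)

lemma form_add:
  assumes "x \<in> R" "y \<in> R" "z \<in> R"
  shows "form (x \<oplus>\<^bsub>bop H\<^esub> y) z = form x z + form y z" "form z (x \<oplus>\<^bsub>bop H\<^esub> y) = form z x + form z y"
  using assms by (simp_all add: gns_form_def bop_distrib state_add)

lemma form_smult:
  assumes "x \<in> R" "z \<in> R"
  shows "form (c \<odot>\<^bsub>bop H\<^esub> x) z = c * form x z" "form z (c \<odot>\<^bsub>bop H\<^esub> x) = cnj c * form z x"
  using assms by (simp_all add: gns_form_def bop_smult_mult state_smult)

lemma form_nonneg:
  assumes "x \<in> R"
  shows "0 \<le> Re (form x x)" "Im (form x x) = 0"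
proof -
  have "form x x \<in> \<real>\<^sub>\<ge>\<^sub>0" using assms state by (simp add: gns_form_def is_state_def)
  then show "0 \<le> Re (form x x)" "Im (form x x) = 0" by (auto simp: complex_nonneg_Reals_iff)
qed

lemma form_cnj:
  assumes "x \<in> R" "y \<in> R"
  shows "form y x = cnj (form x y)"
proof -
  have "Im (cnj c * form x y + c * form y x) = 0" for c
  proof -
    have "form (x \<oplus>\<^bsub>bop H\<^esub> c \<odot>\<^bsub>bop H\<^esub> y) (x \<oplus>\<^bsub>bop H\<^esub> c \<odot>\<^bsub>bop H\<^esub> y)
      = form x x + (cnj c * form x y + c * form y x) + (c * cnj c) * form y y"
      using assms by (simp add: form_add form_smult algebra_simps)
    moreover have "Im (form (x \<oplus>\<^bsub>bop H\<^esub> c \<odot>\<^bsub>bop H\<^esub> y) (x \<oplus>\<^bsub>bop H\<^esub> c \<odot>\<^bsub>bop H\<^esub> y)) = 0"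
      using assms by (intro form_nonneg) auto
    moreover have "Im ((c * cnj c) * form y y) = 0"
      unfolding complex_mult_cnj using form_nonneg(2)[OF assms(2)] by simp
    ultimately show ?thesis using form_nonneg(2)[OF assms(1)] by (simp only: plus_complex.sel add_0 add_0_right)
  qed
  from this[of 1] this[of \<i>] show ?thesis by (simp add: complex_eq_iff)
qed

lemma form_self: "x \<in> R \<Longrightarrow> form x x = complex_of_real ((seminorm x)\<^sup>2)"
  using form_nonneg[of x] by (simp add: seminorm_def complex_eq_iff)

lemma seminorm_nonneg [simp]: "x \<in> R \<Longrightarrow> 0 \<le> seminorm x"
  by (simp add: seminorm_def form_nonneg)

lemma seminorm_power2: "x \<in> R \<Longrightarrow> (seminorm x)\<^sup>2 = Re (form x x)"
  by (simp add: seminorm_def form_nonneg)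

lemma seminorm_add_smult:
  assumes "x \<in> R" "y \<in> R"
  shows "(seminorm (x \<oplus>\<^bsub>bop H\<^esub> c \<odot>\<^bsub>bop H\<^esub> y))\<^sup>2
    = (seminorm x)\<^sup>2 + 2 * Re (c * form y x) + (norm c)\<^sup>2 * (seminorm y)\<^sup>2"
proof -
  have 1: "form (x \<oplus>\<^bsub>bop H\<^esub> c \<odot>\<^bsub>bop H\<^esub> y) (x \<oplus>\<^bsub>bop H\<^esub> c \<odot>\<^bsub>bop H\<^esub> y)
      = form x x + (c * form y x + cnj (c * form y x)) + (c * cnj c) * form y y"
    using assms form_cnj[OF assms(2,1)] by (simp add: form_add form_smult algebra_simps)
  have 2: "Re (form x x + (c * form y x + cnj (c * form y x)) + (c * cnj c) * form y y)
      = Re (form x x) + 2 * Re (c * form y x) + (norm c)\<^sup>2 * Re (form y y)"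
    by (simp add: complex_mult_cnj cmod_power2 del: complex_cnj_mult)
  have "x \<oplus>\<^bsub>bop H\<^esub> c \<odot>\<^bsub>bop H\<^esub> y \<in> R" using assms by simp
  from seminorm_power2[OF this] show ?thesis
    unfolding 1 2 seminorm_power2[OF assms(1)] seminorm_power2[OF assms(2)] .
qed

lemma form_cauchy_schwarz:
  assumes "x \<in> R" "y \<in> R"
  shows "norm (form x y) \<le> seminorm x * seminorm y"
proof -
  have "0 \<le> (seminorm x)\<^sup>2 + 2 * Re (c * form y x) + (norm c)\<^sup>2 * (seminorm y)\<^sup>2" for c
    using seminorm_add_smult[OF assms, of c] zero_le_power2[of "seminorm (x \<oplus>\<^bsub>bop H\<^esub> c \<odot>\<^bsub>bop H\<^esub> y)"] by simp
  then have "(norm (form y x))\<^sup>2 \<le> (seminorm x)\<^sup>2 * (seminorm y)\<^sup>2"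
    by (intro quadratic_form_discriminant) auto
  then have "(norm (form x y))\<^sup>2 \<le> (seminorm x * seminorm y)\<^sup>2"
    using form_cnj[OF assms] by (simp add: power_mult_distrib)
  then show ?thesis by (rule power2_le_imp_le) (use assms in auto)
qed

lemma seminorm_add:
  assumes "x \<in> R" "y \<in> R"
  shows "seminorm (x \<oplus>\<^bsub>bop H\<^esub> y) \<le> seminorm x + seminorm y"
proof -
  have 1: "1 \<odot>\<^bsub>bop H\<^esub> y = y" using assms by (auto intro!: bop_eqI[of _ H] hvec_eqI[OF H])
  have "Re (form y x) \<le> seminorm y * seminorm x"
    using form_cauchy_schwarz[OF assms(2,1)] complex_Re_le_cmod[of "form y x"] by linarith
  then have "(seminorm (x \<oplus>\<^bsub>bop H\<^esub> y))\<^sup>2 \<le> (seminorm x + seminorm y)\<^sup>2"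
    using seminorm_add_smult[OF assms, of 1] by (simp add: 1 power2_sum mult.commute)
  then show ?thesis by (rule power2_le_imp_le) (use assms in auto)
qed

lemma seminorm_smult:
  assumes "x \<in> R"
  shows "seminorm (c \<odot>\<^bsub>bop H\<^esub> x) = norm c * seminorm x"
proof -
  have "form (c \<odot>\<^bsub>bop H\<^esub> x) (c \<odot>\<^bsub>bop H\<^esub> x) = (c * cnj c) * form x x"
    using assms by (simp add: form_smult)
  also have "\<dots> = complex_of_real ((norm c)\<^sup>2) * form x x"
    by (simp only: complex_norm_square)
  finally have "seminorm (c \<odot>\<^bsub>bop H\<^esub> x) = sqrt ((norm c)\<^sup>2 * Re (form x x))"
    by (simp add: seminorm_def)
  then show ?thesis by (simp add: seminorm_def real_sqrt_mult)
qed

lemma gns_dist_eq: "gns_dist H \<omega> x y = seminorm (x \<ominus>\<^bsub>bop H\<^esub> y)"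
  by (simp add: gns_dist_def seminorm_def)

lemma seminorm_minus_self [simp]: "x \<in> R \<Longrightarrow> seminorm (x \<ominus>\<^bsub>bop H\<^esub> x) = 0"
  using form_nonneg[of x] by (simp add: seminorm_def bop_minus_conv form_add form_smult)

lemma seminorm_minus_commute:
  assumes "x \<in> R" "y \<in> R"
  shows "seminorm (x \<ominus>\<^bsub>bop H\<^esub> y) = seminorm (y \<ominus>\<^bsub>bop H\<^esub> x)"
  using assms by (simp add: seminorm_def bop_minus_conv form_add form_smult algebra_simps)

lemma seminorm_triangle:
  assumes "x \<in> R" "y \<in> R" "z \<in> R"
  shows "seminorm (x \<ominus>\<^bsub>bop H\<^esub> z) \<le> seminorm (x \<ominus>\<^bsub>bop H\<^esub> y) + seminorm (y \<ominus>\<^bsub>bop H\<^esub> z)"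
proof -
  have "x \<ominus>\<^bsub>bop H\<^esub> z = (x \<ominus>\<^bsub>bop H\<^esub> y) \<oplus>\<^bsub>bop H\<^esub> (y \<ominus>\<^bsub>bop H\<^esub> z)"
    using assms by (auto intro!: bop_eqI[of _ H] hvec_eqI[OF H])
  then show ?thesis using seminorm_add[of "x \<ominus>\<^bsub>bop H\<^esub> y" "y \<ominus>\<^bsub>bop H\<^esub> z"] assms by simp
qed

lemma seminorm_le_minus:
  assumes "x \<in> R" "y \<in> R"
  shows "seminorm x \<le> seminorm (x \<ominus>\<^bsub>bop H\<^esub> y) + seminorm y"
proof -
  have "x = (x \<ominus>\<^bsub>bop H\<^esub> y) \<oplus>\<^bsub>bop H\<^esub> y"
    using assms by (auto intro!: bop_eqI[of _ H] hvec_eqI[OF H])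
  then show ?thesis using seminorm_add[of "x \<ominus>\<^bsub>bop H\<^esub> y" y] assms by simp
qed

subsection \<open>Cauchy sequences and their classes\<close>

lemma cauchy_iff: "\<sigma> \<in> cauchy \<longleftrightarrow>
    (\<forall>n. \<sigma> n \<in> R) \<and> (\<forall>\<epsilon>>0. \<exists>N. \<forall>m\<ge>N. \<forall>n\<ge>N. seminorm (\<sigma> m \<ominus>\<^bsub>bop H\<^esub> \<sigma> n) < \<epsilon>)"
  by (auto simp: gns_cauchy_def gns_dist_eq)

lemma cauchy_R [simp]: "\<sigma> \<in> cauchy \<Longrightarrow> \<sigma> n \<in> R"
  by (simp add: cauchy_iff)

lemma cauchyD:
  "\<sigma> \<in> cauchy \<Longrightarrow> \<epsilon> > 0 \<Longrightarrow> \<exists>N. \<forall>m\<ge>N. \<forall>n\<ge>N. seminorm (\<sigma> m \<ominus>\<^bsub>bop H\<^esub> \<sigma> n) < \<epsilon>"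
  by (simp add: cauchy_iff)

lemma cauchy_const [simp]: "x \<in> R \<Longrightarrow> (\<lambda>n. x) \<in> cauchy"
  by (simp add: cauchy_iff)

text \<open>An operation that is Lipschitz for the seminorm maps Cauchy sequences to Cauchy sequences.\<close>

lemma cauchy_lincomb:
  assumes "\<sigma> \<in> cauchy" "\<tau> \<in> cauchy"
  shows "(\<lambda>n. \<sigma> n \<oplus>\<^bsub>bop H\<^esub> c \<odot>\<^bsub>bop H\<^esub> \<tau> n) \<in> cauchy"
  unfolding cauchy_iff
proof (intro conjI allI impI)
  fix e :: real assume e: "e > 0"
  obtain N where N: "\<And>m n. m \<ge> N \<Longrightarrow> n \<ge> N \<Longrightarrow> seminorm (\<sigma> m \<ominus>\<^bsub>bop H\<^esub> \<sigma> n) < e / 2"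
    using cauchyD[OF assms(1), of "e / 2"] e by auto
  obtain M where M: "\<And>m n. m \<ge> M \<Longrightarrow> n \<ge> M \<Longrightarrow> seminorm (\<tau> m \<ominus>\<^bsub>bop H\<^esub> \<tau> n) < e / 2 / (norm c + 1)"
    using cauchyD[OF assms(2), of "e / 2 / (norm c + 1)"] e by (auto simp: add_nonneg_pos)
  have "seminorm ((\<sigma> m \<oplus>\<^bsub>bop H\<^esub> c \<odot>\<^bsub>bop H\<^esub> \<tau> m) \<ominus>\<^bsub>bop H\<^esub> (\<sigma> n \<oplus>\<^bsub>bop H\<^esub> c \<odot>\<^bsub>bop H\<^esub> \<tau> n)) < e"
    if "m \<ge> max M N" "n \<ge> max M N" for m n
  proof -
    have 1: "(\<sigma> m \<oplus>\<^bsub>bop H\<^esub> c \<odot>\<^bsub>bop H\<^esub> \<tau> m) \<ominus>\<^bsub>bop H\<^esub> (\<sigma> n \<oplus>\<^bsub>bop H\<^esub> c \<odot>\<^bsub>bop H\<^esub> \<tau> n)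
      = (\<sigma> m \<ominus>\<^bsub>bop H\<^esub> \<sigma> n) \<oplus>\<^bsub>bop H\<^esub> c \<odot>\<^bsub>bop H\<^esub> (\<tau> m \<ominus>\<^bsub>bop H\<^esub> \<tau> n)"
      using assms by (auto intro!: bop_eqI[of _ H] hvec_eqI[OF H] simp: algebra_simps)
    have 2: "seminorm ((\<sigma> m \<ominus>\<^bsub>bop H\<^esub> \<sigma> n) \<oplus>\<^bsub>bop H\<^esub> c \<odot>\<^bsub>bop H\<^esub> (\<tau> m \<ominus>\<^bsub>bop H\<^esub> \<tau> n))
      \<le> seminorm (\<sigma> m \<ominus>\<^bsub>bop H\<^esub> \<sigma> n) + norm c * seminorm (\<tau> m \<ominus>\<^bsub>bop H\<^esub> \<tau> n)"
      using seminorm_add[of "\<sigma> m \<ominus>\<^bsub>bop H\<^esub> \<sigma> n" "c \<odot>\<^bsub>bop H\<^esub> (\<tau> m \<ominus>\<^bsub>bop H\<^esub> \<tau> n)"] assms by (simp add: seminorm_smult)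
    have "norm c * seminorm (\<tau> m \<ominus>\<^bsub>bop H\<^esub> \<tau> n) \<le> (norm c + 1) * (e / 2 / (norm c + 1))"
      using M[of m n] that assms by (intro mult_mono) auto
    moreover have "(norm c + 1) * (e / 2 / (norm c + 1)) = e / 2"
      using norm_ge_zero[of c] by (simp add: field_simps add_nonneg_eq_0_iff)
    ultimately show ?thesis unfolding 1 using 2 N[of m n] that by simp
  qed
  then show "\<exists>N. \<forall>m\<ge>N. \<forall>n\<ge>N.
      seminorm ((\<sigma> m \<oplus>\<^bsub>bop H\<^esub> c \<odot>\<^bsub>bop H\<^esub> \<tau> m) \<ominus>\<^bsub>bop H\<^esub> (\<sigma> n \<oplus>\<^bsub>bop H\<^esub> c \<odot>\<^bsub>bop H\<^esub> \<tau> n)) < e" by blast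
qed (use assms in auto)

lemma cauchy_add:
  assumes "\<sigma> \<in> cauchy" "\<tau> \<in> cauchy"
  shows "(\<lambda>n. \<sigma> n \<oplus>\<^bsub>bop H\<^esub> \<tau> n) \<in> cauchy"
proof -
  have "1 \<odot>\<^bsub>bop H\<^esub> \<tau> n = \<tau> n" for n
    using assms by (auto intro!: bop_eqI[of _ H] hvec_eqI[OF H])
  then show ?thesis using cauchy_lincomb[OF assms, of 1] by simp
qed

lemma cauchy_smult:
  assumes "\<tau> \<in> cauchy"
  shows "(\<lambda>n. c \<odot>\<^bsub>bop H\<^esub> \<tau> n) \<in> cauchy"
proof -
  have "\<zero>\<^bsub>bop H\<^esub> \<oplus>\<^bsub>bop H\<^esub> c \<odot>\<^bsub>bop H\<^esub> \<tau> n = c \<odot>\<^bsub>bop H\<^esub> \<tau> n" for n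
    using assms by (auto intro!: bop_eqI[of _ H] hvec_eqI[OF H])
  then show ?thesis using cauchy_lincomb[OF cauchy_const assms, of "\<zero>\<^bsub>bop H\<^esub>" c] by simp
qed

lemma cauchy_bounded:
  assumes "\<sigma> \<in> cauchy"
  shows "\<exists>C\<ge>0. \<forall>n. seminorm (\<sigma> n) \<le> C"
proof -
  obtain N where N: "\<forall>m\<ge>N. \<forall>n\<ge>N. seminorm (\<sigma> m \<ominus>\<^bsub>bop H\<^esub> \<sigma> n) < 1"
    using cauchyD[OF assms, of 1] by auto
  have "seminorm (\<sigma> n) \<le> 1 + seminorm (\<sigma> N) + (\<Sum>k<N. seminorm (\<sigma> k))" for n
  proof (cases "n < N")
    case True
    then have "seminorm (\<sigma> n) \<le> (\<Sum>k<N. seminorm (\<sigma> k))"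
      using assms by (intro member_le_sum) auto
    then show ?thesis using seminorm_nonneg[of "\<sigma> N"] assms by (auto intro: order_trans)
  next
    case False
    then have "seminorm (\<sigma> n \<ominus>\<^bsub>bop H\<^esub> \<sigma> N) < 1" using N by auto
    moreover have "0 \<le> (\<Sum>k<N. seminorm (\<sigma> k))" using assms by (intro sum_nonneg) auto
    ultimately show ?thesis using seminorm_le_minus[of "\<sigma> n" "\<sigma> N"] assms by simp
  qed
  then show ?thesis using order_trans[OF seminorm_nonneg[OF cauchy_R[OF assms]]] by blast
qed

lemma form_difference:
  assumes "x \<in> R" "y \<in> R" "x' \<in> R" "y' \<in> R"
  shows "norm (form x y - form x' y') \<le> seminorm (x \<ominus>\<^bsub>bop H\<^esub> x') * seminorm y + seminorm x' * seminorm (y \<ominus>\<^bsub>bop H\<^esub> y')"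
proof -
  have "form x y - form x' y' = form (x \<ominus>\<^bsub>bop H\<^esub> x') y + form x' (y \<ominus>\<^bsub>bop H\<^esub> y')"
    using assms by (simp add: bop_minus_conv form_add form_smult)
  then have "norm (form x y - form x' y') \<le> norm (form (x \<ominus>\<^bsub>bop H\<^esub> x') y) + norm (form x' (y \<ominus>\<^bsub>bop H\<^esub> y'))"
    by (metis norm_triangle_ineq)
  then show ?thesis
    using form_cauchy_schwarz[of "x \<ominus>\<^bsub>bop H\<^esub> x'" y] form_cauchy_schwarz[of x' "y \<ominus>\<^bsub>bop H\<^esub> y'"] assms by simp
qed

lemma form_convergent:
  assumes "\<sigma> \<in> cauchy" "\<tau> \<in> cauchy"
  shows "(\<lambda>n. form (\<sigma> n) (\<tau> n)) \<longlonglongrightarrow> lim (\<lambda>n. form (\<sigma> n) (\<tau> n))"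
proof -
  obtain C where C: "0 \<le> C" "\<And>n. seminorm (\<sigma> n) \<le> C" using cauchy_bounded[OF assms(1)] by blast
  obtain D where D: "0 \<le> D" "\<And>n. seminorm (\<tau> n) \<le> D" using cauchy_bounded[OF assms(2)] by blast
  note C0 = C(1) D(1)
  have "Cauchy (\<lambda>n. form (\<sigma> n) (\<tau> n))"
    unfolding Cauchy_def dist_norm
  proof (intro allI impI)
    fix e :: real assume e: "e > 0"
    define d where "d = e / (C + D + 1)"
    have d: "d > 0" using e C0 by (simp add: d_def)
    obtain N where N: "\<And>m n. m \<ge> N \<Longrightarrow> n \<ge> N \<Longrightarrow> seminorm (\<sigma> m \<ominus>\<^bsub>bop H\<^esub> \<sigma> n) < d"
      using cauchyD[OF assms(1) d] by auto
    obtain M where M: "\<And>m n. m \<ge> M \<Longrightarrow> n \<ge> M \<Longrightarrow> seminorm (\<tau> m \<ominus>\<^bsub>bop H\<^esub> \<tau> n) < d"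
      using cauchyD[OF assms(2) d] by auto
    have "norm (form (\<sigma> m) (\<tau> m) - form (\<sigma> n) (\<tau> n)) < e" if "m \<ge> max M N" "n \<ge> max M N" for m n
    proof -
      have "norm (form (\<sigma> m) (\<tau> m) - form (\<sigma> n) (\<tau> n))
        \<le> seminorm (\<sigma> m \<ominus>\<^bsub>bop H\<^esub> \<sigma> n) * seminorm (\<tau> m) + seminorm (\<sigma> n) * seminorm (\<tau> m \<ominus>\<^bsub>bop H\<^esub> \<tau> n)"
        using assms by (intro form_difference) auto
      also have "\<dots> \<le> d * D + C * d"
        using N[of m n] M[of m n] C D C0 d that assms by (intro add_mono mult_mono) (auto simp: less_imp_le)
      also have "\<dots> < d * (C + D + 1)" using d by (simp add: algebra_simps)
      also have "\<dots> = e" using C0 by (simp add: d_def)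
      finally show ?thesis .
    qed
    then show "\<exists>N. \<forall>m\<ge>N. \<forall>n\<ge>N. norm (form (\<sigma> m) (\<tau> m) - form (\<sigma> n) (\<tau> n)) < e" by blast
  qed
  then show ?thesis using Cauchy_convergent convergent_LIMSEQ_iff by blast
qed

lemma equiv_iff: "(\<sigma>, \<tau>) \<in> gns_equiv H R \<omega> \<longleftrightarrow>
    \<sigma> \<in> cauchy \<and> \<tau> \<in> cauchy \<and> (\<lambda>n. seminorm (\<sigma> n \<ominus>\<^bsub>bop H\<^esub> \<tau> n)) \<longlonglongrightarrow> 0"
  by (simp add: gns_equiv_def gns_dist_eq)

lemma equiv: "equiv cauchy (gns_equiv H R \<omega>)"
proof (rule equivI)
  show "gns_equiv H R \<omega> \<subseteq> cauchy \<times> cauchy" by (auto simp: equiv_iff)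
  show "refl_on cauchy (gns_equiv H R \<omega>)"
    by (rule refl_onI) (simp add: equiv_iff)
  show "sym (gns_equiv H R \<omega>)"
    by (rule symI) (simp add: equiv_iff seminorm_minus_commute)
  show "trans (gns_equiv H R \<omega>)"
  proof (rule transI)
    fix \<rho> \<sigma> \<tau> assume a: "(\<rho>, \<sigma>) \<in> gns_equiv H R \<omega>" "(\<sigma>, \<tau>) \<in> gns_equiv H R \<omega>"
    then have c: "\<rho> \<in> cauchy" "\<sigma> \<in> cauchy" "\<tau> \<in> cauchy" by (auto simp: equiv_iff)
    have "(\<lambda>n. seminorm (\<rho> n \<ominus>\<^bsub>bop H\<^esub> \<sigma> n) + seminorm (\<sigma> n \<ominus>\<^bsub>bop H\<^esub> \<tau> n)) \<longlonglongrightarrow> 0 + 0"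
      using a by (intro tendsto_add) (auto simp: equiv_iff)
    then have l: "(\<lambda>n. seminorm (\<rho> n \<ominus>\<^bsub>bop H\<^esub> \<sigma> n) + seminorm (\<sigma> n \<ominus>\<^bsub>bop H\<^esub> \<tau> n)) \<longlonglongrightarrow> 0" by simp
    have "(\<lambda>n. seminorm (\<rho> n \<ominus>\<^bsub>bop H\<^esub> \<tau> n)) \<longlonglongrightarrow> 0"
      by (rule Lim_null_comparison[OF _ l]) (use c in \<open>auto intro!: always_eventually seminorm_triangle\<close>)
    then show "(\<rho>, \<tau>) \<in> gns_equiv H R \<omega>" using c by (simp add: equiv_iff)
  qed
qed

lemma cls_eq_iff: "\<sigma> \<in> cauchy \<Longrightarrow> \<tau> \<in> cauchy \<Longrightarrow>
    cls \<sigma> = cls \<tau> \<longleftrightarrow> (\<lambda>n. seminorm (\<sigma> n \<ominus>\<^bsub>bop H\<^esub> \<tau> n)) \<longlonglongrightarrow> 0"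
  unfolding gns_class_def using eq_equiv_class_iff[OF equiv, of \<sigma> \<tau>] by (simp add: equiv_iff)

lemma gns_carrier: "carrier gns = cls ` cauchy"
  by (auto simp: gns_space_def quotient_def gns_class_def)

lemma cls_closed [simp]: "\<sigma> \<in> cauchy \<Longrightarrow> cls \<sigma> \<in> carrier gns"
  by (auto simp: gns_carrier)

lemma repr_equiv:
  assumes "\<sigma> \<in> cauchy"
  shows "gns_repr (cls \<sigma>) \<in> cauchy" "(\<lambda>n. seminorm (gns_repr (cls \<sigma>) n \<ominus>\<^bsub>bop H\<^esub> \<sigma> n)) \<longlonglongrightarrow> 0"
proof -
  have "\<sigma> \<in> cls \<sigma>" using assms by (simp add: gns_class_def equiv_iff)
  then have "gns_repr (cls \<sigma>) \<in> cls \<sigma>" unfolding gns_repr_def by (rule someI[of "\<lambda>\<tau>. \<tau> \<in> cls \<sigma>"])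
  then have "(\<sigma>, gns_repr (cls \<sigma>)) \<in> gns_equiv H R \<omega>" by (simp add: gns_class_def)
  then show "gns_repr (cls \<sigma>) \<in> cauchy" "(\<lambda>n. seminorm (gns_repr (cls \<sigma>) n \<ominus>\<^bsub>bop H\<^esub> \<sigma> n)) \<longlonglongrightarrow> 0"
    using seminorm_minus_commute assms by (auto simp: equiv_iff)
qed

lemma gns_zero: "\<zero>\<^bsub>gns\<^esub> = cls (\<lambda>n. \<zero>\<^bsub>bop H\<^esub>)"
  by (simp add: gns_space_def)

lemma gns_lincomb:
  assumes "\<sigma> \<in> cauchy" "\<tau> \<in> cauchy"
  shows "cls \<sigma> \<oplus>\<^bsub>gns\<^esub> cls \<tau> = cls (\<lambda>n. \<sigma> n \<oplus>\<^bsub>bop H\<^esub> \<tau> n)"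
    and "c \<odot>\<^bsub>gns\<^esub> cls \<sigma> = cls (\<lambda>n. c \<odot>\<^bsub>bop H\<^esub> \<sigma> n)"
proof -
  let ?s = "gns_repr (cls \<sigma>)" and ?t = "gns_repr (cls \<tau>)"
  note s = repr_equiv[OF assms(1)] and t = repr_equiv[OF assms(2)]
  have "(\<lambda>n. seminorm (?s n \<ominus>\<^bsub>bop H\<^esub> \<sigma> n) + seminorm (?t n \<ominus>\<^bsub>bop H\<^esub> \<tau> n)) \<longlonglongrightarrow> 0 + 0"
    by (intro tendsto_add s t)
  then have l: "(\<lambda>n. seminorm (?s n \<ominus>\<^bsub>bop H\<^esub> \<sigma> n) + seminorm (?t n \<ominus>\<^bsub>bop H\<^esub> \<tau> n)) \<longlonglongrightarrow> 0" by simp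
  have "(\<lambda>n. seminorm ((?s n \<oplus>\<^bsub>bop H\<^esub> ?t n) \<ominus>\<^bsub>bop H\<^esub> (\<sigma> n \<oplus>\<^bsub>bop H\<^esub> \<tau> n))) \<longlonglongrightarrow> 0"
  proof (rule Lim_null_comparison[OF _ l], rule always_eventually, rule allI)
    fix n
    have "(?s n \<oplus>\<^bsub>bop H\<^esub> ?t n) \<ominus>\<^bsub>bop H\<^esub> (\<sigma> n \<oplus>\<^bsub>bop H\<^esub> \<tau> n) = (?s n \<ominus>\<^bsub>bop H\<^esub> \<sigma> n) \<oplus>\<^bsub>bop H\<^esub> (?t n \<ominus>\<^bsub>bop H\<^esub> \<tau> n)"
      using assms s(1) t(1) by (auto intro!: bop_eqI[of _ H] hvec_eqI[OF H])
    then show "norm (seminorm ((?s n \<oplus>\<^bsub>bop H\<^esub> ?t n) \<ominus>\<^bsub>bop H\<^esub> (\<sigma> n \<oplus>\<^bsub>bop H\<^esub> \<tau> n)))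
      \<le> seminorm (?s n \<ominus>\<^bsub>bop H\<^esub> \<sigma> n) + seminorm (?t n \<ominus>\<^bsub>bop H\<^esub> \<tau> n)"
      using seminorm_add[of "?s n \<ominus>\<^bsub>bop H\<^esub> \<sigma> n" "?t n \<ominus>\<^bsub>bop H\<^esub> \<tau> n"] assms s(1) t(1) by simp
  qed
  then show "cls \<sigma> \<oplus>\<^bsub>gns\<^esub> cls \<tau> = cls (\<lambda>n. \<sigma> n \<oplus>\<^bsub>bop H\<^esub> \<tau> n)"
    using assms s(1) t(1) by (simp add: gns_space_def cls_eq_iff cauchy_add)
  have "(\<lambda>n. norm c * seminorm (?s n \<ominus>\<^bsub>bop H\<^esub> \<sigma> n)) \<longlonglongrightarrow> norm c * 0"
    by (intro tendsto_mult_left s)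
  then have "(\<lambda>n. norm c * seminorm (?s n \<ominus>\<^bsub>bop H\<^esub> \<sigma> n)) \<longlonglongrightarrow> 0" by simp
  moreover have "norm c * seminorm (?s n \<ominus>\<^bsub>bop H\<^esub> \<sigma> n) = seminorm (c \<odot>\<^bsub>bop H\<^esub> ?s n \<ominus>\<^bsub>bop H\<^esub> c \<odot>\<^bsub>bop H\<^esub> \<sigma> n)" for n
  proof -
    have "c \<odot>\<^bsub>bop H\<^esub> ?s n \<ominus>\<^bsub>bop H\<^esub> c \<odot>\<^bsub>bop H\<^esub> \<sigma> n = c \<odot>\<^bsub>bop H\<^esub> (?s n \<ominus>\<^bsub>bop H\<^esub> \<sigma> n)"
      using assms s(1) by (auto intro!: bop_eqI[of _ H] hvec_eqI[OF H] simp: algebra_simps)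
    then show ?thesis using assms s(1) by (simp add: seminorm_smult)
  qed
  ultimately show "c \<odot>\<^bsub>gns\<^esub> cls \<sigma> = cls (\<lambda>n. c \<odot>\<^bsub>bop H\<^esub> \<sigma> n)"
    using assms s(1) by (simp add: gns_space_def cls_eq_iff cauchy_smult)
qed

lemma gns_smult: "\<sigma> \<in> cauchy \<Longrightarrow> c \<odot>\<^bsub>gns\<^esub> cls \<sigma> = cls (\<lambda>n. c \<odot>\<^bsub>bop H\<^esub> \<sigma> n)"
  by (rule gns_lincomb(2))

text \<open>The inner product of two classes is independent of the chosen representatives.\<close>

lemma gns_hinner:
  assumes "\<sigma> \<in> cauchy" "\<tau> \<in> cauchy"
  shows "(\<lambda>n. form (\<sigma> n) (\<tau> n)) \<longlonglongrightarrow> hinner gns (cls \<sigma>) (cls \<tau>)"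
proof -
  let ?s = "gns_repr (cls \<sigma>)" and ?t = "gns_repr (cls \<tau>)"
  note s = repr_equiv[OF assms(1)] and t = repr_equiv[OF assms(2)]
  obtain C where C: "0 \<le> C" "\<And>n. seminorm (?s n) \<le> C" using cauchy_bounded[OF s(1)] by blast
  obtain D where D: "0 \<le> D" "\<And>n. seminorm (\<tau> n) \<le> D" using cauchy_bounded[OF assms(2)] by blast
  have "(\<lambda>n. seminorm (?s n \<ominus>\<^bsub>bop H\<^esub> \<sigma> n) * D + C * seminorm (?t n \<ominus>\<^bsub>bop H\<^esub> \<tau> n)) \<longlonglongrightarrow> 0 * D + C * 0"
    by (intro tendsto_intros s t)
  then have l: "(\<lambda>n. seminorm (?s n \<ominus>\<^bsub>bop H\<^esub> \<sigma> n) * D + C * seminorm (?t n \<ominus>\<^bsub>bop H\<^esub> \<tau> n)) \<longlonglongrightarrow> 0" by simp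
  have "(\<lambda>n. form (\<sigma> n) (\<tau> n) - form (?s n) (?t n)) \<longlonglongrightarrow> 0"
  proof (rule Lim_null_comparison[OF _ l], rule always_eventually, rule allI)
    fix n
    have "norm (form (\<sigma> n) (\<tau> n) - form (?s n) (?t n))
      \<le> seminorm (\<sigma> n \<ominus>\<^bsub>bop H\<^esub> ?s n) * seminorm (\<tau> n) + seminorm (?s n) * seminorm (\<tau> n \<ominus>\<^bsub>bop H\<^esub> ?t n)"
      using assms s(1) t(1) by (intro form_difference) auto
    also have "\<dots> \<le> seminorm (?s n \<ominus>\<^bsub>bop H\<^esub> \<sigma> n) * D + C * seminorm (?t n \<ominus>\<^bsub>bop H\<^esub> \<tau> n)"
      using C D assms s(1) t(1) seminorm_minus_commute[of "\<sigma> n" "?s n"] seminorm_minus_commute[of "\<tau> n" "?t n"]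
      by (intro add_mono mult_mono) auto
    finally show "norm (form (\<sigma> n) (\<tau> n) - form (?s n) (?t n))
      \<le> seminorm (?s n \<ominus>\<^bsub>bop H\<^esub> \<sigma> n) * D + C * seminorm (?t n \<ominus>\<^bsub>bop H\<^esub> \<tau> n)" .
  qed
  from tendsto_add[OF this form_convergent[OF s(1) t(1)]]
  show ?thesis by (simp add: gns_space_def)
qed

lemma gns_hinner_eqI:
  assumes "\<sigma> \<in> cauchy" "\<tau> \<in> cauchy" "(\<lambda>n. form (\<sigma> n) (\<tau> n)) \<longlonglongrightarrow> s"
  shows "hinner gns (cls \<sigma>) (cls \<tau>) = s"
  using LIMSEQ_unique[OF gns_hinner[OF assms(1,2)] assms(3)] .

lemma gns_diff_hnorm:
  assumes "\<sigma> \<in> cauchy" "\<tau> \<in> cauchy"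
  shows "(\<lambda>n. seminorm (\<sigma> n \<ominus>\<^bsub>bop H\<^esub> \<tau> n)) \<longlonglongrightarrow> hnorm gns (cls \<sigma> \<oplus>\<^bsub>gns\<^esub> (-1) \<odot>\<^bsub>gns\<^esub> cls \<tau>)"
proof -
  let ?d = "\<lambda>n. \<sigma> n \<oplus>\<^bsub>bop H\<^esub> (-1) \<odot>\<^bsub>bop H\<^esub> \<tau> n"
  have d: "?d \<in> cauchy" by (rule cauchy_lincomb[OF assms])
  have e: "cls \<sigma> \<oplus>\<^bsub>gns\<^esub> (-1) \<odot>\<^bsub>gns\<^esub> cls \<tau> = cls ?d"
    using assms by (simp add: gns_lincomb cauchy_smult)
  have "(\<lambda>n. sqrt (Re (form (?d n) (?d n)))) \<longlonglongrightarrow> sqrt (Re (hinner gns (cls ?d) (cls ?d)))"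
    by (intro tendsto_intros gns_hinner d)
  then show ?thesis
    unfolding e hnorm_def using assms by (simp add: seminorm_def bop_minus_conv)
qed

text \<open>  The limit of a Cauchy sequence of classes is the class of a diagonal sequence, which picks from the
  \<open>k\<close>-th representative a term that approximates its later terms up to \<open>1 / (k + 1)\<close>.\<close>

lemma hilbert_gns [simp]: "hilbert_space gns"
proof (rule hilbert_spaceI)
  note hi = gns_hinner
  show "\<zero>\<^bsub>gns\<^esub> \<in> carrier gns" by (simp add: gns_zero)
  show "A \<oplus>\<^bsub>gns\<^esub> B \<in> carrier gns" if "A \<in> carrier gns" "B \<in> carrier gns" for A B
    using that by (auto simp: gns_carrier gns_lincomb cauchy_add)
  show "c \<odot>\<^bsub>gns\<^esub> A \<in> carrier gns" if "A \<in> carrier gns" for c A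
    using that by (auto simp: gns_carrier gns_lincomb cauchy_smult)
  show "hinner gns \<zero>\<^bsub>gns\<^esub> A = 0" if A: "A \<in> carrier gns" for A
  proof -
    obtain \<sigma> where s: "\<sigma> \<in> cauchy" "A = cls \<sigma>" using A by (auto simp: gns_carrier)
    have z: "\<zero>\<^bsub>bop H\<^esub> = 0 \<odot>\<^bsub>bop H\<^esub> \<one>\<^bsub>bop H\<^esub>" by (auto intro!: bop_eqI[of _ H] hvec_eqI[OF H])
    have "form \<zero>\<^bsub>bop H\<^esub> (\<sigma> n) = 0" for n
      unfolding z using s by (simp add: form_smult)
    then show ?thesis using s by (auto simp: gns_zero intro!: gns_hinner_eqI)
  qed
  show "hinner gns (A \<oplus>\<^bsub>gns\<^esub> B) D = hinner gns A D + hinner gns B D"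
    if ABD: "A \<in> carrier gns" "B \<in> carrier gns" "D \<in> carrier gns" for A B D
  proof -
    obtain \<rho> \<sigma> \<tau> where s: "\<rho> \<in> cauchy" "A = cls \<rho>" "\<sigma> \<in> cauchy" "B = cls \<sigma>" "\<tau> \<in> cauchy" "D = cls \<tau>"
      using ABD by (auto simp: gns_carrier)
    show ?thesis
      unfolding s gns_lincomb(1)[OF s(1,3)]
      using tendsto_add[OF hi[OF s(1,5)] hi[OF s(3,5)]] s
      by (intro gns_hinner_eqI cauchy_add) (simp_all add: form_add)
  qed
  show "hinner gns (c \<odot>\<^bsub>gns\<^esub> A) B = c * hinner gns A B" if AB: "A \<in> carrier gns" "B \<in> carrier gns" for c A B
  proof -
    obtain \<sigma> \<tau> where s: "\<sigma> \<in> cauchy" "A = cls \<sigma>" "\<tau> \<in> cauchy" "B = cls \<tau>"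
      using AB by (auto simp: gns_carrier)
    show ?thesis
      unfolding s gns_lincomb(2)[OF s(1,1)]
      using tendsto_mult_left[OF hi[OF s(1,3)], of c] s
      by (intro gns_hinner_eqI cauchy_smult) (simp_all add: form_smult)
  qed
  show "hinner gns B A = cnj (hinner gns A B)" if AB: "A \<in> carrier gns" "B \<in> carrier gns" for A B
  proof -
    obtain \<sigma> \<tau> where s: "\<sigma> \<in> cauchy" "A = cls \<sigma>" "\<tau> \<in> cauchy" "B = cls \<tau>"
      using AB by (auto simp: gns_carrier)
    have "form (\<tau> n) (\<sigma> n) = cnj (form (\<sigma> n) (\<tau> n))" for n using s by (intro form_cnj) auto
    then show ?thesis
      unfolding s using tendsto_cnj[OF hi[OF s(1,3)]] s by (intro gns_hinner_eqI) auto
  qed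
  show "hinner gns A A \<in> \<real>\<^sub>\<ge>\<^sub>0" if A: "A \<in> carrier gns" for A
  proof -
    obtain \<sigma> where s: "\<sigma> \<in> cauchy" "A = cls \<sigma>" using A by (auto simp: gns_carrier)
    have "0 \<le> Re (hinner gns A A)"
      unfolding s using s(1) by (intro LIMSEQ_le_const[OF tendsto_Re[OF hi[OF s(1,1)]]]) (auto simp: form_nonneg)
    moreover have "Im (hinner gns A A) = 0"
      unfolding s using s(1) LIMSEQ_unique[OF tendsto_Im[OF hi[OF s(1,1)]], of 0] by (simp add: form_nonneg)
    ultimately show ?thesis by (simp add: complex_nonneg_Reals_iff)
  qed
  show "A = B" if AB: "A \<in> carrier gns" "B \<in> carrier gns"
    and z: "hinner gns A A - hinner gns A B - hinner gns B A + hinner gns B B = 0" for A B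
  proof -
    obtain \<sigma> \<tau> where s: "\<sigma> \<in> cauchy" "A = cls \<sigma>" "\<tau> \<in> cauchy" "B = cls \<tau>"
      using AB by (auto simp: gns_carrier)
    have "(\<lambda>n. form (\<sigma> n) (\<sigma> n) - form (\<sigma> n) (\<tau> n) - form (\<tau> n) (\<sigma> n) + form (\<tau> n) (\<tau> n)) \<longlonglongrightarrow> 0"
      unfolding z[symmetric] s by (intro tendsto_intros hi s)
    moreover have "form (\<sigma> n) (\<sigma> n) - form (\<sigma> n) (\<tau> n) - form (\<tau> n) (\<sigma> n) + form (\<tau> n) (\<tau> n)
      = form (\<sigma> n \<ominus>\<^bsub>bop H\<^esub> \<tau> n) (\<sigma> n \<ominus>\<^bsub>bop H\<^esub> \<tau> n)" for n
      using s by (simp add: bop_minus_conv form_add form_smult)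
    ultimately have "(\<lambda>n. form (\<sigma> n \<ominus>\<^bsub>bop H\<^esub> \<tau> n) (\<sigma> n \<ominus>\<^bsub>bop H\<^esub> \<tau> n)) \<longlonglongrightarrow> 0" by simp
    then have "(\<lambda>n. sqrt (Re (form (\<sigma> n \<ominus>\<^bsub>bop H\<^esub> \<tau> n) (\<sigma> n \<ominus>\<^bsub>bop H\<^esub> \<tau> n)))) \<longlonglongrightarrow> sqrt (Re 0)"
      by (intro tendsto_intros)
    then show ?thesis using s by (simp add: cls_eq_iff seminorm_def)
  qed
  show "\<exists>l\<in>carrier gns. (\<lambda>k. hnorm gns (s k \<oplus>\<^bsub>gns\<^esub> (-1) \<odot>\<^bsub>gns\<^esub> l)) \<longlonglongrightarrow> 0"
    if sc: "\<And>k. s k \<in> carrier gns"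
      and cauchy: "\<And>\<epsilon>. \<epsilon> > 0 \<Longrightarrow> \<exists>N. \<forall>k\<ge>N. \<forall>j\<ge>N. hnorm gns (s k \<oplus>\<^bsub>gns\<^esub> (-1) \<odot>\<^bsub>gns\<^esub> s j) < \<epsilon>" for s
  proof -
    have "\<forall>k. \<exists>\<sigma>. \<sigma> \<in> cauchy \<and> s k = cls \<sigma>" using sc by (auto simp: gns_carrier)
    then obtain \<sigma> where s: "\<And>k. \<sigma> k \<in> cauchy" "\<And>k. s k = cls (\<sigma> k)" by metis
    have "\<forall>k. \<exists>N. \<forall>m\<ge>N. \<forall>n\<ge>N. seminorm (\<sigma> k m \<ominus>\<^bsub>bop H\<^esub> \<sigma> k n) < 1 / (real k + 1)"
      using cauchyD[OF s(1)] by simp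
    then obtain p where p: "\<And>k m n. m \<ge> p k \<Longrightarrow> n \<ge> p k \<Longrightarrow> seminorm (\<sigma> k m \<ominus>\<^bsub>bop H\<^esub> \<sigma> k n) < 1 / (real k + 1)"
      by metis
    define \<tau> where "\<tau> k = \<sigma> k (p k)" for k
    have \<tau>R: "\<tau> k \<in> R" for k using s by (simp add: \<tau>_def)
    have near: "seminorm (\<sigma> k n \<ominus>\<^bsub>bop H\<^esub> \<tau> k) < 1 / (real k + 1)" if "n \<ge> p k" for k n
      unfolding \<tau>_def using p that by simp
    have \<tau>: "\<tau> \<in> gns_cauchy H R \<omega>"
      unfolding cauchy_iff
    proof (intro conjI allI impI)
      fix e :: real assume e: "e > 0"
      obtain N where N: "\<And>k j. k \<ge> N \<Longrightarrow> j \<ge> N \<Longrightarrow> hnorm gns (s k \<oplus>\<^bsub>gns\<^esub> (-1) \<odot>\<^bsub>gns\<^esub> s j) < e / 3"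
        using cauchy[of "e / 3"] e by auto
      obtain M where M: "3 / e < real M" using reals_Archimedean2 by blast
      have M': "1 / (real k + 1) < e / 3" if "k \<ge> M" for k
      proof -
        have "3 / e < real k + 1" using M that by simp
        then show ?thesis using e by (simp add: field_simps)
      qed
      have "seminorm (\<tau> k \<ominus>\<^bsub>bop H\<^esub> \<tau> j) < e" if kj: "k \<ge> max M N" "j \<ge> max M N" for k j
      proof -
        have "eventually (\<lambda>n. seminorm (\<sigma> k n \<ominus>\<^bsub>bop H\<^esub> \<sigma> j n) < e / 3) sequentially"
          using order_tendstoD(2)[OF gns_diff_hnorm[OF s(1) s(1)], of k j "e / 3"] N[of k j] kj s by simp
        moreover have "eventually (\<lambda>n. n \<ge> max (p k) (p j)) sequentially" by (rule eventually_ge_at_top)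
        ultimately obtain n where n: "seminorm (\<sigma> k n \<ominus>\<^bsub>bop H\<^esub> \<sigma> j n) < e / 3" "n \<ge> max (p k) (p j)"
          using eventually_happens'[OF sequentially_bot] eventually_conj by blast
        have "seminorm (\<tau> k \<ominus>\<^bsub>bop H\<^esub> \<tau> j) \<le> seminorm (\<tau> k \<ominus>\<^bsub>bop H\<^esub> \<sigma> k n) + seminorm (\<sigma> k n \<ominus>\<^bsub>bop H\<^esub> \<tau> j)"
          "seminorm (\<sigma> k n \<ominus>\<^bsub>bop H\<^esub> \<tau> j) \<le> seminorm (\<sigma> k n \<ominus>\<^bsub>bop H\<^esub> \<sigma> j n) + seminorm (\<sigma> j n \<ominus>\<^bsub>bop H\<^esub> \<tau> j)"
          using \<tau>R s by (auto intro!: seminorm_triangle)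
        then show ?thesis
          using n near[of k n] near[of j n] seminorm_minus_commute[of "\<tau> k" "\<sigma> k n"] \<tau>R s M'[of k] M'[of j] kj by simp
      qed
      then show "\<exists>N. \<forall>m\<ge>N. \<forall>n\<ge>N. seminorm (\<tau> m \<ominus>\<^bsub>bop H\<^esub> \<tau> n) < e" by blast
    qed (rule \<tau>R)
    have "(\<lambda>k. hnorm gns (s k \<oplus>\<^bsub>gns\<^esub> (-1) \<odot>\<^bsub>gns\<^esub> cls \<tau>)) \<longlonglongrightarrow> 0"
      unfolding lim_sequentially
    proof (intro allI impI)
      fix r :: real assume r: "r > 0"
      obtain N where N: "\<And>k n. k \<ge> N \<Longrightarrow> n \<ge> N \<Longrightarrow> seminorm (\<tau> k \<ominus>\<^bsub>bop H\<^esub> \<tau> n) < r / 4"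
        using cauchyD[OF \<tau>, of "r / 4"] r by auto
      obtain M where M: "4 / r < real M" using reals_Archimedean2 by blast
      have "dist (hnorm gns (s k \<oplus>\<^bsub>gns\<^esub> (-1) \<odot>\<^bsub>gns\<^esub> cls \<tau>)) 0 < r" if k: "k \<ge> max M N" for k
      proof -
        have l: "(\<lambda>n. seminorm (\<sigma> k n \<ominus>\<^bsub>bop H\<^esub> \<tau> n)) \<longlonglongrightarrow> hnorm gns (s k \<oplus>\<^bsub>gns\<^esub> (-1) \<odot>\<^bsub>gns\<^esub> cls \<tau>)"
          unfolding s(2) by (rule gns_diff_hnorm[OF s(1) \<tau>])
        have "4 / r < real k + 1" using M k by simp
        then have k': "1 / (real k + 1) < r / 4" using r by (simp add: field_simps)
        have "seminorm (\<sigma> k n \<ominus>\<^bsub>bop H\<^esub> \<tau> n) \<le> r / 2" if "n \<ge> max (p k) N" for n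
          using seminorm_triangle[of "\<sigma> k n" "\<tau> k" "\<tau> n"] near[of k n] N[of k n] k k' that \<tau>R s by simp
        then have "hnorm gns (s k \<oplus>\<^bsub>gns\<^esub> (-1) \<odot>\<^bsub>gns\<^esub> cls \<tau>) \<le> r / 2"
          by (intro LIMSEQ_le_const2[OF l]) blast
        moreover have "0 \<le> hnorm gns (s k \<oplus>\<^bsub>gns\<^esub> (-1) \<odot>\<^bsub>gns\<^esub> cls \<tau>)"
          using \<tau>R s by (intro LIMSEQ_le_const[OF l]) auto
        ultimately show ?thesis using r by simp
      qed
      then show "\<exists>N. \<forall>k\<ge>N. dist (hnorm gns (s k \<oplus>\<^bsub>gns\<^esub> (-1) \<odot>\<^bsub>gns\<^esub> cls \<tau>)) 0 < r" by blast
    qed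
    then show ?thesis using cls_closed[OF \<tau>] by blast
  qed
qed

subsection \<open>The image of the algebra\<close>

abbreviation embed where "embed x \<equiv> cls (\<lambda>n. x)"

lemma embed_hinner: "x \<in> R \<Longrightarrow> y \<in> R \<Longrightarrow> hinner gns (embed x) (embed y) = form x y"
  by (rule gns_hinner_eqI) auto

lemma embed_lincomb:
  assumes "x \<in> R" "y \<in> R"
  shows "embed (x \<oplus>\<^bsub>bop H\<^esub> c \<odot>\<^bsub>bop H\<^esub> y) = embed x \<oplus>\<^bsub>gns\<^esub> c \<odot>\<^bsub>gns\<^esub> embed y"
  using assms by (simp add: gns_lincomb(1) gns_smult)

lemma embed_hnorm: "x \<in> R \<Longrightarrow> hnorm gns (embed x) = seminorm x"
  by (simp add: hnorm_def embed_hinner seminorm_def)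

text \<open>The terms of a Cauchy sequence, embedded as constant sequences, converge to the class of the sequence.\<close>

lemma embed_dense:
  assumes A: "A \<in> carrier gns" and orth: "\<And>x. x \<in> R \<Longrightarrow> hinner gns (embed x) A = 0"
  shows "A = \<zero>\<^bsub>gns\<^esub>"
proof -
  obtain \<sigma> where s: "\<sigma> \<in> cauchy" "A = cls \<sigma>" using A by (auto simp: gns_carrier)
  have "(\<lambda>m. hnorm gns (embed (\<sigma> m) \<ominus>\<^bsub>gns\<^esub> A)) \<longlonglongrightarrow> 0"
    unfolding lim_sequentially
  proof (intro allI impI)
    fix r :: real assume r: "r > 0"
    obtain N where N: "\<And>k n. k \<ge> N \<Longrightarrow> n \<ge> N \<Longrightarrow> seminorm (\<sigma> k \<ominus>\<^bsub>bop H\<^esub> \<sigma> n) < r / 2"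
      using cauchyD[OF s(1), of "r / 2"] r by auto
    have "dist (hnorm gns (embed (\<sigma> m) \<ominus>\<^bsub>gns\<^esub> A)) 0 < r" if m: "m \<ge> N" for m
    proof -
      have l: "(\<lambda>n. seminorm (\<sigma> m \<ominus>\<^bsub>bop H\<^esub> \<sigma> n)) \<longlonglongrightarrow> hnorm gns (embed (\<sigma> m) \<ominus>\<^bsub>gns\<^esub> A)"
        unfolding s(2) using gns_diff_hnorm[of "\<lambda>n. \<sigma> m" \<sigma>] s by (simp add: hminus_conv)
      have "hnorm gns (embed (\<sigma> m) \<ominus>\<^bsub>gns\<^esub> A) \<le> r / 2"
        using N[OF m] by (intro LIMSEQ_le_const2[OF l]) (auto intro: less_imp_le)
      then show ?thesis using r A s by simp
    qed
    then show "\<exists>N. \<forall>m\<ge>N. dist (hnorm gns (embed (\<sigma> m) \<ominus>\<^bsub>gns\<^esub> A)) 0 < r" by blast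
  qed
  then have "(\<lambda>m. hinner gns (embed (\<sigma> m)) A) \<longlonglongrightarrow> hinner gns A A"
    using s A by (intro hinner_tendsto_left) auto
  then have "hinner gns A A = 0"
    using orth s by (simp add: LIMSEQ_const_iff)
  then show ?thesis using hilbert_space.hinner_eq_zero[OF hilbert_gns A] by simp
qed

end


section \<open>Normal states are countable sums of vector functionals\<close>

text \<open>
  A positive contraction \<open>T\<close> is the strong sum of the squares of the positive contractions
  \<open>T\<^sub>0 = T\<close>, \<open>T\<^sub>k\<^sub>+\<^sub>1 = T\<^sub>k - T\<^sub>k\<^sup>2\<close>.  These are polynomials in \<open>T\<close>, so they commute with everything
  that \<open>T\<close> commutes with.  The sequence replaces the square root of \<open>T\<close>.
\<close>

primrec square_remainder :: "'l hilbert \<Rightarrow> ('l \<Rightarrow> 'l) \<Rightarrow> nat \<Rightarrow> 'l \<Rightarrow> 'l" where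
  "square_remainder L T 0 = T"
| "square_remainder L T (Suc k) =
    (\<lambda>\<kappa>. square_remainder L T k \<kappa> \<ominus>\<^bsub>L\<^esub> square_remainder L T k (square_remainder L T k \<kappa>))"

lemma square_remainder_contraction:
  assumes L: "hilbert_space L" and T: "adjoint_pair L L T T"
    and pos: "\<And>\<kappa>. \<kappa> \<in> carrier L \<Longrightarrow> 0 \<le> Re (hinner L (T \<kappa>) \<kappa>)"
    and contr: "\<And>\<kappa>. \<kappa> \<in> carrier L \<Longrightarrow> Re (hinner L (T \<kappa>) \<kappa>) \<le> (hnorm L \<kappa>)\<^sup>2"
  shows "adjoint_pair L L (square_remainder L T k) (square_remainder L T k) \<and>
    (\<forall>\<kappa>\<in>carrier L. 0 \<le> Re (hinner L (square_remainder L T k \<kappa>) \<kappa>) \<and>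
       Re (hinner L (square_remainder L T k \<kappa>) \<kappa>) \<le> (hnorm L \<kappa>)\<^sup>2)"
proof (induction k)
  case (Suc k)
  define S where "S = square_remainder L T k"
  have S: "adjoint_pair L L S S"
    and Spos: "\<And>\<kappa>. \<kappa> \<in> carrier L \<Longrightarrow> 0 \<le> Re (hinner L (S \<kappa>) \<kappa>)"
    and Scontr: "\<And>\<kappa>. \<kappa> \<in> carrier L \<Longrightarrow> Re (hinner L (S \<kappa>) \<kappa>) \<le> (hnorm L \<kappa>)\<^sup>2"
    using Suc by (auto simp: S_def)
  note [simp] = L adjoint_pair_closed(1)[OF S]
  have "adjoint_pair L L (\<lambda>\<kappa>. S \<kappa> \<oplus>\<^bsub>L\<^esub> (-1) \<odot>\<^bsub>L\<^esub> S (S \<kappa>)) (\<lambda>\<kappa>. S \<kappa> \<oplus>\<^bsub>L\<^esub> cnj (-1) \<odot>\<^bsub>L\<^esub> S (S \<kappa>))"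
    by (rule adjoint_pair_lincomb[OF L L S adjoint_pair_comp[OF L L L S S]])
  then have pair: "adjoint_pair L L (\<lambda>\<kappa>. S \<kappa> \<ominus>\<^bsub>L\<^esub> S (S \<kappa>)) (\<lambda>\<kappa>. S \<kappa> \<ominus>\<^bsub>L\<^esub> S (S \<kappa>))"
    unfolding adjoint_pair_def by (auto simp: hminus_conv)
  have "0 \<le> Re (hinner L (S \<kappa> \<ominus>\<^bsub>L\<^esub> S (S \<kappa>)) \<kappa>)" "Re (hinner L (S \<kappa> \<ominus>\<^bsub>L\<^esub> S (S \<kappa>)) \<kappa>) \<le> (hnorm L \<kappa>)\<^sup>2"
    if k: "\<kappa> \<in> carrier L" for \<kappa>
  proof -
    have e: "hinner L (S (S \<kappa>)) \<kappa> = hinner L (S \<kappa>) (S \<kappa>)"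
      using k by (simp add: adjoint_pair_left[OF S, of "S \<kappa>" \<kappa>])
    then have d: "Re (hinner L (S \<kappa> \<ominus>\<^bsub>L\<^esub> S (S \<kappa>)) \<kappa>) = Re (hinner L (S \<kappa>) \<kappa>) - (hnorm L (S \<kappa>))\<^sup>2"
      using k by (simp add: hnorm_power2)
    then show "Re (hinner L (S \<kappa> \<ominus>\<^bsub>L\<^esub> S (S \<kappa>)) \<kappa>) \<le> (hnorm L \<kappa>)\<^sup>2"
      using Scontr[OF k] zero_le_power2[of "hnorm L (S \<kappa>)"] by linarith
    \<comment> \<open>\<open>S - S\<^sup>2 = S (1 - S) S + (1 - S) S (1 - S)\<close>\<close>
    have "S (\<kappa> \<ominus>\<^bsub>L\<^esub> S \<kappa>) = S \<kappa> \<ominus>\<^bsub>L\<^esub> S (S \<kappa>)"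
      using k by (simp add: adjoint_pair_minus[OF L L S])
    then have "Re (hinner L (S (\<kappa> \<ominus>\<^bsub>L\<^esub> S \<kappa>)) (\<kappa> \<ominus>\<^bsub>L\<^esub> S \<kappa>))
      = Re (hinner L (S \<kappa>) \<kappa>) - 2 * (hnorm L (S \<kappa>))\<^sup>2 + Re (hinner L (S (S \<kappa>)) (S \<kappa>))"
      using k by (simp add: e hnorm_power2)
    then show "0 \<le> Re (hinner L (S \<kappa> \<ominus>\<^bsub>L\<^esub> S (S \<kappa>)) \<kappa>)"
      using d Spos[of "\<kappa> \<ominus>\<^bsub>L\<^esub> S \<kappa>"] Scontr[of "S \<kappa>"] k by simp
  qed
  then show ?case using pair by (simp add: S_def)
qed (use assms in auto)

lemma square_remainder_commute:
  assumes L: "hilbert_space L" and T: "\<And>\<kappa>. \<kappa> \<in> carrier L \<Longrightarrow> T \<kappa> \<in> carrier L"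
    and x: "adjoint_pair L L x x'"
    and comm: "\<And>\<kappa>. \<kappa> \<in> carrier L \<Longrightarrow> T (x \<kappa>) = x (T \<kappa>)"
  shows "\<forall>\<kappa>\<in>carrier L. square_remainder L T k \<kappa> \<in> carrier L \<and>
    square_remainder L T k (x \<kappa>) = x (square_remainder L T k \<kappa>)"
  by (induction k) (use assms adjoint_pair_closed[OF x] adjoint_pair_minus[OF L L x] in auto)

text \<open>  The definition of the remainders telescopes to \<open>T = \<Sum>k<n. T\<^sub>k\<^sup>2 + T\<^sub>n\<close>.  This bounds \<open>\<Sum>k<n. \<parallel>T\<^sub>k \<zeta>\<parallel>\<^sup>2\<close> by
  \<open>\<langle>\<zeta>, T \<zeta>\<rangle>\<close>, so \<open>T\<^sub>n \<zeta>\<close> tends to \<open>0\<close> and \<open>T \<zeta> = \<Sum>k. T\<^sub>k\<^sup>2 \<zeta>\<close> weakly.\<close>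

lemma positive_contraction_decomposition:
  assumes L: "hilbert_space L" and T: "adjoint_pair L L T T"
    and pos: "\<And>\<kappa>. \<kappa> \<in> carrier L \<Longrightarrow> 0 \<le> Re (hinner L (T \<kappa>) \<kappa>)"
    and contr: "\<And>\<kappa>. \<kappa> \<in> carrier L \<Longrightarrow> Re (hinner L (T \<kappa>) \<kappa>) \<le> (hnorm L \<kappa>)\<^sup>2"
    and \<zeta>: "\<zeta> \<in> carrier L"
  shows "\<exists>\<tau>. square_summable L \<tau> \<and>
    (\<forall>x x'. adjoint_pair L L x x' \<longrightarrow> (\<forall>\<kappa>\<in>carrier L. T (x \<kappa>) = x (T \<kappa>)) \<longrightarrow>
       (\<lambda>k. hinner L (x (\<tau> k)) (\<tau> k)) sums hinner L (x \<zeta>) (T \<zeta>))"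
proof -
  define S where "S = square_remainder L T"
  have S: "adjoint_pair L L (S k) (S k)"
    and Spos: "\<And>\<kappa>. \<kappa> \<in> carrier L \<Longrightarrow> 0 \<le> Re (hinner L (S k \<kappa>) \<kappa>)" for k
    using square_remainder_contraction[OF L T pos contr] by (auto simp: S_def)
  note [simp] = L \<zeta> adjoint_pair_closed(1)[OF S]
  have partial: "hinner L \<mu> (T \<zeta>) = (\<Sum>k<n. hinner L (S k \<mu>) (S k \<zeta>)) + hinner L \<mu> (S n \<zeta>)"
    if "\<mu> \<in> carrier L" for \<mu> n
  proof (induction n)
    case (Suc n)
    have "hinner L \<mu> (S (Suc n) \<zeta>) = hinner L \<mu> (S n \<zeta>) - hinner L (S n \<mu>) (S n \<zeta>)"
      using that by (simp add: S_def[of] adjoint_pair_left[OF S[unfolded S_def]] adjoint_pair_closed(1)[OF S[unfolded S_def]])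
    then show ?case using Suc by simp
  qed (simp add: S_def)
  have sq: "(\<Sum>k<n. (hnorm L (S k \<zeta>))\<^sup>2) \<le> Re (hinner L \<zeta> (T \<zeta>))" for n
  proof -
    have "hinner L \<zeta> (S n \<zeta>) = hinner L (S n \<zeta>) \<zeta>" by (simp add: adjoint_pair_left[OF S])
    then have "Re (hinner L \<zeta> (T \<zeta>)) = (\<Sum>k<n. (hnorm L (S k \<zeta>))\<^sup>2) + Re (hinner L (S n \<zeta>) \<zeta>)"
      using partial[of \<zeta> n] by (simp add: hnorm_power2)
    then show ?thesis using Spos[of \<zeta> n] by simp
  qed
  have summ: "summable (\<lambda>k. (hnorm L (S k \<zeta>))\<^sup>2)"
    by (rule summableI_nonneg_bounded[OF _ sq]) simp
  have ss: "square_summable L (\<lambda>k. S k \<zeta>)"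
    using summ by (auto simp: square_summable_def)
  have lim0: "(\<lambda>k. hnorm L (S k \<zeta>)) \<longlonglongrightarrow> 0"
    using tendsto_real_sqrt[OF summable_LIMSEQ_zero[OF summ]] by (simp add: real_sqrt_abs)
  have "(\<lambda>k. hinner L (x (S k \<zeta>)) (S k \<zeta>)) sums hinner L (x \<zeta>) (T \<zeta>)"
    if x: "adjoint_pair L L x x'" and comm: "\<forall>\<kappa>\<in>carrier L. T (x \<kappa>) = x (T \<kappa>)" for x x'
    unfolding sums_def
  proof -
    have xc: "x \<zeta> \<in> carrier L" using adjoint_pair_closed[OF x] by simp
    have c: "S k (x \<zeta>) = x (S k \<zeta>)" for k
      using square_remainder_commute[OF L adjoint_pair_closed(1)[OF T] x] comm by (simp add: S_def)
    have l: "(\<lambda>n. hnorm L (x \<zeta>) * hnorm L (S n \<zeta>)) \<longlonglongrightarrow> 0"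
      using tendsto_mult_left[OF lim0, of "hnorm L (x \<zeta>)"] by simp
    have z: "(\<lambda>n. hinner L (x \<zeta>) (S n \<zeta>)) \<longlonglongrightarrow> 0"
      by (rule Lim_null_comparison[OF _ l]) (use xc in \<open>auto intro!: always_eventually hcauchy_schwarz\<close>)
    have "(\<Sum>k<n. hinner L (x (S k \<zeta>)) (S k \<zeta>)) = hinner L (x \<zeta>) (T \<zeta>) - hinner L (x \<zeta>) (S n \<zeta>)" for n
      using partial[OF xc, of n] by (simp add: c)
    then show "(\<lambda>n. \<Sum>k<n. hinner L (x (S k \<zeta>)) (S k \<zeta>)) \<longlonglongrightarrow> hinner L (x \<zeta>) (T \<zeta>)"
      using tendsto_diff[OF tendsto_const z, of "hinner L (x \<zeta>) (T \<zeta>)"] by simp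
  qed
  then show ?thesis using ss by blast
qed

lemma ampl_lincomb:
  assumes "hilbert_space H" "x \<in> carrier (bop H)" "y \<in> carrier (bop H)" "a \<in> carrier (ell2 H)"
  shows "ampl H (x \<oplus>\<^bsub>bop H\<^esub> c \<odot>\<^bsub>bop H\<^esub> y) a = ampl H x a \<oplus>\<^bsub>ell2 H\<^esub> c \<odot>\<^bsub>ell2 H\<^esub> ampl H y a"
  using assms by (auto elim!: ell2_cases simp: fun_eq_iff)

lemma ampl_mult:
  assumes "hilbert_space H" "x \<in> carrier (bop H)" "y \<in> carrier (bop H)" "a \<in> carrier (ell2 H)"
  shows "ampl H (x \<otimes>\<^bsub>bop H\<^esub> y) a = ampl H x (ampl H y a)"
  using assms by (auto elim!: ell2_cases simp: fun_eq_iff)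

lemma ampl_one:
  assumes "a \<in> carrier (ell2 H)"
  shows "ampl H \<one>\<^bsub>bop H\<^esub> a = a"
  using assms by (auto elim!: ell2_cases simp: fun_eq_iff)

lemma (in state_on_algebra) form_mult_left:
  assumes "x \<in> R" "y \<in> R" "z \<in> R"
  shows "form (x \<otimes>\<^bsub>bop H\<^esub> y) z = form y (adj H x \<otimes>\<^bsub>bop H\<^esub> z)"
proof -
  have "adj H z \<otimes>\<^bsub>bop H\<^esub> (x \<otimes>\<^bsub>bop H\<^esub> y) = (adj H z \<otimes>\<^bsub>bop H\<^esub> x) \<otimes>\<^bsub>bop H\<^esub> y"
    using assms by (intro bop_eqI[of _ H]) auto
  then show ?thesis using assms by (simp add: gns_form_def)
qed

lemma (in state_on_algebra) form_one: "x \<in> R \<Longrightarrow> form x \<one>\<^bsub>bop H\<^esub> = \<omega> x"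
proof -
  assume x: "x \<in> R"
  have "\<one>\<^bsub>bop H\<^esub> \<otimes>\<^bsub>bop H\<^esub> x = x" using x by (intro bop_eqI[of _ H]) auto
  then show ?thesis by (simp add: gns_form_def)
qed

text \<open>
  An ultraweakly continuous functional is \<open>x \<mapsto> \<langle>(x \<otimes> 1) \<xi>, \<eta>\<rangle>\<close> on the countable multiple of \<open>H\<close>.  If it is
  positive, it is dominated by the vector functional of \<open>\<xi> + \<eta>\<close>, so it has a density \<open>T\<close> with
  respect to that functional in the commutant of the algebra; here \<open>T = F\<^sup>* F\<close> for the contraction
  \<open>F\<close> from the multiple of \<open>H\<close> to the GNS space.
\<close>

lemma normal_state_decomposition:
  fixes H :: "'h hilbert"
  assumes H: "hilbert_space H" and R: "von_neumann_algebra H R" and \<omega>: "normal_state H R \<omega>"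
  shows "\<exists>\<zeta>. square_summable H \<zeta> \<and> (\<forall>x\<in>R. ((\<lambda>n. hinner H (x (\<zeta> n)) (\<zeta> n)) has_sum \<omega> x) UNIV)"
proof -
  interpret state_on_algebra H R \<omega>
    by (rule state_on_algebra.intro[OF H R]) (use \<omega> in \<open>simp add: normal_state_def\<close>)
  define L where "L = (ell2 H :: ('h, unit) universe hilbert)"
  have L [simp]: "hilbert_space L" by (simp add: L_def)
  have A: "adjoint_pair L L (ampl H x) (ampl H (adj H x))" if "x \<in> R" for x
    unfolding L_def using that by (intro ampl_pair) auto
  note [simp] = adjoint_pair_closed(1)[OF A]
  obtain \<xi> \<eta> where \<xi>: "square_summable H \<xi>" and \<eta>: "square_summable H \<eta>"
    and rep: "\<forall>x\<in>R. \<omega> x = (\<Sum>n. hinner H (x (\<xi> n)) (\<eta> n))"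
    using uw_functional_representation[OF H R state_add state_smult] \<omega> by (auto simp: normal_state_def)
  define a b where "a = (Inl \<xi> :: ('h, unit) universe)" and "b = (Inl \<eta> :: ('h, unit) universe)"
  have ab [simp]: "a \<in> carrier L" "b \<in> carrier L" using \<xi> \<eta> by (auto simp: a_def b_def L_def)
  have \<omega>ab: "\<omega> x = hinner L (ampl H x a) b" if x: "x \<in> R" for x
  proof -
    have "hinner L (Inl (\<lambda>n. x (\<xi> n))) (Inl \<eta>) = (\<Sum>n. hinner H (x (\<xi> n)) (\<eta> n))"
      unfolding L_def using x \<xi> \<eta> by (intro ell2_hinner_eqI uw_has_sum) auto
    then show ?thesis using rep x \<xi> by (simp add: a_def b_def)
  qed
  define \<zeta> where "\<zeta> = a \<oplus>\<^bsub>L\<^esub> b"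
  have \<zeta> [simp]: "\<zeta> \<in> carrier L" by (simp add: \<zeta>_def)
  define u where "u x = ampl H x \<zeta>" for x
  have u [simp]: "u x \<in> carrier L" if "x \<in> R" for x using that by (simp add: u_def)
  \<comment> \<open>domination: \<open>\<parallel>p + q\<parallel>\<^sup>2 = \<parallel>p - q\<parallel>\<^sup>2 + 4 Re \<langle>p, q\<rangle>\<close>, where \<open>\<langle>p, q\<rangle> = \<omega> (x\<^sup>* x)\<close> is nonnegative\<close>
  have dom: "seminorm x \<le> 1 * hnorm L (u x)" if x: "x \<in> R" for x
  proof -
    let ?p = "ampl H x a" and ?q = "ampl H x b"
    have "\<omega> (adj H x \<otimes>\<^bsub>bop H\<^esub> x) = hinner L ?p ?q"
      using x by (simp add: \<omega>ab ampl_mult L_def[symmetric] ab[unfolded L_def]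
          adjoint_pair_left[OF A, of "adj H x" ?p b])
    then have s: "(seminorm x)\<^sup>2 = Re (hinner L ?p ?q)"
      using x by (simp add: seminorm_power2 gns_form_def)
    have up: "u x = ?p \<oplus>\<^bsub>L\<^esub> ?q"
      unfolding u_def \<zeta>_def by (rule adjoint_pair_add[OF L L A[OF x]]) auto
    have "(hnorm L (u x))\<^sup>2 = (hnorm L (?p \<ominus>\<^bsub>L\<^esub> ?q))\<^sup>2 + 4 * Re (hinner L ?p ?q)"
    proof -
      have "cnj (hinner L ?p ?q) = hinner L ?q ?p" using x by (intro hinner_cnj) auto
      then have "Re (hinner L ?q ?p) = Re (hinner L ?p ?q)" using cnj.sel(1) by metis
      then show ?thesis using x by (simp add: up hnorm_power2)
    qed
    then have "(seminorm x)\<^sup>2 \<le> (hnorm L (u x))\<^sup>2"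
      using s zero_le_power2[of "hnorm L (?p \<ominus>\<^bsub>L\<^esub> ?q)"] zero_le_power2[of "seminorm x"] by linarith
    then have "seminorm x \<le> hnorm L (u x)" by (rule power2_le_imp_le) (use x in simp)
    then show ?thesis by simp
  qed
  have lin: "\<exists>k\<in>R. u k = u i \<oplus>\<^bsub>L\<^esub> c \<odot>\<^bsub>L\<^esub> u j \<and> embed k = embed i \<oplus>\<^bsub>gns\<^esub> c \<odot>\<^bsub>gns\<^esub> embed j"
    if "i \<in> R" "j \<in> R" for i j c
    using that \<zeta> unfolding u_def L_def
    by (intro bexI[of _ "i \<oplus>\<^bsub>bop H\<^esub> c \<odot>\<^bsub>bop H\<^esub> j"]) (auto simp: ampl_lincomb embed_lincomb)
  have dom': "hnorm gns (embed x) \<le> 1 * hnorm L (u x)" if "x \<in> R" for x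
    using dom[OF that] that by (simp add: embed_hnorm)
  have ne: "R \<noteq> {}" using vn_closed(1)[OF H R] by blast
  have ec: "embed x \<in> carrier gns" if "x \<in> R" for x using that by simp
  obtain F G where FG: "adjoint_pair L gns F G" and F: "\<And>x. x \<in> R \<Longrightarrow> F (u x) = embed x"
    and Fb: "\<And>\<kappa>. \<kappa> \<in> carrier L \<Longrightarrow> hnorm gns (F \<kappa>) \<le> 1 * hnorm L \<kappa>"
    and F0: "\<And>\<kappa>. \<kappa> \<in> carrier L \<Longrightarrow> (\<And>x. x \<in> R \<Longrightarrow> hinner L (u x) \<kappa> = 0) \<Longrightarrow> F \<kappa> = \<zero>\<^bsub>gns\<^esub>"
    by (rule extend_operator[OF L hilbert_gns u ec ne lin zero_le_one dom']) (assumption | rule that | blast)+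
  note [simp] = adjoint_pair_closed[OF FG]
  note GF = adjoint_pair_sym[OF L hilbert_gns FG]
  define T where "T \<kappa> = G (F \<kappa>)" for \<kappa>
  have T: "adjoint_pair L L T T"
    unfolding T_def[abs_def] by (rule adjoint_pair_comp[OF L hilbert_gns L FG GF])
  have Tin: "hinner L (T \<kappa>) \<mu> = hinner gns (F \<kappa>) (F \<mu>)" if "\<kappa> \<in> carrier L" "\<mu> \<in> carrier L" for \<kappa> \<mu>
    using that by (simp add: T_def adjoint_pair_left[OF GF])
  note [simp] = adjoint_pair_closed(1)[OF T]
  have orth_inv: "hinner L (u y) (ampl H x \<kappa>) = 0"
    if "\<kappa> \<in> carrier L" "\<And>x. x \<in> R \<Longrightarrow> hinner L (u x) \<kappa> = 0" "x \<in> R" "y \<in> R" for x y \<kappa>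
  proof -
    have "hinner L (u y) (ampl H x \<kappa>) = hinner L (ampl H (adj H x) (u y)) \<kappa>"
      using that(1,3,4) by (intro adjoint_pair_right[OF L L A]) auto
    also have "ampl H (adj H x) (u y) = u (adj H x \<otimes>\<^bsub>bop H\<^esub> y)"
      unfolding u_def using that(3,4) \<zeta> unfolding L_def by (intro ampl_mult[symmetric]) auto
    finally show ?thesis using that(3,4) that(2)[of "adj H x \<otimes>\<^bsub>bop H\<^esub> y"] by simp
  qed
  have mult_u: "ampl H x (u y) = u (x \<otimes>\<^bsub>bop H\<^esub> y)" if "x \<in> R" "y \<in> R" for x y
    unfolding u_def using that \<zeta> unfolding L_def by (intro ampl_mult[symmetric]) auto
  have comm: "T (ampl H x \<kappa>) = ampl H x (T \<kappa>)" if x: "x \<in> R" and \<kappa>: "\<kappa> \<in> carrier L" for x \<kappa>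
  proof (rule operators_agree[OF L L adjoint_pair_comp[OF L L L A[OF x] T] adjoint_pair_comp[OF L L L T A[OF x]] u _ _ \<kappa>])
    show "T (ampl H x (u y)) = ampl H x (T (u y))" if y: "y \<in> R" for y
    proof -
      let ?d = "T (ampl H x (u y)) \<ominus>\<^bsub>L\<^esub> ampl H x (T (u y))"
      have dc: "?d \<in> carrier L" using x y by simp
      have lhs: "hinner L (T (ampl H x (u y))) \<mu> = hinner gns (embed (x \<otimes>\<^bsub>bop H\<^esub> y)) (F \<mu>)"
        if "\<mu> \<in> carrier L" for \<mu>
        using that x y by (simp add: mult_u Tin F)
      have rhs: "hinner L (ampl H x (T (u y))) \<mu> = hinner gns (embed y) (F (ampl H (adj H x) \<mu>))"
        if "\<mu> \<in> carrier L" for \<mu>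
        using that x y by (simp add: adjoint_pair_left[OF A] Tin F)
      have orth: "hinner L (u z) ?d = 0" if z: "z \<in> R" for z
      proof -
        have "hinner L ?d (u z) = form (x \<otimes>\<^bsub>bop H\<^esub> y) z - form y (adj H x \<otimes>\<^bsub>bop H\<^esub> z)"
          using x y z lhs[of "u z"] rhs[of "u z"] by (simp add: mult_u F embed_hinner)
        then have "hinner L ?d (u z) = 0" using form_mult_left[OF x y z] by simp
        then show ?thesis using hinner_cnj[OF L dc u[OF z]] by simp
      qed
      have "hinner L ?d ?d = hinner gns (embed (x \<otimes>\<^bsub>bop H\<^esub> y)) (F ?d) - hinner gns (embed y) (F (ampl H (adj H x) ?d))"
        using x y dc by (simp add: lhs rhs del: hinner_simps(8))
      also have "F ?d = \<zero>\<^bsub>gns\<^esub>" by (rule F0[OF dc orth])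
      also have "F (ampl H (adj H x) ?d) = \<zero>\<^bsub>gns\<^esub>"
        using orth_inv[OF dc orth] x dc by (intro F0) auto
      finally have "hinner L ?d ?d = 0" using x y by simp
      then show ?thesis using x y hdiff_eq_zero_iff[OF L, of "T (ampl H x (u y))" "ampl H x (T (u y))"]
        by (simp add: hnorm_def)
    qed
    show "T (ampl H x \<mu>) = ampl H x (T \<mu>)" if m: "\<mu> \<in> carrier L" "\<And>y. y \<in> R \<Longrightarrow> hinner L (u y) \<mu> = 0" for \<mu>
    proof -
      have "F \<mu> = \<zero>\<^bsub>gns\<^esub>" by (rule F0[OF m])
      moreover have "F (ampl H x \<mu>) = \<zero>\<^bsub>gns\<^esub>"
        using orth_inv[OF m x] m x by (intro F0) auto
      ultimately show ?thesis
        by (simp add: T_def adjoint_pair_zero[OF hilbert_gns L GF] adjoint_pair_zero[OF L L A[OF x]])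
    qed
  qed
  have pos: "0 \<le> Re (hinner L (T \<kappa>) \<kappa>)" "Re (hinner L (T \<kappa>) \<kappa>) \<le> (hnorm L \<kappa>)\<^sup>2" if "\<kappa> \<in> carrier L" for \<kappa>
  proof -
    have "Re (hinner L (T \<kappa>) \<kappa>) = (hnorm gns (F \<kappa>))\<^sup>2" using that by (simp add: Tin hnorm_power2)
    then show "0 \<le> Re (hinner L (T \<kappa>) \<kappa>)" "Re (hinner L (T \<kappa>) \<kappa>) \<le> (hnorm L \<kappa>)\<^sup>2"
      using Fb[OF that] that by (auto intro!: power_mono)
  qed
  obtain \<tau> where \<tau>: "square_summable L \<tau>"
    and sums: "\<And>x x'. adjoint_pair L L x x' \<Longrightarrow> (\<forall>\<kappa>\<in>carrier L. T (x \<kappa>) = x (T \<kappa>)) \<Longrightarrow>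
       (\<lambda>k. hinner L (x (\<tau> k)) (\<tau> k)) sums hinner L (x \<zeta>) (T \<zeta>)"
    using positive_contraction_decomposition[OF L T pos \<zeta>] by blast
  have val: "hinner L (ampl H x \<zeta>) (T \<zeta>) = \<omega> x" if x: "x \<in> R" for x
  proof -
    have z1: "\<zeta> = u \<one>\<^bsub>bop H\<^esub>" using \<zeta> unfolding u_def L_def by (simp add: ampl_one)
    have "hinner L (ampl H x \<zeta>) (T \<zeta>) = hinner gns (F (u x)) (F (u \<one>\<^bsub>bop H\<^esub>))"
      unfolding u_def[of x, symmetric] z1[symmetric] T_def
      using x by (simp add: adjoint_pair_left[OF FG, of "u x"])
    then show ?thesis using x by (simp add: F embed_hinner form_one)
  qed
  have "\<forall>k. \<exists>f. \<tau> k = Inl f \<and> square_summable H f"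
    using \<tau> ell2_cases unfolding L_def by (metis square_summable_vec)
  then obtain f where f: "\<And>k. \<tau> k = Inl (f k)" "\<And>k. square_summable H (f k)" by metis
  let ?\<kappa> = "\<lambda>p::nat \<times> nat. f (fst p) (snd p)"
  \<comment> \<open>a square-summable sequence in the multiple is a square-summable double sequence in \<open>H\<close>\<close>
  have fs: "(\<lambda>p. (hnorm H (?\<kappa> p))\<^sup>2) summable_on (UNIV \<times> UNIV)"
  proof (rule summable_on_SigmaI)
    show "((\<lambda>n. (hnorm H (f (fst (k, n)) (snd (k, n))))\<^sup>2) has_sum (hnorm L (\<tau> k))\<^sup>2) UNIV" for k
      unfolding f(1) L_def fst_conv snd_conv by (rule ell2_hnorm_has_sum[OF H f(2)])
    show "(\<lambda>k. (hnorm L (\<tau> k))\<^sup>2) summable_on UNIV" using \<tau> by (simp add: square_summable_iff)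
  qed simp
  have val': "((\<lambda>p. hinner H (x (?\<kappa> p)) (?\<kappa> p)) has_sum \<omega> x) (UNIV \<times> UNIV)" if x: "x \<in> R" for x
  proof -
    have "(\<lambda>p. hinner H (x (?\<kappa> p)) (?\<kappa> p)) summable_on (UNIV \<times> UNIV)"
    proof (rule abs_summable_summable[OF abs_summable_hinner[OF H _ _ _ fs]])
      show "(\<lambda>p. (hnorm H (x (?\<kappa> p)))\<^sup>2) summable_on (UNIV \<times> UNIV)"
        using summable_bounded_image[OF H H adj_pair(1)[OF H R_bop[OF x]] _ fs] f(2) by simp
    qed (use x f in auto)
    then obtain s where s: "((\<lambda>p. hinner H (x (?\<kappa> p)) (?\<kappa> p)) has_sum s) (UNIV \<times> UNIV)"
      by (auto simp: summable_on_def)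
    have "((\<lambda>k. hinner L (ampl H x (\<tau> k)) (\<tau> k)) has_sum s) UNIV"
    proof (rule has_sum_SigmaD[OF s])
      show "((\<lambda>n. hinner H (x (f (fst (k, n)) (snd (k, n)))) (f (fst (k, n)) (snd (k, n)))) has_sum
          hinner L (ampl H x (\<tau> k)) (\<tau> k)) UNIV" for k
        using ell2_hinner[OF H square_summable_bop[OF H R_bop[OF x] f(2)] f(2), of k k, where 'b = unit] f x
        by (simp add: L_def)
    qed
    then have "s = hinner L (ampl H x \<zeta>) (T \<zeta>)"
      using sums[OF A[OF x]] comm[OF x] has_sum_imp_sums sums_unique2 by blast
    then show ?thesis using s val[OF x] by simp
  qed
  obtain z where z: "square_summable H z" "\<And>g :: 'h \<Rightarrow> complex. g \<zero>\<^bsub>H\<^esub> = 0 \<Longrightarrow>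
      (\<forall>t. ((\<lambda>p. g (?\<kappa> p)) has_sum t) (UNIV \<times> UNIV) \<longleftrightarrow> ((\<lambda>n. g (z n)) has_sum t) UNIV)"
    using square_summable_family_enum[OF H _ fs] f(2) by auto
  have "((\<lambda>n. hinner H (x (z n)) (z n)) has_sum \<omega> x) UNIV" if x: "x \<in> R" for x
    using z(2)[of "\<lambda>v. hinner H (x v) v"] val'[OF x] x by simp
  then show ?thesis using z(1) by blast
qed


section \<open>Normal representations and their intertwiners\<close>

lemma star_representationD:
  assumes "star_representation H R K \<pi>"
  shows "x \<in> R \<Longrightarrow> \<pi> x \<in> carrier (bop K)"
    "x \<in> R \<Longrightarrow> y \<in> R \<Longrightarrow> \<pi> (x \<oplus>\<^bsub>bop H\<^esub> y) = \<pi> x \<oplus>\<^bsub>bop K\<^esub> \<pi> y"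
    "x \<in> R \<Longrightarrow> \<pi> (c \<odot>\<^bsub>bop H\<^esub> x) = c \<odot>\<^bsub>bop K\<^esub> \<pi> x"
    "x \<in> R \<Longrightarrow> y \<in> R \<Longrightarrow> \<pi> (x \<otimes>\<^bsub>bop H\<^esub> y) = \<pi> x \<otimes>\<^bsub>bop K\<^esub> \<pi> y"
    "x \<in> R \<Longrightarrow> \<pi> (adj H x) = adj K (\<pi> x)"
    "\<pi> \<one>\<^bsub>bop H\<^esub> = \<one>\<^bsub>bop K\<^esub>"
  using assms unfolding star_representation_def by auto

text \<open>
  The form of normality that is shared by the normal representations and the GNS representation of
  a normal state: every positive vector functional \<open>x \<mapsto> \<langle>\<pi>(x) \<kappa>, \<kappa>\<rangle>\<close> is a countable sum of vector
  functionals of the identity representation.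
\<close>

definition spatially_normal ::
  "'h hilbert \<Rightarrow> ('h \<Rightarrow> 'h) set \<Rightarrow> 'k hilbert \<Rightarrow> (('h \<Rightarrow> 'h) \<Rightarrow> 'k \<Rightarrow> 'k) \<Rightarrow> bool" where
  "spatially_normal H R K \<pi> \<longleftrightarrow> star_representation H R K \<pi> \<and>
     (\<forall>\<kappa>\<in>carrier K. \<exists>\<zeta>. square_summable H \<zeta> \<and>
        (\<forall>x\<in>R. ((\<lambda>n. hinner H (x (\<zeta> n)) (\<zeta> n)) has_sum hinner K (\<pi> x \<kappa>) \<kappa>) UNIV))"

text \<open>
  A cyclic subrepresentation is equivalent to a subrepresentation of the countable multiple of the
  identity representation: evaluating the assumption at \<open>x\<^sup>* x\<close> shows that \<open>\<pi>(x) \<kappa> \<mapsto> (x \<zeta>\<^sub>n)\<^sub>n\<close> is isometric.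
\<close>

lemma cyclic_subrepresentation:
  fixes H :: "'h hilbert"
  defines "L \<equiv> ell2 H :: ('h, 'u) universe hilbert"
  assumes H: "hilbert_space H" and K: "hilbert_space K" and R: "von_neumann_algebra H R"
    and \<pi>: "star_representation H R K \<pi>"
    and \<kappa>: "\<kappa> \<in> carrier K" and \<zeta>: "square_summable H \<zeta>"
    and sum: "\<And>x. x \<in> R \<Longrightarrow> ((\<lambda>n. hinner H (x (\<zeta> n)) (\<zeta> n)) has_sum hinner K (\<pi> x \<kappa>) \<kappa>) UNIV"
  shows "\<exists>F G. adjoint_pair K L F G \<and> F \<kappa> = Inl \<zeta> \<and>
    (\<forall>x\<in>R. \<forall>\<mu>\<in>carrier K. F (\<pi> x \<mu>) = ampl H x (F \<mu>)) \<and> (\<forall>x\<in>R. G (ampl H x (Inl \<zeta>)) = \<pi> x \<kappa>)"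
proof -
  note [simp] = H K R \<kappa> \<zeta> vn_subset[OF R] star_representationD(1)[OF \<pi>]
  have L [simp]: "hilbert_space L" by (simp add: L_def)
  have A: "adjoint_pair L L (ampl H x) (ampl H (adj H x))" if "x \<in> R" for x
    unfolding L_def using that by (intro ampl_pair) auto
  have z [simp]: "Inl \<zeta> \<in> carrier L" by (simp add: L_def)
  define u where "u x = \<pi> x \<kappa>" for x
  define v where "v x = ampl H x (Inl \<zeta> :: ('h, 'u) universe)" for x
  have u: "u x \<in> carrier K" if "x \<in> R" for x using that by (simp add: u_def)
  have v: "v x \<in> carrier L" if "x \<in> R" for x
    unfolding v_def using that by (intro adjoint_pair_closed(1)[OF A]) auto
  have ne: "R \<noteq> {}" using vn_closed(1)[OF H R] by blast
  have lin: "\<exists>k\<in>R. u k = u i \<oplus>\<^bsub>K\<^esub> c \<odot>\<^bsub>K\<^esub> u j \<and> v k = v i \<oplus>\<^bsub>L\<^esub> c \<odot>\<^bsub>L\<^esub> v j"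
    if "i \<in> R" "j \<in> R" for i j c
    using that unfolding u_def v_def L_def
    by (intro bexI[of _ "i \<oplus>\<^bsub>bop H\<^esub> c \<odot>\<^bsub>bop H\<^esub> j"])
       (auto simp: star_representationD(2,3)[OF \<pi>])
  have isom: "hnorm L (v x) = hnorm K (u x)" if x: "x \<in> R" for x
  proof -
    have "hinner K (\<pi> (adj H x \<otimes>\<^bsub>bop H\<^esub> x) \<kappa>) \<kappa> = complex_of_real ((hnorm K (u x))\<^sup>2)"
      using x by (simp add: star_representationD(4,5)[OF \<pi>] hinner_adj hinner_self u_def)
    then have "((\<lambda>n. complex_of_real ((hnorm H (x (\<zeta> n)))\<^sup>2)) has_sum complex_of_real ((hnorm K (u x))\<^sup>2)) UNIV"
      using sum[of "adj H x \<otimes>\<^bsub>bop H\<^esub> x"] x by (simp add: hinner_adj hinner_self)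
    then have "((\<lambda>n. (hnorm H (x (\<zeta> n)))\<^sup>2) has_sum (hnorm K (u x))\<^sup>2) UNIV"
      by (subst (asm) has_sum_of_real_iff)
    moreover have "((\<lambda>n. (hnorm H (x (\<zeta> n)))\<^sup>2) has_sum (hnorm L (v x))\<^sup>2) UNIV"
      using x unfolding v_def L_def by (simp add: ell2_hnorm_has_sum)
    ultimately have "(hnorm L (v x))\<^sup>2 = (hnorm K (u x))\<^sup>2" by (metis has_sum_unique)
    then show ?thesis using u[OF x] v[OF x] by (simp add: power2_eq_iff_nonneg)
  qed
  obtain F G where FG: "adjoint_pair K L F G" and F: "\<And>x. x \<in> R \<Longrightarrow> F (u x) = v x"
    and G: "\<And>x. x \<in> R \<Longrightarrow> G (v x) = u x"
    and F0: "\<And>\<mu>. \<mu> \<in> carrier K \<Longrightarrow> (\<And>x. x \<in> R \<Longrightarrow> hinner K (u x) \<mu> = 0) \<Longrightarrow> F \<mu> = \<zero>\<^bsub>L\<^esub>"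
    by (rule extend_isometry[OF K L u v ne lin isom]) (assumption | rule that | blast)+
  have "F (\<pi> x \<mu>) = ampl H x (F \<mu>)" if x: "x \<in> R" and \<mu>: "\<mu> \<in> carrier K" for x \<mu>
  proof (rule extension_intertwines[OF K L FG F F0 u adj_pair(1)[OF K] A[OF x] _ _ \<mu>])
    show "\<exists>k\<in>R. u k = \<pi> x (u y) \<and> v k = ampl H x (v y)" if "y \<in> R" for y
      using that x by (intro bexI[of _ "x \<otimes>\<^bsub>bop H\<^esub> y"])
        (auto simp: u_def v_def star_representationD(4)[OF \<pi>])
    show "\<exists>k\<in>R. u k = adj K (\<pi> x) (u y)" if "y \<in> R" for y
      using that x by (intro bexI[of _ "adj H x \<otimes>\<^bsub>bop H\<^esub> y"])
        (auto simp: u_def star_representationD(4,5)[OF \<pi>])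
  qed (use x in auto)
  moreover have "F \<kappa> = Inl \<zeta>"
    using F[of "\<one>\<^bsub>bop H\<^esub>"] by (simp add: u_def v_def star_representationD(6)[OF \<pi>])
  moreover have "\<forall>x\<in>R. G (ampl H x (Inl \<zeta>)) = \<pi> x \<kappa>"
    using G by (simp add: u_def v_def)
  ultimately show ?thesis using FG by blast
qed

definition intertwiners ::
  "'h hilbert \<Rightarrow> ('h \<Rightarrow> 'h) set \<Rightarrow> 'k hilbert \<Rightarrow> (('h \<Rightarrow> 'h) \<Rightarrow> 'k \<Rightarrow> 'k) \<Rightarrow> ('k \<Rightarrow> 'h) set" where
  "intertwiners H R K \<pi> =
     {T. (\<exists>S. adjoint_pair K H T S) \<and> (\<forall>x\<in>R. \<forall>\<kappa>\<in>carrier K. T (\<pi> x \<kappa>) = x (T \<kappa>))}"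

text \<open>  The components \<open>\<pi>(x) \<kappa> \<mapsto> x \<zeta>\<^sub>n\<close> of the embedding of the cyclic subspace of \<open>\<kappa>\<close> are intertwiners.  If
  all of them vanish at \<open>\<kappa>\<close>, then \<open>\<parallel>\<kappa>\<parallel>\<^sup>2 = \<Sum>n. \<parallel>\<zeta>\<^sub>n\<parallel>\<^sup>2 = 0\<close>.\<close>

lemma intertwiners_separate:
  fixes H :: "'h hilbert"
  assumes H: "hilbert_space H" and K: "hilbert_space K" and R: "von_neumann_algebra H R"
    and \<pi>: "spatially_normal H R K \<pi>"
    and \<kappa>: "\<kappa> \<in> carrier K" and zero: "\<And>T. T \<in> intertwiners H R K \<pi> \<Longrightarrow> T \<kappa> = \<zero>\<^bsub>H\<^esub>"
  shows "\<kappa> = \<zero>\<^bsub>K\<^esub>"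
proof -
  have sr: "star_representation H R K \<pi>" using \<pi> by (simp add: spatially_normal_def)
  obtain \<zeta> where \<zeta>: "square_summable H \<zeta>"
    and sum: "\<And>x. x \<in> R \<Longrightarrow> ((\<lambda>n. hinner H (x (\<zeta> n)) (\<zeta> n)) has_sum hinner K (\<pi> x \<kappa>) \<kappa>) UNIV"
    using \<pi> \<kappa> unfolding spatially_normal_def by blast
  obtain F G where FG: "adjoint_pair K (ell2 H :: ('h, unit) universe hilbert) F G" and F: "F \<kappa> = Inl \<zeta>"
    and int: "\<forall>x\<in>R. \<forall>\<mu>\<in>carrier K. F (\<pi> x \<mu>) = ampl H x (F \<mu>)"
    using cyclic_subrepresentation[OF H K R sr \<kappa> \<zeta> sum] by blast
  have "\<zeta> n = \<zero>\<^bsub>H\<^esub>" for n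
  proof -
    have "\<exists>S. adjoint_pair K H (\<lambda>\<mu>. projl (F \<mu>) n) S"
      by (rule exI, rule adjoint_pair_comp[OF K hilbert_ell2[OF H] H FG component_pair[OF H]])
    moreover have "projl (F (\<pi> x \<mu>)) n = x (projl (F \<mu>) n)" if x: "x \<in> R" and m: "\<mu> \<in> carrier K" for x \<mu>
    proof -
      have "F \<mu> \<in> carrier (ell2 H)" using adjoint_pair_closed(1)[OF FG m] .
      then obtain f where "F \<mu> = Inl f" "square_summable H f" by (rule ell2_cases)
      then show ?thesis using int x m by simp
    qed
    ultimately have "(\<lambda>\<mu>. projl (F \<mu>) n) \<in> intertwiners H R K \<pi>"
      by (simp add: intertwiners_def)
    from zero[OF this] show ?thesis using F by simp
  qed
  then have "((\<lambda>n::nat. 0::complex) has_sum hinner K \<kappa> \<kappa>) UNIV"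
    using sum[OF vn_closed(1)[OF H R]] H \<kappa> by (simp add: star_representationD(6)[OF sr])
  then have "hinner K \<kappa> \<kappa> = 0" by (rule has_sum_unique) (simp add: has_sum_0)
  then show ?thesis using hilbert_space.hinner_eq_zero[OF K \<kappa>] by simp
qed

text \<open>  The vector state of a unit vector, composed with \<open>\<pi>\<close>, is a normal state on \<open>R\<close> and can be decomposed;
  other vectors are multiples of unit vectors.\<close>

lemma normal_imp_spatially_normal:
  assumes H: "hilbert_space H" and K: "hilbert_space K" and R: "von_neumann_algebra H R"
    and \<pi>: "star_representation H R K \<pi>"
    and cont: "continuous_map (subtopology (ultraweak_topology H) R) (ultraweak_topology K) \<pi>"
  shows "spatially_normal H R K \<pi>"
proof -
  note [simp] = H K R vn_subset[OF R] star_representationD[OF \<pi>]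
  have unit: "\<exists>\<zeta>. square_summable H \<zeta> \<and>
      (\<forall>x\<in>R. ((\<lambda>n. hinner H (x (\<zeta> n)) (\<zeta> n)) has_sum hinner K (\<pi> x \<kappa>) \<kappa>) UNIV)"
    if \<kappa>: "\<kappa> \<in> carrier K" "hnorm K \<kappa> = 1" for \<kappa>
  proof -
    have nv: "normal_state K (carrier (bop K)) (vector_functional K \<kappa>)"
      by (rule normal_vector_state[OF K \<kappa>])
    have "continuous_map (ultraweak_topology K) euclidean (vector_functional K \<kappa>)"
      using nv unfolding normal_state_def uw_topspace[OF K, symmetric] by (simp add: subtopology_topspace)
    from continuous_map_compose[OF cont this]
    have "continuous_map (subtopology (ultraweak_topology H) R) euclidean (\<lambda>x. vector_functional K \<kappa> (\<pi> x))"
      by (simp add: o_def)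
    moreover have "is_state H R (\<lambda>x. vector_functional K \<kappa> (\<pi> x))"
      using nv unfolding normal_state_def is_state_def by simp
    ultimately have "normal_state H R (\<lambda>x. vector_functional K \<kappa> (\<pi> x))"
      by (simp add: normal_state_def)
    from normal_state_decomposition[OF H R this] show ?thesis by (simp add: vector_functional_def)
  qed
  have "\<exists>\<zeta>. square_summable H \<zeta> \<and>
      (\<forall>x\<in>R. ((\<lambda>n. hinner H (x (\<zeta> n)) (\<zeta> n)) has_sum hinner K (\<pi> x \<kappa>) \<kappa>) UNIV)"
    if \<kappa>: "\<kappa> \<in> carrier K" for \<kappa>
  proof (cases "hnorm K \<kappa> = 0")
    case True
    then have "\<kappa> = \<zero>\<^bsub>K\<^esub>" using \<kappa> by (simp add: hnorm_eq_0_iff)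
    then have "hinner K (\<pi> x \<kappa>) \<kappa> = 0" if "x \<in> R" for x
      using that by simp
    then show ?thesis by (intro exI[of _ "\<lambda>n. \<zero>\<^bsub>H\<^esub>"]) simp
  next
    case False
    define c where "c = complex_of_real (hnorm K \<kappa>)"
    define \<mu> where "\<mu> = (1 / c) \<odot>\<^bsub>K\<^esub> \<kappa>"
    have c: "c \<noteq> 0" using False by (simp add: c_def)
    have \<mu>: "\<mu> \<in> carrier K" "hnorm K \<mu> = 1"
      using \<kappa> False by (auto simp: \<mu>_def c_def hnorm_smult norm_divide)
    have \<kappa>\<mu>: "\<kappa> = c \<odot>\<^bsub>K\<^esub> \<mu>" using \<kappa> c by (intro hvec_eqI[OF K]) (auto simp: \<mu>_def)
    obtain \<zeta> where \<zeta>: "square_summable H \<zeta>"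
      and s: "\<And>x. x \<in> R \<Longrightarrow> ((\<lambda>n. hinner H (x (\<zeta> n)) (\<zeta> n)) has_sum hinner K (\<pi> x \<mu>) \<mu>) UNIV"
      using unit[OF \<mu>] by blast
    have "((\<lambda>n. hinner H (x (c \<odot>\<^bsub>H\<^esub> \<zeta> n)) (c \<odot>\<^bsub>H\<^esub> \<zeta> n)) has_sum hinner K (\<pi> x \<kappa>) \<kappa>) UNIV" if x: "x \<in> R" for x
      using has_sum_cmult_right[OF s[OF x], of "c * cnj c"] x \<zeta> \<mu> by (simp add: \<kappa>\<mu> ac_simps)
    then show ?thesis using \<zeta> by (intro exI[of _ "\<lambda>n. c \<odot>\<^bsub>H\<^esub> \<zeta> n"]) simp
  qed
  then show ?thesis using \<pi> unfolding spatially_normal_def by blast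
qed


section \<open>The GNS representation of a normal state\<close>

locale normal_state_on_algebra = state_on_algebra +
  assumes normal: "normal_state H R \<omega>"
begin

abbreviation \<pi> where "\<pi> \<equiv> gns_representation H R \<omega>"

text \<open>  Left multiplication is bounded because \<open>seminorm y\<close> is the norm of \<open>(y \<zeta>\<^sub>n)\<^sub>n\<close> for the sequence \<open>\<zeta>\<close> that
  decomposes the state, on which \<open>x\<close> acts componentwise.\<close>

lemma seminorm_mult:
  assumes x: "x \<in> R"
  shows "\<exists>C\<ge>0. \<forall>y\<in>R. seminorm (x \<otimes>\<^bsub>bop H\<^esub> y) \<le> C * seminorm y"
proof -
  obtain \<zeta> where \<zeta>: "square_summable H \<zeta>"
    and sum: "\<And>x. x \<in> R \<Longrightarrow> ((\<lambda>n. hinner H (x (\<zeta> n)) (\<zeta> n)) has_sum \<omega> x) UNIV"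
    using normal_state_decomposition[OF H R normal] by blast
  have sq: "((\<lambda>n. (hnorm H (y (\<zeta> n)))\<^sup>2) has_sum (seminorm y)\<^sup>2) UNIV" if y: "y \<in> R" for y
  proof -
    have "((\<lambda>n. complex_of_real ((hnorm H (y (\<zeta> n)))\<^sup>2)) has_sum complex_of_real ((seminorm y)\<^sup>2)) UNIV"
      using sum[of "adj H y \<otimes>\<^bsub>bop H\<^esub> y"] y \<zeta> form_self[OF y]
      by (simp add: hinner_adj hinner_self gns_form_def)
    then show ?thesis by (subst (asm) has_sum_of_real_iff)
  qed
  obtain C where C: "C \<ge> 0" "\<forall>\<xi>\<in>carrier H. hnorm H (x \<xi>) \<le> C * hnorm H \<xi>"
    using bop_bound[OF H R_bop[OF x]] by blast
  have "seminorm (x \<otimes>\<^bsub>bop H\<^esub> y) \<le> C * seminorm y" if y: "y \<in> R" for y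
  proof (rule power2_le_imp_le)
    have "(seminorm (x \<otimes>\<^bsub>bop H\<^esub> y))\<^sup>2 \<le> C\<^sup>2 * (seminorm y)\<^sup>2"
    proof (rule has_sum_mono[OF sq has_sum_cmult_right[OF sq[OF y]]])
      show "(hnorm H ((x \<otimes>\<^bsub>bop H\<^esub> y) (\<zeta> n)))\<^sup>2 \<le> C\<^sup>2 * (hnorm H (y (\<zeta> n)))\<^sup>2" for n
        using power_mono[of "hnorm H (x (y (\<zeta> n)))" "C * hnorm H (y (\<zeta> n))" 2] C \<zeta> x y
        by (simp add: power_mult_distrib)
    qed (use x y in auto)
    then show "(seminorm (x \<otimes>\<^bsub>bop H\<^esub> y))\<^sup>2 \<le> (C * seminorm y)\<^sup>2" by (simp add: power_mult_distrib)
  qed (use C y in auto)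
  then show ?thesis using C(1) by blast
qed

lemma cauchy_mult:
  assumes x: "x \<in> R" and s: "\<sigma> \<in> cauchy"
  shows "(\<lambda>n. x \<otimes>\<^bsub>bop H\<^esub> \<sigma> n) \<in> cauchy"
  unfolding cauchy_iff
proof (intro conjI allI impI)
  fix e :: real assume e: "e > 0"
  obtain C where C: "C \<ge> 0" "\<forall>y\<in>R. seminorm (x \<otimes>\<^bsub>bop H\<^esub> y) \<le> C * seminorm y"
    using seminorm_mult[OF x] by blast
  obtain N where N: "\<And>m n. m \<ge> N \<Longrightarrow> n \<ge> N \<Longrightarrow> seminorm (\<sigma> m \<ominus>\<^bsub>bop H\<^esub> \<sigma> n) < e / (C + 1)"
    using cauchyD[OF s, of "e / (C + 1)"] e C by auto
  have "seminorm ((x \<otimes>\<^bsub>bop H\<^esub> \<sigma> m) \<ominus>\<^bsub>bop H\<^esub> (x \<otimes>\<^bsub>bop H\<^esub> \<sigma> n)) < e" if "m \<ge> N" "n \<ge> N" for m n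
  proof -
    have 1: "(x \<otimes>\<^bsub>bop H\<^esub> \<sigma> m) \<ominus>\<^bsub>bop H\<^esub> (x \<otimes>\<^bsub>bop H\<^esub> \<sigma> n) = x \<otimes>\<^bsub>bop H\<^esub> (\<sigma> m \<ominus>\<^bsub>bop H\<^esub> \<sigma> n)"
      using x s by (intro bop_eqI[of _ H]) (auto simp: hminus_conv)
    have "seminorm (x \<otimes>\<^bsub>bop H\<^esub> (\<sigma> m \<ominus>\<^bsub>bop H\<^esub> \<sigma> n)) \<le> C * seminorm (\<sigma> m \<ominus>\<^bsub>bop H\<^esub> \<sigma> n)"
      using C s by simp
    moreover have "C * seminorm (\<sigma> m \<ominus>\<^bsub>bop H\<^esub> \<sigma> n) \<le> C * (e / (C + 1))"
      using N[OF that] C by (intro mult_left_mono) auto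
    moreover have "C * (e / (C + 1)) < e" using C e by (simp add: field_simps)
    ultimately show ?thesis unfolding 1 by linarith
  qed
  then show "\<exists>N. \<forall>m\<ge>N. \<forall>n\<ge>N. seminorm ((x \<otimes>\<^bsub>bop H\<^esub> \<sigma> m) \<ominus>\<^bsub>bop H\<^esub> (x \<otimes>\<^bsub>bop H\<^esub> \<sigma> n)) < e" by blast
qed (use x s in auto)

lemma \<pi>_cls:
  assumes x: "x \<in> R" and s: "\<sigma> \<in> cauchy"
  shows "\<pi> x (cls \<sigma>) = cls (\<lambda>n. x \<otimes>\<^bsub>bop H\<^esub> \<sigma> n)"
proof -
  let ?s = "gns_repr (cls \<sigma>)"
  note r = repr_equiv[OF s]
  obtain C where C: "C \<ge> 0" "\<forall>y\<in>R. seminorm (x \<otimes>\<^bsub>bop H\<^esub> y) \<le> C * seminorm y"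
    using seminorm_mult[OF x] by blast
  have l: "(\<lambda>n. C * seminorm (?s n \<ominus>\<^bsub>bop H\<^esub> \<sigma> n)) \<longlonglongrightarrow> 0"
    using tendsto_mult_left[OF r(2), of C] by simp
  have "(\<lambda>n. seminorm ((x \<otimes>\<^bsub>bop H\<^esub> ?s n) \<ominus>\<^bsub>bop H\<^esub> (x \<otimes>\<^bsub>bop H\<^esub> \<sigma> n))) \<longlonglongrightarrow> 0"
  proof (rule Lim_null_comparison[OF _ l], rule always_eventually, rule allI)
    fix n
    have 1: "(x \<otimes>\<^bsub>bop H\<^esub> ?s n) \<ominus>\<^bsub>bop H\<^esub> (x \<otimes>\<^bsub>bop H\<^esub> \<sigma> n) = x \<otimes>\<^bsub>bop H\<^esub> (?s n \<ominus>\<^bsub>bop H\<^esub> \<sigma> n)"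
      using x s r(1) by (intro bop_eqI[of _ H]) (auto simp: hminus_conv)
    show "norm (seminorm ((x \<otimes>\<^bsub>bop H\<^esub> ?s n) \<ominus>\<^bsub>bop H\<^esub> (x \<otimes>\<^bsub>bop H\<^esub> \<sigma> n))) \<le> C * seminorm (?s n \<ominus>\<^bsub>bop H\<^esub> \<sigma> n)"
      unfolding 1 using C x s r(1) by simp
  qed
  then show ?thesis
    using x s r(1) by (simp add: gns_representation_def cls_eq_iff cauchy_mult)
qed

lemma \<pi>_pair:
  assumes x: "x \<in> R"
  shows "adjoint_pair gns gns (\<pi> x) (\<pi> (adj H x))"
proof -
  obtain C where C: "C \<ge> 0" "\<forall>y\<in>R. seminorm (x \<otimes>\<^bsub>bop H\<^esub> y) \<le> C * seminorm y"
    using seminorm_mult[OF x] by blast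
  have hn: "(\<lambda>n. seminorm (\<sigma> n)) \<longlonglongrightarrow> hnorm gns (cls \<sigma>)" if "\<sigma> \<in> cauchy" for \<sigma>
    unfolding seminorm_def hnorm_def by (intro tendsto_intros gns_hinner that)
  have closed: "\<pi> y A \<in> carrier gns" if "y \<in> R" "A \<in> carrier gns" for y A
    using that by (auto simp: gns_carrier \<pi>_cls cauchy_mult)
  have "hnorm gns (\<pi> x A) \<le> C * hnorm gns A" if A: "A \<in> carrier gns" for A
  proof -
    obtain \<sigma> where s: "\<sigma> \<in> cauchy" "A = cls \<sigma>" using A by (auto simp: gns_carrier)
    show ?thesis
      unfolding s(2) \<pi>_cls[OF x s(1)]
      using C s x by (intro LIMSEQ_le[OF hn[OF cauchy_mult[OF x s(1)]] tendsto_mult_left[OF hn[OF s(1)]]]) auto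
  qed
  moreover have "hinner gns (\<pi> x A) B = hinner gns A (\<pi> (adj H x) B)"
    if AB: "A \<in> carrier gns" "B \<in> carrier gns" for A B
  proof -
    obtain \<sigma> \<tau> where s: "\<sigma> \<in> cauchy" "A = cls \<sigma>" "\<tau> \<in> cauchy" "B = cls \<tau>"
      using AB by (auto simp: gns_carrier)
    have ax: "adj H x \<in> R" using x by simp
    have "(\<lambda>n. form (x \<otimes>\<^bsub>bop H\<^esub> \<sigma> n) (\<tau> n)) \<longlonglongrightarrow> hinner gns (cls \<sigma>) (cls (\<lambda>n. adj H x \<otimes>\<^bsub>bop H\<^esub> \<tau> n))"
      using gns_hinner[OF s(1) cauchy_mult[OF ax s(3)]] form_mult_left[OF x] s by simp
    then show ?thesis
      unfolding s \<pi>_cls[OF x s(1)] \<pi>_cls[OF ax s(3)] by (intro gns_hinner_eqI cauchy_mult x s)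
  qed
  ultimately show ?thesis
    using x closed unfolding adjoint_pair_def by (intro conjI exI[of _ C]) auto
qed

lemma gns_star_representation: "star_representation H R gns \<pi>"
proof -
  have res: "restrict (\<pi> x) (carrier gns) = \<pi> x" for x
    by (simp add: gns_representation_def)
  have bop: "\<pi> x \<in> carrier (bop gns)" if "x \<in> R" for x
    using restrict_bop[OF hilbert_gns \<pi>_pair[OF that]] by (simp add: res)
  have act: "\<pi> z = T" if z: "z \<in> R" and T: "T \<in> carrier (bop gns)"
    and eq: "\<And>\<sigma>. \<sigma> \<in> cauchy \<Longrightarrow> cls (\<lambda>n. z \<otimes>\<^bsub>bop H\<^esub> \<sigma> n) = T (cls \<sigma>)" for z T
  proof (rule bop_eqI[OF bop[OF z] T])
    fix A assume "A \<in> carrier gns"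
    then obtain \<sigma> where s: "\<sigma> \<in> cauchy" "A = cls \<sigma>" by (auto simp: gns_carrier)
    show "\<pi> z A = T A" unfolding s(2) \<pi>_cls[OF z s(1)] by (rule eq[OF s(1)])
  qed
  show ?thesis
    unfolding star_representation_def
  proof (intro conjI ballI allI)
    show "\<pi> \<in> R \<rightarrow> carrier (bop gns)" using bop by blast
    show "\<pi> (x \<oplus>\<^bsub>bop H\<^esub> y) = \<pi> x \<oplus>\<^bsub>bop gns\<^esub> \<pi> y" if xy: "x \<in> R" "y \<in> R" for x y
    proof (rule act)
      fix \<sigma> assume s: "\<sigma> \<in> cauchy"
      show "cls (\<lambda>n. (x \<oplus>\<^bsub>bop H\<^esub> y) \<otimes>\<^bsub>bop H\<^esub> \<sigma> n) = (\<pi> x \<oplus>\<^bsub>bop gns\<^esub> \<pi> y) (cls \<sigma>)"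
        using xy s by (simp add: \<pi>_cls bop_distrib gns_lincomb(1) cauchy_mult)
    qed (use xy bop in auto)
    show "\<pi> (c \<odot>\<^bsub>bop H\<^esub> x) = c \<odot>\<^bsub>bop gns\<^esub> \<pi> x" if x: "x \<in> R" for c x
    proof (rule act)
      fix \<sigma> assume s: "\<sigma> \<in> cauchy"
      show "cls (\<lambda>n. (c \<odot>\<^bsub>bop H\<^esub> x) \<otimes>\<^bsub>bop H\<^esub> \<sigma> n) = (c \<odot>\<^bsub>bop gns\<^esub> \<pi> x) (cls \<sigma>)"
        using x s by (simp add: \<pi>_cls bop_smult_mult gns_smult cauchy_mult)
    qed (use x bop in auto)
    show "\<pi> (x \<otimes>\<^bsub>bop H\<^esub> y) = \<pi> x \<otimes>\<^bsub>bop gns\<^esub> \<pi> y" if xy: "x \<in> R" "y \<in> R" for x y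
    proof (rule act)
      fix \<sigma> assume s: "\<sigma> \<in> cauchy"
      have "(x \<otimes>\<^bsub>bop H\<^esub> y) \<otimes>\<^bsub>bop H\<^esub> \<sigma> n = x \<otimes>\<^bsub>bop H\<^esub> (y \<otimes>\<^bsub>bop H\<^esub> \<sigma> n)" for n
        using xy s by (intro bop_eqI[of _ H]) auto
      then show "cls (\<lambda>n. (x \<otimes>\<^bsub>bop H\<^esub> y) \<otimes>\<^bsub>bop H\<^esub> \<sigma> n) = (\<pi> x \<otimes>\<^bsub>bop gns\<^esub> \<pi> y) (cls \<sigma>)"
        using xy s by (simp add: \<pi>_cls cauchy_mult)
    qed (use xy bop in auto)
    show "\<pi> (adj H x) = adj gns (\<pi> x)" if x: "x \<in> R" for x
      using adj_restrict[OF hilbert_gns \<pi>_pair[OF x]] by (simp add: res)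
    show "\<pi> \<one>\<^bsub>bop H\<^esub> = \<one>\<^bsub>bop gns\<^esub>"
    proof (rule act)
      fix \<sigma> assume s: "\<sigma> \<in> cauchy"
      have "\<one>\<^bsub>bop H\<^esub> \<otimes>\<^bsub>bop H\<^esub> \<sigma> n = \<sigma> n" for n using s by (intro bop_eqI[of _ H]) auto
      then show "cls (\<lambda>n. \<one>\<^bsub>bop H\<^esub> \<otimes>\<^bsub>bop H\<^esub> \<sigma> n) = \<one>\<^bsub>bop gns\<^esub> (cls \<sigma>)" using s by simp
    qed auto
  qed
qed

abbreviation \<Omega> where "\<Omega> \<equiv> gns_vector H R \<omega>"

lemma \<Omega>_eq: "\<Omega> = embed \<one>\<^bsub>bop H\<^esub>"
  by (simp add: gns_vector_def)

lemma \<Omega>_closed [simp]: "\<Omega> \<in> carrier gns"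
  by (simp add: \<Omega>_eq)

lemma \<pi>_\<Omega>: "x \<in> R \<Longrightarrow> \<pi> x \<Omega> = embed x"
proof -
  assume x: "x \<in> R"
  have "x \<otimes>\<^bsub>bop H\<^esub> \<one>\<^bsub>bop H\<^esub> = x" using x by (intro bop_eqI[of _ H]) auto
  then show ?thesis using x by (simp add: \<Omega>_eq \<pi>_cls)
qed

lemma \<omega>_\<Omega>: "x \<in> R \<Longrightarrow> hinner gns (\<pi> x \<Omega>) \<Omega> = \<omega> x"
  by (simp add: \<pi>_\<Omega>, simp add: \<Omega>_eq embed_hinner form_one)

text \<open>
  The partial isometry of the cyclic subspace into the multiple of \<open>H\<close> is isometric on the whole GNS
  space, because the GNS vector is cyclic.  It carries every vector to a decomposing sequence.
\<close>

lemma gns_spatially_normal: "spatially_normal H R gns \<pi>"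
proof -
  obtain \<zeta> where \<zeta>: "square_summable H \<zeta>"
    and sum: "\<And>x. x \<in> R \<Longrightarrow> ((\<lambda>n. hinner H (x (\<zeta> n)) (\<zeta> n)) has_sum \<omega> x) UNIV"
    using normal_state_decomposition[OF H R normal] by blast
  let ?L = "ell2 H :: ('a, unit) universe hilbert"
  have L: "hilbert_space ?L" by simp
  have "\<exists>F G. adjoint_pair gns ?L F G \<and> F \<Omega> = Inl \<zeta> \<and>
    (\<forall>x\<in>R. \<forall>\<mu>\<in>carrier gns. F (\<pi> x \<mu>) = ampl H x (F \<mu>)) \<and> (\<forall>x\<in>R. G (ampl H x (Inl \<zeta>)) = \<pi> x \<Omega>)"
    using sum by (intro cyclic_subrepresentation[OF H hilbert_gns R gns_star_representation \<Omega>_closed \<zeta>]) (simp add: \<omega>_\<Omega>)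
  then obtain F G where FG: "adjoint_pair gns ?L F G" and F: "F \<Omega> = Inl \<zeta>"
    and int: "\<And>x \<mu>. x \<in> R \<Longrightarrow> \<mu> \<in> carrier gns \<Longrightarrow> F (\<pi> x \<mu>) = ampl H x (F \<mu>)"
    and G: "\<And>x. x \<in> R \<Longrightarrow> G (ampl H x (Inl \<zeta>)) = \<pi> x \<Omega>" by blast
  have GF: "adjoint_pair gns gns (\<lambda>\<kappa>. G (F \<kappa>)) (\<lambda>\<kappa>. G (F \<kappa>))"
    by (rule adjoint_pair_comp[OF hilbert_gns L hilbert_gns FG adjoint_pair_sym[OF hilbert_gns L FG]])
  have id: "G (F \<kappa>) = \<kappa>" if "\<kappa> \<in> carrier gns" for \<kappa>
  proof (rule operators_agree[OF hilbert_gns hilbert_gns GF adjoint_pair_id, of R embed])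
    show "G (F (embed x)) = embed x" if x: "x \<in> R" for x
      using int[OF x \<Omega>_closed] G[OF x] x by (simp add: \<pi>_\<Omega> F)
    show "G (F \<mu>) = \<mu>" if m: "\<mu> \<in> carrier gns" "\<And>x. x \<in> R \<Longrightarrow> hinner gns (embed x) \<mu> = 0" for \<mu>
    proof -
      have z: "\<mu> = \<zero>\<^bsub>gns\<^esub>" by (rule embed_dense[OF m])
      show ?thesis
        unfolding z adjoint_pair_zero[OF hilbert_gns L FG]
        by (rule adjoint_pair_zero[OF L hilbert_gns adjoint_pair_sym[OF hilbert_gns L FG]])
    qed
  qed (use that in auto)
  have "\<exists>\<zeta>. square_summable H \<zeta> \<and>
      (\<forall>x\<in>R. ((\<lambda>n. hinner H (x (\<zeta> n)) (\<zeta> n)) has_sum hinner gns (\<pi> x \<kappa>) \<kappa>) UNIV)"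
    if \<kappa>: "\<kappa> \<in> carrier gns" for \<kappa>
  proof -
    obtain f where f: "F \<kappa> = Inl f" "square_summable H f"
      using adjoint_pair_closed(1)[OF FG \<kappa>] by (rule ell2_cases)
    have "((\<lambda>n. hinner H (x (f n)) (f n)) has_sum hinner gns (\<pi> x \<kappa>) \<kappa>) UNIV" if x: "x \<in> R" for x
    proof -
      have "hinner gns (\<pi> x \<kappa>) \<kappa> = hinner gns (\<pi> x \<kappa>) (G (F \<kappa>))" using id[OF \<kappa>] by simp
      also have "\<dots> = hinner ?L (F (\<pi> x \<kappa>)) (F \<kappa>)"
        using \<kappa> adjoint_pair_closed[OF \<pi>_pair[OF x]] adjoint_pair_closed[OF FG]
        by (simp add: adjoint_pair_left[OF FG])
      also have "\<dots> = hinner ?L (Inl (\<lambda>n. x (f n))) (Inl f)" using int[OF x \<kappa>] f by simp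
      finally have e: "hinner gns (\<pi> x \<kappa>) \<kappa> = hinner ?L (Inl (\<lambda>n. x (f n))) (Inl f)" .
      show ?thesis unfolding e using x f by (intro ell2_hinner[OF H]) auto
    qed
    then show ?thesis using f(2) by blast
  qed
  then show ?thesis using gns_star_representation unfolding spatially_normal_def by blast
qed

end


section \<open>Quantum channels\<close>

subsection \<open>Convergence in the strong operator topology\<close>

lemma sot_subbasic_ball:
  assumes H: "hilbert_space H" and \<xi>: "\<xi> \<in> carrier H" and v: "v \<in> carrier H" and r: "r > 0"
  shows "openin (strong_operator_topology H) {x \<in> carrier (bop H). hnorm H (x \<xi> \<ominus>\<^bsub>H\<^esub> v) < r}"
proof -
  interpret M: Metric_space "carrier H" "hdist H" by (rule hdist_metric[OF H])
  have "{x \<in> carrier (bop H). hnorm H (x \<xi> \<ominus>\<^bsub>H\<^esub> v) < r} = {x \<in> carrier (bop H). x \<xi> \<in> M.mball v r}"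
    using \<xi> v H by (auto simp: M.in_mball hdist_def hnorm_minus_commute)
  moreover have "openin (strong_operator_topology H) {x \<in> carrier (bop H). x \<xi> \<in> M.mball v r}"
    unfolding strong_operator_topology_def
    by (rule topology_generated_by_Basis) (use \<xi> M.openin_mball in blast)
  ultimately show ?thesis by simp
qed

lemma sot_limitinI:
  assumes H: "hilbert_space H" and l: "l \<in> carrier (bop H)"
    and f: "eventually (\<lambda>i. f i \<in> carrier (bop H)) F"
    and lim: "\<And>\<xi>. \<xi> \<in> carrier H \<Longrightarrow> ((\<lambda>i. hnorm H (f i \<xi> \<ominus>\<^bsub>H\<^esub> l \<xi>)) \<longlongrightarrow> 0) F"
  shows "limitin (strong_operator_topology H) f l F"
proof -
  interpret M: Metric_space "carrier H" "hdist H" by (rule hdist_metric[OF H])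
  have "openin (strong_operator_topology H) {x \<in> carrier (bop H). hnorm H (x \<zero>\<^bsub>H\<^esub> \<ominus>\<^bsub>H\<^esub> l \<zero>\<^bsub>H\<^esub>) < 1}"
    using H l by (intro sot_subbasic_ball) auto
  then have "{x \<in> carrier (bop H). hnorm H (x \<zero>\<^bsub>H\<^esub> \<ominus>\<^bsub>H\<^esub> l \<zero>\<^bsub>H\<^esub>) < 1} \<subseteq> topspace (strong_operator_topology H)"
    by (rule openin_subset)
  moreover have "l \<in> {x \<in> carrier (bop H). hnorm H (x \<zero>\<^bsub>H\<^esub> \<ominus>\<^bsub>H\<^esub> l \<zero>\<^bsub>H\<^esub>) < 1}"
    using H l hdiff_eq_zero_iff[OF H, of "l \<zero>\<^bsub>H\<^esub>" "l \<zero>\<^bsub>H\<^esub>"] by simp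
  ultimately have "l \<in> topspace (strong_operator_topology H)" by blast
  moreover have "eventually (\<lambda>i. f i \<in> U) F"
    if U: "openin (strong_operator_topology H) U" and lU: "l \<in> U" for U
  proof -
    have "generate_topology_on {{x \<in> carrier (bop H). x \<xi> \<in> U} | \<xi> U.
        \<xi> \<in> carrier H \<and> openin M.mtopology U} U"
      using U unfolding strong_operator_topology_def by (rule openin_topology_generated_by)
    then show ?thesis using lU
    proof induction
      case (Int a b)
      then have "eventually (\<lambda>i. f i \<in> a) F" "eventually (\<lambda>i. f i \<in> b) F" by auto
      then show ?case by eventually_elim simp
    next
      case (UN K)
      then obtain k where k: "k \<in> K" "l \<in> k" by blast
      then have "eventually (\<lambda>i. f i \<in> k) F" using UN.IH by blast
      then show ?case by eventually_elim (use k in blast)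
    next
      case (Basis s)
      then obtain \<xi> V where s: "s = {x \<in> carrier (bop H). x \<xi> \<in> V}" "\<xi> \<in> carrier H" "openin M.mtopology V" by blast
      then obtain r where r: "r > 0" "M.mball (l \<xi>) r \<subseteq> V"
        using Basis.prems by (auto simp: M.openin_mtopology)
      have "eventually (\<lambda>i. hnorm H (f i \<xi> \<ominus>\<^bsub>H\<^esub> l \<xi>) < r) F"
        by (rule order_tendstoD(2)[OF lim[OF s(2)] r(1)])
      with f show ?case
      proof eventually_elim
        case (elim i)
        then have "f i \<xi> \<in> M.mball (l \<xi>) r"
          using H l s(2) by (simp add: M.in_mball hdist_def hnorm_minus_commute)
        then show ?case using r s elim by blast
      qed
    qed simp
  qed
  ultimately show ?thesis by (simp add: limitin_def)
qed

lemma sot_has_sum: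
  assumes H: "hilbert_space H" and b: "\<And>j. j \<in> J \<Longrightarrow> b j \<in> carrier (bop H)"
    and lim: "limitin (strong_operator_topology H) (\<lambda>F. \<Oplus>\<^bsub>bop H\<^esub> j\<in>F. b j) l (finite_subsets_at_top J)"
    and l: "l \<in> carrier (bop H)" and \<xi>: "\<xi> \<in> carrier H" and \<eta>: "\<eta> \<in> carrier H"
  shows "((\<lambda>j. hinner H (b j \<xi>) \<eta>) has_sum hinner H (l \<xi>) \<eta>) J"
proof -
  define s where "s F = (if finite F \<and> F \<subseteq> J then (\<Oplus>\<^bsub>bop H\<^esub> j\<in>F. b j) \<xi> else l \<xi>)" for F
  have sc: "s F \<in> carrier H" for F
    using bop_finsum(1)[OF H, of F b] b \<xi> l by (auto simp: s_def subset_iff)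
  have "((\<lambda>F. hnorm H (s F \<ominus>\<^bsub>H\<^esub> l \<xi>)) \<longlongrightarrow> 0) (finite_subsets_at_top J)"
  proof (rule tendstoI)
    fix r :: real assume r: "r > 0"
    have "openin (strong_operator_topology H) {x \<in> carrier (bop H). hnorm H (x \<xi> \<ominus>\<^bsub>H\<^esub> l \<xi>) < r}"
      using H l \<xi> r by (intro sot_subbasic_ball) auto
    moreover have "l \<in> {x \<in> carrier (bop H). hnorm H (x \<xi> \<ominus>\<^bsub>H\<^esub> l \<xi>) < r}"
      using H l \<xi> r hdiff_eq_zero_iff[OF H, of "l \<xi>" "l \<xi>"] by simp
    ultimately have "eventually (\<lambda>F. (\<Oplus>\<^bsub>bop H\<^esub> j\<in>F. b j) \<in> {x \<in> carrier (bop H). hnorm H (x \<xi> \<ominus>\<^bsub>H\<^esub> l \<xi>) < r})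
        (finite_subsets_at_top J)"
      using lim unfolding limitin_def by blast
    moreover have "eventually (\<lambda>F. finite F \<and> F \<subseteq> J) (finite_subsets_at_top J)"
      by (rule eventually_finite_subsets_at_top_weakI) simp
    ultimately show "eventually (\<lambda>F. dist (hnorm H (s F \<ominus>\<^bsub>H\<^esub> l \<xi>)) 0 < r) (finite_subsets_at_top J)"
    proof eventually_elim
      case (elim F)
      then show ?case using H l \<xi> by (simp add: s_def)
    qed
  qed
  then have "((\<lambda>F. hinner H (s F) \<eta>) \<longlongrightarrow> hinner H (l \<xi>) \<eta>) (finite_subsets_at_top J)"
    using H l \<xi> \<eta> sc by (intro hinner_tendsto_left) auto
  moreover have "eventually (\<lambda>F. hinner H (s F) \<eta> = (\<Sum>j\<in>F. hinner H (b j \<xi>) \<eta>)) (finite_subsets_at_top J)"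
  proof (rule eventually_finite_subsets_at_top_weakI)
    fix F assume "finite F" "F \<subseteq> J"
    then show "hinner H (s F) \<eta> = (\<Sum>j\<in>F. hinner H (b j \<xi>) \<eta>)"
      using bop_finsum(2)[OF H, of F b \<xi> \<eta>] b \<xi> \<eta> by (auto simp: s_def subset_iff)
  qed
  ultimately show ?thesis
    unfolding has_sum_def using tendsto_cong by fast
qed

lemma has_sum_transform:
  "(f has_sum s) A \<Longrightarrow> (\<And>j. j \<in> A \<Longrightarrow> f j = g j) \<Longrightarrow> s = t \<Longrightarrow> (g has_sum t) A"
  using has_sum_cong[of A f g] by simp

text \<open>  The Cauchy-Schwarz inequality in the Hilbert sum of copies of \<open>H\<close> over \<open>J\<close>, expressed through sums so
  that this Hilbert sum does not have to be formed.\<close>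

lemma has_sum_hinner_bound:
  assumes H: "hilbert_space H" and \<alpha>: "\<And>j. j \<in> J \<Longrightarrow> \<alpha> j \<in> carrier H" and \<beta>: "\<And>j. j \<in> J \<Longrightarrow> \<beta> j \<in> carrier H"
    and A: "((\<lambda>j. (hnorm H (\<alpha> j))\<^sup>2) has_sum A) J" and B: "((\<lambda>j. (hnorm H (\<beta> j))\<^sup>2) has_sum B) J"
    and s: "((\<lambda>j. hinner H (\<beta> j) (\<alpha> j)) has_sum s) J"
  shows "(norm s)\<^sup>2 \<le> A * B"
proof (rule quadratic_form_discriminant)
  show "0 \<le> B" by (rule has_sum_nonneg[OF B]) simp
  fix c
  have "((\<lambda>j. (hnorm H (\<alpha> j))\<^sup>2 + 2 * Re (c * hinner H (\<beta> j) (\<alpha> j)) + (norm c)\<^sup>2 * (hnorm H (\<beta> j))\<^sup>2)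
      has_sum (A + 2 * Re (c * s) + (norm c)\<^sup>2 * B)) J"
    by (intro has_sum_add has_sum_cmult_right has_sum_Re A B s)
  moreover have "0 \<le> (hnorm H (\<alpha> j))\<^sup>2 + 2 * Re (c * hinner H (\<beta> j) (\<alpha> j)) + (norm c)\<^sup>2 * (hnorm H (\<beta> j))\<^sup>2"
    if "j \<in> J" for j
    using hnorm_add_smult[OF H \<alpha>[OF that] \<beta>[OF that], of c] zero_le_power2 by metis
  ultimately show "0 \<le> A + 2 * Re (c * s) + (norm c)\<^sup>2 * B"
    by (rule has_sum_nonneg)
qed

text \<open>
  A family \<open>a\<close> with \<open>\<Sum>j. a\<^sub>j\<^sup>* a\<^sub>j = 1\<close> is handled through the equivalent condition
  \<open>\<Sum>j. \<parallel>a\<^sub>j \<xi>\<parallel>\<^sup>2 = \<parallel>\<xi>\<parallel>\<^sup>2\<close>, that is, as an isometry into a multiple of the Hilbert space.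
\<close>

definition isometric_family :: "'k hilbert \<Rightarrow> 'j set \<Rightarrow> ('j \<Rightarrow> 'k \<Rightarrow> 'k) \<Rightarrow> bool" where
  "isometric_family K J a \<longleftrightarrow> (\<forall>j\<in>J. a j \<in> carrier (bop K)) \<and>
     (\<forall>\<xi>\<in>carrier K. ((\<lambda>j. (hnorm K (a j \<xi>))\<^sup>2) has_sum (hnorm K \<xi>)\<^sup>2) J)"

lemma isometric_familyD:
  assumes "isometric_family K J a"
  shows "j \<in> J \<Longrightarrow> a j \<in> carrier (bop K)"
    "\<xi> \<in> carrier K \<Longrightarrow> ((\<lambda>j. (hnorm K (a j \<xi>))\<^sup>2) has_sum (hnorm K \<xi>)\<^sup>2) J"
  using assms by (auto simp: isometric_family_def)

lemma isometric_family_summable: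
  assumes K: "hilbert_space K" and a: "isometric_family K J a" and x: "x \<in> carrier (bop K)"
    and \<xi>: "\<xi> \<in> carrier K" and \<eta>: "\<eta> \<in> carrier K"
  shows "(\<lambda>j. (hnorm K (x (a j \<xi>)))\<^sup>2) summable_on J" "(\<lambda>j. hinner K (x (a j \<xi>)) (a j \<eta>)) summable_on J"
proof -
  have sq: "(\<lambda>j. (hnorm K (a j \<mu>))\<^sup>2) summable_on J" if "\<mu> \<in> carrier K" for \<mu>
    using isometric_familyD(2)[OF a that] by (auto simp: summable_on_def)
  show 1: "(\<lambda>j. (hnorm K (x (a j \<xi>)))\<^sup>2) summable_on J"
    using isometric_familyD(1)[OF a] \<xi> by (intro summable_bounded_image[OF K K adj_pair(1)[OF K x] _ sq[OF \<xi>]]) auto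
  show "(\<lambda>j. hinner K (x (a j \<xi>)) (a j \<eta>)) summable_on J"
    using isometric_familyD(1)[OF a] \<xi> \<eta> x
    by (intro abs_summable_summable[OF abs_summable_hinner[OF K _ _ 1 sq[OF \<eta>]]]) auto
qed

lemma isometric_family_polarized:
  assumes K: "hilbert_space K" and a: "isometric_family K J a" and \<xi>: "\<xi> \<in> carrier K" and \<eta>: "\<eta> \<in> carrier K"
  shows "((\<lambda>j. hinner K (a j \<xi>) (a j \<eta>)) has_sum hinner K \<xi> \<eta>) J"
proof -
  note ac = isometric_familyD(1)[OF a] and sq = isometric_familyD(2)[OF a]
  have "(\<lambda>j. hinner K (\<one>\<^bsub>bop K\<^esub> (a j \<xi>)) (a j \<eta>)) summable_on J"
    using K by (intro isometric_family_summable(2)[OF K a _ \<xi> \<eta>]) auto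
  moreover have "hinner K (\<one>\<^bsub>bop K\<^esub> (a j \<xi>)) (a j \<eta>) = hinner K (a j \<xi>) (a j \<eta>)" if "j \<in> J" for j
    using ac[OF that] \<xi> by simp
  ultimately have "(\<lambda>j. hinner K (a j \<xi>) (a j \<eta>)) summable_on J"
    by (simp cong: summable_on_cong)
  then obtain s where s: "((\<lambda>j. hinner K (a j \<xi>) (a j \<eta>)) has_sum s) J" by (auto simp: summable_on_def)
  have "Re (c * s) = Re (c * hinner K \<xi> \<eta>)" for c
  proof -
    have cx: "c \<odot>\<^bsub>K\<^esub> \<xi> \<in> carrier K" "\<eta> \<oplus>\<^bsub>K\<^esub> c \<odot>\<^bsub>K\<^esub> \<xi> \<in> carrier K" using K \<xi> \<eta> by auto
    have "((\<lambda>j. (hnorm K (a j \<eta>))\<^sup>2 + 2 * Re (c * hinner K (a j \<xi>) (a j \<eta>)) + (norm c)\<^sup>2 * (hnorm K (a j \<xi>))\<^sup>2)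
      has_sum ((hnorm K \<eta>)\<^sup>2 + 2 * Re (c * s) + (norm c)\<^sup>2 * (hnorm K \<xi>)\<^sup>2)) J"
      by (intro has_sum_add has_sum_cmult_right has_sum_Re s sq \<xi> \<eta>)
    moreover have "(hnorm K (a j \<eta>))\<^sup>2 + 2 * Re (c * hinner K (a j \<xi>) (a j \<eta>)) + (norm c)\<^sup>2 * (hnorm K (a j \<xi>))\<^sup>2
      = (hnorm K (a j (\<eta> \<oplus>\<^bsub>K\<^esub> c \<odot>\<^bsub>K\<^esub> \<xi>)))\<^sup>2" if "j \<in> J" for j
      using hnorm_add_smult[OF K, of "a j \<eta>" "a j \<xi>" c] ac[OF that] \<xi> \<eta> K by simp
    ultimately have "((\<lambda>j. (hnorm K (a j (\<eta> \<oplus>\<^bsub>K\<^esub> c \<odot>\<^bsub>K\<^esub> \<xi>)))\<^sup>2)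
      has_sum ((hnorm K \<eta>)\<^sup>2 + 2 * Re (c * s) + (norm c)\<^sup>2 * (hnorm K \<xi>)\<^sup>2)) J"
      by (simp cong: has_sum_cong)
    then have "(hnorm K \<eta>)\<^sup>2 + 2 * Re (c * s) + (norm c)\<^sup>2 * (hnorm K \<xi>)\<^sup>2 = (hnorm K (\<eta> \<oplus>\<^bsub>K\<^esub> c \<odot>\<^bsub>K\<^esub> \<xi>))\<^sup>2"
      using sq[OF cx(2)] by (rule has_sum_unique)
    then show ?thesis using hnorm_add_smult[OF K \<eta> \<xi>, of c] by simp
  qed
  from this[of 1] this[of \<i>] have "s = hinner K \<xi> \<eta>" by (simp add: complex_eq_iff)
  then show ?thesis using s by simp
qed

text \<open>  The difference \<open>d\<close> of \<open>y \<xi>\<close> and the partial sum over \<open>F\<close> satisfies \<open>\<parallel>d\<parallel>\<^sup>2 = \<bar>\<Sum>j\<notin>F. \<langle>x a\<^sub>j \<xi>, a\<^sub>j d\<rangle>\<bar>\<close>, so it is bounded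
  by the tail of the sum of \<open>\<parallel>x a\<^sub>j \<xi>\<parallel>\<^sup>2\<close>.\<close>

lemma isometric_family_sot:
  assumes K: "hilbert_space K" and a: "isometric_family K J a" and x: "x \<in> carrier (bop K)"
    and b: "\<And>j. j \<in> J \<Longrightarrow> b j \<in> carrier (bop K)"
    and ba: "\<And>j \<xi> \<eta>. j \<in> J \<Longrightarrow> \<xi> \<in> carrier K \<Longrightarrow> \<eta> \<in> carrier K \<Longrightarrow>
       hinner K (b j \<xi>) \<eta> = hinner K (x (a j \<xi>)) (a j \<eta>)"
    and y: "y \<in> carrier (bop K)"
    and sum: "\<And>\<xi> \<eta>. \<xi> \<in> carrier K \<Longrightarrow> \<eta> \<in> carrier K \<Longrightarrow>
       ((\<lambda>j. hinner K (x (a j \<xi>)) (a j \<eta>)) has_sum hinner K (y \<xi>) \<eta>) J"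
  shows "limitin (strong_operator_topology K) (\<lambda>F. \<Oplus>\<^bsub>bop K\<^esub> j\<in>F. b j) y (finite_subsets_at_top J)"
proof (rule sot_limitinI[OF K y])
  note ac = isometric_familyD(1)[OF a] and sq = isometric_familyD(2)[OF a]
  show "eventually (\<lambda>F. (\<Oplus>\<^bsub>bop K\<^esub> j\<in>F. b j) \<in> carrier (bop K)) (finite_subsets_at_top J)"
    using b by (intro eventually_finite_subsets_at_top_weakI bop_finsum(1)[OF K]) auto
  fix \<xi> assume \<xi>: "\<xi> \<in> carrier K"
  obtain t where t: "((\<lambda>j. (hnorm K (x (a j \<xi>)))\<^sup>2) has_sum t) J"
    using isometric_family_summable(1)[OF K a x \<xi> \<xi>] by (auto simp: summable_on_def)
  have est: "hnorm K ((\<Oplus>\<^bsub>bop K\<^esub> j\<in>F. b j) \<xi> \<ominus>\<^bsub>K\<^esub> y \<xi>) \<le> sqrt (t - (\<Sum>j\<in>F. (hnorm K (x (a j \<xi>)))\<^sup>2))"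
    if F: "finite F" "F \<subseteq> J" for F
  proof -
    let ?d = "(\<Oplus>\<^bsub>bop K\<^esub> j\<in>F. b j) \<xi> \<ominus>\<^bsub>K\<^esub> y \<xi>"
    have S: "(\<Oplus>\<^bsub>bop K\<^esub> j\<in>F. b j) \<in> carrier (bop K)"
      using F b by (intro bop_finsum(1)[OF K]) auto
    have dc: "?d \<in> carrier K" using K S y \<xi> by simp
    have tail: "((\<lambda>j. (hnorm K (x (a j \<xi>)))\<^sup>2) has_sum (t - (\<Sum>j\<in>F. (hnorm K (x (a j \<xi>)))\<^sup>2))) (J - F)"
      by (rule has_sum_Diff[OF t has_sum_finite[OF F(1)] F(2)])
    have "((\<lambda>j. hinner K (x (a j \<xi>)) (a j ?d)) has_sum (hinner K (y \<xi>) ?d - (\<Sum>j\<in>F. hinner K (x (a j \<xi>)) (a j ?d)))) (J - F)"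
      by (rule has_sum_Diff[OF sum[OF \<xi> dc] has_sum_finite[OF F(1)] F(2)])
    moreover have "hinner K (y \<xi>) ?d - (\<Sum>j\<in>F. hinner K (x (a j \<xi>)) (a j ?d)) = - hinner K ?d ?d"
    proof -
      have "(\<Sum>j\<in>F. hinner K (x (a j \<xi>)) (a j ?d)) = (\<Sum>j\<in>F. hinner K (b j \<xi>) ?d)"
        using F \<xi> dc by (intro sum.cong) (auto simp: ba)
      also have "\<dots> = hinner K ((\<Oplus>\<^bsub>bop K\<^esub> j\<in>F. b j) \<xi>) ?d"
        by (rule bop_finsum(2)[OF K F(1) _ \<xi> dc, symmetric]) (use b F in auto)
      finally have e: "(\<Sum>j\<in>F. hinner K (x (a j \<xi>)) (a j ?d)) = hinner K ((\<Oplus>\<^bsub>bop K\<^esub> j\<in>F. b j) \<xi>) ?d" .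
      have "hinner K ?d ?d = hinner K ((\<Oplus>\<^bsub>bop K\<^esub> j\<in>F. b j) \<xi>) ?d - hinner K (y \<xi>) ?d"
        using S y \<xi> dc by (intro hinner_simps(7)[OF K]) auto
      then show ?thesis using e by simp
    qed
    ultimately have inn: "((\<lambda>j. hinner K (x (a j \<xi>)) (a j ?d)) has_sum (- hinner K ?d ?d)) (J - F)" by simp
    obtain t' where t': "((\<lambda>j. (hnorm K (a j ?d))\<^sup>2) has_sum t') (J - F)"
      using has_sum_Diff[OF sq[OF dc] has_sum_finite[OF F(1)] F(2)] by blast
    have t'le: "t' \<le> (hnorm K ?d)\<^sup>2"
      by (rule has_sum_mono2[OF t' sq[OF dc]]) auto
    have tn: "0 \<le> t - (\<Sum>j\<in>F. (hnorm K (x (a j \<xi>)))\<^sup>2)" by (rule has_sum_nonneg[OF tail]) simp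
    have "(norm (- hinner K ?d ?d))\<^sup>2 \<le> t' * (t - (\<Sum>j\<in>F. (hnorm K (x (a j \<xi>)))\<^sup>2))"
      by (rule has_sum_hinner_bound[OF K _ _ t' tail inn]) (use ac dc \<xi> x in auto)
    also have "\<dots> \<le> (hnorm K ?d)\<^sup>2 * (t - (\<Sum>j\<in>F. (hnorm K (x (a j \<xi>)))\<^sup>2))"
      by (rule mult_right_mono[OF t'le tn])
    also have "\<dots> = (sqrt (t - (\<Sum>j\<in>F. (hnorm K (x (a j \<xi>)))\<^sup>2)) * hnorm K ?d)\<^sup>2"
      using tn by (simp add: power_mult_distrib)
    finally have "norm (- hinner K ?d ?d) \<le> sqrt (t - (\<Sum>j\<in>F. (hnorm K (x (a j \<xi>)))\<^sup>2)) * hnorm K ?d"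
      by (rule power2_le_imp_le) (use tn K dc in simp)
    then have "norm (hinner K ?d ?d) \<le> sqrt (t - (\<Sum>j\<in>F. (hnorm K (x (a j \<xi>)))\<^sup>2)) * hnorm K ?d"
      by (simp only: norm_minus_cancel)
    then show ?thesis using tn by (intro hnorm_le_by_testing[OF K dc]) auto
  qed
  have "((\<lambda>F. sqrt (t - (\<Sum>j\<in>F. (hnorm K (x (a j \<xi>)))\<^sup>2))) \<longlongrightarrow> sqrt (t - t)) (finite_subsets_at_top J)"
    using t unfolding has_sum_def by (intro tendsto_intros)
  then have l: "((\<lambda>F. sqrt (t - (\<Sum>j\<in>F. (hnorm K (x (a j \<xi>)))\<^sup>2))) \<longlongrightarrow> 0) (finite_subsets_at_top J)" by simp
  show "((\<lambda>F. hnorm K ((\<Oplus>\<^bsub>bop K\<^esub> j\<in>F. b j) \<xi> \<ominus>\<^bsub>K\<^esub> y \<xi>)) \<longlongrightarrow> 0) (finite_subsets_at_top J)"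
  proof (rule Lim_null_comparison[OF _ l], rule eventually_finite_subsets_at_top_weakI)
    fix F assume F: "finite F" "F \<subseteq> J"
    have "(\<Oplus>\<^bsub>bop K\<^esub> j\<in>F. b j) \<in> carrier (bop K)"
      using F b by (intro bop_finsum(1)[OF K]) auto
    then show "norm (hnorm K ((\<Oplus>\<^bsub>bop K\<^esub> j\<in>F. b j) \<xi> \<ominus>\<^bsub>K\<^esub> y \<xi>)) \<le> sqrt (t - (\<Sum>j\<in>F. (hnorm K (x (a j \<xi>)))\<^sup>2))"
      using est[OF F] K y \<xi> by simp
  qed
qed

text \<open>  The Riesz theorem turns the bounded form \<open>\<Sum>j. \<langle>x a\<^sub>j \<xi>, a\<^sub>j \<eta>\<rangle>\<close> into an operator; the form of \<open>x\<^sup>*\<close> provides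
  its adjoint.\<close>

lemma isometric_family_average:
  assumes K: "hilbert_space K" and a: "isometric_family K J a" and x: "x \<in> carrier (bop K)"
  shows "\<exists>y\<in>carrier (bop K). \<forall>\<xi>\<in>carrier K. \<forall>\<eta>\<in>carrier K.
    ((\<lambda>j. hinner K (x (a j \<xi>)) (a j \<eta>)) has_sum hinner K (y \<xi>) \<eta>) J"
proof -
  note ac = isometric_familyD(1)[OF a] and sq = isometric_familyD(2)[OF a]
  have ex: "\<exists>C\<ge>0. \<exists>T. \<forall>\<xi>\<in>carrier K. T \<xi> \<in> carrier K \<and> hnorm K (T \<xi>) \<le> C * hnorm K \<xi> \<and>
    (\<forall>\<eta>\<in>carrier K. ((\<lambda>j. hinner K (a j \<eta>) (x (a j \<xi>))) has_sum hinner K \<eta> (T \<xi>)) J)"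
    if x: "x \<in> carrier (bop K)" for x
  proof -
    obtain C where C: "C \<ge> 0" "\<forall>\<xi>\<in>carrier K. hnorm K (x \<xi>) \<le> C * hnorm K \<xi>"
      using bop_bound[OF K x] by blast
    have "\<exists>\<mu>\<in>carrier K. (\<forall>\<eta>\<in>carrier K. (\<Sum>\<^sub>\<infinity>j\<in>J. hinner K (a j \<eta>) (x (a j \<xi>))) = hinner K \<eta> \<mu>) \<and>
        hnorm K \<mu> \<le> C * hnorm K \<xi> \<and> (\<forall>\<kappa>\<in>carrier K. (\<forall>\<eta>\<in>carrier K. hinner K \<eta> \<kappa> = 0) \<longrightarrow> hinner K \<mu> \<kappa> = 0)"
      and hs: "\<And>\<eta>. \<eta> \<in> carrier K \<Longrightarrow> ((\<lambda>j. hinner K (a j \<eta>) (x (a j \<xi>))) has_sum (\<Sum>\<^sub>\<infinity>j\<in>J. hinner K (a j \<eta>) (x (a j \<xi>)))) J"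
      if \<xi>: "\<xi> \<in> carrier K" for \<xi>
    proof -
      obtain t where t: "((\<lambda>j. (hnorm K (x (a j \<xi>)))\<^sup>2) has_sum t) J"
        using isometric_family_summable(1)[OF K a x \<xi> \<xi>] by (auto simp: summable_on_def)
      have "t \<le> C\<^sup>2 * (hnorm K \<xi>)\<^sup>2"
      proof (rule has_sum_mono[OF t has_sum_cmult_right[OF sq[OF \<xi>]]])
        show "(hnorm K (x (a j \<xi>)))\<^sup>2 \<le> C\<^sup>2 * (hnorm K (a j \<xi>))\<^sup>2" if "j \<in> J" for j
          using power_mono[of "hnorm K (x (a j \<xi>))" "C * hnorm K (a j \<xi>)" 2] C ac[OF that] \<xi> x K
          by (simp add: power_mult_distrib)
      qed
      then have tC: "t \<le> (C * hnorm K \<xi>)\<^sup>2" by (simp add: power_mult_distrib)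
      show hs: "((\<lambda>j. hinner K (a j \<eta>) (x (a j \<xi>))) has_sum (\<Sum>\<^sub>\<infinity>j\<in>J. hinner K (a j \<eta>) (x (a j \<xi>)))) J"
        if \<eta>: "\<eta> \<in> carrier K" for \<eta>
      proof (rule has_sum_infsum, rule abs_summable_summable, rule abs_summable_hinner[OF K])
        show "(\<lambda>j. (hnorm K (a j \<eta>))\<^sup>2) summable_on J" using sq[OF \<eta>] by (auto simp: summable_on_def)
        show "(\<lambda>j. (hnorm K (x (a j \<xi>)))\<^sup>2) summable_on J" using t by (auto simp: summable_on_def)
      qed (use ac x \<xi> \<eta> in auto)
      show "\<exists>\<mu>\<in>carrier K. (\<forall>\<eta>\<in>carrier K. (\<Sum>\<^sub>\<infinity>j\<in>J. hinner K (a j \<eta>) (x (a j \<xi>))) = hinner K \<eta> \<mu>) \<and>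
        hnorm K \<mu> \<le> C * hnorm K \<xi> \<and> (\<forall>\<kappa>\<in>carrier K. (\<forall>\<eta>\<in>carrier K. hinner K \<eta> \<kappa> = 0) \<longrightarrow> hinner K \<mu> \<kappa> = 0)"
      proof (rule riesz_on_subspace[OF K])
        show "carrier K \<noteq> {}" using K hvec_closed(1) by blast
        show "\<exists>k\<in>carrier K. k = \<eta> \<oplus>\<^bsub>K\<^esub> c \<odot>\<^bsub>K\<^esub> \<mu> \<and> (\<Sum>\<^sub>\<infinity>j\<in>J. hinner K (a j k) (x (a j \<xi>)))
            = (\<Sum>\<^sub>\<infinity>j\<in>J. hinner K (a j \<eta>) (x (a j \<xi>))) + c * (\<Sum>\<^sub>\<infinity>j\<in>J. hinner K (a j \<mu>) (x (a j \<xi>)))"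
          if em: "\<eta> \<in> carrier K" "\<mu> \<in> carrier K" for \<eta> \<mu> c
        proof -
          have "((\<lambda>j. hinner K (a j \<eta>) (x (a j \<xi>)) + c * hinner K (a j \<mu>) (x (a j \<xi>))) has_sum
            ((\<Sum>\<^sub>\<infinity>j\<in>J. hinner K (a j \<eta>) (x (a j \<xi>))) + c * (\<Sum>\<^sub>\<infinity>j\<in>J. hinner K (a j \<mu>) (x (a j \<xi>))))) J"
            by (intro has_sum_add has_sum_cmult_right hs em)
          moreover have "hinner K (a j \<eta>) (x (a j \<xi>)) + c * hinner K (a j \<mu>) (x (a j \<xi>))
            = hinner K (a j (\<eta> \<oplus>\<^bsub>K\<^esub> c \<odot>\<^bsub>K\<^esub> \<mu>)) (x (a j \<xi>))" if "j \<in> J" for j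
            using ac[OF that] em \<xi> x K by simp
          ultimately have "((\<lambda>j. hinner K (a j (\<eta> \<oplus>\<^bsub>K\<^esub> c \<odot>\<^bsub>K\<^esub> \<mu>)) (x (a j \<xi>))) has_sum
            ((\<Sum>\<^sub>\<infinity>j\<in>J. hinner K (a j \<eta>) (x (a j \<xi>))) + c * (\<Sum>\<^sub>\<infinity>j\<in>J. hinner K (a j \<mu>) (x (a j \<xi>))))) J"
            by (simp cong: has_sum_cong)
          from infsumI[OF this] show ?thesis using em K by simp
        qed
        show "norm (\<Sum>\<^sub>\<infinity>j\<in>J. hinner K (a j \<eta>) (x (a j \<xi>))) \<le> C * hnorm K \<xi> * hnorm K \<eta>" if \<eta>: "\<eta> \<in> carrier K" for \<eta>
        proof (rule power2_le_imp_le)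
          have "(norm (\<Sum>\<^sub>\<infinity>j\<in>J. hinner K (a j \<eta>) (x (a j \<xi>))))\<^sup>2 \<le> t * (hnorm K \<eta>)\<^sup>2"
            by (rule has_sum_hinner_bound[OF K _ _ t sq[OF \<eta>] hs[OF \<eta>]]) (use ac x \<xi> \<eta> in auto)
          also have "\<dots> \<le> (C * hnorm K \<xi>)\<^sup>2 * (hnorm K \<eta>)\<^sup>2" using tC by (rule mult_right_mono) simp
          finally show "(norm (\<Sum>\<^sub>\<infinity>j\<in>J. hinner K (a j \<eta>) (x (a j \<xi>))))\<^sup>2 \<le> (C * hnorm K \<xi> * hnorm K \<eta>)\<^sup>2"
            by (simp add: power_mult_distrib)
        qed (use C K \<xi> \<eta> in auto)
      qed (use C K \<xi> in auto)
    qed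
    then have "\<forall>\<xi>\<in>carrier K. \<exists>\<mu>. \<mu> \<in> carrier K \<and> hnorm K \<mu> \<le> C * hnorm K \<xi> \<and>
      (\<forall>\<eta>\<in>carrier K. ((\<lambda>j. hinner K (a j \<eta>) (x (a j \<xi>))) has_sum hinner K \<eta> \<mu>) J)"
      by fastforce
    from bchoice[OF this] C(1) show ?thesis by blast
  qed
  obtain C T where C: "C \<ge> 0" and T: "\<forall>\<xi>\<in>carrier K. T \<xi> \<in> carrier K \<and> hnorm K (T \<xi>) \<le> C * hnorm K \<xi> \<and>
    (\<forall>\<eta>\<in>carrier K. ((\<lambda>j. hinner K (a j \<eta>) (x (a j \<xi>))) has_sum hinner K \<eta> (T \<xi>)) J)"
    using ex[OF x] by blast
  obtain D S where S: "\<forall>\<xi>\<in>carrier K. S \<xi> \<in> carrier K \<and> hnorm K (S \<xi>) \<le> D * hnorm K \<xi> \<and>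
    (\<forall>\<eta>\<in>carrier K. ((\<lambda>j. hinner K (a j \<eta>) (adj K x (a j \<xi>))) has_sum hinner K \<eta> (S \<xi>)) J)"
    using ex[OF adj_pair(2)[OF K x]] by blast
  have val: "((\<lambda>j. hinner K (x (a j \<xi>)) (a j \<eta>)) has_sum hinner K (T \<xi>) \<eta>) J"
    if "\<xi> \<in> carrier K" "\<eta> \<in> carrier K" for \<xi> \<eta>
  proof -
    have "((\<lambda>j. cnj (hinner K (a j \<eta>) (x (a j \<xi>)))) has_sum cnj (hinner K \<eta> (T \<xi>))) J"
      using T that by (subst has_sum_cnj_iff) blast
    moreover have "cnj (hinner K (a j \<eta>) (x (a j \<xi>))) = hinner K (x (a j \<xi>)) (a j \<eta>)" if "j \<in> J" for j
      using ac[OF that] \<open>\<xi> \<in> carrier K\<close> \<open>\<eta> \<in> carrier K\<close> x by (intro hinner_cnj[OF K]) auto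
    moreover have "cnj (hinner K \<eta> (T \<xi>)) = hinner K (T \<xi>) \<eta>"
      using T that by (intro hinner_cnj[OF K]) auto
    ultimately show ?thesis by (rule has_sum_transform)
  qed
  have "hinner K (T \<xi>) \<eta> = hinner K \<xi> (S \<eta>)" if xe: "\<xi> \<in> carrier K" "\<eta> \<in> carrier K" for \<xi> \<eta>
  proof (rule has_sum_unique[OF val[OF xe]])
    have "((\<lambda>j. hinner K (a j \<xi>) (adj K x (a j \<eta>))) has_sum hinner K \<xi> (S \<eta>)) J" using S xe by blast
    moreover have "hinner K (a j \<xi>) (adj K x (a j \<eta>)) = hinner K (x (a j \<xi>)) (a j \<eta>)" if "j \<in> J" for j
      using ac[OF that] xe x by (simp add: adjoint_pair_left[OF adj_pair(1)[OF K x]])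
    ultimately show "((\<lambda>j. hinner K (x (a j \<xi>)) (a j \<eta>)) has_sum hinner K \<xi> (S \<eta>)) J"
      by (simp cong: has_sum_cong)
  qed
  then have "adjoint_pair K K T S"
    unfolding adjoint_pair_def using T S by (intro conjI exI[of _ C]) auto
  then have "restrict T (carrier K) \<in> carrier (bop K)" by (rule restrict_bop[OF K])
  then show ?thesis using val by (intro bexI[of _ "restrict T (carrier K)"]) auto
qed

text \<open>The sum of the \<open>a\<^sub>j\<^sup>* x a\<^sub>j\<close> is in \<open>R\<close>, because every summand commutes with the commutant of \<open>R\<close>.\<close>

lemma isometric_family_channel:
  fixes J :: "'j set"
  assumes H: "hilbert_space H" and R: "von_neumann_algebra H R"
    and aR: "a \<in> J \<rightarrow> R" and a: "isometric_family H J a"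
  shows "\<exists>\<phi>. quantum_channel TYPE('j) H R \<phi> \<and> (\<forall>x\<in>R. \<forall>\<xi>\<in>carrier H. \<forall>\<eta>\<in>carrier H.
    ((\<lambda>j. hinner H (x (a j \<xi>)) (a j \<eta>)) has_sum hinner H (\<phi> x \<xi>) \<eta>) J)"
proof -
  note [simp] = H R vn_subset[OF R]
  note ac = isometric_familyD(1)[OF a]
  have "\<forall>x\<in>R. \<exists>y. y \<in> carrier (bop H) \<and> (\<forall>\<xi>\<in>carrier H. \<forall>\<eta>\<in>carrier H.
    ((\<lambda>j. hinner H (x (a j \<xi>)) (a j \<eta>)) has_sum hinner H (y \<xi>) \<eta>) J)"
    using isometric_family_average[OF H a] vn_subset[OF R] by blast
  from bchoice[OF this] obtain \<phi> where \<phi>: "\<And>x. x \<in> R \<Longrightarrow> \<phi> x \<in> carrier (bop H)"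
    and val: "\<And>x \<xi> \<eta>. x \<in> R \<Longrightarrow> \<xi> \<in> carrier H \<Longrightarrow> \<eta> \<in> carrier H \<Longrightarrow>
      ((\<lambda>j. hinner H (x (a j \<xi>)) (a j \<eta>)) has_sum hinner H (\<phi> x \<xi>) \<eta>) J"
    by blast
  have \<phi>R: "\<phi> x \<in> R" if x: "x \<in> R" for x
  proof (rule vn_memI[OF H R \<phi>[OF x]])
    fix z \<xi> assume z: "z \<in> commutant H R" and \<xi>: "\<xi> \<in> carrier H"
    have zb: "z \<in> carrier (bop H)" by (rule commutantD(1)[OF z])
    have z': "adj H z \<in> commutant H R"
      by (rule commutant_adj[OF H _ _ z]) (use vn_closed(3)[OF H R] in auto)
    show "\<phi> x (z \<xi>) = z (\<phi> x \<xi>)"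
    proof (rule hvec_eqI[OF H])
      fix \<eta> assume \<eta>: "\<eta> \<in> carrier H"
      have "((\<lambda>j. hinner H (x (a j \<xi>)) (a j (adj H z \<eta>))) has_sum hinner H (\<phi> x \<xi>) (adj H z \<eta>)) J"
        using x \<xi> \<eta> zb by (intro val) auto
      moreover have "hinner H (x (a j \<xi>)) (a j (adj H z \<eta>)) = hinner H (x (a j (z \<xi>))) (a j \<eta>)" if j: "j \<in> J" for j
      proof -
        have aj: "a j \<in> R" using aR j by blast
        have "hinner H (x (a j \<xi>)) (a j (adj H z \<eta>)) = hinner H (x (a j \<xi>)) (adj H z (a j \<eta>))"
          using commutantD(2)[OF z' aj \<eta>] by simp
        also have "\<dots> = hinner H (z (x (a j \<xi>))) (a j \<eta>)"
          using x aj \<xi> \<eta> by (simp add: adjoint_pair_left[OF adj_pair(1)[OF H zb]])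
        also have "z (x (a j \<xi>)) = x (z (a j \<xi>))" using commutantD(2)[OF z x, of "a j \<xi>"] aj \<xi> by simp
        also have "z (a j \<xi>) = a j (z \<xi>)" using commutantD(2)[OF z aj \<xi>] by simp
        finally show ?thesis .
      qed
      ultimately have "((\<lambda>j. hinner H (x (a j (z \<xi>))) (a j \<eta>)) has_sum hinner H (\<phi> x \<xi>) (adj H z \<eta>)) J"
        by (simp cong: has_sum_cong)
      then have "hinner H (\<phi> x (z \<xi>)) \<eta> = hinner H (\<phi> x \<xi>) (adj H z \<eta>)"
        using has_sum_unique val[OF x, of "z \<xi>" \<eta>] zb \<xi> \<eta> by blast
      then show "hinner H (\<phi> x (z \<xi>)) \<eta> = hinner H (z (\<phi> x \<xi>)) \<eta>"
        using \<phi>[OF x] \<xi> \<eta> by (simp add: adjoint_pair_left[OF adj_pair(1)[OF H zb]])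
    qed (use \<phi>[OF x] zb \<xi> in auto)
  qed
  have "limitin (strong_operator_topology H) (\<lambda>F. \<Oplus>\<^bsub>bop H\<^esub> j\<in>F. adj H (a j) \<otimes>\<^bsub>bop H\<^esub> a j)
    \<one>\<^bsub>bop H\<^esub> (finite_subsets_at_top J)"
  proof (rule isometric_family_sot[OF H a, of "\<one>\<^bsub>bop H\<^esub>"])
    show "((\<lambda>j. hinner H (\<one>\<^bsub>bop H\<^esub> (a j \<xi>)) (a j \<eta>)) has_sum hinner H (\<one>\<^bsub>bop H\<^esub> \<xi>) \<eta>) J"
      if xe: "\<xi> \<in> carrier H" "\<eta> \<in> carrier H" for \<xi> \<eta>
      by (rule has_sum_transform[OF isometric_family_polarized[OF H a xe]]) (use ac xe in auto)
  qed (use ac in \<open>auto simp: hinner_adj\<close>)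
  moreover have "limitin (strong_operator_topology H) (\<lambda>F. \<Oplus>\<^bsub>bop H\<^esub> j\<in>F. adj H (a j) \<otimes>\<^bsub>bop H\<^esub> x \<otimes>\<^bsub>bop H\<^esub> a j)
    (\<phi> x) (finite_subsets_at_top J)" if x: "x \<in> R" for x
    by (rule isometric_family_sot[OF H a _ _ _ \<phi>[OF x] val[OF x]]) (use ac x in \<open>auto simp: hinner_adj\<close>)
  ultimately have "quantum_channel TYPE('j) H R \<phi>"
    unfolding quantum_channel_def using \<phi>R aR by blast
  then show ?thesis using val by blast
qed

lemma channel_isometric_family:
  assumes H: "hilbert_space H" and R: "von_neumann_algebra H R"
    and \<phi>: "quantum_channel TYPE('j) H R \<phi>"
  shows "\<exists>(J :: 'j set) a. a \<in> J \<rightarrow> R \<and> isometric_family H J a \<and> (\<forall>x\<in>R. \<forall>\<xi>\<in>carrier H. \<forall>\<eta>\<in>carrier H.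
    ((\<lambda>j. hinner H (x (a j \<xi>)) (a j \<eta>)) has_sum hinner H (\<phi> x \<xi>) \<eta>) J)"
proof -
  note [simp] = H R vn_subset[OF R]
  obtain J :: "'j set" and a where aR: "a \<in> J \<rightarrow> R"
    and one: "limitin (strong_operator_topology H) (\<lambda>F. \<Oplus>\<^bsub>bop H\<^esub> j\<in>F. adj H (a j) \<otimes>\<^bsub>bop H\<^esub> a j)
          \<one>\<^bsub>bop H\<^esub> (finite_subsets_at_top J)"
    and lim: "\<And>x. x \<in> R \<Longrightarrow> limitin (strong_operator_topology H)
          (\<lambda>F. \<Oplus>\<^bsub>bop H\<^esub> j\<in>F. adj H (a j) \<otimes>\<^bsub>bop H\<^esub> x \<otimes>\<^bsub>bop H\<^esub> a j)
          (\<phi> x) (finite_subsets_at_top J)" and \<phi>R: "\<phi> \<in> R \<rightarrow> R"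
    using \<phi> unfolding quantum_channel_def by blast
  have aj: "a j \<in> R" if "j \<in> J" for j using aR that by blast
  have "((\<lambda>j. (hnorm H (a j \<xi>))\<^sup>2) has_sum (hnorm H \<xi>)\<^sup>2) J" if \<xi>: "\<xi> \<in> carrier H" for \<xi>
  proof -
    have "((\<lambda>j. hinner H ((adj H (a j) \<otimes>\<^bsub>bop H\<^esub> a j) \<xi>) \<xi>) has_sum hinner H (\<one>\<^bsub>bop H\<^esub> \<xi>) \<xi>) J"
      using aj by (intro sot_has_sum[OF H _ one _ \<xi> \<xi>]) auto
    then have "((\<lambda>j. complex_of_real ((hnorm H (a j \<xi>))\<^sup>2)) has_sum complex_of_real ((hnorm H \<xi>)\<^sup>2)) J"
      by (rule has_sum_transform) (use aj \<xi> in \<open>auto simp: hinner_adj hinner_self\<close>)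
    then show ?thesis by (subst (asm) has_sum_of_real_iff)
  qed
  then have "isometric_family H J a" using aj by (auto simp: isometric_family_def)
  moreover have "((\<lambda>j. hinner H (x (a j \<xi>)) (a j \<eta>)) has_sum hinner H (\<phi> x \<xi>) \<eta>) J"
    if x: "x \<in> R" and xe: "\<xi> \<in> carrier H" "\<eta> \<in> carrier H" for x \<xi> \<eta>
  proof -
    have \<phi>x: "\<phi> x \<in> R" using \<phi>R x by blast
    have "((\<lambda>j. hinner H ((adj H (a j) \<otimes>\<^bsub>bop H\<^esub> x \<otimes>\<^bsub>bop H\<^esub> a j) \<xi>) \<eta>) has_sum hinner H (\<phi> x \<xi>) \<eta>) J"
      using aj x by (intro sot_has_sum[OF H _ lim[OF x] vn_subset[OF R \<phi>x] xe]) auto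
    moreover have "hinner H ((adj H (a j) \<otimes>\<^bsub>bop H\<^esub> x \<otimes>\<^bsub>bop H\<^esub> a j) \<xi>) \<eta> = hinner H (x (a j \<xi>)) (a j \<eta>)" if "j \<in> J" for j
      using aj[OF that] x xe by (simp add: hinner_adj)
    ultimately show ?thesis by (simp cong: has_sum_cong)
  qed
  ultimately show ?thesis using aR by blast
qed


section \<open>Channels and extensions of states\<close>

lemma isometric_family_pairs:
  assumes K: "hilbert_space K" and a: "isometric_family K J a" and \<zeta>: "square_summable K \<zeta>"
    and t: "((\<lambda>n. (hnorm K (\<zeta> n))\<^sup>2) has_sum t) UNIV"
  shows "((\<lambda>p. (hnorm K (a (fst p) (\<zeta> (snd p))))\<^sup>2) has_sum t) (J \<times> UNIV)"
proof -
  have "((\<lambda>p. (hnorm K (a (snd p) (\<zeta> (fst p))))\<^sup>2) has_sum t) (UNIV \<times> J)"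
  proof (rule has_sum_SigmaI[OF _ t])
    show inner: "((\<lambda>j. (hnorm K (a (snd (n, j)) (\<zeta> (fst (n, j)))))\<^sup>2) has_sum (hnorm K (\<zeta> n))\<^sup>2) J" for n
      using isometric_familyD(2)[OF a square_summable_vec[OF \<zeta>]] by simp
    show "(\<lambda>p. (hnorm K (a (snd p) (\<zeta> (fst p))))\<^sup>2) summable_on UNIV \<times> J"
      by (rule summable_on_SigmaI[OF inner]) (use t in \<open>auto simp: summable_on_def\<close>)
  qed
  then show ?thesis by (subst has_sum_swap) (simp add: case_prod_unfold)
qed

text \<open>  The family \<open>\<langle>x a\<^sub>j \<zeta>\<^sub>n, a\<^sub>j \<zeta>\<^sub>n\<rangle>\<close> is absolutely summable over all pairs, since the vectors \<open>a\<^sub>j \<zeta>\<^sub>n\<close> are square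
  summable.  Hence the two iterated sums agree.\<close>

lemma isometric_family_double_sum:
  assumes K: "hilbert_space K" and a: "isometric_family K J a" and \<zeta>: "square_summable K \<zeta>"
    and x: "x \<in> carrier (bop K)"
  obtains s where "((\<lambda>p. hinner K (x (a (fst p) (\<zeta> (snd p)))) (a (fst p) (\<zeta> (snd p)))) has_sum s) (J \<times> UNIV)"
    "\<And>g. (\<And>j. j \<in> J \<Longrightarrow> ((\<lambda>n. hinner K (x (a j (\<zeta> n))) (a j (\<zeta> n))) has_sum g j) UNIV) \<Longrightarrow> (g has_sum s) J"
    "\<And>g. (\<And>n. ((\<lambda>j. hinner K (x (a j (\<zeta> n))) (a j (\<zeta> n))) has_sum g n) J) \<Longrightarrow> (g has_sum s) UNIV"
proof -
  let ?\<kappa> = "\<lambda>p. a (fst p) (\<zeta> (snd p))"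
  obtain t where "((\<lambda>n. (hnorm K (\<zeta> n))\<^sup>2) has_sum t) UNIV"
    using \<zeta> by (auto simp: square_summable_iff summable_on_def)
  from isometric_family_pairs[OF K a \<zeta> this]
  have sq: "(\<lambda>p. (hnorm K (?\<kappa> p))\<^sup>2) summable_on (J \<times> UNIV)" by (auto simp: summable_on_def)
  have \<kappa>c: "?\<kappa> p \<in> carrier K" if "p \<in> J \<times> UNIV" for p
    using that isometric_familyD(1)[OF a] \<zeta> by auto
  have "(\<lambda>p. (hnorm K (x (?\<kappa> p)))\<^sup>2) summable_on (J \<times> UNIV)"
    by (rule summable_bounded_image[OF K K adj_pair(1)[OF K x] \<kappa>c sq])
  then have "(\<lambda>p. hinner K (x (?\<kappa> p)) (?\<kappa> p)) summable_on (J \<times> UNIV)"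
    using \<kappa>c x by (intro abs_summable_summable[OF abs_summable_hinner[OF K _ _ _ sq]]) auto
  then obtain s where s: "((\<lambda>p. hinner K (x (?\<kappa> p)) (?\<kappa> p)) has_sum s) (J \<times> UNIV)"
    by (auto simp: summable_on_def)
  have s': "((\<lambda>p. hinner K (x (a (snd p) (\<zeta> (fst p)))) (a (snd p) (\<zeta> (fst p)))) has_sum s) (UNIV \<times> J)"
    using s by (subst has_sum_swap) (simp add: case_prod_unfold)
  show thesis
  proof (rule that[OF s])
    show "(g has_sum s) J" if "\<And>j. j \<in> J \<Longrightarrow> ((\<lambda>n. hinner K (x (a j (\<zeta> n))) (a j (\<zeta> n))) has_sum g j) UNIV" for g
      by (rule has_sum_SigmaD[OF s]) (simp add: that)
    show "(g has_sum s) UNIV" if "\<And>n. ((\<lambda>j. hinner K (x (a j (\<zeta> n))) (a j (\<zeta> n))) has_sum g n) J" for g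
      by (rule has_sum_SigmaD[OF s']) (simp add: that)
  qed
qed

text \<open>  A normal state may be applied termwise to the sum that defines a channel: decompose the state and
  exchange the summations over \<open>j\<close> and \<open>n\<close>.\<close>

lemma normal_state_channel:
  assumes H: "hilbert_space H" and R: "von_neumann_algebra H R" and \<omega>: "normal_state H R \<omega>"
    and aR: "a \<in> J \<rightarrow> R" and a: "isometric_family H J a" and x: "x \<in> R" and y: "y \<in> R"
    and val: "\<And>\<xi> \<eta>. \<xi> \<in> carrier H \<Longrightarrow> \<eta> \<in> carrier H \<Longrightarrow>
      ((\<lambda>j. hinner H (x (a j \<xi>)) (a j \<eta>)) has_sum hinner H (y \<xi>) \<eta>) J"
  shows "((\<lambda>j. \<omega> (adj H (a j) \<otimes>\<^bsub>bop H\<^esub> x \<otimes>\<^bsub>bop H\<^esub> a j)) has_sum \<omega> y) J"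
proof -
  note [simp] = H R vn_subset[OF R]
  obtain \<zeta> where \<zeta>: "square_summable H \<zeta>"
    and sum: "\<And>x. x \<in> R \<Longrightarrow> ((\<lambda>n. hinner H (x (\<zeta> n)) (\<zeta> n)) has_sum \<omega> x) UNIV"
    using normal_state_decomposition[OF H R \<omega>] by blast
  obtain s where rows: "\<And>g. (\<And>j. j \<in> J \<Longrightarrow> ((\<lambda>n. hinner H (x (a j (\<zeta> n))) (a j (\<zeta> n))) has_sum g j) UNIV) \<Longrightarrow> (g has_sum s) J"
    and cols: "\<And>g. (\<And>n. ((\<lambda>j. hinner H (x (a j (\<zeta> n))) (a j (\<zeta> n))) has_sum g n) J) \<Longrightarrow> (g has_sum s) UNIV"
    by (rule isometric_family_double_sum[OF H a \<zeta> vn_subset[OF R x]]) blast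
  have "((\<lambda>n. hinner H (y (\<zeta> n)) (\<zeta> n)) has_sum s) UNIV"
    using \<zeta> by (intro cols val) auto
  then have "s = \<omega> y" using sum[OF y] has_sum_unique by blast
  moreover have "((\<lambda>j. \<omega> (adj H (a j) \<otimes>\<^bsub>bop H\<^esub> x \<otimes>\<^bsub>bop H\<^esub> a j)) has_sum s) J"
  proof (rule rows)
    fix j assume j: "j \<in> J"
    have aj: "a j \<in> R" using aR j by blast
    show "((\<lambda>n. hinner H (x (a j (\<zeta> n))) (a j (\<zeta> n))) has_sum \<omega> (adj H (a j) \<otimes>\<^bsub>bop H\<^esub> x \<otimes>\<^bsub>bop H\<^esub> a j)) UNIV"
      by (rule has_sum_transform[OF sum]) (use aj x \<zeta> in \<open>auto simp: hinner_adj\<close>)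
  qed
  ultimately show ?thesis by simp
qed

text \<open>  The identity \<open>\<Sum>j. a\<^sub>j\<^sup>* a\<^sub>j = 1\<close> passes through \<open>\<pi>\<close>, since \<open>\<parallel>\<pi>(a\<^sub>j) \<kappa>\<parallel>\<^sup>2 = \<Sum>n. \<parallel>a\<^sub>j \<zeta>\<^sub>n\<parallel>\<^sup>2\<close> for the sequence \<open>\<zeta>\<close> that
  decomposes the vector functional of \<open>\<kappa>\<close>.\<close>

lemma representation_isometric_family:
  assumes H: "hilbert_space H" and K: "hilbert_space K" and R: "von_neumann_algebra H R"
    and \<pi>: "spatially_normal H R K \<pi>" and aR: "a \<in> J \<rightarrow> R" and a: "isometric_family H J a"
  shows "isometric_family K J (\<lambda>j. \<pi> (a j))"
proof -
  note [simp] = H K R vn_subset[OF R]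
  have sr: "star_representation H R K \<pi>" using \<pi> by (simp add: spatially_normal_def)
  note [simp] = star_representationD[OF sr]
  have aj: "a j \<in> R" if "j \<in> J" for j using aR that by blast
  have "((\<lambda>j. (hnorm K (\<pi> (a j) \<kappa>))\<^sup>2) has_sum (hnorm K \<kappa>)\<^sup>2) J" if \<kappa>: "\<kappa> \<in> carrier K" for \<kappa>
  proof -
    obtain \<zeta> where \<zeta>: "square_summable H \<zeta>"
      and sum: "\<And>x. x \<in> R \<Longrightarrow> ((\<lambda>n. hinner H (x (\<zeta> n)) (\<zeta> n)) has_sum hinner K (\<pi> x \<kappa>) \<kappa>) UNIV"
      using \<pi> \<kappa> unfolding spatially_normal_def by blast
    have sq: "((\<lambda>n. (hnorm H (y (\<zeta> n)))\<^sup>2) has_sum (hnorm K (\<pi> y \<kappa>))\<^sup>2) UNIV" if y: "y \<in> R" for y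
    proof -
      have "((\<lambda>n. complex_of_real ((hnorm H (y (\<zeta> n)))\<^sup>2)) has_sum complex_of_real ((hnorm K (\<pi> y \<kappa>))\<^sup>2)) UNIV"
        by (rule has_sum_transform[OF sum[of "adj H y \<otimes>\<^bsub>bop H\<^esub> y"]])
           (use y \<kappa> \<zeta> in \<open>auto simp: hinner_adj hinner_self\<close>)
      then show ?thesis by (subst (asm) has_sum_of_real_iff)
    qed
    have "((\<lambda>n. (hnorm H (\<zeta> n))\<^sup>2) has_sum (hnorm K \<kappa>)\<^sup>2) UNIV"
      using sq[of "\<one>\<^bsub>bop H\<^esub>"] \<kappa> \<zeta> by simp
    from has_sum_SigmaD[OF isometric_family_pairs[OF H a \<zeta> this]]
    show ?thesis using sq aj by simp
  qed
  then show ?thesis using aj by (simp add: isometric_family_def)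
qed

text \<open>
  From a channel to the extension of \<open>\<rho>\<close>: apply to the given extension of \<open>\<omega>\<close> the map
  \<open>y \<mapsto> \<Sum>j. \<pi>(a\<^sub>j)\<^sup>* y \<pi>(a\<^sub>j)\<close>, which fixes the commutant.  If \<open>\<omega>'\<close> is decomposed by \<open>\<xi>\<close>, the result is
  decomposed by the vectors \<open>\<pi>(a\<^sub>j) \<xi>\<^sub>n\<close>, of which countably many are nonzero.
\<close>

lemma channel_imp_extension:
  assumes H: "hilbert_space H" and K: "hilbert_space K" and R: "von_neumann_algebra H R"
    and \<omega>: "normal_state H R \<omega>"
    and \<pi>: "spatially_normal H R K \<pi>"
    and \<phi>: "quantum_channel TYPE('j) H R \<phi>" and \<rho>: "\<And>x. x \<in> R \<Longrightarrow> \<omega> (\<phi> x) = \<rho> x"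
    and \<omega>': "normal_state K (carrier (bop K)) \<omega>'" and ext: "\<And>x. x \<in> R \<Longrightarrow> \<omega>' (\<pi> x) = \<omega> x"
  shows "\<exists>\<rho>'. normal_state K (carrier (bop K)) \<rho>' \<and> (\<forall>x\<in>R. \<rho>' (\<pi> x) = \<rho> x) \<and>
    (\<forall>y\<in>commutant K (\<pi> ` R). \<omega>' y = \<rho>' y)"
proof -
  note [simp] = H K R vn_subset[OF R]
  have sr: "star_representation H R K \<pi>" using \<pi> by (simp add: spatially_normal_def)
  note [simp] = star_representationD[OF sr]
  obtain J :: "'j set" and a where aR: "a \<in> J \<rightarrow> R" and a: "isometric_family H J a"
    and val: "\<And>x \<xi> \<eta>. x \<in> R \<Longrightarrow> \<xi> \<in> carrier H \<Longrightarrow> \<eta> \<in> carrier H \<Longrightarrow>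
      ((\<lambda>j. hinner H (x (a j \<xi>)) (a j \<eta>)) has_sum hinner H (\<phi> x \<xi>) \<eta>) J"
    using channel_isometric_family[OF H R \<phi>] by blast
  have \<phi>R: "\<phi> x \<in> R" if "x \<in> R" for x using \<phi> that by (auto simp: quantum_channel_def)
  have aj: "a j \<in> R" if "j \<in> J" for j using aR that by blast
  define b where "b j = \<pi> (a j)" for j
  have b: "isometric_family K J b"
    using representation_isometric_family[OF H K R \<pi> aR a] by (simp add: b_def[abs_def])
  obtain \<xi> where \<xi>: "square_summable K \<xi>"
    and \<omega>\<xi>: "\<And>y. y \<in> carrier (bop K) \<Longrightarrow> ((\<lambda>n. hinner K (y (\<xi> n)) (\<xi> n)) has_sum \<omega>' y) UNIV"
    using normal_state_decomposition[OF K vn_bop[OF K] \<omega>'] by blast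
  have "\<omega>' \<one>\<^bsub>bop K\<^esub> = 1" using \<omega>' by (simp add: normal_state_def is_state_def)
  then have "((\<lambda>n. complex_of_real ((hnorm K (\<xi> n))\<^sup>2)) has_sum complex_of_real 1) UNIV"
    by (intro has_sum_transform[OF \<omega>\<xi>[of "\<one>\<^bsub>bop K\<^esub>"]]) (use \<xi> in \<open>auto simp: hinner_self\<close>)
  then have \<xi>1: "((\<lambda>n. (hnorm K (\<xi> n))\<^sup>2) has_sum 1) UNIV" by (subst (asm) has_sum_of_real_iff)
  let ?\<kappa> = "\<lambda>p. b (fst p) (\<xi> (snd p))"
  have sq: "((\<lambda>p. (hnorm K (?\<kappa> p))\<^sup>2) has_sum 1) (J \<times> UNIV)"
    by (rule isometric_family_pairs[OF K b \<xi> \<xi>1])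
  have "\<exists>\<zeta>. square_summable K \<zeta> \<and> (\<forall>f :: 'b \<Rightarrow> complex. f \<zero>\<^bsub>K\<^esub> = 0 \<longrightarrow>
      (\<forall>t. ((\<lambda>p. f (?\<kappa> p)) has_sum t) (J \<times> UNIV) \<longleftrightarrow> ((\<lambda>n. f (\<zeta> n)) has_sum t) UNIV))"
    using isometric_familyD(1)[OF b] \<xi> sq
    by (intro square_summable_family_enum[OF K]) (auto simp: summable_on_def)
  then obtain \<zeta> where \<zeta>: "square_summable K \<zeta>"
    and enum: "\<And>f :: 'b \<Rightarrow> complex. \<And>t. f \<zero>\<^bsub>K\<^esub> = 0 \<Longrightarrow>
      ((\<lambda>p. f (?\<kappa> p)) has_sum t) (J \<times> UNIV) \<Longrightarrow> ((\<lambda>n. f (\<zeta> n)) has_sum t) UNIV"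
    by blast
  have "((\<lambda>n. complex_of_real ((hnorm K (\<zeta> n))\<^sup>2)) has_sum complex_of_real 1) UNIV"
    using enum[of "\<lambda>v. complex_of_real ((hnorm K v)\<^sup>2)", OF _ has_sum_of_real[OF sq]] by simp
  then have \<zeta>1: "((\<lambda>n. (hnorm K (\<zeta> n))\<^sup>2) has_sum 1) UNIV" by (subst (asm) has_sum_of_real_iff)
  define \<rho>' where "\<rho>' y = (\<Sum>n. hinner K (y (\<zeta> n)) (\<zeta> n))" for y
  have "normal_state K (carrier (bop K)) \<rho>'"
    unfolding \<rho>'_def[abs_def] by (rule normal_state_of_sequence[OF K \<zeta> \<zeta>1])
  moreover have "\<rho>' (\<pi> x) = \<rho> x" if x: "x \<in> R" for x
  proof -
    have \<pi>x: "\<pi> x \<in> carrier (bop K)" using x by simp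
    obtain s where s: "((\<lambda>p. hinner K (\<pi> x (?\<kappa> p)) (?\<kappa> p)) has_sum s) (J \<times> UNIV)"
      and rows: "\<And>g. (\<And>j. j \<in> J \<Longrightarrow> ((\<lambda>n. hinner K (\<pi> x (b j (\<xi> n))) (b j (\<xi> n))) has_sum g j) UNIV) \<Longrightarrow> (g has_sum s) J"
      by (rule isometric_family_double_sum[OF K b \<xi> \<pi>x]) blast
    have "((\<lambda>n. hinner K (\<pi> x (\<zeta> n)) (\<zeta> n)) has_sum s) UNIV"
      by (rule enum[OF _ s]) (use x in simp)
    then have "\<rho>' (\<pi> x) = s" unfolding \<rho>'_def by (rule has_sum_imp_suminf)
    moreover have "((\<lambda>j. \<omega> (adj H (a j) \<otimes>\<^bsub>bop H\<^esub> x \<otimes>\<^bsub>bop H\<^esub> a j)) has_sum s) J"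
    proof (rule rows)
      fix j assume j: "j \<in> J"
      let ?y = "adj H (a j) \<otimes>\<^bsub>bop H\<^esub> x \<otimes>\<^bsub>bop H\<^esub> a j"
      have y: "?y \<in> R" using aj[OF j] x by simp
      show "((\<lambda>n. hinner K (\<pi> x (b j (\<xi> n))) (b j (\<xi> n))) has_sum \<omega> ?y) UNIV"
      proof (rule has_sum_transform[OF \<omega>\<xi>[of "\<pi> ?y"]])
        show "hinner K (\<pi> ?y (\<xi> n)) (\<xi> n) = hinner K (\<pi> x (b j (\<xi> n))) (b j (\<xi> n))" for n
          using aj[OF j] x \<xi> by (simp add: b_def hinner_adj)
        show "\<omega>' (\<pi> ?y) = \<omega> ?y" by (rule ext[OF y])
      qed (use y in simp)
    qed
    moreover have "((\<lambda>j. \<omega> (adj H (a j) \<otimes>\<^bsub>bop H\<^esub> x \<otimes>\<^bsub>bop H\<^esub> a j)) has_sum \<omega> (\<phi> x)) J"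
      by (rule normal_state_channel[OF H R \<omega> aR a x \<phi>R[OF x] val[OF x]])
    ultimately have "\<rho>' (\<pi> x) = \<omega> (\<phi> x)" using has_sum_unique by blast
    then show ?thesis using \<rho>[OF x] by simp
  qed
  moreover have "\<omega>' y = \<rho>' y" if y: "y \<in> commutant K (\<pi> ` R)" for y
  proof -
    have yb: "y \<in> carrier (bop K)" by (rule commutantD(1)[OF y])
    obtain s where s: "((\<lambda>p. hinner K (y (?\<kappa> p)) (?\<kappa> p)) has_sum s) (J \<times> UNIV)"
      and cols: "\<And>g. (\<And>n. ((\<lambda>j. hinner K (y (b j (\<xi> n))) (b j (\<xi> n))) has_sum g n) J) \<Longrightarrow> (g has_sum s) UNIV"
      by (rule isometric_family_double_sum[OF K b \<xi> yb]) blast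
    have "((\<lambda>n. hinner K (y (\<zeta> n)) (\<zeta> n)) has_sum s) UNIV"
      by (rule enum[OF _ s]) (use yb adjoint_pair_zero[OF K K adj_pair(1)[OF K yb]] in simp)
    then have "\<rho>' y = s" unfolding \<rho>'_def by (rule has_sum_imp_suminf)
    moreover have "((\<lambda>n. hinner K (y (\<xi> n)) (\<xi> n)) has_sum s) UNIV"
    proof (rule cols)
      fix n
      have yx: "y (\<xi> n) \<in> carrier K" "\<xi> n \<in> carrier K" using yb \<xi> by auto
      show "((\<lambda>j. hinner K (y (b j (\<xi> n))) (b j (\<xi> n))) has_sum hinner K (y (\<xi> n)) (\<xi> n)) J"
      proof (rule has_sum_transform[OF isometric_family_polarized[OF K b yx]])
        fix j assume "j \<in> J"
        then have "b j \<in> \<pi> ` R" using aj by (simp add: b_def)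
        from commutantD(2)[OF y this yx(2)]
        show "hinner K (b j (y (\<xi> n))) (b j (\<xi> n)) = hinner K (y (b j (\<xi> n))) (b j (\<xi> n))" by simp
      qed simp
    qed
    ultimately show ?thesis using has_sum_unique[OF \<omega>\<xi>[OF yb]] by blast
  qed
  ultimately show ?thesis by blast
qed

text \<open>
  From the extension of \<open>\<rho>\<close> to a channel.  The vectors \<open>T \<xi>\<close>, with \<open>T\<close> running through the
  intertwiners from \<open>\<pi>\<close> to the identity representation, form a subspace of \<open>H\<close>.  Since \<open>T\<^sup>* T\<close> is
  in the commutant of \<open>\<pi>(R)\<close>, the assumption says that \<open>T \<xi> \<mapsto> (T \<eta>\<^sub>n)\<^sub>n\<close> preserves norms.
  Its components \<open>a\<^sub>n\<close>, extended by zero, commute with the commutant of \<open>R\<close>, which acts on the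
  intertwiners.  As the intertwiners separate points, \<open>\<pi>(a\<^sub>n) \<xi> = \<eta>\<^sub>n\<close>.
\<close>

lemma extension_imp_channel:
  fixes H :: "'h hilbert" and K :: "'k hilbert" and e :: "nat \<Rightarrow> 'j"
  assumes H: "hilbert_space H" and K: "hilbert_space K" and R: "von_neumann_algebra H R"
    and \<omega>: "normal_state H R \<omega>" and e: "inj e"
    and \<pi>: "spatially_normal H R K \<pi>"
    and \<xi>: "\<xi> \<in> carrier K" and \<omega>\<xi>: "\<And>x. x \<in> R \<Longrightarrow> hinner K (\<pi> x \<xi>) \<xi> = \<omega> x"
    and \<rho>': "normal_state K (carrier (bop K)) \<rho>'" and \<rho>: "\<And>x. x \<in> R \<Longrightarrow> \<rho>' (\<pi> x) = \<rho> x"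
    and comm: "\<And>y. y \<in> commutant K (\<pi> ` R) \<Longrightarrow> \<rho>' y = hinner K (y \<xi>) \<xi>"
  shows "\<exists>\<phi>. quantum_channel TYPE('j) H R \<phi> \<and> (\<forall>x\<in>R. \<omega> (\<phi> x) = \<rho> x)"
proof -
  note [simp] = H K R \<xi> vn_subset[OF R]
  have sr: "star_representation H R K \<pi>" using \<pi> by (simp add: spatially_normal_def)
  note [simp] = star_representationD[OF sr]
  define L where "L = (ell2 H :: ('h, unit) universe hilbert)"
  have L [simp]: "hilbert_space L" by (simp add: L_def)
  obtain \<eta> where \<eta>: "square_summable K \<eta>"
    and \<rho>\<eta>: "\<And>y. y \<in> carrier (bop K) \<Longrightarrow> ((\<lambda>n. hinner K (y (\<eta> n)) (\<eta> n)) has_sum \<rho>' y) UNIV"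
    using normal_state_decomposition[OF K vn_bop[OF K] \<rho>'] by blast
  define I where "I = intertwiners H R K \<pi>"
  have Ipair: "\<exists>S. adjoint_pair K H T S" and Iint: "\<And>x \<kappa>. x \<in> R \<Longrightarrow> \<kappa> \<in> carrier K \<Longrightarrow> T (\<pi> x \<kappa>) = x (T \<kappa>)"
    if "T \<in> I" for T
    using that by (auto simp: I_def intertwiners_def)
  have Ic: "T \<kappa> \<in> carrier H" if T: "T \<in> I" and \<kappa>: "\<kappa> \<in> carrier K" for T \<kappa>
  proof -
    obtain S where S: "adjoint_pair K H T S" using Ipair[OF T] by blast
    show ?thesis by (rule adjoint_pair_closed(1)[OF S \<kappa>])
  qed
  define u where "u T = T \<xi>" for T :: "'k \<Rightarrow> 'h"
  define v where "v T = (Inl (\<lambda>n. T (\<eta> n)) :: ('h, unit) universe)" for T :: "'k \<Rightarrow> 'h"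
  have Tss: "square_summable H (\<lambda>n. T (\<eta> n))" if T: "T \<in> I" for T
  proof -
    obtain S where S: "adjoint_pair K H T S" using Ipair[OF T] by blast
    show ?thesis by (rule square_summable_image[OF K H S \<eta>])
  qed
  have u: "u T \<in> carrier H" if "T \<in> I" for T using Ic[OF that \<xi>] by (simp add: u_def)
  have v: "v T \<in> carrier L" if "T \<in> I" for T using Tss[OF that] by (simp add: v_def L_def)
  have zero: "adjoint_pair K H (\<lambda>\<kappa>. \<zero>\<^bsub>H\<^esub>) (\<lambda>\<xi>. \<zero>\<^bsub>K\<^esub>)"
    by (auto simp: adjoint_pair_def intro!: exI[of _ 0])
  have z0: "\<zero>\<^bsub>H\<^esub> = x \<zero>\<^bsub>H\<^esub>" if "x \<in> R" for x
    by (rule adjoint_pair_zero[OF H H adj_pair(1)[OF H vn_subset[OF R that]], symmetric])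
  have "(\<lambda>\<kappa>. \<zero>\<^bsub>H\<^esub>) \<in> I"
    unfolding I_def intertwiners_def using zero z0 by blast
  then have ne: "I \<noteq> {}" by blast
  have lin: "\<exists>k\<in>I. u k = u S \<oplus>\<^bsub>H\<^esub> c \<odot>\<^bsub>H\<^esub> u T \<and> v k = v S \<oplus>\<^bsub>L\<^esub> c \<odot>\<^bsub>L\<^esub> v T"
    if ST: "S \<in> I" "T \<in> I" for S T c
  proof (intro bexI conjI)
    obtain S' T' where S': "adjoint_pair K H S S'" and T': "adjoint_pair K H T T'"
      using Ipair[OF ST(1)] Ipair[OF ST(2)] by blast
    have "\<exists>Z. adjoint_pair K H (\<lambda>\<kappa>. S \<kappa> \<oplus>\<^bsub>H\<^esub> c \<odot>\<^bsub>H\<^esub> T \<kappa>) Z"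
      by (rule exI, rule adjoint_pair_lincomb[OF K H S' T'])
    then show "(\<lambda>\<kappa>. S \<kappa> \<oplus>\<^bsub>H\<^esub> c \<odot>\<^bsub>H\<^esub> T \<kappa>) \<in> I"
      using Ic[OF ST(1)] Ic[OF ST(2)] Iint[OF ST(1)] Iint[OF ST(2)]
      by (simp add: I_def intertwiners_def)
  qed (auto simp: u_def v_def L_def)
  have isom: "hnorm L (v T) = hnorm H (u T)" if T: "T \<in> I" for T
  proof -
    obtain S where S: "adjoint_pair K H T S" using Ipair[OF T] by blast
    note ST = adjoint_pair_sym[OF K H S]
    have pair: "adjoint_pair K K (\<lambda>\<kappa>. S (T \<kappa>)) (\<lambda>\<kappa>. S (T \<kappa>))"
      by (rule adjoint_pair_comp[OF K H K S ST])
    define y where "y = restrict (\<lambda>\<kappa>. S (T \<kappa>)) (carrier K)"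
    have yb: "y \<in> carrier (bop K)" unfolding y_def by (rule restrict_bop[OF K pair])
    have yin: "hinner K (y \<kappa>) \<kappa> = complex_of_real ((hnorm H (T \<kappa>))\<^sup>2)" if "\<kappa> \<in> carrier K" for \<kappa>
      using that Ic[OF T that] by (simp add: y_def adjoint_pair_left[OF ST] hinner_self)
    have "y \<in> commutant K (\<pi> ` R)"
    proof (rule commutantI[OF K _ yb])
      show "\<pi> ` R \<subseteq> carrier (bop K)" by auto
      fix p \<kappa> assume "p \<in> \<pi> ` R" and \<kappa>: "\<kappa> \<in> carrier K"
      then obtain x where x: "x \<in> R" "p = \<pi> x" by blast
      have "\<pi> x (S (T \<kappa>)) = S (T (\<pi> x \<kappa>))"
      proof (rule hvec_eqI[OF K])
        fix \<mu> assume \<mu>: "\<mu> \<in> carrier K"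
        have SC: "S h \<in> carrier K" if "h \<in> carrier H" for h using adjoint_pair_closed(1)[OF ST that] .
        have "hinner K (\<pi> x (S (T \<kappa>))) \<mu> = hinner K (S (T \<kappa>)) (\<pi> (adj H x) \<mu>)"
          using x \<kappa> \<mu> SC Ic[OF T] by (simp add: adjoint_pair_left[OF adj_pair(1)[OF K]])
        also have "\<dots> = hinner H (T \<kappa>) (T (\<pi> (adj H x) \<mu>))"
          using x \<kappa> \<mu> Ic[OF T] by (intro adjoint_pair_left[OF ST]) auto
        also have "\<dots> = hinner H (T \<kappa>) (adj H x (T \<mu>))"
          using x \<mu> Iint[OF T, of "adj H x" \<mu>] by simp
        also have "\<dots> = hinner H (x (T \<kappa>)) (T \<mu>)"
          using x \<kappa> \<mu> Ic[OF T] by (simp add: adjoint_pair_left[OF adj_pair(1)[OF H]])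
        also have "\<dots> = hinner H (T (\<pi> x \<kappa>)) (T \<mu>)"
          using x \<kappa> Iint[OF T, of x \<kappa>] by simp
        also have "\<dots> = hinner K (S (T (\<pi> x \<kappa>))) \<mu>"
          using x \<kappa> \<mu> Ic[OF T] by (intro adjoint_pair_left[OF ST, symmetric]) auto
        finally show "hinner K (\<pi> x (S (T \<kappa>))) \<mu> = hinner K (S (T (\<pi> x \<kappa>))) \<mu>" .
      qed (use x \<kappa> Ic[OF T] adjoint_pair_closed(1)[OF ST] in auto)
      then show "p (y \<kappa>) = y (p \<kappa>)" using x \<kappa> by (simp add: y_def)
    qed
    then have "\<rho>' y = complex_of_real ((hnorm H (u T))\<^sup>2)"
      using comm yin[OF \<xi>] by (simp add: u_def)
    then have "((\<lambda>n. complex_of_real ((hnorm H (T (\<eta> n)))\<^sup>2)) has_sum complex_of_real ((hnorm H (u T))\<^sup>2)) UNIV"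
      by (intro has_sum_transform[OF \<rho>\<eta>[OF yb]]) (use yin \<eta> in auto)
    then have "((\<lambda>n. (hnorm H (T (\<eta> n)))\<^sup>2) has_sum (hnorm H (u T))\<^sup>2) UNIV"
      by (subst (asm) has_sum_of_real_iff)
    moreover have "((\<lambda>n. (hnorm H (T (\<eta> n)))\<^sup>2) has_sum (hnorm L (v T))\<^sup>2) UNIV"
      unfolding v_def L_def by (rule ell2_hnorm_has_sum[OF H Tss[OF T]])
    ultimately have "(hnorm L (v T))\<^sup>2 = (hnorm H (u T))\<^sup>2" by (metis has_sum_unique)
    then show ?thesis using u[OF T] v[OF T] by (simp add: power2_eq_iff_nonneg)
  qed
  obtain F G where FG: "adjoint_pair H L F G" and F: "\<And>T. T \<in> I \<Longrightarrow> F (u T) = v T"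
    and G: "\<And>T. T \<in> I \<Longrightarrow> G (v T) = u T"
    and F0: "\<And>\<mu>. \<mu> \<in> carrier H \<Longrightarrow> (\<And>T. T \<in> I \<Longrightarrow> hinner H (u T) \<mu> = 0) \<Longrightarrow> F \<mu> = \<zero>\<^bsub>L\<^esub>"
    and FGF: "\<And>\<mu>. \<mu> \<in> carrier H \<Longrightarrow> F (G (F \<mu>)) = F \<mu>"
    by (rule extend_isometry[OF H L u v ne lin isom]) (assumption | rule that | blast)+
  note GF = adjoint_pair_sym[OF H L FG]
  note [simp] = adjoint_pair_closed[OF FG]
  have A: "adjoint_pair L L (ampl H y) (ampl H (adj H y))" if "y \<in> carrier (bop H)" for y
    unfolding L_def using that by (intro ampl_pair) auto
  have commI: "(\<lambda>\<kappa>. y (T \<kappa>)) \<in> I" if y: "y \<in> commutant H R" and T: "T \<in> I" for y T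
  proof -
    obtain S where S: "adjoint_pair K H T S" using Ipair[OF T] by blast
    have "\<exists>Z. adjoint_pair K H (\<lambda>\<kappa>. y (T \<kappa>)) Z"
      by (rule exI, rule adjoint_pair_comp[OF K H H S adj_pair(1)[OF H commutantD(1)[OF y]]])
    moreover have "y (T (\<pi> x \<kappa>)) = x (y (T \<kappa>))" if "x \<in> R" "\<kappa> \<in> carrier K" for x \<kappa>
      using Iint[OF T that] commutantD(2)[OF y that(1) Ic[OF T that(2)]] by simp
    ultimately show ?thesis by (simp add: I_def intertwiners_def)
  qed
  have comm': "adj H y \<in> commutant H R" if "y \<in> commutant H R" for y
    by (rule commutant_adj[OF H _ _ that]) (use vn_closed(3)[OF H R] in auto)
  have Fy: "F (y \<mu>) = ampl H y (F \<mu>)" if y: "y \<in> commutant H R" and \<mu>: "\<mu> \<in> carrier H" for y \<mu>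
  proof (rule extension_intertwines[OF H L FG F F0 u adj_pair(1)[OF H commutantD(1)[OF y]] A[OF commutantD(1)[OF y]] _ _ \<mu>])
    show "\<exists>k\<in>I. u k = y (u T) \<and> v k = ampl H y (v T)" if "T \<in> I" for T
      using commI[OF y that] Tss[OF that] by (intro bexI[of _ "\<lambda>\<kappa>. y (T \<kappa>)"]) (auto simp: u_def v_def)
    show "\<exists>k\<in>I. u k = adj H y (u T)" if "T \<in> I" for T
      using commI[OF comm'[OF y] that] by (intro bexI[of _ "\<lambda>\<kappa>. adj H y (T \<kappa>)"]) (auto simp: u_def)
  qed
  \<comment> \<open>the Kraus operators: the components of the partial isometry \<open>F\<close>\<close>
  define a where "a n = restrict (\<lambda>\<mu>. projl (F \<mu>) n) (carrier H)" for n
  have Fe: "\<exists>f. F \<mu> = Inl f \<and> square_summable H f" if "\<mu> \<in> carrier H" for \<mu>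
    using adjoint_pair_closed(1)[OF FG that] ell2_cases unfolding L_def by blast
  have an: "a n \<in> carrier (bop H)" for n
    unfolding a_def
    by (rule restrict_bop[OF H], rule adjoint_pair_comp[OF H L H FG], unfold L_def, rule component_pair[OF H])
  have Fa: "F \<mu> = Inl (\<lambda>n. a n \<mu>)" "square_summable H (\<lambda>n. a n \<mu>)" if "\<mu> \<in> carrier H" for \<mu>
    using Fe[OF that] that by (auto simp: a_def)
  have anR: "a n \<in> R" for n
  proof (rule vn_memI[OF H R an])
    fix y \<mu> assume y: "y \<in> commutant H R" and \<mu>: "\<mu> \<in> carrier H"
    have yb: "y \<in> carrier (bop H)" by (rule commutantD(1)[OF y])
    have "Inl (\<lambda>n. a n (y \<mu>)) = (Inl (\<lambda>n. y (a n \<mu>)) :: ('h, unit) universe)"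
      using Fy[OF y \<mu>] Fa[OF \<mu>] Fa[of "y \<mu>"] yb \<mu> by simp
    then show "a n (y \<mu>) = y (a n \<mu>)" by (simp add: fun_eq_iff)
  qed
  \<comment> \<open>the projection \<open>1 - F\<^sup>* F\<close> makes up for the kernel of \<open>F\<close>\<close>
  define c where "c = restrict (\<lambda>\<mu>. \<mu> \<oplus>\<^bsub>H\<^esub> (-1) \<odot>\<^bsub>H\<^esub> G (F \<mu>)) (carrier H)"
  have cpair: "adjoint_pair H H (\<lambda>\<mu>. \<mu> \<oplus>\<^bsub>H\<^esub> (-1) \<odot>\<^bsub>H\<^esub> G (F \<mu>)) (\<lambda>\<mu>. \<mu> \<oplus>\<^bsub>H\<^esub> cnj (-1) \<odot>\<^bsub>H\<^esub> G (F \<mu>))"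
    by (rule adjoint_pair_lincomb[OF H H adjoint_pair_id adjoint_pair_comp[OF H L H FG GF]])
  have cb: "c \<in> carrier (bop H)" unfolding c_def by (rule restrict_bop[OF H cpair])
  have GFy: "G (F (y \<mu>)) = y (G (F \<mu>))" if y: "y \<in> commutant H R" and \<mu>: "\<mu> \<in> carrier H" for y \<mu>
  proof (rule hvec_eqI_right[OF H])
    have yb: "y \<in> carrier (bop H)" by (rule commutantD(1)[OF y])
    fix \<nu> assume \<nu>: "\<nu> \<in> carrier H"
    have "hinner H \<nu> (G (F (y \<mu>))) = hinner L (F \<nu>) (ampl H y (F \<mu>))"
      using yb \<mu> \<nu> adjoint_pair_closed(1)[OF A[OF yb]] by (simp add: adjoint_pair_left[OF FG, symmetric] Fy[OF y \<mu>])
    also have "\<dots> = hinner L (ampl H (adj H y) (F \<nu>)) (F \<mu>)"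
      using \<mu> \<nu> by (intro adjoint_pair_right[OF L L A[OF yb]]) auto
    also have "\<dots> = hinner L (F (adj H y \<nu>)) (F \<mu>)" using Fy[OF comm'[OF y] \<nu>] by simp
    also have "\<dots> = hinner H \<nu> (y (G (F \<mu>)))"
      using yb \<mu> \<nu> by (simp add: adjoint_pair_left[OF FG] hinner_adj)
    finally show "hinner H \<nu> (G (F (y \<mu>))) = hinner H \<nu> (y (G (F \<mu>)))" .
  qed (use commutantD(1)[OF y] \<mu> in auto)
  have cR: "c \<in> R"
  proof (rule vn_memI[OF H R cb])
    fix y \<mu> assume y: "y \<in> commutant H R" and \<mu>: "\<mu> \<in> carrier H"
    show "c (y \<mu>) = y (c \<mu>)"
      using GFy[OF y \<mu>] commutantD(1)[OF y] \<mu> by (simp add: c_def)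
  qed
  have c2: "(hnorm H (c \<mu>))\<^sup>2 = (hnorm H \<mu>)\<^sup>2 - (hnorm L (F \<mu>))\<^sup>2" if \<mu>: "\<mu> \<in> carrier H" for \<mu>
  proof -
    have g: "hinner H (G (F \<mu>)) (G (F \<mu>)) = hinner L (F \<mu>) (F \<mu>)"
      using \<mu> FGF[OF \<mu>] by (simp add: adjoint_pair_left[OF GF])
    have g': "hinner H (G (F \<mu>)) \<mu> = hinner L (F \<mu>) (F \<mu>)" "hinner H \<mu> (G (F \<mu>)) = hinner L (F \<mu>) (F \<mu>)"
      using \<mu> by (simp_all add: adjoint_pair_left[OF GF] adjoint_pair_left[OF FG, symmetric])
    show ?thesis using \<mu> by (simp add: c_def hnorm_power2 g g')
  qed
  \<comment> \<open>the index \<open>e 0\<close> is reserved for \<open>c\<close>\<close>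
  define b where "b j = (case inv_into UNIV e j of 0 \<Rightarrow> c | Suc n \<Rightarrow> a n)" for j
  have be: "b (e 0) = c" "b (e (Suc n)) = a n" for n
    using e by (simp_all add: b_def)
  let ?J = "range e"
  have sum_split: "(g has_sum s) ?J" if "((\<lambda>n. g (e (Suc n))) has_sum (s - g (e 0))) UNIV"
    for g :: "'j \<Rightarrow> 'v :: real_normed_vector" and s
  proof -
    have "((g \<circ> e) has_sum (s - g (e 0))) (range Suc)"
      using that by (subst has_sum_reindex) (auto simp: o_def)
    moreover have "((g \<circ> e) has_sum g (e 0)) {0}"
      using has_sum_finite[of "{0}" "g \<circ> e"] by simp
    ultimately have "((g \<circ> e) has_sum ((s - g (e 0)) + g (e 0))) (range Suc \<union> {0})"
      by (intro has_sum_Un_disjoint) auto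
    moreover have "range Suc \<union> {0} = UNIV" by (auto simp: image_iff) (metis not0_implies_Suc)
    ultimately have "((g \<circ> e) has_sum s) UNIV" by simp
    then show ?thesis using has_sum_reindex[OF e] by blast
  qed
  have bR: "b \<in> ?J \<rightarrow> R" using anR cR by (auto simp: b_def split: nat.split)
  have biso: "isometric_family H ?J b"
    unfolding isometric_family_def
  proof (intro conjI ballI)
    show "b j \<in> carrier (bop H)" if "j \<in> ?J" for j
      using bR that by (intro vn_subset[OF R]) blast
    show "((\<lambda>j. (hnorm H (b j \<mu>))\<^sup>2) has_sum (hnorm H \<mu>)\<^sup>2) ?J" if \<mu>: "\<mu> \<in> carrier H" for \<mu>
    proof (rule sum_split)
      have "((\<lambda>n. (hnorm H (a n \<mu>))\<^sup>2) has_sum (hnorm L (F \<mu>))\<^sup>2) UNIV"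
        unfolding Fa(1)[OF \<mu>] L_def by (rule ell2_hnorm_has_sum[OF H Fa(2)[OF \<mu>]])
      then show "((\<lambda>n. (hnorm H (b (e (Suc n)) \<mu>))\<^sup>2) has_sum ((hnorm H \<mu>)\<^sup>2 - (hnorm H (b (e 0) \<mu>))\<^sup>2)) UNIV"
        by (simp add: be c2[OF \<mu>])
    qed
  qed
  have sep: "\<kappa> = \<mu>" if km: "\<kappa> \<in> carrier K" "\<mu> \<in> carrier K" "\<And>T. T \<in> I \<Longrightarrow> T \<kappa> = T \<mu>" for \<kappa> \<mu>
  proof -
    have "\<kappa> \<ominus>\<^bsub>K\<^esub> \<mu> = \<zero>\<^bsub>K\<^esub>"
    proof (rule intertwiners_separate[OF H K R \<pi>])
      fix T assume T: "T \<in> intertwiners H R K \<pi>"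
      then obtain S where S: "adjoint_pair K H T S" using Ipair by (auto simp: I_def)
      have TI: "T \<in> I" using T by (simp add: I_def)
      have "T (\<kappa> \<ominus>\<^bsub>K\<^esub> \<mu>) = T \<kappa> \<ominus>\<^bsub>H\<^esub> T \<mu>" by (rule adjoint_pair_minus[OF K H S km(1,2)])
      also have "\<dots> = \<zero>\<^bsub>H\<^esub>"
        unfolding km(3)[OF TI] using Ic[OF TI km(2)] by (intro hvec_eqI[OF H]) auto
      finally show "T (\<kappa> \<ominus>\<^bsub>K\<^esub> \<mu>) = \<zero>\<^bsub>H\<^esub>" .
    qed (use km in simp)
    then show ?thesis using km hdiff_eq_zero_iff[OF K, of \<kappa> \<mu>] by simp
  qed
  have \<pi>a: "\<pi> (a n) \<xi> = \<eta> n" for n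
  proof (rule sep)
    fix T assume T: "T \<in> I"
    have "Inl (\<lambda>n. a n (u T)) = v T" using F[OF T] Fa(1)[OF u[OF T]] by simp
    then have "a n (u T) = T (\<eta> n)" by (simp add: v_def fun_eq_iff)
    then show "T (\<pi> (a n) \<xi>) = T (\<eta> n)" using Iint[OF T anR \<xi>] by (simp add: u_def)
  qed (use anR \<eta> in auto)
  have \<pi>c: "\<pi> c \<xi> = \<zero>\<^bsub>K\<^esub>"
  proof (rule sep)
    fix T assume T: "T \<in> I"
    have "c (u T) = \<zero>\<^bsub>H\<^esub>"
      using u[OF T] F[OF T] G[OF T] by (auto simp: c_def intro!: hvec_eqI[OF H])
    moreover obtain S where "adjoint_pair K H T S" using Ipair[OF T] by blast
    ultimately show "T (\<pi> c \<xi>) = T \<zero>\<^bsub>K\<^esub>"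
      using Iint[OF T cR \<xi>] adjoint_pair_zero[OF K H] by (simp add: u_def)
  qed (use cR in auto)
  obtain \<phi> where \<phi>: "quantum_channel TYPE('j) H R \<phi>"
    and val: "\<And>x \<xi> \<eta>. x \<in> R \<Longrightarrow> \<xi> \<in> carrier H \<Longrightarrow> \<eta> \<in> carrier H \<Longrightarrow>
      ((\<lambda>j. hinner H (x (b j \<xi>)) (b j \<eta>)) has_sum hinner H (\<phi> x \<xi>) \<eta>) ?J"
    using isometric_family_channel[OF H R bR biso] by blast
  have "\<omega> (\<phi> x) = \<rho> x" if x: "x \<in> R" for x
  proof (rule has_sum_unique)
    have \<phi>x: "\<phi> x \<in> R" using \<phi> x by (auto simp: quantum_channel_def)
    show "((\<lambda>j. \<omega> (adj H (b j) \<otimes>\<^bsub>bop H\<^esub> x \<otimes>\<^bsub>bop H\<^esub> b j)) has_sum \<omega> (\<phi> x)) ?J"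
      by (rule normal_state_channel[OF H R \<omega> bR biso x \<phi>x val[OF x]])
    have t: "\<omega> (adj H d \<otimes>\<^bsub>bop H\<^esub> x \<otimes>\<^bsub>bop H\<^esub> d) = hinner K (\<pi> x (\<pi> d \<xi>)) (\<pi> d \<xi>)" if "d \<in> R" for d
      using that x \<omega>\<xi>[of "adj H d \<otimes>\<^bsub>bop H\<^esub> x \<otimes>\<^bsub>bop H\<^esub> d"] by (simp add: hinner_adj)
    have tc: "\<omega> (adj H c \<otimes>\<^bsub>bop H\<^esub> x \<otimes>\<^bsub>bop H\<^esub> c) = 0" using t[OF cR] x by (simp add: \<pi>c)
    have ta: "\<omega> (adj H (a n) \<otimes>\<^bsub>bop H\<^esub> x \<otimes>\<^bsub>bop H\<^esub> a n) = hinner K (\<pi> x (\<eta> n)) (\<eta> n)" for n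
      using t[OF anR] by (simp add: \<pi>a)
    show "((\<lambda>j. \<omega> (adj H (b j) \<otimes>\<^bsub>bop H\<^esub> x \<otimes>\<^bsub>bop H\<^esub> b j)) has_sum \<rho> x) ?J"
      by (rule sum_split) (use \<rho>\<eta>[of "\<pi> x"] \<rho>[OF x] x in \<open>simp add: be tc ta\<close>)
  qed
  then show ?thesis using \<phi> by blast
qed


section \<open>The countable multiple as a faithful normal representation\<close>

lemma ampl_star_representation:
  assumes H: "hilbert_space H" and R: "von_neumann_algebra H R"
  shows "star_representation H R (ell2 H) (ampl H)" (is "star_representation H R ?L _")
proof -
  note [simp] = H R vn_subset[OF R] ampl_bop
  have eqI: "S = T" if "S \<in> carrier (bop ?L)" "T \<in> carrier (bop ?L)"
    "\<And>f. square_summable H f \<Longrightarrow> S (Inl f) = T (Inl f)" for S T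
    by (rule bop_eqI[OF that(1,2)]) (metis ell2_cases that(3))
  show ?thesis
    unfolding star_representation_def
  proof (intro conjI ballI allI)
    show "ampl H \<in> R \<rightarrow> carrier (bop ?L)" by auto
    show "ampl H (x \<oplus>\<^bsub>bop H\<^esub> y) = ampl H x \<oplus>\<^bsub>bop ?L\<^esub> ampl H y" if "x \<in> R" "y \<in> R" for x y
      using that by (intro eqI) auto
    show "ampl H (c \<odot>\<^bsub>bop H\<^esub> x) = c \<odot>\<^bsub>bop ?L\<^esub> ampl H x" if "x \<in> R" for c x
      using that by (intro eqI) auto
    show "ampl H (x \<otimes>\<^bsub>bop H\<^esub> y) = ampl H x \<otimes>\<^bsub>bop ?L\<^esub> ampl H y" if "x \<in> R" "y \<in> R" for x y
      using that by (intro eqI) auto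
    show "ampl H (adj H x) = adj ?L (ampl H x)" if x: "x \<in> R" for x
      by (rule sym, rule adj_unique) (use x in \<open>auto intro: adjoint_pair_left[OF ampl_pair]\<close>)
    show "ampl H \<one>\<^bsub>bop H\<^esub> = \<one>\<^bsub>bop ?L\<^esub>"
      by (intro eqI) auto
  qed
qed

lemma ampl_faithful_normal:
  fixes H :: "'h hilbert"
  assumes H: "hilbert_space H" and R: "von_neumann_algebra H R"
  shows "faithful_normal_representation H R (ell2 H :: ('h, 'u) universe hilbert) (ampl H)"
proof -
  let ?L = "ell2 H :: ('h, 'u) universe hilbert"
  note [simp] = H R vn_subset[OF R]
  have sing: "square_summable H (\<lambda>n::nat. if n = 0 then \<xi> else \<zero>\<^bsub>H\<^esub>)" if "\<xi> \<in> carrier H" for \<xi>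
    using adjoint_pair_closed(2)[OF component_pair[OF H, of 0] that] by simp
  have "inj_on (ampl H :: _ \<Rightarrow> ('h, 'u) universe \<Rightarrow> _) R"
  proof (rule inj_onI)
    fix x y assume x: "x \<in> R" and y: "y \<in> R" and eq: "(ampl H x :: ('h, 'u) universe \<Rightarrow> _) = ampl H y"
    show "x = y"
    proof (rule bop_eqI[of _ H])
      fix \<xi> assume \<xi>: "\<xi> \<in> carrier H"
      let ?s = "\<lambda>n::nat. if n = 0 then \<xi> else \<zero>\<^bsub>H\<^esub>"
      have "ampl H x (Inl ?s :: ('h, 'u) universe) = ampl H y (Inl ?s)" using eq by simp
      then have "(\<lambda>n. x (?s n)) = (\<lambda>n. y (?s n))" by (simp add: sing[OF \<xi>])
      from fun_cong[OF this, of 0] show "x \<xi> = y \<xi>" by simp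
    qed (use x y in auto)
  qed
  moreover have "continuous_map (subtopology (ultraweak_topology H) R) (ultraweak_topology ?L) (ampl H)"
    unfolding ultraweak_topology_def[of ?L]
  proof (rule continuous_on_generated_topo)
    have top: "topspace (subtopology (ultraweak_topology H) R) = R"
      using vn_subset[OF R] by (auto simp: topspace_subtopology uw_topspace)
    have "ampl H x \<in> \<Union> {{x \<in> carrier (bop ?L). (\<Sum>n. hinner ?L (x (\<alpha> n)) (\<beta> n)) \<in> U} | \<alpha> \<beta> U.
        square_summable ?L \<alpha> \<and> square_summable ?L \<beta> \<and> open U}" if "x \<in> R" for x
    proof -
      have "ampl H x \<in> topspace (ultraweak_topology ?L)" using that by (simp add: uw_topspace ampl_bop)
      then show ?thesis unfolding ultraweak_topology_def topology_generated_by_topspace .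
    qed
    then show "ampl H ` topspace (subtopology (ultraweak_topology H) R) \<subseteq>
      \<Union> {{x \<in> carrier (bop ?L). (\<Sum>n. hinner ?L (x (\<alpha> n)) (\<beta> n)) \<in> U} | \<alpha> \<beta> U.
        square_summable ?L \<alpha> \<and> square_summable ?L \<beta> \<and> open U}"
      unfolding top by blast
    fix W assume "W \<in> {{x \<in> carrier (bop ?L). (\<Sum>n. hinner ?L (x (\<alpha> n)) (\<beta> n)) \<in> U} | \<alpha> \<beta> U.
        square_summable ?L \<alpha> \<and> square_summable ?L \<beta> \<and> open U}"
    then obtain \<alpha> \<beta> U where W: "W = {x \<in> carrier (bop ?L). (\<Sum>n. hinner ?L (x (\<alpha> n)) (\<beta> n)) \<in> U}"
      and \<alpha>: "square_summable ?L \<alpha>" and \<beta>: "square_summable ?L \<beta>" and U: "open U" by blast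
    \<comment> \<open>a square-summable sequence in the multiple is a square-summable double sequence in \<open>H\<close>\<close>
    have flat: "\<exists>f. square_summable H f \<and> (\<forall>n. \<alpha> n = Inl (\<lambda>m. f (prod_encode (n, m)))) \<and>
        (\<forall>n. square_summable H (\<lambda>m. f (prod_encode (n, m))))"
      if \<alpha>: "square_summable ?L \<alpha>" for \<alpha>
    proof -
      have "\<forall>n. \<exists>f. \<alpha> n = Inl f \<and> square_summable H f"
        using \<alpha> ell2_cases by (metis square_summable_vec)
      then obtain f where f: "\<And>n. \<alpha> n = Inl (f n)" "\<And>n. square_summable H (f n)" by metis
      define g where "g k = f (fst (prod_decode k)) (snd (prod_decode k))" for k
      have "(\<lambda>p. (hnorm H (f (fst p) (snd p)))\<^sup>2) summable_on (UNIV \<times> UNIV)"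
      proof (rule summable_on_SigmaI)
        show "((\<lambda>m. (hnorm H (f (fst (n, m)) (snd (n, m))))\<^sup>2) has_sum (hnorm ?L (\<alpha> n))\<^sup>2) UNIV" for n
          unfolding f(1) fst_conv snd_conv by (rule ell2_hnorm_has_sum[OF H f(2)])
        show "(\<lambda>n. (hnorm ?L (\<alpha> n))\<^sup>2) summable_on UNIV" using \<alpha> by (simp add: square_summable_iff)
      qed simp
      then have "(\<lambda>k. (hnorm H (g k))\<^sup>2) summable_on UNIV"
        unfolding g_def
        by (subst summable_on_reindex_bij_betw[OF bij_prod_decode, of "\<lambda>p. (hnorm H (f (fst p) (snd p)))\<^sup>2"]) simp
      then show ?thesis using f by (intro exI[of _ g]) (auto simp: g_def square_summable_iff)
    qed
    obtain f where f: "square_summable H f" "\<And>n. \<alpha> n = Inl (\<lambda>m. f (prod_encode (n, m)))"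
      "\<And>n. square_summable H (\<lambda>m. f (prod_encode (n, m)))" using flat[OF \<alpha>] by blast
    obtain g where g: "square_summable H g" "\<And>n. \<beta> n = Inl (\<lambda>m. g (prod_encode (n, m)))"
      "\<And>n. square_summable H (\<lambda>m. g (prod_encode (n, m)))" using flat[OF \<beta>] by blast
    have val: "(\<Sum>n. hinner ?L (ampl H x (\<alpha> n)) (\<beta> n)) = (\<Sum>k. hinner H (x (f k)) (g k))" if x: "x \<in> R" for x
    proof (rule has_sum_imp_suminf)
      have "((\<lambda>k. hinner H (x (f k)) (g k)) has_sum (\<Sum>k. hinner H (x (f k)) (g k))) UNIV"
        using x by (intro uw_has_sum f g) auto
      then have s: "((\<lambda>p. hinner H (x (f (prod_encode p))) (g (prod_encode p))) has_sum
          (\<Sum>k. hinner H (x (f k)) (g k))) (UNIV \<times> UNIV)"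
        using has_sum_reindex_bij_betw[OF bij_prod_encode, of "\<lambda>k. hinner H (x (f k)) (g k)"] by simp
      show "((\<lambda>n. hinner ?L (ampl H x (\<alpha> n)) (\<beta> n)) has_sum (\<Sum>k. hinner H (x (f k)) (g k))) UNIV"
      proof (rule has_sum_SigmaD[OF s])
        show "((\<lambda>m. hinner H (x (f (prod_encode (n, m)))) (g (prod_encode (n, m)))) has_sum
            hinner ?L (ampl H x (\<alpha> n)) (\<beta> n)) UNIV" for n
          unfolding f(2) g(2) ampl_Inl[OF f(3)]
          by (rule ell2_hinner[OF H square_summable_bop[OF H vn_subset[OF R x] f(3)] g(3)])
      qed
    qed
    have "openin (subtopology (ultraweak_topology H) R)
      (R \<inter> {x \<in> carrier (bop H). (\<Sum>k. hinner H (x (f k)) (g k)) \<in> U})"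
      unfolding ultraweak_topology_def
      by (rule openin_subtopology_Int2, rule topology_generated_by_Basis) (use f g U in blast)
    moreover have "ampl H -` W \<inter> topspace (subtopology (ultraweak_topology H) R)
      = R \<inter> {x \<in> carrier (bop H). (\<Sum>k. hinner H (x (f k)) (g k)) \<in> U}"
      unfolding top W by (auto simp: val ampl_bop)
    ultimately show "openin (subtopology (ultraweak_topology H) R)
        (ampl H -` W \<inter> topspace (subtopology (ultraweak_topology H) R))" by simp
  qed
  ultimately show ?thesis
    using ampl_star_representation[OF H R] by (simp add: faithful_normal_representation_def)
qed


section \<open>Equivalence of the conditions\<close>

text \<open>
  A state forces the Hilbert space to have a nonzero vector, so its universe is infinite and contains
  the index set of a sequence of Kraus operators.
\<close>

lemma state_imp_infinite_universe:
  fixes H :: "'h hilbert"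
  assumes H: "hilbert_space H" and R: "von_neumann_algebra H R" and \<omega>: "is_state H R \<omega>"
  shows "\<exists>e :: nat \<Rightarrow> ('h, 'u) universe. inj e"
proof -
  have "\<exists>\<xi>\<in>carrier H. \<xi> \<noteq> \<zero>\<^bsub>H\<^esub>"
  proof (rule ccontr)
    assume "\<not> ?thesis"
    then have z: "\<xi> = \<zero>\<^bsub>H\<^esub>" if "\<xi> \<in> carrier H" for \<xi> using that by blast
    have one: "\<one>\<^bsub>bop H\<^esub> = 0 \<odot>\<^bsub>bop H\<^esub> \<one>\<^bsub>bop H\<^esub>"
    proof (rule bop_eqI[of _ H])
      fix \<xi> assume \<xi>: "\<xi> \<in> carrier H"
      have "0 \<odot>\<^bsub>H\<^esub> \<xi> \<in> carrier H" using H \<xi> by simp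
      then have "\<xi> = 0 \<odot>\<^bsub>H\<^esub> \<xi>" using z[OF \<xi>] z by metis
      then show "\<one>\<^bsub>bop H\<^esub> \<xi> = (0 \<odot>\<^bsub>bop H\<^esub> \<one>\<^bsub>bop H\<^esub>) \<xi>" using \<xi> by simp
    qed (use H in auto)
    have "\<omega> (0 \<odot>\<^bsub>bop H\<^esub> \<one>\<^bsub>bop H\<^esub>) = 0 * \<omega> \<one>\<^bsub>bop H\<^esub>"
      using \<omega> vn_closed(1)[OF H R] unfolding is_state_def by blast
    then have "\<omega> \<one>\<^bsub>bop H\<^esub> = 0" using one by simp
    then show False using \<omega> by (simp add: is_state_def)
  qed
  then obtain \<xi> where \<xi>: "\<xi> \<noteq> \<zero>\<^bsub>H\<^esub>" by blast
  have "inj (\<lambda>n. Inl (\<lambda>m. if m = n then \<xi> else \<zero>\<^bsub>H\<^esub>) :: ('h, 'u) universe)"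
  proof (rule injI)
    fix n k :: nat
    assume "Inl (\<lambda>m. if m = n then \<xi> else \<zero>\<^bsub>H\<^esub>) = (Inl (\<lambda>m. if m = k then \<xi> else \<zero>\<^bsub>H\<^esub>) :: ('h, 'u) universe)"
    then have "(\<lambda>m. if m = n then \<xi> else \<zero>\<^bsub>H\<^esub>) = (\<lambda>m. if m = k then \<xi> else \<zero>\<^bsub>H\<^esub>)" by simp
    from fun_cong[OF this, of n] show "n = k" using \<xi> by (auto split: if_splits)
  qed
  then show ?thesis by blast
qed

theorem theorem2p5:
  fixes H :: "'h hilbert" and R :: "('h \<Rightarrow> 'h) set" and \<omega> \<rho> :: "('h \<Rightarrow> 'h) \<Rightarrow> complex"
  assumes "hilbert_space H" and "von_neumann_algebra H R"
    and "normal_state H R \<omega>" and "normal_state H R \<rho>"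
  shows
    "((\<exists>\<phi>. quantum_channel TYPE(('h, 'u) universe) H R \<phi> \<and> (\<forall>x\<in>R. \<omega> (\<phi> x) = \<rho> x))
      \<longleftrightarrow>
      (\<forall>(K :: ('h, 'u) universe hilbert) \<pi> \<omega>'.
         faithful_normal_representation H R K \<pi> \<and>
         normal_state K (carrier (bop K)) \<omega>' \<and> (\<forall>x\<in>R. \<omega>' (\<pi> x) = \<omega> x) \<longrightarrow>
         (\<exists>\<rho>'. normal_state K (carrier (bop K)) \<rho>' \<and> (\<forall>x\<in>R. \<rho>' (\<pi> x) = \<rho> x) \<and>
               (\<forall>y\<in>commutant K (\<pi> ` R). \<omega>' y = \<rho>' y))))
     \<and>
     ((\<exists>\<phi>. quantum_channel TYPE(('h, 'u) universe) H R \<phi> \<and> (\<forall>x\<in>R. \<omega> (\<phi> x) = \<rho> x))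
      \<longleftrightarrow>
      (\<exists>(K :: ('h, 'u) universe hilbert) \<pi> \<omega>'.
         faithful_normal_representation H R K \<pi> \<and>
         vector_state K \<omega>' \<and> (\<forall>x\<in>R. \<omega>' (\<pi> x) = \<omega> x) \<and>
         (\<exists>\<rho>'. normal_state K (carrier (bop K)) \<rho>' \<and> (\<forall>x\<in>R. \<rho>' (\<pi> x) = \<rho> x) \<and>
               (\<forall>y\<in>commutant K (\<pi> ` R). \<rho>' y = \<omega>' y))))
     \<and>
     ((\<exists>\<phi>. quantum_channel TYPE(('h, 'u) universe) H R \<phi> \<and> (\<forall>x\<in>R. \<omega> (\<phi> x) = \<rho> x))
      \<longleftrightarrow>
      (let K = gns_space H R \<omega>; \<pi> = gns_representation H R \<omega>;
           \<omega>' = vector_functional K (gns_vector H R \<omega>)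
       in (\<forall>x\<in>R. \<pi> x = \<zero>\<^bsub>bop K\<^esub> \<longrightarrow> \<rho> x = 0) \<and>
          (\<exists>\<rho>'. normal_state K (carrier (bop K)) \<rho>' \<and> (\<forall>x\<in>R. \<rho>' (\<pi> x) = \<rho> x) \<and>
                (\<forall>y\<in>commutant K (\<pi> ` R). \<rho>' y = \<omega>' y))))"
proof -
  let ?U = "TYPE(('h, 'u) universe)"
  let ?channel = "\<exists>\<phi>. quantum_channel ?U H R \<phi> \<and> (\<forall>x\<in>R. \<omega> (\<phi> x) = \<rho> x)"
  let ?every = "\<forall>(K :: ('h, 'u) universe hilbert) \<pi> \<omega>'.
         faithful_normal_representation H R K \<pi> \<and>
         normal_state K (carrier (bop K)) \<omega>' \<and> (\<forall>x\<in>R. \<omega>' (\<pi> x) = \<omega> x) \<longrightarrow>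
         (\<exists>\<rho>'. normal_state K (carrier (bop K)) \<rho>' \<and> (\<forall>x\<in>R. \<rho>' (\<pi> x) = \<rho> x) \<and>
               (\<forall>y\<in>commutant K (\<pi> ` R). \<omega>' y = \<rho>' y))"
  let ?some = "\<exists>(K :: ('h, 'u) universe hilbert) \<pi> \<omega>'.
         faithful_normal_representation H R K \<pi> \<and>
         vector_state K \<omega>' \<and> (\<forall>x\<in>R. \<omega>' (\<pi> x) = \<omega> x) \<and>
         (\<exists>\<rho>'. normal_state K (carrier (bop K)) \<rho>' \<and> (\<forall>x\<in>R. \<rho>' (\<pi> x) = \<rho> x) \<and>
               (\<forall>y\<in>commutant K (\<pi> ` R). \<rho>' y = \<omega>' y))"
  let ?K = "gns_space H R \<omega>" and ?\<pi> = "gns_representation H R \<omega>" and ?\<Omega> = "gns_vector H R \<omega>"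
  let ?gns = "(\<forall>x\<in>R. ?\<pi> x = \<zero>\<^bsub>bop ?K\<^esub> \<longrightarrow> \<rho> x = 0) \<and>
          (\<exists>\<rho>'. normal_state ?K (carrier (bop ?K)) \<rho>' \<and> (\<forall>x\<in>R. \<rho>' (?\<pi> x) = \<rho> x) \<and>
                (\<forall>y\<in>commutant ?K (?\<pi> ` R). \<rho>' y = vector_functional ?K ?\<Omega> y))"
  note H = assms(1) and R = assms(2) and \<omega> = assms(3)
  interpret normal_state_on_algebra H R \<omega>
    by (rule normal_state_on_algebra.intro[OF state_on_algebra.intro[OF H R] normal_state_on_algebra_axioms.intro[OF \<omega>]])
       (use \<omega> in \<open>simp add: normal_state_def\<close>)
  obtain e :: "nat \<Rightarrow> ('h, 'u) universe" where e: "inj e"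
    using state_imp_infinite_universe[OF H R state] by blast
  have spatial: "spatially_normal H R K \<pi>'"
    if "faithful_normal_representation H R K \<pi>'" for K :: "('h, 'u) universe hilbert" and \<pi>'
    using that unfolding faithful_normal_representation_def
    by (elim conjE) (rule normal_imp_spatially_normal[OF H _ R])
  have channel_every: "?every" if ch: ?channel
  proof -
    obtain \<phi> where \<phi>: "quantum_channel ?U H R \<phi>" "\<And>x. x \<in> R \<Longrightarrow> \<omega> (\<phi> x) = \<rho> x" using ch by blast
    show ?thesis
    proof (intro allI impI, elim conjE)
      fix K :: "('h, 'u) universe hilbert" and \<pi>' \<omega>'
      assume *: "faithful_normal_representation H R K \<pi>'" "normal_state K (carrier (bop K)) \<omega>'"
        "\<forall>x\<in>R. \<omega>' (\<pi>' x) = \<omega> x"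
      have K: "hilbert_space K" using *(1) by (simp add: faithful_normal_representation_def)
      show "\<exists>\<rho>'. normal_state K (carrier (bop K)) \<rho>' \<and> (\<forall>x\<in>R. \<rho>' (\<pi>' x) = \<rho> x) \<and>
               (\<forall>y\<in>commutant K (\<pi>' ` R). \<omega>' y = \<rho>' y)"
        by (rule channel_imp_extension[OF H K R \<omega> spatial[OF *(1)] \<phi> *(2)]) (use *(3) in auto)
    qed
  qed
  \<comment> \<open>on the countable multiple, \<open>\<omega>\<close> is the vector state of its decomposing sequence\<close>
  have every_some: "?some" if every: ?every
  proof -
    let ?L = "ell2 H :: ('h, 'u) universe hilbert"
    obtain \<zeta> where \<zeta>: "square_summable H \<zeta>"
      and sum: "\<And>x. x \<in> R \<Longrightarrow> ((\<lambda>n. hinner H (x (\<zeta> n)) (\<zeta> n)) has_sum \<omega> x) UNIV"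
      using normal_state_decomposition[OF H R \<omega>] by blast
    let ?z = "Inl \<zeta> :: ('h, 'u) universe"
    have z: "?z \<in> carrier ?L" using \<zeta> by simp
    have vec: "vector_functional ?L ?z (ampl H x) = \<omega> x" if x: "x \<in> R" for x
      using ell2_hinner_eqI[OF H square_summable_bop[OF H R_bop[OF x] \<zeta>] \<zeta> sum[OF x], where 'b = 'u] \<zeta>
      by (simp add: vector_functional_def)
    have "hinner ?L ?z ?z = 1"
    proof -
      have "hinner ?L ?z ?z = \<omega> \<one>\<^bsub>bop H\<^esub>"
        using vec[of "\<one>\<^bsub>bop H\<^esub>"] \<zeta> by (simp add: vector_functional_def)
      then show ?thesis using state by (simp add: is_state_def)
    qed
    then have norm: "hnorm ?L ?z = 1" by (simp add: hnorm_def)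
    have fn: "faithful_normal_representation H R ?L (ampl H)" by (rule ampl_faithful_normal[OF H R])
    have L: "hilbert_space ?L" using H by simp
    have nv: "normal_state ?L (carrier (bop ?L)) (vector_functional ?L ?z)"
      by (rule normal_vector_state[OF L z norm])
    have "\<exists>\<rho>'. normal_state ?L (carrier (bop ?L)) \<rho>' \<and> (\<forall>x\<in>R. \<rho>' (ampl H x) = \<rho> x) \<and>
               (\<forall>y\<in>commutant ?L (ampl H ` R). vector_functional ?L ?z y = \<rho>' y)"
      using every fn nv vec by blast
    moreover have "vector_state ?L (vector_functional ?L ?z)"
      using z norm by (auto simp: vector_state_def)
    ultimately show ?some using fn vec by (metis (no_types, lifting))
  qed
  have some_channel: "?channel" if some: ?some
  proof -
    obtain K :: "('h, 'u) universe hilbert" and \<pi>' \<omega>' \<rho>'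
      where fn: "faithful_normal_representation H R K \<pi>'" and vs: "vector_state K \<omega>'"
        and ext: "\<forall>x\<in>R. \<omega>' (\<pi>' x) = \<omega> x" and \<rho>': "normal_state K (carrier (bop K)) \<rho>'"
        and \<rho>e: "\<forall>x\<in>R. \<rho>' (\<pi>' x) = \<rho> x" and comm: "\<forall>y\<in>commutant K (\<pi>' ` R). \<rho>' y = \<omega>' y"
      using some by blast
    obtain \<xi> where \<xi>: "\<xi> \<in> carrier K" "\<omega>' = vector_functional K \<xi>" using vs by (auto simp: vector_state_def)
    have K: "hilbert_space K" using fn by (simp add: faithful_normal_representation_def)
    show ?thesis
      by (rule extension_imp_channel[OF H K R \<omega> e spatial[OF fn] \<xi>(1) _ \<rho>'])
         (use ext \<rho>e comm in \<open>auto simp: \<xi>(2) vector_functional_def\<close>)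
  qed
  have channel_gns: "?gns" if ch: ?channel
  proof -
    obtain \<phi> where \<phi>: "quantum_channel ?U H R \<phi>" "\<And>x. x \<in> R \<Longrightarrow> \<omega> (\<phi> x) = \<rho> x" using ch by blast
    have "hinner ?K ?\<Omega> ?\<Omega> = 1"
      using \<omega>_\<Omega>[of "\<one>\<^bsub>bop H\<^esub>"] state by (simp add: is_state_def star_representationD(6)[OF gns_star_representation])
    then have norm: "hnorm ?K ?\<Omega> = 1" by (simp add: hnorm_def)
    obtain \<rho>' where \<rho>': "normal_state ?K (carrier (bop ?K)) \<rho>'" and \<rho>e: "\<forall>x\<in>R. \<rho>' (?\<pi> x) = \<rho> x"
      and comm: "\<forall>y\<in>commutant ?K (?\<pi> ` R). vector_functional ?K ?\<Omega> y = \<rho>' y"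
      using channel_imp_extension[OF H hilbert_gns R \<omega> gns_spatially_normal \<phi> normal_vector_state[OF hilbert_gns \<Omega>_closed norm]]
      by (auto simp: vector_functional_def \<omega>_\<Omega>)
    have "\<rho>' \<zero>\<^bsub>bop ?K\<^esub> = 0"
    proof -
      have z: "0 \<odot>\<^bsub>bop ?K\<^esub> \<zero>\<^bsub>bop ?K\<^esub> = \<zero>\<^bsub>bop ?K\<^esub>"
        by (rule bop_eqI[of _ ?K]) (use hvec_eqI[OF hilbert_gns, of "0 \<odot>\<^bsub>?K\<^esub> \<zero>\<^bsub>?K\<^esub>" "\<zero>\<^bsub>?K\<^esub>"] in simp_all)
      have "\<rho>' (0 \<odot>\<^bsub>bop ?K\<^esub> \<zero>\<^bsub>bop ?K\<^esub>) = 0 * \<rho>' \<zero>\<^bsub>bop ?K\<^esub>"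
        using \<rho>' bop_closed(2)[OF hilbert_gns] unfolding normal_state_def is_state_def by blast
      then show ?thesis by (simp add: z)
    qed
    then have "\<forall>x\<in>R. ?\<pi> x = \<zero>\<^bsub>bop ?K\<^esub> \<longrightarrow> \<rho> x = 0" using \<rho>e by metis
    moreover have "\<forall>y\<in>commutant ?K (?\<pi> ` R). \<rho>' y = vector_functional ?K ?\<Omega> y" using comm by simp
    ultimately show ?gns using \<rho>' \<rho>e by blast
  qed
  have gns_channel: "?channel" if gns: ?gns
  proof -
    obtain \<rho>' where \<rho>': "normal_state ?K (carrier (bop ?K)) \<rho>'" and \<rho>e: "\<forall>x\<in>R. \<rho>' (?\<pi> x) = \<rho> x"
      and comm: "\<forall>y\<in>commutant ?K (?\<pi> ` R). \<rho>' y = vector_functional ?K ?\<Omega> y"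
      using gns by blast
    show ?thesis
      by (rule extension_imp_channel[OF H hilbert_gns R \<omega> e gns_spatially_normal \<Omega>_closed \<omega>_\<Omega> \<rho>'])
         (use \<rho>e comm in \<open>auto simp: vector_functional_def\<close>)
  qed
  have "?channel \<longleftrightarrow> ?every" by (rule iffI[OF channel_every some_channel[OF every_some]])
  moreover have "?channel \<longleftrightarrow> ?some" by (rule iffI[OF every_some[OF channel_every] some_channel])
  moreover have "?channel \<longleftrightarrow> ?gns" by (rule iffI[OF channel_gns gns_channel])
  ultimately show ?thesis unfolding Let_def by (rule conjI[OF _ conjI])
qed

end
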